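(* Let $0<\alpha<2$, and let $\sigma, q, M, \pi, \Pi, H, T$ be as in the context. For $n\ge1$ let $b_n:=\inf\{x: P(\|H\|>x)\le n^{-1}\}$. Let $(v_n)$ be a sequence of positive numbers with $v_n\to\infty$ satisfying $$\lim_{n\to\infty} v_n^{-1}b_n=\sigma(S^{d-1})^{1/\alpha},$$ and let $Y_{nj}$ and $S_n(k)$ be defined from $(v_n)$ as in the context. Then, as $n\to\infty$, $$v_n^{-1}S_n(n)-a_n\Rightarrow\rho,$$ where $\rho$ is the infinitely divisible probability measure on $\mathbb{R}^d$ with L\'evy representation $[0,0,M]$ and $$a_n:=n\int_{\{\|x\|<1\}}x\,P(v_n^{-1}Y_{n1}\in dx).$$
   Context: Setting. $\|\cdot\|$ is the Euclidean norm on $\mathbb{R}^d$, $S^{d-1}=\{x\in\mathbb{R}^d:\|x\|=1\}$, $\Rightarrow$ denotes weak convergence, and $u\wedge v=\min(u,v)$. L\'evy representation. An infinitely divisible law on $\mathbb{R}^d$ has L\'evy representation $[a,Q,M]$ if its characteristic function is $e^{\psi(\lambda)}$ with $$\psi(\lambda)=i\langle a,\lambda\rangle-\tfrac12\langle\lambda,Q\lambda\rangle+\int_{x\ne0}\bigl(e^{i\langle\lambda,x\rangle}-1-i\langle\lambda,x\rangle\mathbf{1}(\|x\|\le1)\bigr)M(dx).$$ Tempering. Let $\alpha\in(0,2)$ and let $\sigma$ be a finite non-zero Borel measure on $S^{d-1}$. Let $q:(0,\infty)\times S^{d-1}\to\mathbb{R}$ be a Borel measurable function such that for every $s\in S^{d-1}$,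 $q(\cdot,s)$ is non-increasing with $q(0+,s)=\alpha$ and $q(\infty,s)=0$, and such that $q(r,\cdot)$ is continuous for every $r>0$. Let $M$ be the measure on $\mathbb{R}^d\setminus\{0\}$ given in polar coordinates $x=rs$ ($r>0$, $s\in S^{d-1}$) by $M(dr,ds)=r^{-\alpha-1}q(r,s)\,dr\,\sigma(ds)$. Put $\pi(u,s)=u^\alpha\int_u^\infty r^{-\alpha-1}q(r,s)\,dr$ for $u>0$, $s\in S^{d-1}$; for each $s$, $\pi(\cdot,s)$ is non-increasing with $\pi(0+,s)=1$ and $\pi(\infty,s)=0$. Let $\Pi(du,s)=-\frac{\partial}{\partial u}\pi(u,s)\,du$, a probability measure on $(0,\infty)$, i.e. $\Pi((u,\infty),s)=\pi(u,s)$. Jumps. $H$ is a random vector in $\mathbb{R}^d$ with $P(H=0)=0$ that lies in the domain of attraction of the (non-Gaussian) $\alpha$-stable random vector $X$ with L\'evy representation $[a,0,M_0]$ for some $a\in\mathbb{R}^d$, where $M_0(dr,ds)=r^{-\alpha-1}dr\,\sigma(ds)$: that is, there are $c_n>0$ and $d_n\in\mathbb{R}^d$ such that $c_n^{-1}(H_1+\cdots+H_n)-d_n\Rightarrow X$ for i.i.d. copies $H_j$ of $H$. (Equivalently, $V(r)=P(\|H\|>r)$ is regularly varying at infinity with index $-\alpha$, and $P(H/\|H\|\in D\mid\|H\|>r)\to\sigma(D)/\sigma(S^{d-1})$ as $r\to\infty$ for all Borel $D\subset S^{d-1}$ with $\sigma(\partial D)=0$.) $T>0$ is a random variable whose conditional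 distribution given $H$ is $\Pi(\cdot,H/\|H\|)$. Let $\{(H_j,T_j):j\ge1\}$ be i.i.d. copies of $(H,T)$. Given positive numbers $v_n\to\infty$, define $Y_{nj}:=(\|H_j\|\wedge v_nT_j)\,H_j/\|H_j\|$ for $n,j\ge1$ and $S_n(k):=Y_{n1}+\cdots+Y_{nk}$. *)

theory Defs
  imports "HOL-Probability.Probability"
begin

text \<open>The library's \<open>weak_conv_m\<close> and \<open>char\<close> only treat measures on the real line;
  the following are their counterparts on \<open>\<real>\<^sup>d\<close>.\<close>

definition weakly_converges ::
  "(nat \<Rightarrow> (real ^ 'd) measure) \<Rightarrow> (real ^ 'd) measure \<Rightarrow> bool" where
  "weakly_converges \<mu> \<nu> \<longleftrightarrow>
     (\<forall>f :: real ^ 'd \<Rightarrow> real. continuous_on UNIV f \<longrightarrow> bounded (range f) \<longrightarrow>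
        (\<lambda>n. LINT x|\<mu> n. f x) \<longlonglongrightarrow> (LINT x|\<nu>. f x))"

definition char_fun :: "(real ^ 'd) measure \<Rightarrow> real ^ 'd \<Rightarrow> complex" where
  "char_fun \<mu> l = (CLINT x|\<mu>. iexp (l \<bullet> x))"

text \<open>The law of the sum of \<open>n\<close> independent random vectors, each with law \<open>\<nu>\<close>.\<close>

definition iid_sum_law :: "nat \<Rightarrow> (real ^ 'd) measure \<Rightarrow> (real ^ 'd) measure" where
  "iid_sum_law n \<nu> = distr (Pi\<^sub>M {1..n} (\<lambda>_. \<nu>)) borel (\<lambda>x. \<Sum>j = 1..n. x j)"

definition infinitely_divisible :: "(real ^ 'd) measure \<Rightarrow> bool" where
  "infinitely_divisible \<mu> \<longleftrightarrow> prob_space \<mu> \<and> sets \<mu> = sets borel \<and>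
     (\<forall>n\<ge>1. \<exists>\<nu>. prob_space \<nu> \<and> sets \<nu> = sets borel \<and> iid_sum_law n \<nu> = \<mu>)"

definition levy_integrand :: "real ^ 'd \<Rightarrow> real ^ 'd \<Rightarrow> complex" where
  "levy_integrand l x =
     iexp (l \<bullet> x) - 1 - \<i> * complex_of_real ((l \<bullet> x) * indicator {x. norm x \<le> 1} x)"

definition levy_exponent ::
  "real ^ 'd \<Rightarrow> real ^ 'd ^ 'd \<Rightarrow> (real ^ 'd) measure \<Rightarrow> real ^ 'd \<Rightarrow> complex" where
  "levy_exponent a Q M l =
     \<i> * complex_of_real (a \<bullet> l) - complex_of_real (l \<bullet> (Q *v l)) / 2
     + (CLINT x:(- {0})|M. levy_integrand l x)"

text \<open>Integrability is required explicitly because the Bochner integral of a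
  non-integrable function is \<open>0\<close>.\<close>

definition has_levy_representation ::
  "(real ^ 'd) measure \<Rightarrow> real ^ 'd \<Rightarrow> real ^ 'd ^ 'd \<Rightarrow> (real ^ 'd) measure \<Rightarrow> bool" where
  "has_levy_representation \<mu> a Q M \<longleftrightarrow> infinitely_divisible \<mu> \<and>
     (\<forall>l. set_integrable M (- {0}) (levy_integrand l) \<and>
          char_fun \<mu> l = exp (levy_exponent a Q M l))"

definition in_domain_of_attraction ::
  "(real ^ 'd) measure \<Rightarrow> (real ^ 'd) measure \<Rightarrow> bool" where
  "in_domain_of_attraction \<nu> \<mu> \<longleftrightarrow>
     (\<exists>(c :: nat \<Rightarrow> real) (d :: nat \<Rightarrow> real ^ 'd). (\<forall>n\<ge>1. c n > 0) \<and>
        weakly_converges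
          (\<lambda>n. distr (iid_sum_law n \<nu>) borel (\<lambda>x. inverse (c n) *\<^sub>R x - d n)) \<mu>)"

definition sphere_measure :: "(real ^ 'd) measure \<Rightarrow> bool" where
  "sphere_measure \<sigma> \<longleftrightarrow> sets \<sigma> = sets (restrict_space borel (sphere 0 1)) \<and>
     finite_measure \<sigma> \<and> emeasure \<sigma> (sphere 0 1) \<noteq> 0"

definition tempering_function :: "real \<Rightarrow> (real \<Rightarrow> real ^ 'd \<Rightarrow> real) \<Rightarrow> bool" where
  "tempering_function \<alpha> q \<longleftrightarrow>
     (\<lambda>(r, s). q r s) \<in> borel_measurable (restrict_space borel ({0<..} \<times> sphere 0 1)) \<and>
     (\<forall>s\<in>sphere 0 1.
        antimono_on {0<..} (\<lambda>r. q r s) \<and>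
        ((\<lambda>r. q r s) \<longlongrightarrow> \<alpha>) (at_right 0) \<and>
        ((\<lambda>r. q r s) \<longlongrightarrow> 0) at_top) \<and>
     (\<forall>r>0. continuous_on (sphere 0 1) (q r))"

text \<open>The measure \<open>r\<^bsup>-\<alpha>-1\<^esup> q(r,s) dr \<sigma>(ds)\<close> in polar coordinates \<open>x = r s\<close>, as a measure on
  the Borel sets of the whole space that gives mass \<open>0\<close> to the origin.  The choice \<open>q = 1\<close>
  gives the Levy measure of the stable law.\<close>

definition polar_measure ::
  "real \<Rightarrow> (real ^ 'd) measure \<Rightarrow> (real \<Rightarrow> real ^ 'd \<Rightarrow> real) \<Rightarrow> (real ^ 'd) measure" where
  "polar_measure \<alpha> \<sigma> q =
     distr (density (restrict_space lborel {0<..} \<Otimes>\<^sub>M \<sigma>)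
              (\<lambda>(r, s). ennreal (r powr (- \<alpha> - 1) * q r s)))
           borel (\<lambda>(r, s). r *\<^sub>R s)"

definition tempering_tail ::
  "real \<Rightarrow> (real \<Rightarrow> real ^ 'd \<Rightarrow> real) \<Rightarrow> real \<Rightarrow> real ^ 'd \<Rightarrow> real" where
  "tempering_tail \<alpha> q u s = u powr \<alpha> * (LINT r:{u<..}|lborel. r powr (- \<alpha> - 1) * q r s)"

text \<open>\<open>tempering_tail \<alpha> q \<cdot> s\<close> is differentiable at all but countably many points (the jumps of
  \<open>q \<cdot> s\<close>), so the values of \<open>deriv\<close> where no derivative exists do not affect this measure.\<close>

definition tempering_law ::
  "real \<Rightarrow> (real \<Rightarrow> real ^ 'd \<Rightarrow> real) \<Rightarrow> real ^ 'd \<Rightarrow> real measure" where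
  "tempering_law \<alpha> q s =
     density lborel
       (\<lambda>u. ennreal (- deriv (\<lambda>w. tempering_tail \<alpha> q w s) u) * indicator {0<..} u)"

text \<open>The conditional distribution of \<open>T\<close> given \<open>H\<close> is the kernel \<open>K\<close>.\<close>

definition has_cond_distribution ::
  "'w measure \<Rightarrow> ('w \<Rightarrow> real) \<Rightarrow> ('w \<Rightarrow> real ^ 'd) \<Rightarrow> (real ^ 'd \<Rightarrow> real measure) \<Rightarrow> bool" where
  "has_cond_distribution P T H K \<longleftrightarrow>
     (\<forall>A \<in> sets borel. \<forall>B \<in> sets borel.
        emeasure P {\<omega> \<in> space P. T \<omega> \<in> A \<and> H \<omega> \<in> B} =
        (\<integral>\<^sup>+ \<omega>. emeasure (K (H \<omega>)) A * indicator B (H \<omega>) \<partial>P))"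

definition tempered_jump :: "real \<Rightarrow> real ^ 'd \<Rightarrow> real \<Rightarrow> real ^ 'd" where
  "tempered_jump v h t = min (norm h) (v * t) *\<^sub>R (h /\<^sub>R norm h)"

text \<open>For \<open>n = 1\<close> the set below is all of \<open>\<real>\<close> (its infimum is \<open>-\<infinity>\<close> on paper, unspecified
  here); only large \<open>n\<close> matter, for which it is nonempty and bounded below.\<close>

definition norm_quantile :: "'w measure \<Rightarrow> ('w \<Rightarrow> real ^ 'd) \<Rightarrow> nat \<Rightarrow> real" where
  "norm_quantile P H n = Inf {x. measure P {\<omega> \<in> space P. norm (H \<omega>) > x} \<le> inverse (real n)}"

end

theory Submission
  imports Defs
begin

text \<open>The proof uses characteristic functions. Write \<open>\<phi>\<close> for that of \<open>H\<close> and \<open>\<psi>\<close> for the exponent of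
  the stable limit. The hypothesis gives \<open>\<phi>(l/c\<^sub>n)\<^sup>n \<rightarrow> exp \<psi>(l)\<close> only up to the factors coming from the
  centering, so it is first applied to \<open>\<bar>\<phi>\<bar>\<^sup>2\<close> and then to the quotients
  \<open>\<phi>(l + f) \<phi>(l - f) / \<phi>(l)\<^sup>2\<close>, in which those factors cancel. Second differences of \<open>n \<phi>(l/c\<^sub>n)\<close> therefore
  converge; these are characteristic functions of \<open>n P(H/c\<^sub>n \<in> dx)\<close> with the weight \<open>1 - cos(f \<bullet> x)\<close>, and
  averaging over \<open>f\<close> with Levy's continuity theorem yields
  \<open>n E G(H/c\<^sub>n) \<rightarrow> \<integral> G dM\<^sub>0\<close> whenever \<open>\<bar>G(x)\<bar> \<le> C min(1, \<bar>x\<bar>\<^sup>2)\<close> and \<open>G\<close> is continuous off the origin and a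
  sphere. With indicators of \<open>\<bar>x\<bar> > r\<close> this identifies the quantiles \<open>b\<^sub>n\<close>, so that \<open>c\<^sub>n\<close> may be replaced by
  \<open>v\<^sub>n\<close> at the price of a factor \<open>\<alpha>\<close>.

  Integrating out \<open>T\<close> turns \<open>E f(Y\<^sub>n\<^sub>1/v\<^sub>n)\<close> into \<open>E G(H/v\<^sub>n)\<close> with \<open>G\<close> a kernel average of \<open>f\<close> that
  inherits bound and continuity, and the same kernel maps \<open>\<alpha> M\<^sub>0\<close> to \<open>M\<close>. Taking for \<open>f\<close> the integrand of
  the Levy exponent gives the limit of \<open>n (E exp(i (l \<bullet> Y\<^sub>n\<^sub>1)/v\<^sub>n) - 1 - i \<beta>\<^sub>n)\<close>, where \<open>n \<beta>\<^sub>n = l \<bullet> a\<^sub>n\<close>; since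
  \<open>n \<beta>\<^sub>n\<^sup>2 \<rightarrow> 0\<close>, the characteristic functions of the centered sums converge.\<close>

section \<open>Averages of cosines\<close>

text \<open>The obstacle is the complex logarithm: convergence of z^n determines the limit of n (z -
  1) only up to multiples of 2 pi i, unless n (z - 1) is already known to be small. The number
  |phi|^2 is real, so it can be treated at every frequency. The quotients are complex and are
  treated only for small \<open>f\<close>, where n (1 - |phi(f/c_n)|^2) controls their distance to 1
  uniformly in \<open>l\<close>. Small \<open>f\<close> are enough: the average of 1 - cos over the
  segment from 0 to \<open>f\<close> is 1 - sinc, which vanishes only at 0. The resulting weight is
  comparable to min(1, |x|^2) and can be divided out again. The factor alpha arises because M0 gives
  mass sigma(S) r^(-alpha) / alpha to |x| > r, so b_n/c_n tends to (sigma(S)/alpha)^(1/alpha),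
  whereas b_n/v_n tends to sigma(S)^(1/alpha). Hence c_n/v_n tends to alpha^(1/alpha), and dilating
  M0 by this number multiplies it by alpha. The same alpha is q(0+), which makes the tempering
  kernel a probability kernel.\<close>

lemma iexp_add: "iexp (x + y) = iexp x * iexp y"
  by (simp add: exp_add distrib_left)

lemma norm_iexp_diff_one_le: "cmod (iexp x - 1) \<le> \<bar>x\<bar>"
  using iexp_approx1[of x 0] by simp

lemma norm_iexp_diff_linear_le: "cmod (iexp x - 1 - \<i> * of_real x) \<le> x\<^sup>2 / 2"
  using iexp_approx1[of x 1] by (simp add: numeral_2_eq_2 algebra_simps fact_numeral power2_eq_square)

lemma one_minus_cos_le: "1 - cos x \<le> x\<^sup>2 / 2" for x :: real
proof -
  have "1 - cos x = - Re (iexp x - 1 - \<i> * of_real x)" by (simp add: Re_exp)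
  also have "\<dots> \<le> cmod (iexp x - 1 - \<i> * of_real x)" using abs_Re_le_cmod by (smt (verit))
  finally show ?thesis using norm_iexp_diff_linear_le[of x] by simp
qed

text \<open>The fourth order Maclaurin bound gives x^2/2 - x^4/24. For |x| <= 2 the last term is at
  most x^2/6, which leaves the constant 1/3.\<close>

lemma one_minus_cos_ge:
  fixes x :: real assumes "\<bar>x\<bar> \<le> 2" shows "x\<^sup>2 / 3 \<le> 1 - cos x"
proof -
  obtain t where "cos x = (\<Sum>m<4. cos_coeff m * x ^ m) + cos (t + 1/2 * real 4 * pi) / fact 4 * x ^ 4"
    using Maclaurin_cos_expansion[of x 4] by auto
  moreover have "cos (t + 1/2 * real 4 * pi) / fact 4 * x ^ 4 \<le> 1 / fact 4 * x ^ 4"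
    by (intro mult_right_mono divide_right_mono) auto
  moreover have "(\<Sum>m<4. cos_coeff m * x ^ m) = 1 - x^2/2"
  proof -
    have "{..<4} = {0, 1, 2, 3::nat}" by auto
    then show ?thesis by (simp add: cos_coeff_def)
  qed
  moreover have "1 / fact 4 * x ^ 4 = x ^ 4 / 24" by (simp add: fact_numeral)
  ultimately have "cos x \<le> 1 - x^2/2 + x^4/24" by linarith
  moreover have "x^4 \<le> 4 * x\<^sup>2"
  proof -
    have "x\<^sup>2 \<le> 2\<^sup>2" using assms by (metis abs_le_square_iff abs_numeral)
    then have "x\<^sup>2 * x\<^sup>2 \<le> 4 * x\<^sup>2" by (intro mult_right_mono) auto
    then show ?thesis by (simp add: eval_nat_numeral)
  qed
  ultimately show ?thesis by linarith
qed

text \<open>Via 1 - cos z = 2 sin^2(z/2) this is subadditivity of |sin| followed by (a + b)^2 <= 2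
  a^2 + 2 b^2.\<close>

lemma one_minus_cos_add_le: "1 - cos (x + y) \<le> 2 * (1 - cos x) + 2 * (1 - cos y)" for x y :: real
proof -
  have *: "1 - cos z = 2 * (sin (z/2))\<^sup>2" for z :: real
    using cos_double_sin[of "z/2"] by simp
  have "\<bar>sin (x/2 + y/2)\<bar> \<le> \<bar>sin (x/2)\<bar> + \<bar>sin (y/2)\<bar>"
  proof -
    have "\<bar>sin (x/2 + y/2)\<bar> \<le> \<bar>sin (x/2) * cos (y/2)\<bar> + \<bar>cos (x/2) * sin (y/2)\<bar>"
      unfolding sin_add by (rule abs_triangle_ineq)
    also have "\<dots> \<le> \<bar>sin (x/2)\<bar> * 1 + 1 * \<bar>sin (y/2)\<bar>"
      unfolding abs_mult by (intro add_mono mult_mono) auto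
    finally show ?thesis by simp
  qed
  then have "(sin (x/2 + y/2))\<^sup>2 \<le> (\<bar>sin (x/2)\<bar> + \<bar>sin (y/2)\<bar>)\<^sup>2"
    by (metis abs_ge_zero power2_abs power_mono)
  also have "\<dots> \<le> 2 * (sin (x/2))\<^sup>2 + 2 * (sin (y/2))\<^sup>2"
    using sum_squares_bound[of "\<bar>sin (x/2)\<bar>" "\<bar>sin (y/2)\<bar>"] by (simp add: power2_sum)
  finally show ?thesis unfolding * by (simp add: add_divide_distrib)
qed

text \<open>Averaging over \<open>t\<close> is what removes the zeros of 1 - cos at the nonzero
  multiples of 2 pi: the result vanishes at \<open>y = 0\<close> only.\<close>

lemma has_integral_one_minus_cos:
  "((\<lambda>t. 1 - cos (t * y)) has_integral (1 - sinc y)) {0..1}" for y :: real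
proof (cases "y = 0")
  case False
  have "((\<lambda>t. 1 - cos (t * y)) has_integral ((1 - sin (1 * y) / y) - (0 - sin (0 * y) / y))) {0..1}"
    by (rule fundamental_theorem_of_calculus)
       (use False in \<open>auto intro!: derivative_eq_intros simp flip: has_real_derivative_iff_has_vector_derivative\<close>)
  then show ?thesis using False by simp
qed simp

lemma one_minus_cos_LBINT:
  fixes y :: real
  shows "(LBINT t:{0..1}. 1 - cos (t * y)) = 1 - sinc y"
proof -
  have *: "set_integrable lborel {0..1::real} (\<lambda>t. 1 - cos (t * y))"
    by (rule borel_integrable_atLeastAtMost') (auto intro!: continuous_intros)
  show "(LBINT t:{0..1}. 1 - cos (t * y)) = 1 - sinc y"
    using set_borel_integral_eq_integral(2)[OF *] has_integral_one_minus_cos[of y] by (simp add: integral_unique)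
qed

lemma one_minus_sinc_le: "1 - sinc y \<le> min 2 (y\<^sup>2 / 2)"
proof -
  have "1 - sinc y \<le> 2" "1 - sinc y \<le> y\<^sup>2 / 2"
  proof -
    have "((\<lambda>t::real. 2::real) has_integral 2) {0..1}" using has_integral_const_real[of "2::real" 0 1] by simp
    from has_integral_le[OF has_integral_one_minus_cos this] show "1 - sinc y \<le> 2"
      by (smt (verit) cos_ge_minus_one)
    have "((\<lambda>t::real. y\<^sup>2/2) has_integral y\<^sup>2/2) {0..1}" using has_integral_const_real[of "y\<^sup>2/2" 0 1] by simp
    moreover have "1 - cos (t * y) \<le> y\<^sup>2/2" if "t \<in> {0..1}" for t
    proof -
      have "(t*y)\<^sup>2 \<le> y\<^sup>2" using that by (simp add: power_mult_distrib mult_left_le_one_le power_le_one)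
      then show ?thesis using one_minus_cos_le[of "t*y"] by linarith
    qed
    ultimately show "1 - sinc y \<le> y\<^sup>2 / 2" using has_integral_le[OF has_integral_one_minus_cos] by blast
  qed
  then show ?thesis by simp
qed

text \<open>For |y| <= 2 the bound (t y)^2 / 3 for 1 - cos (t y) integrates over [0,1] to y^2 / 9;
  for larger |y| already sinc y <= 1/2.\<close>

lemma one_minus_sinc_ge: "min 1 (y\<^sup>2) / 9 \<le> 1 - sinc y"
proof (cases "\<bar>y\<bar> \<le> 2")
  case True
  have "((\<lambda>t. y\<^sup>2/3 * t^2) has_integral (y\<^sup>2/9 * 1 ^ 3 - y\<^sup>2/9 * 0 ^ 3)) {0..1}"
    by (rule fundamental_theorem_of_calculus)
       (auto intro!: derivative_eq_intros simp flip: has_real_derivative_iff_has_vector_derivative)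
  moreover have "y\<^sup>2/3 * t^2 \<le> 1 - cos (t * y)" if "t \<in> {0..1}" for t
  proof -
    have "\<bar>t * y\<bar> \<le> 2" using that True mult_mono[of "\<bar>t\<bar>" 1 "\<bar>y\<bar>" 2] by (simp add: abs_mult)
    from one_minus_cos_ge[OF this] show ?thesis by (simp add: power_mult_distrib mult.commute)
  qed
  ultimately have "y\<^sup>2/9 * 1 ^ 3 - y\<^sup>2/9 * 0 ^ 3 \<le> 1 - sinc y"
    using has_integral_le has_integral_one_minus_cos by blast
  then show ?thesis by simp
next
  case False
  then have "y \<noteq> 0" by auto
  have "sinc y \<le> 1/2"
  proof -
    have "sinc y \<le> \<bar>sin y\<bar> / \<bar>y\<bar>" using \<open>y \<noteq> 0\<close> by (simp flip: abs_divide)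
    also have "\<dots> \<le> 1 / 2" using False by (intro frac_le) auto
    finally show ?thesis .
  qed
  then show ?thesis by simp
qed

lemma one_minus_sinc_nonneg: "0 \<le> 1 - sinc y"
  using one_minus_sinc_ge[of y] by (smt (verit) divide_nonneg_nonneg zero_le_power2)

lemma one_minus_sinc_ge_half: "2 \<le> \<bar>y\<bar> \<Longrightarrow> 1 / 2 \<le> 1 - sinc y"
proof -
  assume y: "2 \<le> \<bar>y\<bar>"
  have "sinc y \<le> \<bar>sin y\<bar> / \<bar>y\<bar>" using y by (auto simp flip: abs_divide)
  also have "\<dots> \<le> 1 / 2" using y by (intro frac_le) auto
  finally show ?thesis by simp
qed

lemma abs_one_minus_sinc_le: "\<bar>1 - sinc y\<bar> \<le> 2"
  using one_minus_sinc_le[of y] one_minus_sinc_nonneg[of y] by simp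

text \<open>Fubini with the dominating function min 2 (y^2). It is stated for sigma-finite
  \<open>M\<close> so that it covers the infinite stable Levy measure as well as probability laws;
  \<open>F\<close> will carry the oscillating factor \<open>iexp (l \<bullet> x)\<close>.\<close>

lemma integral_one_minus_sinc:
  fixes F :: "'a \<Rightarrow> complex" and y :: "'a \<Rightarrow> real"
  assumes M: "sigma_finite_measure M"
    and [measurable]: "F \<in> borel_measurable M" "y \<in> borel_measurable M"
    and F: "\<And>x. cmod (F x) \<le> 1" and y: "integrable M (\<lambda>x. min 2 ((y x)\<^sup>2))"
  shows "(CLINT t:{0..1}|lborel. \<integral>x. F x * of_real (1 - cos (t * y x)) \<partial>M)
      = (\<integral>x. F x * of_real (1 - sinc (y x)) \<partial>M)"
proof -
  interpret M: sigma_finite_measure M by fact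
  interpret P: pair_sigma_finite lborel M by unfold_locales
  define f where "f t x = indicator {0..1::real} t *\<^sub>R (F x * of_real (1 - cos (t * y x)))" for t x
  have meas[measurable]: "case_prod f \<in> borel_measurable (lborel \<Otimes>\<^sub>M M)"
    unfolding f_def[abs_def] by measurable
  have bound: "norm (f t x) \<le> indicator {0..1} t * min 2 ((y x)\<^sup>2)" for t x
  proof (cases "t \<in> {0..1}")
    case True
    have "\<bar>1 - cos (t * y x)\<bar> \<le> min 2 ((y x)\<^sup>2)"
    proof -
      have "(t * y x)\<^sup>2 \<le> (y x)\<^sup>2" using True by (simp add: power_mult_distrib mult_left_le_one_le power_le_one)
      then have "1 - cos (t * y x) \<le> (y x)\<^sup>2" using one_minus_cos_le[of "t * y x"] zero_le_power2[of "y x"] by linarith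
      moreover have "1 - cos (t * y x) \<le> 2" "0 \<le> 1 - cos (t * y x)"
        using cos_ge_minus_one[of "t * y x"] cos_le_one[of "t * y x"] by linarith+
      ultimately show ?thesis by simp
    qed
    moreover have "norm (f t x) = norm (F x) * \<bar>1 - cos (t * y x)\<bar>"
      using True by (simp add: f_def norm_mult del: of_real_diff)
    ultimately show ?thesis using True mult_mono[OF F[of x], of "\<bar>1 - cos (t * y x)\<bar>" "min 2 ((y x)\<^sup>2)"] by simp
  qed (simp add: f_def)
  have int_x: "integrable M (f t)" for t
  proof (rule Bochner_Integration.integrable_bound)
    show "integrable M (\<lambda>x. indicator {0..1} t * min 2 ((y x)\<^sup>2))" using y by simp
    show "f t \<in> borel_measurable M" unfolding f_def[abs_def] by measurable
    show "AE x in M. norm (f t x) \<le> norm (indicator {0..1} t * min 2 ((y x)\<^sup>2))"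
      using bound by (intro AE_I2) (auto intro: order_trans)
  qed
  have "integrable (lborel \<Otimes>\<^sub>M M) (case_prod f)"
  proof (rule P.Fubini_integrable)
    show "integrable lborel (\<lambda>t. \<integral>x. norm (case_prod f (t, x)) \<partial>M)"
    proof (rule Bochner_Integration.integrable_bound)
      show "integrable lborel (\<lambda>t::real. indicator {0..1} t * (\<integral>x. min 2 ((y x)\<^sup>2) \<partial>M) :: real)" by simp
      show "(\<lambda>t. \<integral>x. norm (case_prod f (t, x)) \<partial>M) \<in> borel_measurable lborel" by measurable
      have "(\<integral>x. norm (f t x) \<partial>M) \<le> (\<integral>x. indicator {0..1} t * min 2 ((y x)\<^sup>2) \<partial>M)" for t
        using int_x[of t] y bound by (intro integral_mono) auto
      then show "AE t in lborel. norm (\<integral>x. norm (case_prod f (t, x)) \<partial>M)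
          \<le> norm (indicator {0..1} t * (\<integral>x. min 2 ((y x)\<^sup>2) \<partial>M) :: real)"
        by (intro AE_I2) (auto intro: order_trans)
    qed
  qed (use int_x in auto)
  from P.Fubini_integral[OF this]
  have "(\<integral>t. (\<integral>x. f t x \<partial>M) \<partial>lborel) = (\<integral>x. (\<integral>t. f t x \<partial>lborel) \<partial>M)" by simp
  moreover have "(\<integral>t. f t x \<partial>lborel) = F x * of_real (1 - sinc (y x))" for x
  proof -
    have "(\<integral>t. f t x \<partial>lborel) = (\<integral>t. F x * complex_of_real (indicator {0..1} t *\<^sub>R (1 - cos (t * y x))) \<partial>lborel)"
      unfolding f_def by (intro Bochner_Integration.integral_cong) (auto split: split_indicator)
    also have "\<dots> = F x * of_real (LBINT t:{0..1}. 1 - cos (t * y x))"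
      unfolding set_lebesgue_integral_def by (simp only: integral_mult_right_zero integral_complex_of_real)
    finally show ?thesis by (simp only: one_minus_cos_LBINT)
  qed
  moreover have "(\<integral>x. f t x \<partial>M) = indicator {0..1::real} t *\<^sub>R (\<integral>x. F x * of_real (1 - cos (t * y x)) \<partial>M)" for t
    unfolding f_def by simp
  ultimately show ?thesis
    by (simp add: set_lebesgue_integral_def)
qed

section \<open>Levy's continuity theorem\<close>

lemma integrable_iexp_inner:
  fixes M :: "(real ^ 'd) measure"
  assumes M: "finite_measure M" "sets M = sets borel"
  shows "integrable M (\<lambda>x. iexp (l \<bullet> x))"
proof -
  note [measurable_cong] = M(2)
  show ?thesis by (rule finite_measure.integrable_const_bound[OF M(1), of _ 1]) auto
qed

lemma char_fun_zero: "char_fun M 0 = measure M (space M)"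
  by (simp add: char_fun_def scaleR_conv_of_real)

lemma norm_char_fun_le:
  assumes "finite_measure M"
  shows "cmod (char_fun M l) \<le> measure M (space M)"
proof -
  have "cmod (char_fun M l) \<le> (\<integral>x. norm (iexp (l \<bullet> x)) \<partial>M)"
    unfolding char_fun_def by (rule integral_norm_bound)
  then show ?thesis by simp
qed

text \<open>The nonnegative factor 1 - cos b on the measure side corresponds to a second difference
  on the frequency side, in which everything linear in the frequency cancels.\<close>

lemma iexp_second_difference:
  "iexp a * of_real (1 - cos b) = iexp a - iexp (a + b) / 2 - iexp (a - b) / 2"
proof -
  have "complex_of_real (cos b) = (iexp b + iexp (- b)) / 2"
    by (simp add: complex_eq_iff Re_exp Im_exp)
  moreover have "iexp (a - b) = iexp a * iexp (- b)" using iexp_add[of a "- b"] by simp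
  ultimately show ?thesis unfolding iexp_add[of a b] of_real_diff of_real_1
    by (simp only:) (simp add: field_simps)
qed

lemma char_fun_second_difference:
  fixes M :: "(real ^ 'd) measure"
  assumes "finite_measure M" "sets M = sets borel"
  shows "(\<integral>x. iexp (l \<bullet> x) * of_real (1 - cos (e \<bullet> x)) \<partial>M)
    = char_fun M l - char_fun M (l + e) / 2 - char_fun M (l - e) / 2"
proof -
  have "(\<integral>x. iexp (l \<bullet> x) * of_real (1 - cos (e \<bullet> x)) \<partial>M)
      = (\<integral>x. iexp (l \<bullet> x) - iexp ((l + e) \<bullet> x) / 2 - iexp ((l - e) \<bullet> x) / 2 \<partial>M)"
    unfolding iexp_second_difference by (simp add: inner_add_left inner_diff_left)
  then show ?thesis using integrable_iexp_inner[OF assms]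
    by (simp add: char_fun_def)
qed

text \<open>The classical truncation estimate as a limit: the integral is an average over
  \<open>t\<close> in [0,1] of second differences at 0. These converge pointwise and are bounded by
  the convergent, hence bounded, total masses.\<close>

lemma tendsto_integral_one_minus_sinc:
  fixes N :: "nat \<Rightarrow> (real ^ 'd) measure" and e :: "real ^ 'd"
  assumes N: "\<And>n. finite_measure (N n)" "\<And>n. sets (N n) = sets borel"
    and L: "finite_measure L" "sets L = sets borel"
    and conv: "\<And>l. (\<lambda>n. char_fun (N n) l) \<longlonglongrightarrow> char_fun L l"
  shows "(\<lambda>n. \<integral>x. 1 - sinc (e \<bullet> x) \<partial>N n) \<longlonglongrightarrow> (\<integral>x. 1 - sinc (e \<bullet> x) \<partial>L)"
proof -
  define G where "G K t = char_fun K (0::real^'d) - char_fun K (t *\<^sub>R e) / 2 - char_fun K (- (t *\<^sub>R e)) / 2" for K t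
  have avg: "(CLINT t:{0..1}|lborel. G K t) = of_real (\<integral>x. 1 - sinc (e \<bullet> x) \<partial>K)"
    and meas: "G K \<in> borel_measurable borel"
    if K: "finite_measure K" "sets K = sets borel" for K
  proof -
    interpret K: finite_measure K by fact
    note [measurable_cong] = K(2)
    have "(CLINT t:{0..1}|lborel. \<integral>x. 1 * of_real (1 - cos (t * (e \<bullet> x))) \<partial>K)
        = (\<integral>x. 1 * of_real (1 - sinc (e \<bullet> x)) \<partial>K)"
      by (rule integral_one_minus_sinc) (auto intro!: K.integrable_const_bound[of _ 2] K.sigma_finite_measure_axioms)
    moreover have G: "(\<integral>x. 1 * of_real (1 - cos (t * (e \<bullet> x))) \<partial>K) = G K t" for t
      using char_fun_second_difference[OF K, of 0 "t *\<^sub>R e"] by (simp add: G_def)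
    ultimately show "(CLINT t:{0..1}|lborel. G K t) = of_real (\<integral>x. 1 - sinc (e \<bullet> x) \<partial>K)"
      by (simp only: mult_1_left integral_complex_of_real)
    have "(\<lambda>t. \<integral>x. 1 * complex_of_real (1 - cos (t * (e \<bullet> x))) \<partial>K) \<in> borel_measurable borel"
      by measurable
    moreover have "(\<lambda>t. \<integral>x. 1 * complex_of_real (1 - cos (t * (e \<bullet> x))) \<partial>K) = G K" using G by blast
    ultimately show "G K \<in> borel_measurable borel" by (simp only:)
  qed
  have "convergent (\<lambda>n. cmod (char_fun (N n) 0))" using tendsto_norm[OF conv[of 0]] by (auto simp: convergent_def)
  then obtain B where B: "\<And>n. cmod (char_fun (N n) 0) \<le> B"
    using convergent_imp_Bseq[of "\<lambda>n. cmod (char_fun (N n) 0)"] by (auto simp: Bseq_def)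
  have cB: "cmod (char_fun (N n) l) \<le> B" for n l
    using norm_char_fun_le[OF N(1), of n l] B[of n] by (simp add: char_fun_zero)
  have GB: "norm (G (N n) t) \<le> 2 * B" for n t
  proof -
    have "norm (G (N n) t) \<le> cmod (char_fun (N n) 0) + cmod (char_fun (N n) (t *\<^sub>R e) / 2) + cmod (char_fun (N n) (- (t *\<^sub>R e)) / 2)"
      unfolding G_def
      using norm_triangle_ineq4[of "char_fun (N n) 0 - char_fun (N n) (t *\<^sub>R e) / 2" "char_fun (N n) (- (t *\<^sub>R e)) / 2"]
        norm_triangle_ineq4[of "char_fun (N n) 0" "char_fun (N n) (t *\<^sub>R e) / 2"] by linarith
    then show ?thesis using cB[of n 0] cB[of n "t *\<^sub>R e"] cB[of n "- (t *\<^sub>R e)"] by (simp add: norm_divide)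
  qed
  have "(\<lambda>n. CLINT t:{0..1}|lborel. G (N n) t) \<longlonglongrightarrow> (CLINT t:{0..1}|lborel. G L t)"
    unfolding set_lebesgue_integral_def
  proof (rule integral_dominated_convergence[where w="\<lambda>t. indicator {0..1} t * (2 * B)"])
    show "AE t in lborel. (\<lambda>n. indicator {0..1} t *\<^sub>R G (N n) t) \<longlonglongrightarrow> indicator {0..1} t *\<^sub>R G L t"
      unfolding G_def
      by (intro AE_I2 tendsto_scaleR[OF tendsto_const] tendsto_diff tendsto_divide conv tendsto_const) simp_all
    show "AE t in lborel. norm (indicator {0..1} t *\<^sub>R G (N n) t) \<le> indicator {0..1} t * (2 * B)" for n
      using GB[of n] by (simp add: indicator_def)
    show "(\<lambda>t. indicator {0..1} t *\<^sub>R G L t) \<in> borel_measurable lborel"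
      using meas[OF L] by simp
    show "(\<lambda>t. indicator {0..1} t *\<^sub>R G (N n) t) \<in> borel_measurable lborel" for n
      using meas[OF N] by simp
    show "integrable lborel (\<lambda>t. indicator {0..1::real} t * (2 * B))" by simp
  qed
  then have "(\<lambda>n. complex_of_real (\<integral>x. 1 - sinc (e \<bullet> x) \<partial>N n)) \<longlonglongrightarrow> of_real (\<integral>x. 1 - sinc (e \<bullet> x) \<partial>L)"
    by (simp only: avg N L)
  then show ?thesis by (simp only: tendsto_of_real_iff)
qed

section \<open>Trigonometric polynomials as test functions\<close>

inductive trig_poly :: "(real ^ 'd \<Rightarrow> complex) \<Rightarrow> bool" where
  "trig_poly (\<lambda>x. c * iexp (l \<bullet> x))"
| "trig_poly f \<Longrightarrow> trig_poly g \<Longrightarrow> trig_poly (\<lambda>x. f x + g x)"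

lemma trig_poly_const: "trig_poly (\<lambda>x. c)"
  using trig_poly.intros(1)[of c 0] by simp

lemma trig_poly_mult:
  assumes "trig_poly f" "trig_poly g" shows "trig_poly (\<lambda>x. f x * g x)"
  using assms
proof (induction f rule: trig_poly.induct)
  case (1 c l)
  from 1 show ?case
  proof (induction g rule: trig_poly.induct)
    case (1 c' l')
    have "(\<lambda>x. c * iexp (l \<bullet> x) * (c' * iexp (l' \<bullet> x))) = (\<lambda>x. (c * c') * iexp ((l + l') \<bullet> x))"
      by (auto simp: inner_add_left iexp_add simp del: of_real_add)
    then show ?case using trig_poly.intros(1)[of "c * c'" "l + l'"] by (simp only:)
  next
    case (2 f g) then show ?case unfolding distrib_left by (intro trig_poly.intros(2))
  qed
next
  case (2 f g) then show ?case unfolding distrib_right by (intro trig_poly.intros(2))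
qed

lemma trig_poly_sum:
  assumes "finite A" "\<And>k. k \<in> A \<Longrightarrow> trig_poly (f k)" shows "trig_poly (\<lambda>x. \<Sum>k\<in>A. f k x)"
  using assms
proof (induction A)
  case (insert k A)
  then have "trig_poly (\<lambda>x. f k x + (\<Sum>k\<in>A. f k x))" by (intro trig_poly.intros(2)) auto
  then show ?case using insert.hyps by simp
qed (simp add: trig_poly_const)

text \<open>The coordinatewise sine maps the whole space into the cube [-1,1]^d. A polynomial that
  is a good approximation on that cube therefore yields a trigonometric polynomial that is bounded
  everywhere.\<close>

lemma trig_poly_real_polynomial_function:
  assumes "real_polynomial_function p"
  shows "trig_poly (\<lambda>x :: real ^ 'd. complex_of_real (p (\<chi> k. sin (x $ k / R))))"
  using assms
proof (induction p rule: real_polynomial_function.induct)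
  case (linear p)
  interpret p: bounded_linear p by fact
  have sin: "trig_poly (\<lambda>x :: real ^ 'd. complex_of_real (sin (x $ k / R)))" for k
  proof -
    have "(\<lambda>x :: real ^ 'd. complex_of_real (sin (x $ k / R))) =
      (\<lambda>x. (1 / (2 * \<i>)) * iexp ((axis k (1/R)) \<bullet> x) + (- 1 / (2 * \<i>)) * iexp ((- axis k (1/R)) \<bullet> x))"
      by (auto simp: inner_axis' complex_eq_iff Re_exp Im_exp Re_divide Im_divide field_simps power2_eq_square)
    then show ?thesis
      using trig_poly.intros(2)[OF trig_poly.intros(1)[of "1 / (2 * \<i>)" "axis k (1/R)"]
        trig_poly.intros(1)[of "- 1 / (2 * \<i>)" "- axis k (1/R)"]] by (simp only:)
  qed
  have p_sum: "p y = (\<Sum>k\<in>UNIV. y $ k * p (axis k 1))" for y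
  proof -
    have "p y = p (\<Sum>k\<in>UNIV. y $ k *\<^sub>R axis k 1)" by (simp only: basis_expansion scalar_mult_eq_scaleR[symmetric])
    then show ?thesis by (simp add: p.sum p.scaleR)
  qed
  have eq: "complex_of_real (p (\<chi> k. sin (x $ k / R)))
      = (\<Sum>k\<in>UNIV. of_real (sin (x $ k / R)) * of_real (p (axis k 1)))" for x :: "real ^ 'd"
    by (subst p_sum) simp
  show ?case unfolding eq by (intro trig_poly_sum trig_poly_mult sin trig_poly_const) simp
next
  case (const c)
  show ?case by (rule trig_poly_const)
next
  case (add f g)
  then show ?case unfolding of_real_add by (intro trig_poly.intros(2))
next
  case (mult f g)
  then show ?case unfolding of_real_mult by (intro trig_poly_mult)
qed

lemma trig_poly_integrable:
  assumes "trig_poly f" "finite_measure M" "sets M = sets borel"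
  shows "integrable M f"
  using assms(1)
proof induction
  case (1 c l)
  show ?case by (rule integrable_mult_right[OF integrable_iexp_inner[OF assms(2,3)]])
next
  case (2 f g)
  then show ?case by (intro Bochner_Integration.integrable_add)
qed

lemma trig_poly_integral_tendsto:
  assumes "trig_poly f"
    and "\<And>n. finite_measure (N n)" "\<And>n. sets (N n) = sets borel"
    and "finite_measure L" "sets L = sets borel"
    and conv: "\<And>l. (\<lambda>n. char_fun (N n) l) \<longlonglongrightarrow> char_fun L l"
  shows "(\<lambda>n. integral\<^sup>L (N n) f) \<longlonglongrightarrow> integral\<^sup>L L f"
  using assms(1)
proof induction
  case (1 c l)
  then show ?case using tendsto_mult_left[OF conv[of l], of c] by (simp add: char_fun_def)
next
  case (2 f g)
  then show ?case using trig_poly_integrable[OF _ assms(2,3)] trig_poly_integrable[OF _ assms(4,5)]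
    by (simp add: tendsto_add)
qed

text \<open>The frequency 2/R is chosen so that |x_k| > R puts the argument of \<open>sinc\<close>
  beyond 2, where 1 - sinc is at least 1/2.\<close>

lemma measure_norm_inf_gt_le:
  fixes M :: "(real ^ 'd) measure"
  assumes "finite_measure M" and M: "sets M = sets borel" and R: "R > 0"
  shows "measure M {x. \<exists>k. \<bar>x $ k\<bar> > R}
    \<le> (\<Sum>k\<in>UNIV. 2 * (\<integral>x. 1 - sinc (axis k (2 / R) \<bullet> x) \<partial>M))"
proof -
  interpret finite_measure M by fact
  note [measurable_cong] = M
  have *: "measure M {x. \<bar>x $ k\<bar> > R} \<le> 2 * (\<integral>x. 1 - sinc (axis k (2 / R) \<bullet> x) \<partial>M)" for k
  proof -
    have "measure M {x. \<bar>x $ k\<bar> > R} = (\<integral>x. indicator {x. \<bar>x $ k\<bar> > R} x \<partial>M)"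
      using sets_eq_imp_space_eq[OF M] by simp
    also have "\<dots> \<le> (\<integral>x. 2 * (1 - sinc (axis k (2 / R) \<bullet> x)) \<partial>M)"
    proof (rule integral_mono)
      show "integrable M (indicat_real {x. \<bar>x $ k\<bar> > R})"
        by (rule integrable_const_bound[of _ 1]) (auto simp: indicator_def)
      have "norm (2 * (1 - sinc y)) \<le> 4" for y
        using mult_left_mono[OF abs_one_minus_sinc_le[of y], of 2] unfolding real_norm_def abs_mult by simp
      then show "integrable M (\<lambda>x. 2 * (1 - sinc (axis k (2 / R) \<bullet> x)))"
        by (intro integrable_const_bound[of _ 4] AE_I2) (blast, measurable)
      show "indicat_real {x. \<bar>x $ k\<bar> > R} x \<le> 2 * (1 - sinc (axis k (2 / R) \<bullet> x))" for x
      proof (cases "\<bar>x $ k\<bar> > R")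
        case True
        then have "2 \<le> \<bar>axis k (2 / R) \<bullet> x\<bar>" using R by (simp add: inner_axis' abs_mult field_simps)
        from one_minus_sinc_ge_half[OF this] show ?thesis using True by simp
      qed (use one_minus_sinc_nonneg in auto)
    qed
    finally show ?thesis by (simp only: integral_mult_right_zero)
  qed
  have "measure M {x. \<exists>k. \<bar>x $ k\<bar> > R} = measure M (\<Union>k\<in>UNIV. {x. \<bar>x $ k\<bar> > R})"
    by (rule arg_cong[where f="measure M"]) auto
  also have "\<dots> \<le> (\<Sum>k\<in>UNIV. measure M {x. \<bar>x $ k\<bar> > R})"
    by (rule finite_measure_subadditive_finite) auto
  also have "\<dots> \<le> (\<Sum>k\<in>UNIV. 2 * (\<integral>x. 1 - sinc (axis k (2 / R) \<bullet> x) \<partial>M))"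
    by (intro sum_mono *)
  finally show ?thesis .
qed

text \<open>Instead of extracting limits from a tight family, the test function is replaced by one
  trigonometric polynomial \<open>g\<close> that is close to it on a large box and bounded outside.
  The mass outside the box is controlled by integrals of 1 - sinc, which converge, so a box that is
  good for \<open>L\<close> is good for \<open>N n\<close> with large \<open>n\<close>.\<close>

theorem levy_continuity_finite:
  fixes N :: "nat \<Rightarrow> (real ^ 'd) measure"
  assumes N: "\<And>n. finite_measure (N n)" "\<And>n. sets (N n) = sets borel"
    and L: "finite_measure L" "sets L = sets borel"
    and conv: "\<And>l. (\<lambda>n. char_fun (N n) l) \<longlonglongrightarrow> char_fun L l"
  shows "weakly_converges N L"
  unfolding weakly_converges_def
proof (intro allI impI)
  fix f :: "real ^ 'd \<Rightarrow> real"
  assume f: "continuous_on UNIV f" "bounded (range f)"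
  then obtain B where B: "B > 0" "\<And>x. \<bar>f x\<bar> \<le> B" by (auto simp: bounded_pos)
  have [measurable]: "f \<in> borel_measurable borel" using f(1) by (rule borel_measurable_continuous_onI)
  define mass where "mass K = measure K (space K)" for K :: "(real ^ 'd) measure"
  define tail where "tail R K = (\<Sum>k\<in>UNIV. 2 * (\<integral>x. 1 - sinc (axis k (2 / R) \<bullet> x) \<partial>K))"
    for R and K :: "(real ^ 'd) measure"
  have mass: "(\<lambda>n. mass (N n)) \<longlonglongrightarrow> mass L"
    using conv[of 0] by (simp only: char_fun_zero mass_def tendsto_of_real_iff)
  have tail: "(\<lambda>n. tail R (N n)) \<longlonglongrightarrow> tail R L" for R
    unfolding tail_def by (intro tendsto_intros tendsto_integral_one_minus_sinc assms)
  interpret L: finite_measure L by fact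
  note [measurable_cong] = L(2)
  \<comment> \<open>The frequencies 2/m tend to 0, and so does 1 - sinc pointwise; the constant 2
    dominates because \<open>L\<close> is finite.\<close>
  have tail0: "((\<lambda>m. tail (real m) L) \<longlongrightarrow> 0) sequentially"
  proof -
    have "(\<lambda>m. \<integral>x. 1 - sinc (axis k (2 / real m) \<bullet> x) \<partial>L) \<longlonglongrightarrow> (\<integral>x. 0 \<partial>L)" for k
    proof (rule integral_dominated_convergence[where w="\<lambda>_. 2"])
      have "(\<lambda>m. 1 - sinc (axis k (2 / real m) \<bullet> x)) \<longlonglongrightarrow> 0" for x
      proof -
        have *: "(\<lambda>m. axis k (2 / real m) \<bullet> x) \<longlonglongrightarrow> 0"
          unfolding inner_axis' inner_real_def by (intro tendsto_mult_left_zero lim_const_over_n)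
        have "(\<lambda>m. sinc (axis k (2 / real m) \<bullet> x)) \<longlonglongrightarrow> sinc 0"
          by (rule isCont_tendsto_compose[OF isCont_sinc *])
        from tendsto_diff[OF tendsto_const[of 1] this]
        show ?thesis by (simp only: simp_thms if_True diff_self)
      qed
      then show "AE x in L. (\<lambda>m. 1 - sinc (axis k (2 / real m) \<bullet> x)) \<longlonglongrightarrow> 0"
        by (intro AE_I2)
      show "AE x in L. norm (1 - sinc (axis k (2 / real m) \<bullet> x)) \<le> 2" for m
        unfolding real_norm_def by (intro AE_I2 abs_one_minus_sinc_le)
      show "(\<lambda>x. 1 - sinc (axis k (2 / real m) \<bullet> x)) \<in> borel_measurable L" for m by measurable
    qed simp_all
    then have "(\<lambda>m. tail (real m) L) \<longlonglongrightarrow> (\<Sum>k\<in>(UNIV :: 'd set). 2 * (\<integral>x. 0 \<partial>L))"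
      unfolding tail_def by (intro tendsto_intros)
    then show ?thesis by simp
  qed
  have err: "\<bar>integral\<^sup>L K f - integral\<^sup>L K g\<bar> \<le> \<delta> * mass K + (2 * B + \<delta>) * tail R K"
    if K: "finite_measure K" "sets K = sets borel" and g: "integrable K g" and "R > 0" "\<delta> > 0"
      and in_box: "\<And>x. \<forall>k. \<bar>x $ k\<bar> \<le> R \<Longrightarrow> \<bar>f x - g x\<bar> \<le> \<delta>"
      and all: "\<And>x. \<bar>g x\<bar> \<le> B + \<delta>" for K g R \<delta>
  proof -
    interpret K: finite_measure K by fact
    note [measurable_cong] = K(2)
    let ?A = "{x :: real ^ 'd. \<exists>k. \<bar>x $ k\<bar> > R}"
    have fK: "integrable K f" by (rule K.integrable_const_bound[of _ B]) (use B in auto)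
    have A: "?A \<in> sets K" unfolding K(2) by measurable
    have ind: "integrable K (indicat_real ?A)" using A by (simp add: K.emeasure_finite less_top[symmetric])
    have "\<bar>integral\<^sup>L K f - integral\<^sup>L K g\<bar> = \<bar>\<integral>x. f x - g x \<partial>K\<bar>"
      using fK g by simp
    also have "\<dots> \<le> (\<integral>x. \<bar>f x - g x\<bar> \<partial>K)" using integral_norm_bound[of K "\<lambda>x. f x - g x"] by simp
    also have "\<dots> \<le> (\<integral>x. \<delta> + (2 * B + \<delta>) * indicator ?A x \<partial>K)"
    proof (rule integral_mono)
      show "\<bar>f x - g x\<bar> \<le> \<delta> + (2 * B + \<delta>) * indicat_real ?A x" for x
      proof (cases "x \<in> ?A")
        case True
        then show ?thesis using B(2)[of x] all[of x] \<open>\<delta> > 0\<close> by simp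
      next
        case False
        then have "\<forall>k. \<bar>x $ k\<bar> \<le> R" by (auto simp: not_less)
        then show ?thesis using False in_box[of x] by simp
      qed
    qed (use fK g ind in auto)
    also have "\<dots> = \<delta> * mass K + (2 * B + \<delta>) * measure K ?A"
      using ind A sets.sets_into_space[OF A] by (simp add: mass_def Int_absorb2)
    also have "\<dots> \<le> \<delta> * mass K + (2 * B + \<delta>) * tail R K"
      using measure_norm_inf_gt_le[OF K \<open>R > 0\<close>] B(1) \<open>\<delta> > 0\<close> unfolding tail_def
      by (intro add_mono mult_left_mono) auto
    finally show ?thesis .
  qed
  show "(\<lambda>n. integral\<^sup>L (N n) f) \<longlonglongrightarrow> integral\<^sup>L L f"
  proof (rule tendstoI)
    fix \<epsilon> :: real assume "\<epsilon> > 0"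
    \<comment> \<open>Error budget: replacing \<open>f\<close> by \<open>g\<close> costs at most
      epsilon/12 inside the box and epsilon/12 outside it, once under \<open>N n\<close> and once
      under \<open>L\<close>; the convergence for \<open>g\<close> itself costs epsilon/3. The cap
      at 1 lets \<open>\<eta>\<close> be chosen independently of \<open>\<delta>\<close>.\<close>
    define \<delta> where "\<delta> = min 1 (\<epsilon> / (12 * (mass L + 1)))"
    have massL: "mass L \<ge> 0" by (simp add: mass_def)
    have \<delta>: "0 < \<delta>" "\<delta> \<le> 1" "\<delta> * (mass L + 1) \<le> \<epsilon> / 12"
    proof -
      show "0 < \<delta>" "\<delta> \<le> 1" using \<open>\<epsilon> > 0\<close> massL by (auto simp: \<delta>_def)
      have "\<delta> * (mass L + 1) \<le> \<epsilon> / (12 * (mass L + 1)) * (mass L + 1)"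
        using massL by (intro mult_right_mono) (auto simp: \<delta>_def)
      also have "\<dots> = \<epsilon> / 12" using massL by (simp add: divide_simps)
      finally show "\<delta> * (mass L + 1) \<le> \<epsilon> / 12" .
    qed
    define \<eta> where "\<eta> = \<epsilon> / (12 * (2 * B + 1))"
    have \<eta>: "0 < \<eta>" "(2 * B + \<delta>) * \<eta> \<le> \<epsilon> / 12"
    proof -
      show "0 < \<eta>" using \<open>\<epsilon> > 0\<close> B by (simp add: \<eta>_def)
      have "(2 * B + \<delta>) * \<eta> \<le> (2 * B + 1) * \<eta>" using \<open>0 < \<eta>\<close> \<delta> by (intro mult_right_mono) auto
      also have "\<dots> = \<epsilon> / 12" using B(1) by (simp add: \<eta>_def divide_simps)
      finally show "(2 * B + \<delta>) * \<eta> \<le> \<epsilon> / 12" .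
    qed
    have "eventually (\<lambda>m. tail (real m) L < \<eta> \<and> m > 0) sequentially"
      using order_tendstoD(2)[OF tail0 \<open>\<eta> > 0\<close>] eventually_gt_at_top[of 0] by eventually_elim auto
    then obtain m where m: "tail (real m) L < \<eta>" "m > 0" by (auto simp: eventually_sequentially)
    define R where "R = real m"
    have R: "R > 0" "tail R L < \<eta>" using m by (auto simp: R_def)
    \<comment> \<open>Composed with y_k = sin (x_k / R), this function returns f x on the box |x_k|
      <= R, because x_k / R then lies within the range of \<open>arcsin\<close>.\<close>
    define G where "G y = f (\<chi> k. R * arcsin (y $ k))" for y
    have "continuous_on (cbox (- 1) 1) G"
      unfolding G_def
      by (rule continuous_on_compose2[OF f(1)]) (auto intro!: continuous_intros simp: mem_box_cart)
    from Stone_Weierstrass_real_polynomial_function[OF compact_cbox this \<open>0 < \<delta>\<close>]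
    obtain p where p: "real_polynomial_function p" "\<And>y. y \<in> cbox (- 1) 1 \<Longrightarrow> \<bar>G y - p y\<bar> < \<delta>"
      by blast
    define g where "g x = p (\<chi> k. sin (x $ k / R))" for x :: "real ^ 'd"
    have trig: "trig_poly (\<lambda>x. complex_of_real (g x))"
      unfolding g_def by (rule trig_poly_real_polynomial_function[OF p(1)])
    have g_int: "integrable K g" if "finite_measure K" "sets K = sets borel" for K
      using trig_poly_integrable[OF trig that] by (simp only: complex_of_real_integrable_eq)
    have box: "(\<chi> k. sin (x $ k / R)) \<in> cbox (- 1) 1" for x :: "real ^ 'd"
      by (auto simp: mem_box_cart)
    have in_box: "\<bar>f x - g x\<bar> \<le> \<delta>" if "\<forall>k. \<bar>x $ k\<bar> \<le> R" for x
    proof -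
      have "arcsin (sin (x $ k / R)) = x $ k / R" for k
      proof (rule arcsin_sin)
        have "\<bar>x $ k / R\<bar> \<le> 1" using that R by simp
        then show "- (pi / 2) \<le> x $ k / R" "x $ k / R \<le> pi / 2" using pi_ge_two by linarith+
      qed
      then have "G (\<chi> k. sin (x $ k / R)) = f x" using R by (simp add: G_def vec_eq_iff)
      then show ?thesis using p(2)[OF box[of x]] by (simp add: g_def)
    qed
    have g_le: "\<bar>g x\<bar> \<le> B + \<delta>" for x
      using p(2)[OF box[of x]] B(2)[of "\<chi> k. R * arcsin (sin (x $ k / R))"] by (simp add: g_def G_def)
    have "(\<lambda>n. integral\<^sup>L (N n) g) \<longlonglongrightarrow> integral\<^sup>L L g"
      using trig_poly_integral_tendsto[OF trig assms] by (simp only: integral_complex_of_real tendsto_of_real_iff)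
    then have "eventually (\<lambda>n. dist (integral\<^sup>L (N n) g) (integral\<^sup>L L g) < \<epsilon> / 3) sequentially"
      using \<open>\<epsilon> > 0\<close> by (intro tendstoD) auto
    moreover have "eventually (\<lambda>n. tail R (N n) < \<eta>) sequentially"
      using order_tendstoD(2)[OF tail R(2)] .
    moreover have "eventually (\<lambda>n. mass (N n) < mass L + 1) sequentially"
      using order_tendstoD(2)[OF mass] by simp
    ultimately
    show "eventually (\<lambda>n. dist (integral\<^sup>L (N n) f) (integral\<^sup>L L f) < \<epsilon>) sequentially"
    proof eventually_elim
      fix n assume n3: "dist (integral\<^sup>L (N n) g) (integral\<^sup>L L g) < \<epsilon> / 3"
        and n: "tail R (N n) < \<eta>" "mass (N n) < mass L + 1"
      have bd: "\<delta> * mass K + (2 * B + \<delta>) * tail R K \<le> \<epsilon> / 6" if "mass K \<le> mass L + 1" "tail R K \<le> \<eta>" for K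
      proof -
        have "\<delta> * mass K \<le> \<delta> * (mass L + 1)" using that \<delta> by (intro mult_left_mono) auto
        moreover have "(2 * B + \<delta>) * tail R K \<le> (2 * B + \<delta>) * \<eta>" using that \<delta> B by (intro mult_left_mono) auto
        ultimately show ?thesis using \<delta>(3) \<eta>(2) by linarith
      qed
      have "\<bar>integral\<^sup>L (N n) f - integral\<^sup>L (N n) g\<bar> \<le> \<epsilon> / 6"
        using err[OF N(1,2)[of n] g_int[OF N(1,2)[of n]] R(1) \<delta>(1)] in_box g_le bd[of "N n"] n
        by (meson less_imp_le order_trans)
      moreover have "\<bar>integral\<^sup>L L f - integral\<^sup>L L g\<bar> \<le> \<epsilon> / 6"
        using err[OF L g_int[OF L] R(1) \<delta>(1)] in_box g_le bd[of L] R
        by (meson less_imp_le order_trans le_add_same_cancel1 zero_le_one)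
      ultimately show "dist (integral\<^sup>L (N n) f) (integral\<^sup>L L f) < \<epsilon>"
        using n3 \<open>\<epsilon> > 0\<close> unfolding dist_real_def by linarith
    qed
  qed
qed

text \<open>The hypothesis \<open>conv\<close> says that \<open>g n (y n) \<rightarrow> g0 x\<close> whenever \<open>y n \<rightarrow> x\<close>.\<close>

lemma weakly_converges_integral_varying:
  fixes W :: "nat \<Rightarrow> (real ^ 'd) measure" and g :: "nat \<Rightarrow> real ^ 'd \<Rightarrow> real"
  assumes weak: "weakly_converges W W0"
    and W: "\<And>n. finite_measure (W n)" "\<And>n. sets (W n) = sets borel"
    and W0: "finite_measure W0" "sets W0 = sets borel"
    and N: "closed N" "N \<noteq> {}" "N \<in> null_sets W0"
    and g[measurable]: "\<And>n. g n \<in> borel_measurable borel" and bound: "\<And>n x. \<bar>g n x\<bar> \<le> C"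
    and g0[measurable]: "g0 \<in> borel_measurable borel" and bound0: "\<And>x. \<bar>g0 x\<bar> \<le> C"
    and conv: "\<And>x. x \<notin> N \<Longrightarrow> ((\<lambda>(n, y). g n y) \<longlongrightarrow> g0 x) (sequentially \<times>\<^sub>F nhds x)"
  shows "(\<lambda>n. integral\<^sup>L (W n) (g n)) \<longlonglongrightarrow> integral\<^sup>L W0 g0"
proof -
  have C: "0 \<le> C" using bound[of 0 undefined] by linarith
  interpret W0: finite_measure W0 by fact
  note [measurable_cong] = W0(2) W(2)
  \<comment> \<open>Joint convergence in \<open>n\<close> and \<open>y\<close> gives a neighbourhood
    on which all late \<open>g n\<close> are close to \<open>g0 x\<close>. Letting \<open>n\<close>
    tend to infinity at each fixed \<open>y\<close> transfers this to \<open>g0\<close>, which is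
    therefore continuous off \<open>N\<close>.\<close>
  have nbhd: "\<exists>U n0. open U \<and> x \<in> U \<and> U \<subseteq> - N \<and> (\<forall>n\<ge>n0. \<forall>y\<in>U. \<bar>g n y - g0 x\<bar> < e) \<and> (\<forall>y\<in>U. \<bar>g0 y - g0 x\<bar> \<le> e)"
    if x: "x \<notin> N" and e: "e > 0" for x e
  proof -
    have "eventually (\<lambda>p. dist (case p of (n, y) \<Rightarrow> g n y) (g0 x) < e) (sequentially \<times>\<^sub>F nhds x)"
      using conv[OF x] e by (rule tendstoD)
    then obtain Pn Py where P: "eventually Pn sequentially" "eventually Py (nhds x)"
      "\<And>n y. Pn n \<Longrightarrow> Py y \<Longrightarrow> dist (g n y) (g0 x) < e"
      unfolding eventually_prod_filter by force
    from P(1) obtain n0 where n0: "\<And>n. n \<ge> n0 \<Longrightarrow> Pn n" by (auto simp: eventually_sequentially)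
    from P(2) obtain U where U: "open U" "x \<in> U" "\<And>y. y \<in> U \<Longrightarrow> Py y" by (auto simp: eventually_nhds)
    have 1: "\<bar>g n y - g0 x\<bar> < e" if "n \<ge> n0" "y \<in> U" for n y
      using P(3)[OF n0 U(3)] that by (simp add: dist_real_def)
    have 2: "\<bar>g0 y - g0 x\<bar> \<le> e" if "y \<in> U - N" for y
    proof -
      have "filterlim (\<lambda>n. (n, y)) (sequentially \<times>\<^sub>F nhds y) sequentially"
        by (intro filterlim_Pair filterlim_ident tendsto_const)
      from filterlim_compose[OF conv this] that have "(\<lambda>n. g n y) \<longlonglongrightarrow> g0 y" by simp
      then have "(\<lambda>n. \<bar>g n y - g0 x\<bar>) \<longlonglongrightarrow> \<bar>g0 y - g0 x\<bar>"
        by (intro tendsto_rabs tendsto_diff tendsto_const)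
      moreover have "eventually (\<lambda>n. \<bar>g n y - g0 x\<bar> \<le> e) sequentially"
        using eventually_ge_at_top[of n0] by eventually_elim (use 1 that in force)
      ultimately show ?thesis using tendsto_upperbound by (metis sequentially_bot)
    qed
    show ?thesis
      by (rule exI[of _ "U - N"], rule exI[of _ n0]) (use U N(1) 1 2 x in \<open>auto intro: open_Diff\<close>)
  qed
  have cont: "continuous_on (- N) g0"
    unfolding continuous_on_iff
  proof (intro ballI allI impI)
    fix x and e :: real assume x: "x \<in> - N" and "e > 0"
    then obtain U where U: "open U" "x \<in> U" "\<forall>y\<in>U. \<bar>g0 y - g0 x\<bar> \<le> e / 2"
      using nbhd[of x "e/2"] by auto
    then obtain d where "d > 0" "\<And>y. dist y x < d \<Longrightarrow> y \<in> U" unfolding open_dist by metis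
    then show "\<exists>d>0. \<forall>x'\<in>- N. dist x' x < d \<longrightarrow> dist (g0 x') (g0 x) < e"
      using U(3) \<open>e > 0\<close> by (intro exI[of _ d]) (force simp: dist_real_def)
  qed
  \<comment> \<open>A finite subcover of these neighbourhoods upgrades the convergence to uniform
    convergence on compact sets off \<open>N\<close>.\<close>
  have unif: "eventually (\<lambda>n. \<forall>y\<in>K. \<bar>g n y - g0 y\<bar> \<le> e) sequentially"
    if K: "compact K" "K \<subseteq> - N" and "e > 0" for K e
  proof -
    have "\<forall>x\<in>K. \<exists>U n0. open U \<and> x \<in> U \<and> (\<forall>n\<ge>n0. \<forall>y\<in>U. \<bar>g n y - g0 y\<bar> \<le> e)"
    proof
      fix x assume "x \<in> K"
      then have "x \<notin> N" using K(2) by blast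
      from nbhd[OF this half_gt_zero[OF \<open>e > 0\<close>]] obtain U n0
        where U: "open U" "x \<in> U" "\<forall>n\<ge>n0. \<forall>y\<in>U. \<bar>g n y - g0 x\<bar> < e / 2" "\<forall>y\<in>U. \<bar>g0 y - g0 x\<bar> \<le> e / 2"
        by blast
      have "\<bar>g n y - g0 y\<bar> \<le> e" if "n \<ge> n0" "y \<in> U" for n y
        using U(3)[rule_format, OF that] U(4)[rule_format, OF that(2)] by linarith
      with U(1,2) show "\<exists>U n0. open U \<and> x \<in> U \<and> (\<forall>n\<ge>n0. \<forall>y\<in>U. \<bar>g n y - g0 y\<bar> \<le> e)" by blast
    qed
    then obtain U n0 where Un: "\<And>x. x \<in> K \<Longrightarrow> open (U x) \<and> x \<in> U x \<and> (\<forall>n\<ge>n0 x. \<forall>y\<in>U x. \<bar>g n y - g0 y\<bar> \<le> e)"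
      by metis
    obtain F where F: "F \<subseteq> K" "finite F" "K \<subseteq> (\<Union>x\<in>F. U x)"
      by (rule compactE_image[OF K(1), of K U]) (use Un in auto)
    have "eventually (\<lambda>n. \<forall>x\<in>F. n0 x \<le> n) sequentially"
      using F(2) by (intro eventually_ball_finite) auto
    then show ?thesis
    proof eventually_elim
      case (elim n)
      show ?case
      proof
        fix y assume "y \<in> K"
        then obtain x where x: "x \<in> F" "y \<in> U x" using F(3) by blast
        then have "x \<in> K" using F(1) by blast
        from Un[OF this] x elim show "\<bar>g n y - g0 y\<bar> \<le> e" by blast
      qed
    qed
  qed
  \<comment> \<open>\<open>cut m\<close> is a continuous cutoff that vanishes outside the compact
    set of points at distance at least 1/m from \<open>N\<close> and of norm at most
    \<open>m\<close>, and it is eventually 1 at each point off \<open>N\<close>. As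
    \<open>infdist\<close> to the empty set is 0, \<open>N\<close> has to be nonempty here.\<close>
  define cl where "cl y = max 0 (min 1 y)" for y :: real
  define cut where "cut m x = cl (real m * infdist x N - 1) * cl (real m - norm x)" for m and x :: "real ^ 'd"
  have cl: "0 \<le> cl y" "cl y \<le> 1" for y by (auto simp: cl_def)
  have cut: "0 \<le> cut m x" "cut m x \<le> 1" for m x
    unfolding cut_def using cl by (auto intro: mult_le_one)
  have cut_cont: "continuous_on UNIV (cut m)" for m
    unfolding cut_def cl_def by (intro continuous_intros)
  have [measurable]: "cut m \<in> borel_measurable borel" for m
    by (rule borel_measurable_continuous_onI[OF cut_cont])
  have weakE: "(\<lambda>n. integral\<^sup>L (W n) f) \<longlonglongrightarrow> integral\<^sup>L W0 f"
    if "continuous_on UNIV f" "\<And>x. \<bar>f x\<bar> \<le> B" for f and B :: real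
    using weak that unfolding weakly_converges_def by (auto intro!: boundedI[of _ B])
  have supp: "cut m x = 0" if "x \<notin> {x. infdist x N \<ge> 1 / real m \<and> norm x \<le> real m}" "m > 0" for m x
    using that by (auto simp: cut_def cl_def field_simps not_le)
  \<comment> \<open>Near \<open>N\<close> the product is identically 0, and off \<open>N\<close>
    both factors are continuous; these two open sets cover the space.\<close>
  have prod_cont: "continuous_on UNIV (\<lambda>x. g0 x * cut m x)" if m: "m > 0" for m
  proof -
    have "open {x. infdist x N < 1 / real m}" by (intro open_Collect_less continuous_intros)
    moreover have "continuous_on {x. infdist x N < 1 / real m} (\<lambda>x. g0 x * cut m x)"
      by (rule continuous_on_cong[THEN iffD2, OF refl, of _ _ "\<lambda>_. 0"]) (use supp[OF _ m] in auto)
    moreover have "continuous_on (- N) (\<lambda>x. g0 x * cut m x)"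
      by (intro continuous_intros cont continuous_on_subset[OF cut_cont]) auto
    ultimately have "continuous_on ({x. infdist x N < 1 / real m} \<union> - N) (\<lambda>x. g0 x * cut m x)"
      using N(1) by (intro continuous_on_open_Un) auto
    moreover have "{x. infdist x N < 1 / real m} \<union> - N = UNIV" using m by auto
    ultimately show ?thesis by simp
  qed
  have tail0: "(\<lambda>m. \<integral>x. 1 - cut m x \<partial>W0) \<longlonglongrightarrow> (\<integral>x. 0 \<partial>W0)"
  proof (rule integral_dominated_convergence[where w="\<lambda>_. 1"])
    have "(\<lambda>m. 1 - cut m x) \<longlonglongrightarrow> 0" if "x \<notin> N" for x
    proof -
      have d: "infdist x N > 0" using that N by (metis in_closed_iff_infdist_zero infdist_nonneg less_eq_real_def)
      obtain k where k: "real k > 2 / infdist x N" "real k > norm x + 1" using reals_Archimedean2[of "max (2 / infdist x N) (norm x + 1)"] by auto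
      have "cut m x = 1" if "m \<ge> k" for m
      proof -
        have "real m \<ge> 2 / infdist x N" "real m \<ge> norm x + 1" using that k of_nat_mono[OF that, where 'a=real] by linarith+
        then show ?thesis using d by (simp add: cut_def cl_def field_simps)
      qed
      then have "eventually (\<lambda>m. 1 - cut m x = 0) sequentially" by (auto simp: eventually_sequentially intro!: exI[of _ k])
      then show ?thesis by (rule tendsto_eventually)
    qed
    then show "AE x in W0. (\<lambda>m. 1 - cut m x) \<longlonglongrightarrow> 0"
      using AE_not_in[OF N(3)] by (rule_tac AE_mp) (auto intro: AE_I2)
    show "AE x in W0. norm (1 - cut m x) \<le> 1" for m using cut by (intro AE_I2) simp
  qed (simp_all, measurable)
  have int: "integrable K f" if "finite_measure K" "sets K = sets borel" "f \<in> borel_measurable borel" "\<And>x. \<bar>f x\<bar> \<le> B"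
    for K :: "(real ^ 'd) measure" and f and B :: real
    using that by (intro finite_measure.integrable_const_bound[of K _ B]) (auto simp: measurable_cong_sets[OF that(2) refl])
  show ?thesis
  proof (rule tendstoI)
    fix e :: real assume e: "e > 0"
    \<comment> \<open>Four errors of e/8 each: removing the cutoff under \<open>W n\<close> and
      under \<open>W0\<close>, replacing \<open>g n\<close> by \<open>g0\<close> on
      \<open>K\<close>, and weak convergence for the continuous function
      \<open>g0 x * cut m x\<close>.\<close>
    define \<eta> where "\<eta> = e / (8 * (C + 1))"
    have \<eta>: "\<eta> > 0" "C * \<eta> \<le> e / 8"
    proof -
      show "\<eta> > 0" using e C by (simp add: \<eta>_def)
      have "C * \<eta> \<le> (C + 1) * \<eta>" using \<open>\<eta> > 0\<close> by (intro mult_right_mono) auto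
      also have "\<dots> = e / 8" using C by (simp add: \<eta>_def divide_simps)
      finally show "C * \<eta> \<le> e / 8" .
    qed
    have "eventually (\<lambda>m. (\<integral>x. 1 - cut m x \<partial>W0) < \<eta> \<and> m > 0) sequentially"
      using order_tendstoD(2)[OF tail0, of \<eta>] \<eta> by (intro eventually_conj eventually_gt_at_top) simp
    then obtain m where m: "(\<integral>x. 1 - cut m x \<partial>W0) < \<eta>" "m > 0" by (auto simp: eventually_sequentially)
    define K where "K = {x. infdist x N \<ge> 1 / real m} \<inter> cball 0 (real m)"
    have K: "compact K" "K \<subseteq> - N"
    proof -
      have "closed {x. infdist x N \<ge> 1 / real m}" by (intro closed_Collect_le continuous_intros)
      then show "compact K" unfolding K_def by (intro closed_Int_compact) auto
      show "K \<subseteq> - N" using m(2) by (auto simp: K_def)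
    qed
    define M where "M = measure W0 UNIV + 1"
    have M: "M > 0" by (simp add: M_def add_nonneg_pos)
    have "(\<lambda>n. \<integral>x. (1::real) \<partial>W n) \<longlonglongrightarrow> (\<integral>x. (1::real) \<partial>W0)" by (rule weakE[of "\<lambda>_. 1" 1]) auto
    then have "(\<lambda>n. measure (W n) UNIV) \<longlonglongrightarrow> measure W0 UNIV"
      using sets_eq_imp_space_eq[OF W(2)] sets_eq_imp_space_eq[OF W0(2)] by simp
    then have mass: "eventually (\<lambda>n. measure (W n) UNIV < M) sequentially"
      using order_tendstoD(2) unfolding M_def by (metis less_add_one)
    have tail: "eventually (\<lambda>n. (\<integral>x. 1 - cut m x \<partial>W n) < \<eta>) sequentially"
      by (rule order_tendstoD(2)[OF weakE[of _ 1] m(1)]) (use cut cut_cont in \<open>auto intro!: continuous_intros\<close>)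
    have mid: "eventually (\<lambda>n. dist (\<integral>x. g0 x * cut m x \<partial>W n) (\<integral>x. g0 x * cut m x \<partial>W0) < e / 8) sequentially"
    proof (rule tendstoD[OF weakE[OF prod_cont[OF m(2)], of C]])
      show "\<bar>g0 x * cut m x\<bar> \<le> C" for x
        using mult_mono[OF bound0[of x] cut(2)[of m x]] cut(1)[of m x] C by (simp add: abs_mult)
    qed (use e in simp)
    have unif': "eventually (\<lambda>n. \<forall>y\<in>K. \<bar>g n y - g0 y\<bar> \<le> e / (8 * M)) sequentially"
      by (rule unif[OF K]) (use e M in simp)
    from mass tail mid unif'
    show "eventually (\<lambda>n. dist (integral\<^sup>L (W n) (g n)) (integral\<^sup>L W0 g0) < e) sequentially"
    proof eventually_elim
      case (elim n)
      have split: "\<bar>integral\<^sup>L V f - (\<integral>x. f x * cut m x \<partial>V)\<bar> \<le> e / 8"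
        if V: "finite_measure V" "sets V = sets borel" and f: "f \<in> borel_measurable borel" "\<And>x. \<bar>f x\<bar> \<le> C"
          and small: "(\<integral>x. 1 - cut m x \<partial>V) < \<eta>" for V :: "(real ^ 'd) measure" and f
      proof -
        note [measurable] = f(1)
        have i1: "integrable V f" by (rule int[OF V f])
        have i2: "integrable V (\<lambda>x. f x * cut m x)"
          by (rule int[OF V, of _ C], measurable)
             (use mult_mono[OF f(2) cut(2)] cut(1) C in \<open>simp add: abs_mult\<close>)
        have i3: "integrable V (\<lambda>x. 1 - cut m x)" by (rule int[OF V, of _ 1], measurable) (use cut in auto)
        have "\<bar>integral\<^sup>L V f - (\<integral>x. f x * cut m x \<partial>V)\<bar> = norm (\<integral>x. f x - f x * cut m x \<partial>V)"
          using i1 i2 by simp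
        also have "\<dots> \<le> (\<integral>x. norm (f x - f x * cut m x) \<partial>V)" by (rule integral_norm_bound)
        also have "\<dots> \<le> (\<integral>x. C * (1 - cut m x) \<partial>V)"
        proof (rule integral_mono)
          show "norm (f x - f x * cut m x) \<le> C * (1 - cut m x)" for x
          proof -
            have "norm (f x - f x * cut m x) = \<bar>f x\<bar> * (1 - cut m x)"
            proof -
              have "f x - f x * cut m x = f x * (1 - cut m x)" by (simp add: algebra_simps)
              then show ?thesis using cut(2)[of m x] by (simp only: real_norm_def abs_mult)
            qed
            then show ?thesis using f(2)[of x] cut(2)[of m x] by (simp add: mult_right_mono)
          qed
        qed (use i1 i2 i3 in auto)
        also have "\<dots> \<le> C * \<eta>" using small C i3 by (simp add: mult_left_mono)
        finally show ?thesis using \<eta>(2) by simp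
      qed
      have s1: "\<bar>integral\<^sup>L (W n) (g n) - (\<integral>x. g n x * cut m x \<partial>W n)\<bar> \<le> e / 8"
        by (rule split[OF W g bound elim(2)])
      have s2: "\<bar>integral\<^sup>L W0 g0 - (\<integral>x. g0 x * cut m x \<partial>W0)\<bar> \<le> e / 8"
        by (rule split[OF W0 g0 bound0 m(1)])
      have s3: "\<bar>(\<integral>x. g n x * cut m x \<partial>W n) - (\<integral>x. g0 x * cut m x \<partial>W n)\<bar> \<le> e / 8"
      proof -
        interpret Wn: finite_measure "W n" by (rule W)
        have i: "integrable (W n) (\<lambda>x. f x * cut m x)" if "f \<in> borel_measurable borel" "\<And>x. \<bar>f x\<bar> \<le> C" for f
        proof -
          note [measurable] = that(1)
          show ?thesis
            by (rule int[OF W, of _ C], measurable)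
               (use mult_mono[OF that(2) cut(2)] cut(1) C in \<open>simp add: abs_mult\<close>)
        qed
        have "\<bar>(\<integral>x. g n x * cut m x \<partial>W n) - (\<integral>x. g0 x * cut m x \<partial>W n)\<bar> = norm (\<integral>x. g n x * cut m x - g0 x * cut m x \<partial>W n)"
          using i[OF g bound] i[OF g0 bound0] by simp
        also have "\<dots> \<le> (\<integral>x. norm (g n x * cut m x - g0 x * cut m x) \<partial>W n)" by (rule integral_norm_bound)
        also have "\<dots> \<le> (\<integral>x. e / (8 * M) \<partial>W n)"
        proof (rule integral_mono)
          show "norm (g n x * cut m x - g0 x * cut m x) \<le> e / (8 * M)" for x
          proof (cases "x \<in> K")
            case True
            have "norm (g n x * cut m x - g0 x * cut m x) = \<bar>g n x - g0 x\<bar> * cut m x"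
              using cut(1)[of m x] by (simp add: abs_mult flip: left_diff_distrib)
            also have "\<dots> \<le> e / (8 * M) * 1"
              using elim(4) True cut[of m x] e M by (intro mult_mono) auto
            finally show ?thesis by simp
          next
            case False
            then have "cut m x = 0" using supp[OF _ m(2), of x] by (auto simp: K_def)
            then show ?thesis using e M by simp
          qed
        qed (use i[OF g bound] i[OF g0 bound0] in auto)
        also have "\<dots> = e / (8 * M) * measure (W n) UNIV"
          using sets_eq_imp_space_eq[OF W(2)] by simp
        also have "\<dots> \<le> e / (8 * M) * M" using elim(1) e M by (intro mult_left_mono) auto
        also have "\<dots> = e / 8" using M by simp
        finally show ?thesis .
      qed
      show ?case using s1 s2 s3 elim(3) e unfolding dist_real_def by linarith
    qed
  qed
qed

section \<open>Measures in polar coordinates\<close>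

lemma
  assumes "sphere_measure \<sigma>"
  shows sphere_measure_finite: "finite_measure \<sigma>"
    and sphere_measure_sets: "sets \<sigma> = sets (restrict_space borel (sphere 0 1))"
    and sphere_measure_space: "space \<sigma> = sphere 0 1"
  using assms sets_eq_imp_space_eq[of \<sigma> "restrict_space borel (sphere 0 1)"]
  by (auto simp: sphere_measure_def space_restrict_space)

lemma measurable_sphere_measure_ident:
  assumes "sphere_measure \<sigma>" shows "(\<lambda>s. s) \<in> borel_measurable \<sigma>"
  unfolding measurable_cong_sets[OF sphere_measure_sets[OF assms] refl]
  by (rule measurable_restrict_space1) simp

lemma sphere_measure_pos:
  assumes "sphere_measure \<sigma>" shows "measure \<sigma> (sphere 0 1) > 0"
  using assms finite_measure.emeasure_eq_measure[OF sphere_measure_finite[OF assms]]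
  by (simp add: sphere_measure_def zero_less_measure_iff)

lemma nn_integral_polar_measure:
  fixes \<sigma> :: "(real ^ 'd) measure"
  assumes \<sigma>: "sphere_measure \<sigma>"
    and q[measurable]: "(\<lambda>(r, s). q r s) \<in> borel_measurable (restrict_space lborel {0<..} \<Otimes>\<^sub>M \<sigma>)"
    and G[measurable]: "G \<in> borel_measurable borel"
  shows "(\<integral>\<^sup>+x. G x \<partial>polar_measure \<alpha> \<sigma> q)
    = (\<integral>\<^sup>+s. (\<integral>\<^sup>+r. ennreal (r powr (- \<alpha> - 1) * q r s) * G (r *\<^sub>R s) * indicator {0<..} r \<partial>lborel) \<partial>\<sigma>)"
proof -
  let ?R = "restrict_space lborel {0<..} :: real measure"
  interpret \<sigma>: finite_measure \<sigma> by (rule sphere_measure_finite[OF \<sigma>])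
  interpret R: sigma_finite_measure ?R
    by (rule sigma_finite_measure_restrict_space) (auto intro: lborel.sigma_finite_measure_axioms)
  interpret P: pair_sigma_finite ?R \<sigma> by unfold_locales
  have [measurable]: "(\<lambda>r. r) \<in> borel_measurable ?R"
    by (rule measurable_restrict_space1) simp
  note [measurable] = measurable_sphere_measure_ident[OF \<sigma>]
  have m: "(\<lambda>(r, s). r *\<^sub>R s) \<in> borel_measurable (?R \<Otimes>\<^sub>M \<sigma>)" by measurable
  have mf: "(\<lambda>(r, s). ennreal (r powr (- \<alpha> - 1) * q r s)) \<in> borel_measurable (?R \<Otimes>\<^sub>M \<sigma>)" by measurable
  have mG: "(\<lambda>(r, s). ennreal (r powr (- \<alpha> - 1) * q r s) * G (r *\<^sub>R s)) \<in> borel_measurable (?R \<Otimes>\<^sub>M \<sigma>)"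
    by measurable
  have "(\<integral>\<^sup>+x. G x \<partial>polar_measure \<alpha> \<sigma> q)
      = (\<integral>\<^sup>+p. G (case p of (r, s) \<Rightarrow> r *\<^sub>R s) \<partial>density (?R \<Otimes>\<^sub>M \<sigma>) (\<lambda>(r, s). ennreal (r powr (- \<alpha> - 1) * q r s)))"
    unfolding polar_measure_def using m by (intro nn_integral_distr) simp_all
  also have "\<dots> = (\<integral>\<^sup>+p. (case p of (r, s) \<Rightarrow> ennreal (r powr (- \<alpha> - 1) * q r s)) * G (case p of (r, s) \<Rightarrow> r *\<^sub>R s) \<partial>(?R \<Otimes>\<^sub>M \<sigma>))"
    using mf measurable_compose[OF m G] by (intro nn_integral_density) simp_all
  also have "\<dots> = (\<integral>\<^sup>+p. (case p of (r, s) \<Rightarrow> ennreal (r powr (- \<alpha> - 1) * q r s) * G (r *\<^sub>R s)) \<partial>(?R \<Otimes>\<^sub>M \<sigma>))"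
    by (intro nn_integral_cong) (simp split: prod.split)
  also have "\<dots> = (\<integral>\<^sup>+s. (\<integral>\<^sup>+r. ennreal (r powr (- \<alpha> - 1) * q r s) * G (r *\<^sub>R s) \<partial>?R) \<partial>\<sigma>)"
    using P.nn_integral_snd[OF mG] by simp
  finally show ?thesis by (simp add: nn_integral_restrict_space)
qed

lemma nn_integral_stable_polar_measure:
  fixes \<sigma> :: "(real ^ 'd) measure"
  assumes \<sigma>: "sphere_measure \<sigma>" and G: "G \<in> borel_measurable borel"
  shows "(\<integral>\<^sup>+x. G x \<partial>polar_measure \<alpha> \<sigma> (\<lambda>r s. 1))
    = (\<integral>\<^sup>+s. (\<integral>\<^sup>+r. ennreal (r powr (- \<alpha> - 1)) * G (r *\<^sub>R s) * indicator {0<..} r \<partial>lborel) \<partial>\<sigma>)"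
  using nn_integral_polar_measure[OF \<sigma> _ G, of "\<lambda>r s. 1" \<alpha>] by simp

lemma sets_polar_measure[simp, measurable_cong]: "sets (polar_measure \<alpha> \<sigma> q) = sets borel"
  and space_polar_measure[simp]: "space (polar_measure \<alpha> \<sigma> q) = UNIV"
  by (simp_all add: polar_measure_def)

text \<open>Each ray meets the set in at most one radius, a Lebesgue null set. The case
  \<open>R = 0\<close> says that the origin carries no mass.\<close>

lemma polar_measure_sphere_null:
  assumes \<sigma>: "sphere_measure \<sigma>"
    and q: "(\<lambda>(r, s). q r s) \<in> borel_measurable (restrict_space lborel {0<..} \<Otimes>\<^sub>M \<sigma>)"
  shows "{x :: real ^ 'd. norm x = R} \<in> null_sets (polar_measure \<alpha> \<sigma> q)"
proof -
  have "emeasure (polar_measure \<alpha> \<sigma> q) {x. norm x = R} = (\<integral>\<^sup>+x. indicator {x. norm x = R} x \<partial>polar_measure \<alpha> \<sigma> q)"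
    by (simp add: nn_integral_indicator)
  also have "\<dots> = (\<integral>\<^sup>+s. (\<integral>\<^sup>+r. ennreal (r powr (- \<alpha> - 1) * q r s) * indicator {x. norm x = R} (r *\<^sub>R s) * indicator {0<..} r \<partial>lborel) \<partial>\<sigma>)"
    by (rule nn_integral_polar_measure[OF \<sigma> q]) simp
  also have "\<dots> = (\<integral>\<^sup>+s. (\<integral>\<^sup>+(r::real). 0 \<partial>lborel) \<partial>\<sigma>)"
  proof (rule nn_integral_cong, rule nn_integral_cong_AE)
    fix s assume "s \<in> space \<sigma>"
    then have "norm s = 1" using sphere_measure_space[OF \<sigma>] by simp
    show "AE r in lborel. ennreal (r powr (- \<alpha> - 1) * q r s) * indicator {x. norm x = R} (r *\<^sub>R s) * indicator {0<..} r = 0"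
      using AE_lborel_singleton[of R] by eventually_elim (use \<open>norm s = 1\<close> in \<open>auto simp: indicator_def\<close>)
  qed
  finally show ?thesis by (simp add: null_setsI)
qed

lemma nn_integral_powr_tail:
  assumes "\<alpha> > 0" "R > 0"
  shows "(\<integral>\<^sup>+r. ennreal (r powr (- \<alpha> - 1)) * indicator {R<..} r \<partial>lborel) = ennreal (R powr (- \<alpha>) / \<alpha>)"
proof -
  have "((\<lambda>x. x powr (- \<alpha> - 1)) has_integral -(R powr (- \<alpha> - 1 + 1)) / (- \<alpha> - 1 + 1)) {R..}"
    using assms by (intro has_integral_powr_to_inf) auto
  then have h: "((\<lambda>x. x powr (- \<alpha> - 1)) has_integral (R powr (- \<alpha>) / \<alpha>)) {R..}" by simp
  have "(\<integral>\<^sup>+r. ennreal (r powr (- \<alpha> - 1)) * indicator {R<..} r \<partial>lborel) = (\<integral>\<^sup>+r. ennreal (indicator {R..} r * r powr (- \<alpha> - 1)) \<partial>lborel)"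
    by (rule nn_integral_cong_AE) (use AE_lborel_singleton[of R] in eventually_elim, auto simp: indicator_def)
  also have "\<dots> = ennreal (R powr (- \<alpha>) / \<alpha>)"
    using nn_integral_has_integral_lebesgue[OF _ h] by simp
  finally show ?thesis .
qed

lemma nn_integral_powr_near_0:
  assumes "\<alpha> < 2"
  shows "(\<integral>\<^sup>+r. ennreal (r powr (1 - \<alpha>)) * indicator {0<..1} r \<partial>lborel) = ennreal (1 / (2 - \<alpha>))"
proof -
  have "((\<lambda>x. x powr (1 - \<alpha>)) has_integral (1 powr (1 - \<alpha> + 1) / (1 - \<alpha> + 1))) {0..1}"
    using assms by (intro has_integral_powr_from_0) auto
  then have h: "((\<lambda>x. x powr (1 - \<alpha>)) has_integral (1 / (2 - \<alpha>))) {0..1}" by simp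
  have "(\<integral>\<^sup>+r. ennreal (r powr (1 - \<alpha>)) * indicator {0<..1} r \<partial>lborel) = (\<integral>\<^sup>+r. ennreal (indicator {0..1} r * r powr (1 - \<alpha>)) \<partial>lborel)"
    by (rule nn_integral_cong_AE) (use AE_lborel_singleton[of 0] in eventually_elim, auto simp: indicator_def)
  also have "\<dots> = ennreal (1 / (2 - \<alpha>))"
    using nn_integral_has_integral_lebesgue[OF _ h] by simp
  finally show ?thesis .
qed

lemma emeasure_stable_tail:
  assumes \<sigma>: "sphere_measure \<sigma>" and \<alpha>: "\<alpha> > 0" and R: "R > 0"
  shows "emeasure (polar_measure \<alpha> \<sigma> (\<lambda>r s. 1)) {x :: real ^ 'd. norm x > R} = ennreal (measure \<sigma> (sphere 0 1) * (R powr (- \<alpha>) / \<alpha>))"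
proof -
  interpret \<sigma>: finite_measure \<sigma> by (rule sphere_measure_finite[OF \<sigma>])
  have "emeasure (polar_measure \<alpha> \<sigma> (\<lambda>r s. 1)) {x. norm x > R} = (\<integral>\<^sup>+x. indicator {x. norm x > R} x \<partial>polar_measure \<alpha> \<sigma> (\<lambda>r s. 1))"
    by (simp add: nn_integral_indicator)
  also have "\<dots> = (\<integral>\<^sup>+s. (\<integral>\<^sup>+r. ennreal (r powr (- \<alpha> - 1)) * indicator {x. norm x > R} (r *\<^sub>R s) * indicator {0<..} r \<partial>lborel) \<partial>\<sigma>)"
    by (rule nn_integral_stable_polar_measure[OF \<sigma>]) simp
  also have "\<dots> = (\<integral>\<^sup>+s. (\<integral>\<^sup>+r. ennreal (r powr (- \<alpha> - 1)) * indicator {R<..} r \<partial>lborel) \<partial>\<sigma>)"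
    using sphere_measure_space[OF \<sigma>] R by (intro nn_integral_cong) (auto simp: indicator_def)
  also have "\<dots> = ennreal (R powr (- \<alpha>) / \<alpha>) * emeasure \<sigma> (space \<sigma>)"
    unfolding nn_integral_powr_tail[OF \<alpha> R] by simp
  also have "\<dots> = ennreal (measure \<sigma> (sphere 0 1) * (R powr (- \<alpha>) / \<alpha>))"
    unfolding \<sigma>.emeasure_eq_measure sphere_measure_space[OF \<sigma>] using \<alpha>
    by (subst ennreal_mult'[symmetric]) (auto simp: mult.commute)
  finally show ?thesis .
qed

text \<open>Near the origin the radial integrand is r^(1 - alpha), integrable by
  \<open>\<alpha> < 2\<close>; beyond 1 it is r^(-alpha - 1), integrable by
  \<open>\<alpha> > 0\<close>.\<close>

lemma integrable_stable_min:
  assumes \<sigma>: "sphere_measure \<sigma>" and \<alpha>: "\<alpha> > 0" "\<alpha> < 2"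
  shows "integrable (polar_measure \<alpha> \<sigma> (\<lambda>r s. 1)) (\<lambda>x :: real ^ 'd. min 1 ((norm x)\<^sup>2))"
proof -
  interpret \<sigma>: finite_measure \<sigma> by (rule sphere_measure_finite[OF \<sigma>])
  have "(\<integral>\<^sup>+x. ennreal (min 1 ((norm x)\<^sup>2)) \<partial>polar_measure \<alpha> \<sigma> (\<lambda>r s. 1))
      = (\<integral>\<^sup>+s. (\<integral>\<^sup>+r. ennreal (r powr (- \<alpha> - 1)) * ennreal (min 1 ((norm (r *\<^sub>R s))\<^sup>2)) * indicator {0<..} r \<partial>lborel) \<partial>\<sigma>)"
    by (rule nn_integral_stable_polar_measure[OF \<sigma>]) simp
  also have "\<dots> \<le> (\<integral>\<^sup>+s. (\<integral>\<^sup>+r. ennreal (r powr (1 - \<alpha>)) * indicator {0<..1} r + ennreal (r powr (- \<alpha> - 1)) * indicator {1<..} r \<partial>lborel) \<partial>\<sigma>)"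
  proof (intro nn_integral_mono)
    fix s and r :: real assume "s \<in> space \<sigma>"
    then have s: "norm s = 1" using sphere_measure_space[OF \<sigma>] by simp
    show "ennreal (r powr (- \<alpha> - 1)) * ennreal (min 1 ((norm (r *\<^sub>R s))\<^sup>2)) * indicator {0<..} r
        \<le> ennreal (r powr (1 - \<alpha>)) * indicator {0<..1} r + ennreal (r powr (- \<alpha> - 1)) * indicator {1<..} r"
    proof (cases "r > 0")
      case True
      have sq: "(norm (r *\<^sub>R s))\<^sup>2 = r\<^sup>2" using s by simp
      have "r powr (- \<alpha> - 1) * r\<^sup>2 = r powr (1 - \<alpha>)"
        using True by (simp add: powr_add[symmetric] flip: powr_numeral)
      then have 1: "r powr (- \<alpha> - 1) * min 1 (r\<^sup>2) \<le> r powr (1 - \<alpha>)"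
        by (metis min.cobounded2 mult_left_mono powr_ge_zero)
      have 2: "r powr (- \<alpha> - 1) * min 1 (r\<^sup>2) \<le> r powr (- \<alpha> - 1)" by (simp add: mult_left_le)
      show ?thesis
        using True 1 2 unfolding sq by (cases "r \<le> 1") (auto simp: ennreal_mult'[symmetric] intro!: ennreal_leI)
    qed simp
  qed
  also have "\<dots> = (ennreal (1 / (2 - \<alpha>)) + ennreal (1 / \<alpha>)) * emeasure \<sigma> (space \<sigma>)"
    using nn_integral_powr_tail[OF \<alpha>(1), of 1] nn_integral_powr_near_0[OF \<alpha>(2)] by (simp add: nn_integral_add)
  also have "\<dots> < \<infinity>" by (simp add: less_top[symmetric] ennreal_mult_eq_top_iff \<sigma>.emeasure_finite)
  finally show ?thesis by (intro integrableI_bounded) simp_all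
qed

text \<open>Homogeneity of the stable Levy measure: substituting k r for r on each ray, the density
  contributes k^(-alpha - 1) and the differential contributes k.\<close>

lemma distr_scale_stable:
  fixes \<sigma> :: "(real ^ 'd) measure"
  assumes \<sigma>: "sphere_measure \<sigma>" and k: "k > 0"
  shows "distr (polar_measure \<alpha> \<sigma> (\<lambda>r s. 1)) borel (\<lambda>x. k *\<^sub>R x)
    = density (polar_measure \<alpha> \<sigma> (\<lambda>r s. 1)) (\<lambda>_. ennreal (k powr \<alpha>))"
proof (rule measure_eqI)
  let ?M = "polar_measure \<alpha> \<sigma> (\<lambda>r s. 1)"
  fix A assume "A \<in> sets (distr ?M borel (\<lambda>x. k *\<^sub>R x))"
  then have A[measurable]: "A \<in> sets borel" by simp
  have radial: "(\<integral>\<^sup>+r. ennreal (r powr (- \<alpha> - 1)) * indicator A (k *\<^sub>R (r *\<^sub>R s)) * indicator {0<..} r \<partial>lborel)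
      = ennreal (k powr \<alpha>) * (\<integral>\<^sup>+r. ennreal (r powr (- \<alpha> - 1)) * indicator A (r *\<^sub>R s) * indicator {0<..} r \<partial>lborel)" for s
  proof -
    have "(\<integral>\<^sup>+r. ennreal (r powr (- \<alpha> - 1)) * indicator A (r *\<^sub>R s) * indicator {0<..} r \<partial>lborel)
      = ennreal \<bar>k\<bar> * (\<integral>\<^sup>+r. ennreal ((0 + k * r) powr (- \<alpha> - 1)) * indicator A ((0 + k * r) *\<^sub>R s) * indicator {0<..} (0 + k * r) \<partial>lborel)"
      using k by (intro nn_integral_real_affine) auto
    also have "(\<integral>\<^sup>+r. ennreal ((0 + k * r) powr (- \<alpha> - 1)) * indicator A ((0 + k * r) *\<^sub>R s) * indicator {0<..} (0 + k * r) \<partial>lborel)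
      = (\<integral>\<^sup>+r. ennreal (k powr (- \<alpha> - 1)) * (ennreal (r powr (- \<alpha> - 1)) * indicator A (k *\<^sub>R (r *\<^sub>R s)) * indicator {0<..} r) \<partial>lborel)"
      using k by (intro nn_integral_cong)
        (auto simp: indicator_def powr_mult zero_less_mult_iff ennreal_mult'[symmetric])
    also have "\<dots> = ennreal (k powr (- \<alpha> - 1)) * (\<integral>\<^sup>+r. ennreal (r powr (- \<alpha> - 1)) * indicator A (k *\<^sub>R (r *\<^sub>R s)) * indicator {0<..} r \<partial>lborel)"
      by (rule nn_integral_cmult) measurable
    finally have "(\<integral>\<^sup>+r. ennreal (r powr (- \<alpha> - 1)) * indicator A (r *\<^sub>R s) * indicator {0<..} r \<partial>lborel)
       = ennreal (k powr - \<alpha>) * (\<integral>\<^sup>+r. ennreal (r powr (- \<alpha> - 1)) * indicator A (k *\<^sub>R (r *\<^sub>R s)) * indicator {0<..} r \<partial>lborel)"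
      using k by (simp add: ennreal_mult'[symmetric] mult.assoc[symmetric] powr_mult_base)
    moreover have "ennreal (k powr \<alpha>) * ennreal (k powr - \<alpha>) = 1"
      using k by (simp add: ennreal_mult'[symmetric] powr_add[symmetric])
    ultimately show ?thesis by (simp add: mult.assoc[symmetric])
  qed
  have "emeasure (distr ?M borel (\<lambda>x. k *\<^sub>R x)) A = (\<integral>\<^sup>+x. indicator A x \<partial>distr ?M borel (\<lambda>x. k *\<^sub>R x))"
    by simp
  also have "\<dots> = (\<integral>\<^sup>+x. indicator A (k *\<^sub>R x) \<partial>?M)" by (rule nn_integral_distr) (auto simp: measurable_cong_sets[OF sets_polar_measure refl])
  also have "\<dots> = (\<integral>\<^sup>+s. (\<integral>\<^sup>+r. ennreal (r powr (- \<alpha> - 1)) * indicator A (k *\<^sub>R (r *\<^sub>R s)) * indicator {0<..} r \<partial>lborel) \<partial>\<sigma>)"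
    by (rule nn_integral_stable_polar_measure[OF \<sigma>]) measurable
  also have "\<dots> = (\<integral>\<^sup>+s. ennreal (k powr \<alpha>) * (\<integral>\<^sup>+r. ennreal (r powr (- \<alpha> - 1)) * indicator A (r *\<^sub>R s) * indicator {0<..} r \<partial>lborel) \<partial>\<sigma>)"
    by (simp only: radial)
  also have "\<dots> = ennreal (k powr \<alpha>) * (\<integral>\<^sup>+s. (\<integral>\<^sup>+r. ennreal (r powr (- \<alpha> - 1)) * indicator A (r *\<^sub>R s) * indicator {0<..} r \<partial>lborel) \<partial>\<sigma>)"
  proof (rule nn_integral_cmult)
    note [measurable] = measurable_sphere_measure_ident[OF \<sigma>]
    show "(\<lambda>s. \<integral>\<^sup>+r. ennreal (r powr (- \<alpha> - 1)) * indicator A (r *\<^sub>R s) * indicator {0<..} r \<partial>lborel) \<in> borel_measurable \<sigma>"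
      by measurable
  qed
  also have "\<dots> = ennreal (k powr \<alpha>) * (\<integral>\<^sup>+x. indicator A x \<partial>?M)"
    by (subst nn_integral_stable_polar_measure[OF \<sigma>]) auto
  also have "\<dots> = emeasure (density ?M (\<lambda>_. ennreal (k powr \<alpha>))) A"
    by (subst emeasure_density) (auto simp: nn_integral_cmult_indicator)
  finally show "emeasure (distr ?M borel (\<lambda>x. k *\<^sub>R x)) A = emeasure (density ?M (\<lambda>_. ennreal (k powr \<alpha>))) A" .
qed simp

lemma integral_scale_stable:
  fixes \<sigma> :: "(real ^ 'd) measure" and G :: "real ^ 'd \<Rightarrow> 'b :: {banach, second_countable_topology}"
  assumes \<sigma>: "sphere_measure \<sigma>" and k: "k > 0" and G: "G \<in> borel_measurable borel"
  shows "(\<integral>x. G (k *\<^sub>R x) \<partial>polar_measure \<alpha> \<sigma> (\<lambda>r s. 1)) = (k powr \<alpha>) *\<^sub>R (\<integral>x. G x \<partial>polar_measure \<alpha> \<sigma> (\<lambda>r s. 1))"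
proof -
  let ?M = "polar_measure \<alpha> \<sigma> (\<lambda>r s. 1)"
  have "(\<integral>x. G (k *\<^sub>R x) \<partial>?M) = (\<integral>x. G x \<partial>distr ?M borel (\<lambda>x. k *\<^sub>R x))"
    by (rule integral_distr[symmetric]) (use G in \<open>auto simp: measurable_cong_sets[OF sets_polar_measure refl]\<close>)
  also have "\<dots> = (\<integral>x. (k powr \<alpha>) *\<^sub>R G x \<partial>?M)"
    unfolding distr_scale_stable[OF \<sigma> k] using k G by (subst integral_density) (auto simp: measurable_cong_sets[OF sets_polar_measure refl])
  finally show ?thesis by simp
qed

text \<open>By Markov's inequality the sets where \<open>f\<close> is at least 1/(n+1) have finite
  measure; together with the zero set of \<open>f\<close> they exhaust the space.\<close>

lemma sigma_finite_if_integrable_pos: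
  fixes f :: "'a \<Rightarrow> real"
  assumes f: "integrable M f" and nonneg: "\<And>x. x \<in> space M \<Longrightarrow> 0 \<le> f x"
    and null: "emeasure M {x \<in> space M. f x = 0} \<noteq> \<infinity>"
  shows "sigma_finite_measure M"
proof
  note [measurable] = borel_measurable_integrable[OF f]
  let ?A = "\<lambda>n::nat. {x \<in> space M. f x \<ge> 1 / Suc n}"
  let ?S = "insert {x \<in> space M. f x = 0} (range ?A)"
  have "emeasure M (?A n) \<noteq> \<infinity>" for n
  proof -
    have sub: "?A n \<subseteq> {x \<in> space M. 1 \<le> ennreal (Suc n) * ennreal (f x)}"
    proof safe
      fix x assume "x \<in> space M" "1 / real (Suc n) \<le> f x"
      then have "1 \<le> real (Suc n) * f x" by (simp add: field_simps)
      then have "ennreal 1 \<le> ennreal (real (Suc n) * f x)" by (rule ennreal_leI)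
      then show "1 \<le> ennreal (Suc n) * ennreal (f x)"
        by (simp only: ennreal_1 ennreal_mult' of_nat_0_le_iff)
    qed
    have "emeasure M (?A n) \<le> emeasure M {x \<in> space M. 1 \<le> ennreal (Suc n) * ennreal (f x)}"
      by (rule emeasure_mono[OF sub]) measurable
    also have "\<dots> \<le> ennreal (Suc n) * (\<integral>\<^sup>+x. ennreal (f x) * indicator (space M) x \<partial>M)"
      by (rule nn_integral_Markov_inequality) auto
    also have "\<dots> < \<infinity>"
      using f nonneg by (auto simp: integrable_iff_bounded ennreal_mult_less_top nn_integral_cong[of M "\<lambda>x. ennreal \<bar>f x\<bar>" "\<lambda>x. ennreal (f x) * indicator (space M) x"])
    finally show ?thesis by simp
  qed
  moreover have "x \<in> \<Union>?S" if "x \<in> space M" for x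
  proof (cases "f x = 0")
    case False
    then have "f x > 0" using nonneg[OF that] by simp
    then obtain n where "1 / real (Suc n) < f x" using nat_approx_posE[of "f x"] by auto
    then have "x \<in> ?A n" using that by auto
    then show ?thesis by blast
  qed (use that in blast)
  then have "\<Union>?S = space M" by (intro equalityI subsetI) auto
  moreover have "?S \<subseteq> sets M" by auto
  ultimately show "\<exists>A. countable A \<and> A \<subseteq> sets M \<and> \<Union> A = space M \<and> (\<forall>a\<in>A. emeasure M a \<noteq> \<infinity>)"
    using null by (intro exI[of _ ?S]) auto
qed

lemma sigma_finite_stable:
  assumes \<sigma>: "sphere_measure \<sigma>" and \<alpha>: "\<alpha> > 0" "\<alpha> < 2"
  shows "sigma_finite_measure (polar_measure \<alpha> \<sigma> (\<lambda>r (s :: real ^ 'd). 1))"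
proof (rule sigma_finite_if_integrable_pos[OF integrable_stable_min[OF \<sigma> \<alpha>]])
  have "{x :: real ^ 'd. min 1 ((norm x)\<^sup>2) = 0} = {x. norm x = 0}" by (auto simp: min_def split: if_splits)
  then show "emeasure (polar_measure \<alpha> \<sigma> (\<lambda>r s. 1)) {x \<in> space (polar_measure \<alpha> \<sigma> (\<lambda>r s. 1)). min 1 ((norm x)\<^sup>2) = 0} \<noteq> \<infinity>"
    using polar_measure_sphere_null[OF \<sigma>, of "\<lambda>r s. 1" 0 \<alpha>] by (simp add: null_sets_def)
qed auto

section \<open>Powers of characteristic functions\<close>

lemma norm_exp_minus_one_minus_le:
  assumes "cmod z \<le> 1" shows "cmod (exp z - 1 - z) \<le> 3 * (cmod z)\<^sup>2"
proof -
  have "cmod (exp z - (\<Sum>i\<le>1. z ^ i / fact i)) \<le> exp \<bar>Re z\<bar> * cmod z ^ Suc 1 / fact 1"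
    by (rule Taylor_exp)
  then have "cmod (exp z - 1 - z) \<le> exp \<bar>Re z\<bar> * (cmod z)\<^sup>2"
    by (simp add: algebra_simps numeral_2_eq_2)
  also have "\<dots> \<le> 3 * (cmod z)\<^sup>2"
  proof (rule mult_right_mono)
    have "exp \<bar>Re z\<bar> \<le> exp 1" using abs_Re_le_cmod[of z] assms by simp
    then show "exp \<bar>Re z\<bar> \<le> 3" using exp_le by linarith
  qed simp
  finally show ?thesis .
qed

text \<open>Both smallness assumptions serve the principal branch: \<open>cmod D \<le> 1\<close>
  gives Ln (exp D) = D, and the bound 1/4 gives n |Ln z| <= 1/2, hence Ln (z^n) = n Ln z. Replacing
  Ln z by z - 1 then costs only O(1/n).\<close>

lemma power_tendsto_exp_imp:
  fixes z :: "nat \<Rightarrow> complex"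
  assumes lim: "(\<lambda>n. z n ^ n) \<longlonglongrightarrow> exp D" and D: "cmod D \<le> 1"
    and small: "eventually (\<lambda>n. real n * cmod (z n - 1) \<le> 1 / 4) sequentially"
  shows "(\<lambda>n. of_nat n * (z n - 1)) \<longlonglongrightarrow> D"
proof -
  have ImD: "\<bar>Im D\<bar> < pi" using D abs_Im_le_cmod[of D] pi_ge_two by linarith
  then have not_nonpos: "exp D \<notin> \<real>\<^sub>\<le>\<^sub>0"
  proof -
    have "cos (Im D) > 0" using D abs_Im_le_cmod[of D] pi_gt3 by (intro cos_gt_zero_pi) linarith+
    then have "Re (exp D) > 0" by (simp add: Re_exp)
    then show ?thesis by (auto simp: complex_nonpos_Reals_iff)
  qed
  have "(\<lambda>n. Ln (z n ^ n)) \<longlonglongrightarrow> Ln (exp D)" by (rule tendsto_Ln[OF lim not_nonpos])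
  moreover have "Ln (exp D) = D" using ImD by (intro Ln_exp) auto
  ultimately have Ln_lim: "(\<lambda>n. Ln (z n ^ n)) \<longlonglongrightarrow> D" by simp
  have ev: "eventually (\<lambda>n. cmod (of_nat n * Ln (z n)) \<le> 1 / 2 \<and> Ln (z n ^ n) = of_nat n * Ln (z n)
      \<and> z n = exp (Ln (z n)) \<and> n > 0) sequentially"
    using small eventually_gt_at_top[of 0]
  proof eventually_elim
    case (elim n)
    have "1 * cmod (z n - 1) \<le> real n * cmod (z n - 1)" using elim by (intro mult_right_mono) auto
    then have z: "cmod (z n - 1) \<le> 1 / 4" using elim by linarith
    then have "cmod (Ln (1 + (z n - 1))) \<le> 2 * cmod (z n - 1)" by (intro norm_Ln_le) simp
    then have b: "cmod (of_nat n * Ln (z n)) \<le> 1 / 2"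
    proof -
      assume "cmod (Ln (1 + (z n - 1))) \<le> 2 * cmod (z n - 1)"
      then have "real n * cmod (Ln (z n)) \<le> real n * (2 * cmod (z n - 1))" by (intro mult_left_mono) auto
      then show ?thesis using elim(1) unfolding norm_mult norm_of_nat by linarith
    qed
    have nz: "z n \<noteq> 0" using z by auto
    then have e: "exp (Ln (z n)) = z n" by simp
    have "z n ^ n = exp (of_nat n * Ln (z n))" using e by (simp add: exp_of_nat_mult)
    moreover have "Ln (exp (of_nat n * Ln (z n))) = of_nat n * Ln (z n)"
      using b abs_Im_le_cmod[of "of_nat n * Ln (z n)"] pi_ge_two by (intro Ln_exp) linarith+
    ultimately show ?case using b e elim by simp
  qed
  then have L: "(\<lambda>n. of_nat n * Ln (z n)) \<longlonglongrightarrow> D"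
    by (intro Lim_transform_eventually[OF Ln_lim]) (auto elim: eventually_mono)
  have "(\<lambda>n. of_nat n * (z n - 1) - of_nat n * Ln (z n)) \<longlonglongrightarrow> 0"
  proof (rule Lim_null_comparison)
    show "eventually (\<lambda>n. cmod (of_nat n * (z n - 1) - of_nat n * Ln (z n)) \<le> 1 / real n) sequentially"
      using ev
    proof eventually_elim
      case (elim n)
      let ?w = "Ln (z n)"
      have nw: "real n * cmod ?w \<le> 1 / 2" using elim by (simp add: norm_mult)
      moreover have "1 * cmod ?w \<le> real n * cmod ?w" using elim by (intro mult_right_mono) auto
      ultimately have w: "cmod ?w \<le> 1" by linarith
      have "cmod (of_nat n * (z n - 1) - of_nat n * ?w) = real n * cmod (exp ?w - 1 - ?w)"
        using elim by (simp flip: right_diff_distrib add: norm_mult)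
      also have "\<dots> \<le> real n * (3 * (cmod ?w)\<^sup>2)"
        by (intro mult_left_mono norm_exp_minus_one_minus_le w) auto
      also have "\<dots> = 3 * (real n * cmod ?w)\<^sup>2 / real n" using elim by (simp add: power2_eq_square field_simps)
      also have "\<dots> \<le> 1 / real n"
      proof (rule divide_right_mono)
        have "(real n * cmod ?w)\<^sup>2 \<le> (1/2)\<^sup>2" using nw by (intro power_mono) auto
        then show "3 * (real n * cmod ?w)\<^sup>2 \<le> 1" by (simp add: power2_eq_square)
      qed simp
      finally show ?case .
    qed
  qed (rule lim_1_over_n)
  from tendsto_add[OF this L] show ?thesis by simp
qed

text \<open>For nonnegative reals the logarithm is single valued, so a limit of any size is
  admissible. Since the limit is positive, \<open>b n\<close> can vanish for finitely many
  \<open>n\<close> at most.\<close>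

lemma power_tendsto_pos_imp:
  fixes b :: "nat \<Rightarrow> real"
  assumes lim: "(\<lambda>n. b n ^ n) \<longlonglongrightarrow> exp (- D)" and b: "\<And>n. 0 \<le> b n"
  shows "(\<lambda>n. real n * (1 - b n)) \<longlonglongrightarrow> D"
proof -
  have "(\<lambda>n. ln (b n ^ n)) \<longlonglongrightarrow> ln (exp (- D))" by (rule tendsto_ln[OF lim]) simp
  then have ln_lim: "(\<lambda>n. ln (b n ^ n)) \<longlonglongrightarrow> - D" by simp
  have pos: "eventually (\<lambda>n. b n > 0 \<and> n > 0) sequentially"
    using order_tendstoD(1)[OF lim exp_gt_zero] eventually_gt_at_top[of 0]
  proof eventually_elim
    case (elim n)
    then show ?case using b[of n] by (cases "b n = 0") (auto simp: zero_power)
  qed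
  have y: "(\<lambda>n. real n * ln (b n)) \<longlonglongrightarrow> - D"
    by (rule Lim_transform_eventually[OF ln_lim]) (use pos in eventually_elim, simp add: ln_realpow)
  \<comment> \<open>A convergent multiple by n forces ln (b n) itself to 0, which makes the
    quadratic error n (ln (b n))^2 negligible.\<close>
  have y0: "(\<lambda>n. ln (b n)) \<longlonglongrightarrow> 0"
  proof (rule Lim_transform_eventually)
    show "(\<lambda>n. (real n * ln (b n)) * (1 / real n)) \<longlonglongrightarrow> 0"
      using tendsto_mult[OF y lim_1_over_n] by simp
  qed (use pos in eventually_elim, simp)
  have "(\<lambda>n. complex_of_real (real n * (b n - 1) - real n * ln (b n))) \<longlonglongrightarrow> 0"
  proof (rule Lim_null_comparison)
    show "eventually (\<lambda>n. cmod (complex_of_real (real n * (b n - 1) - real n * ln (b n)))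
        \<le> 3 * \<bar>real n * ln (b n)\<bar> * \<bar>ln (b n)\<bar>) sequentially"
      using pos tendstoD[OF y0 zero_less_one]
    proof eventually_elim
      case (elim n)
      let ?w = "complex_of_real (ln (b n))"
      have "complex_of_real (real n * (b n - 1) - real n * ln (b n)) = of_nat n * (exp ?w - 1 - ?w)"
        using elim by (simp add: exp_of_real algebra_simps)
      then have "cmod (complex_of_real (real n * (b n - 1) - real n * ln (b n))) = real n * cmod (exp ?w - 1 - ?w)"
        by (simp add: norm_mult)
      also have "\<dots> \<le> real n * (3 * (cmod ?w)\<^sup>2)"
        using elim by (intro mult_left_mono norm_exp_minus_one_minus_le) auto
      also have "\<dots> = 3 * \<bar>real n * ln (b n)\<bar> * \<bar>ln (b n)\<bar>"
        by (simp add: abs_mult power2_eq_square)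
      finally show ?case .
    qed
    show "(\<lambda>n. 3 * \<bar>real n * ln (b n)\<bar> * \<bar>ln (b n)\<bar>) \<longlonglongrightarrow> 0"
      using tendsto_mult[OF tendsto_mult[OF tendsto_const tendsto_rabs[OF y]] tendsto_rabs[OF y0], of 3] by simp
  qed
  then have "(\<lambda>n. complex_of_real (real n * (b n - 1) - real n * ln (b n))) \<longlonglongrightarrow> complex_of_real 0"
    by (simp only: of_real_0)
  then have "(\<lambda>n. real n * (b n - 1) - real n * ln (b n)) \<longlonglongrightarrow> 0"
    by (simp only: tendsto_of_real_iff)
  from tendsto_minus[OF tendsto_add[OF this y]] show ?thesis by (simp add: algebra_simps)
qed

text \<open>In the closed unit disc |w^n - v^n| <= n |w - v|. This is applied with v = exp (psi/n),
  which lies in the disc because the hypothesis on \<open>exp \<psi>\<close> means that psi has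
  nonpositive real part.\<close>

lemma tendsto_power_exp:
  fixes w :: "nat \<Rightarrow> complex"
  assumes lim: "(\<lambda>n. of_nat n * (w n - 1)) \<longlonglongrightarrow> \<psi>"
    and w: "\<And>n. cmod (w n) \<le> 1" and \<psi>: "cmod (exp \<psi>) \<le> 1"
  shows "(\<lambda>n. w n ^ n) \<longlonglongrightarrow> exp \<psi>"
proof -
  have Re: "Re \<psi> \<le> 0" using \<psi> by simp
  have "(\<lambda>n. w n ^ n - exp \<psi>) \<longlonglongrightarrow> 0"
  proof (rule Lim_null_comparison)
    let ?e = "\<lambda>n. cmod (of_nat n * (w n - 1) - \<psi>) + 3 * (cmod \<psi>)\<^sup>2 * (1 / real n)"
    show "eventually (\<lambda>n. cmod (w n ^ n - exp \<psi>) \<le> ?e n) sequentially"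
      using eventually_gt_at_top[of 0] eventually_ge_at_top[of "nat \<lceil>cmod \<psi>\<rceil>"]
    proof eventually_elim
      case (elim n)
      let ?v = "\<psi> / of_nat n"
      have v: "cmod ?v \<le> 1" using elim by (simp add: norm_divide nat_ceiling_le_eq)
      have "exp \<psi> = exp ?v ^ n" using elim by (simp flip: exp_of_nat_mult)
      moreover have "cmod (exp ?v) \<le> 1" using Re elim by (simp add: divide_nonpos_pos)
      ultimately have "cmod (w n ^ n - exp \<psi>) \<le> n * cmod (w n - exp ?v)"
        using norm_power_diff[OF w[of n], of "exp ?v" n] by simp
      also have "\<dots> = cmod (of_nat n * (w n - exp ?v))" by (simp add: norm_mult)
      also have "of_nat n * (w n - exp ?v) = (of_nat n * (w n - 1) - \<psi>) - of_nat n * (exp ?v - 1 - ?v)"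
        using elim by (simp add: algebra_simps)
      also have "cmod \<dots> \<le> cmod (of_nat n * (w n - 1) - \<psi>) + cmod (of_nat n * (exp ?v - 1 - ?v))"
        by (rule norm_triangle_ineq4)
      also have "cmod (of_nat n * (exp ?v - 1 - ?v)) \<le> real n * (3 * (cmod ?v)\<^sup>2)"
        unfolding norm_mult norm_of_nat by (intro mult_left_mono norm_exp_minus_one_minus_le v) simp
      also have "real n * (3 * (cmod ?v)\<^sup>2) = 3 * (cmod \<psi>)\<^sup>2 * (1 / real n)"
        using elim by (simp add: norm_divide power2_eq_square)
      finally show ?case by simp
    qed
    have "(\<lambda>n. cmod (of_nat n * (w n - 1) - \<psi>)) \<longlonglongrightarrow> 0"
      using tendsto_norm[OF tendsto_diff[OF lim tendsto_const[of \<psi>]]] by simp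
    then show "?e \<longlonglongrightarrow> 0"
      using tendsto_add[OF _ tendsto_mult[OF tendsto_const lim_1_over_n]] by fastforce
  qed
  from tendsto_add[OF this tendsto_const[of "exp \<psi>"]] show ?thesis by simp
qed

text \<open>Cauchy-Schwarz, read off from the nonnegativity in \<open>t\<close> of the integral of
  (X - t 1_A)^2.\<close>

lemma (in finite_measure) integral_mult_indicator_square_le:
  fixes X :: "'a \<Rightarrow> real"
  assumes X[measurable]: "X \<in> borel_measurable M" "\<And>x. \<bar>X x\<bar> \<le> B" and A[measurable]: "A \<in> sets M"
  shows "(\<integral>x. X x * indicator A x \<partial>M)\<^sup>2 \<le> (\<integral>x. (X x)\<^sup>2 \<partial>M) * measure M A"
proof -
  let ?m = "\<integral>x. X x * indicator A x \<partial>M" and ?b = "\<integral>x. (X x)\<^sup>2 \<partial>M" and ?a = "measure M A"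
  have B: "0 \<le> B" using X(2)[of undefined] by linarith
  have i1: "integrable M (\<lambda>x. X x * indicator A x)"
    by (rule integrable_const_bound[of _ B]) (use X B in \<open>auto simp: indicator_def\<close>)
  have i2: "integrable M (\<lambda>x. (X x)\<^sup>2)"
    by (rule integrable_const_bound[of _ "B\<^sup>2"]) (use X B in \<open>auto simp: abs_le_square_iff[symmetric]\<close>)
  have i3: "integrable M (\<lambda>x. indicator A x :: real)"
    by (rule integrable_const_bound[of _ 1]) (auto simp: indicator_def)
  have quad: "0 \<le> ?b - 2 * t * ?m + t\<^sup>2 * ?a" for t
  proof -
    have "0 \<le> (\<integral>x. (X x - t * indicator A x)\<^sup>2 \<partial>M)" by simp
    also have "(\<lambda>x. (X x - t * indicator A x)\<^sup>2) = (\<lambda>x. (X x)\<^sup>2 - 2 * t * (X x * indicator A x) + t\<^sup>2 * indicator A x)"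
      by (auto simp: indicator_def power2_eq_square algebra_simps)
    also have "(\<integral>x. (X x)\<^sup>2 - 2 * t * (X x * indicator A x) + t\<^sup>2 * indicator A x \<partial>M) = ?b - 2 * t * ?m + t\<^sup>2 * ?a"
      using i1 i2 i3 sets.sets_into_space[OF A] by (simp add: Int_absorb2)
    finally show ?thesis .
  qed
  show ?thesis
  proof (cases "?a = 0")
    case True
    have "?m = 0"
    proof (rule ccontr)
      assume "?m \<noteq> 0"
      \<comment> \<open>With a vanishing leading coefficient the quadratic is linear in
        \<open>t\<close>, and this \<open>t\<close> gives it the value -1.\<close>
      then show False using quad[of "(?b + 1) / (2 * ?m)"] True by simp
    qed
    then show ?thesis using True by simp
  next
    case False
    then have "?a > 0" by (simp add: zero_less_measure_iff less_le)
    then have "2 * (?m / ?a) * ?m - (?m / ?a)\<^sup>2 * ?a = ?m\<^sup>2 / ?a" by (simp add: power2_eq_square field_simps)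
    then have "?m\<^sup>2 / ?a \<le> ?b" using quad[of "?m / ?a"] by linarith
    then show ?thesis using \<open>?a > 0\<close> by (simp add: field_simps)
  qed
qed

section \<open>Characteristic functions of sums and of symmetrizations\<close>

lemma weakly_converges_imp_char_fun:
  fixes N :: "nat \<Rightarrow> (real ^ 'd) measure"
  assumes weak: "weakly_converges N L"
    and N: "\<And>n. finite_measure (N n)" "\<And>n. sets (N n) = sets borel"
    and L: "finite_measure L" "sets L = sets borel"
  shows "(\<lambda>n. char_fun (N n) l) \<longlonglongrightarrow> char_fun L l"
proof -
  have re_im: "Re (char_fun K l) = (\<integral>x. cos (l \<bullet> x) \<partial>K)" "Im (char_fun K l) = (\<integral>x. sin (l \<bullet> x) \<partial>K)"
    if "finite_measure K" "sets K = sets borel" for K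
    using integrable_iexp_inner[OF that, of l] unfolding char_fun_def
    by (simp_all add: Re_exp Im_exp flip: integral_Re integral_Im)
  have "(\<lambda>n. \<integral>x. cos (l \<bullet> x) \<partial>N n) \<longlonglongrightarrow> (\<integral>x. cos (l \<bullet> x) \<partial>L)"
    using weak unfolding weakly_converges_def
    by (rule allE[of _ "\<lambda>x. cos (l \<bullet> x)"]) (auto intro!: continuous_intros boundedI[of _ 1])
  moreover have "(\<lambda>n. \<integral>x. sin (l \<bullet> x) \<partial>N n) \<longlonglongrightarrow> (\<integral>x. sin (l \<bullet> x) \<partial>L)"
    using weak unfolding weakly_converges_def
    by (rule allE[of _ "\<lambda>x. sin (l \<bullet> x)"]) (auto intro!: continuous_intros boundedI[of _ 1])
  ultimately show ?thesis by (simp add: tendsto_complex_iff re_im N L)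
qed

lemma char_fun_iid_sum_law:
  fixes \<nu> :: "(real ^ 'd) measure"
  assumes \<nu>: "prob_space \<nu>" "sets \<nu> = sets borel"
  shows "char_fun (distr (iid_sum_law n \<nu>) borel (\<lambda>x. k *\<^sub>R x - b)) l
    = iexp (- (l \<bullet> b)) * char_fun \<nu> (k *\<^sub>R l) ^ n"
proof -
  interpret \<nu>: prob_space \<nu> by fact
  interpret P: product_sigma_finite "\<lambda>_ :: nat. \<nu>" by unfold_locales
  note [measurable_cong] = \<nu>(2)
  have s: "(\<lambda>x. \<Sum>j = 1..n. x j) \<in> borel_measurable (Pi\<^sub>M {1..n} (\<lambda>_. \<nu>))" by measurable
  have "char_fun (distr (iid_sum_law n \<nu>) borel (\<lambda>x. k *\<^sub>R x - b)) l
      = (\<integral>x. iexp (l \<bullet> (k *\<^sub>R (\<Sum>j = 1..n. x j) - b)) \<partial>Pi\<^sub>M {1..n} (\<lambda>_. \<nu>))"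
    unfolding char_fun_def iid_sum_law_def using s by (subst integral_distr, simp, simp, subst integral_distr) simp_all
  also have "(\<lambda>x. iexp (l \<bullet> (k *\<^sub>R (\<Sum>j = 1..n. x j) - b))) = (\<lambda>x. iexp (- (l \<bullet> b)) * (\<Prod>j = 1..n. iexp ((k *\<^sub>R l) \<bullet> x j)))"
  proof
    fix x :: "nat \<Rightarrow> real ^ 'd"
    have "l \<bullet> (k *\<^sub>R (\<Sum>j = 1..n. x j) - b) = - (l \<bullet> b) + (\<Sum>j = 1..n. (k *\<^sub>R l) \<bullet> x j)"
      by (simp add: inner_diff_right inner_sum_right sum_distrib_left)
    then show "iexp (l \<bullet> (k *\<^sub>R (\<Sum>j = 1..n. x j) - b)) = iexp (- (l \<bullet> b)) * (\<Prod>j = 1..n. iexp ((k *\<^sub>R l) \<bullet> x j))"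
      by (simp only: iexp_add of_real_sum sum_distrib_left exp_sum finite_atLeastAtMost)
  qed
  also have "(\<integral>x. iexp (- (l \<bullet> b)) * (\<Prod>j = 1..n. iexp ((k *\<^sub>R l) \<bullet> x j)) \<partial>Pi\<^sub>M {1..n} (\<lambda>_. \<nu>))
      = iexp (- (l \<bullet> b)) * (\<Prod>j = 1..n. \<integral>x. iexp ((k *\<^sub>R l) \<bullet> x) \<partial>\<nu>)"
    by (simp only: integral_mult_right_zero
        P.product_integral_prod[OF finite_atLeastAtMost integrable_iexp_inner[OF \<nu>.finite_measure_axioms \<nu>(2)]])
  finally show ?thesis by (simp add: char_fun_def)
qed

text \<open>Its characteristic function is |phi|^2, so statements about the modulus of phi become
  statements about integrals of 1 - cos against a probability measure.\<close>

definition symmetrization :: "(real ^ 'd) measure \<Rightarrow> (real ^ 'd) measure" where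
  "symmetrization \<nu> = distr (\<nu> \<Otimes>\<^sub>M \<nu>) borel (\<lambda>(x, y). x - y)"

lemma integral_iexp_pair:
  fixes \<nu> :: "(real ^ 'd) measure"
  assumes \<nu>: "prob_space \<nu>" "sets \<nu> = sets borel"
  shows "(\<integral>p. iexp (k \<bullet> fst p + l \<bullet> snd p) \<partial>(\<nu> \<Otimes>\<^sub>M \<nu>)) = char_fun \<nu> k * char_fun \<nu> l"
    and "integrable (\<nu> \<Otimes>\<^sub>M \<nu>) (\<lambda>p. iexp (k \<bullet> fst p + l \<bullet> snd p))"
proof -
  interpret \<nu>: prob_space \<nu> by fact
  interpret P: pair_prob_space \<nu> \<nu> by unfold_locales
  note [measurable_cong] = \<nu>(2)
  show i: "integrable (\<nu> \<Otimes>\<^sub>M \<nu>) (\<lambda>p. iexp (k \<bullet> fst p + l \<bullet> snd p))"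
    by (rule P.integrable_const_bound[of _ 1]) (simp, measurable)
  have "(\<integral>p. iexp (k \<bullet> fst p + l \<bullet> snd p) \<partial>(\<nu> \<Otimes>\<^sub>M \<nu>)) = (\<integral>x. (\<integral>y. iexp (k \<bullet> x + l \<bullet> y) \<partial>\<nu>) \<partial>\<nu>)"
    using P.integral_fst'[OF i] by simp
  also have "\<dots> = char_fun \<nu> k * char_fun \<nu> l"
    by (simp only: iexp_add integral_mult_right_zero integral_mult_left_zero char_fun_def)
  finally show "(\<integral>p. iexp (k \<bullet> fst p + l \<bullet> snd p) \<partial>(\<nu> \<Otimes>\<^sub>M \<nu>)) = char_fun \<nu> k * char_fun \<nu> l" .
qed

lemma char_fun_uminus:
  fixes \<nu> :: "(real ^ 'd) measure"
  assumes "finite_measure \<nu>" "sets \<nu> = sets borel"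
  shows "char_fun \<nu> (- l) = cnj (char_fun \<nu> l)"
proof -
  have "(CLINT x|\<nu>. cnj (iexp (l \<bullet> x))) = cnj (char_fun \<nu> l)"
    unfolding char_fun_def
    by (rule integral_bounded_linear[OF bounded_linear_cnj integrable_iexp_inner[OF assms]])
  then show ?thesis by (simp add: char_fun_def exp_cnj)
qed

lemma
  fixes \<nu> :: "(real ^ 'd) measure"
  assumes \<nu>: "prob_space \<nu>" "sets \<nu> = sets borel"
  shows prob_space_symmetrization: "prob_space (symmetrization \<nu>)"
    and sets_symmetrization: "sets (symmetrization \<nu>) = sets borel"
    and integral_symmetrization_cos: "(\<integral>z. 1 - cos (l \<bullet> z) \<partial>symmetrization \<nu>) = 1 - (cmod (char_fun \<nu> l))\<^sup>2"
    and integral_pair_cos: "(\<integral>p. 1 - cos (l \<bullet> (fst p - snd p)) \<partial>(\<nu> \<Otimes>\<^sub>M \<nu>)) = 1 - (cmod (char_fun \<nu> l))\<^sup>2"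
proof -
  interpret \<nu>: prob_space \<nu> by fact
  interpret P: pair_prob_space \<nu> \<nu> by unfold_locales
  note [measurable_cong] = \<nu>(2)
  have m: "(\<lambda>(x, y). x - y) \<in> borel_measurable (\<nu> \<Otimes>\<^sub>M \<nu>)" by measurable
  show "prob_space (symmetrization \<nu>)" unfolding symmetrization_def by (rule P.prob_space_distr[OF m])
  show "sets (symmetrization \<nu>) = sets borel" by (simp add: symmetrization_def)
  have "(\<integral>p. Re (iexp (l \<bullet> fst p + (- l) \<bullet> snd p)) \<partial>(\<nu> \<Otimes>\<^sub>M \<nu>)) = Re (char_fun \<nu> l * char_fun \<nu> (- l))"
    using integral_iexp_pair[OF \<nu>, of l "- l"] by (simp del: of_real_add)
  moreover have "Re (char_fun \<nu> l * char_fun \<nu> (- l)) = (cmod (char_fun \<nu> l))\<^sup>2"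
    by (simp only: char_fun_uminus[OF \<nu>.finite_measure_axioms \<nu>(2)] complex_norm_square[symmetric] Re_complex_of_real)
  moreover have "Re (iexp (l \<bullet> fst p + (- l) \<bullet> snd p)) = cos (l \<bullet> (fst p - snd p))" for p
    by (simp only: Re_exp) (simp add: inner_diff_right)
  ultimately have c: "(\<integral>p. cos (l \<bullet> (fst p - snd p)) \<partial>(\<nu> \<Otimes>\<^sub>M \<nu>)) = (cmod (char_fun \<nu> l))\<^sup>2" by simp
  have "integrable (\<nu> \<Otimes>\<^sub>M \<nu>) (\<lambda>p. cos (l \<bullet> (fst p - snd p)))"
    by (rule P.integrable_const_bound[of _ 1]) (simp, measurable)
  then show pc: "(\<integral>p. 1 - cos (l \<bullet> (fst p - snd p)) \<partial>(\<nu> \<Otimes>\<^sub>M \<nu>)) = 1 - (cmod (char_fun \<nu> l))\<^sup>2"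
    using c P.prob_space by simp
  show "(\<integral>z. 1 - cos (l \<bullet> z) \<partial>symmetrization \<nu>) = 1 - (cmod (char_fun \<nu> l))\<^sup>2"
    unfolding symmetrization_def using m by (subst integral_distr) (auto simp: pc case_prod_beta)
qed

text \<open>For two independent copies x, y the difference on the left is the mean of iexp (l . (x +
  y)) (1 - cos (f . (x - y))), where the roles of l + f and l - f have been averaged over the two
  copies. Taking moduli removes \<open>l\<close>, so the bound is uniform in it.\<close>

lemma norm_char_fun_square_diff_le:
  fixes \<nu> :: "(real ^ 'd) measure"
  assumes \<nu>: "prob_space \<nu>" "sets \<nu> = sets borel"
  shows "cmod ((char_fun \<nu> l)\<^sup>2 - char_fun \<nu> (l + f) * char_fun \<nu> (l - f)) \<le> 1 - (cmod (char_fun \<nu> f))\<^sup>2"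
proof -
  interpret \<nu>: prob_space \<nu> by fact
  interpret P: pair_prob_space \<nu> \<nu> by unfold_locales
  note [measurable_cong] = \<nu>(2)
  note pair = integral_iexp_pair[OF \<nu>]
  let ?g = "\<lambda>p. iexp (l \<bullet> (fst p + snd p)) * of_real (1 - cos (f \<bullet> (fst p - snd p)))"
  have eq: "?g p = iexp (l \<bullet> fst p + l \<bullet> snd p) - iexp ((l + f) \<bullet> fst p + (l - f) \<bullet> snd p) / 2
      - iexp ((l - f) \<bullet> fst p + (l + f) \<bullet> snd p) / 2" for p
    unfolding iexp_second_difference by (simp add: algebra_simps inner_simps)
  have "(char_fun \<nu> l)\<^sup>2 - char_fun \<nu> (l + f) * char_fun \<nu> (l - f) = (\<integral>p. ?g p \<partial>(\<nu> \<Otimes>\<^sub>M \<nu>))"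
    unfolding eq using pair by (simp add: power2_eq_square del: of_real_add)
  also have "cmod \<dots> \<le> (\<integral>p. cmod (?g p) \<partial>(\<nu> \<Otimes>\<^sub>M \<nu>))" by (rule integral_norm_bound)
  also have "\<dots> = (\<integral>p. 1 - cos (f \<bullet> (fst p - snd p)) \<partial>(\<nu> \<Otimes>\<^sub>M \<nu>))"
    by (intro Bochner_Integration.integral_cong) (auto simp: norm_mult simp del: of_real_diff)
  finally show ?thesis using integral_pair_cos[OF \<nu>] by simp
qed

lemma abs_one_minus_cos_le: "\<bar>1 - cos x\<bar> \<le> 2" for x :: real
  using cos_ge_minus_one[of x] cos_le_one[of x] by linarith

text \<open>Desymmetrization: conditioning on the second copy lying in a ball of mass at least one half.\<close>

lemma one_minus_Re_char_fun_le:
  fixes \<nu> :: "(real ^ 'd) measure"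
  assumes \<nu>: "prob_space \<nu>" "sets \<nu> = sets borel" and R: "measure \<nu> (cball 0 R) \<ge> 1 / 2" "R \<ge> 0"
  shows "1 - Re (char_fun \<nu> l) \<le> 4 * (1 - (cmod (char_fun \<nu> l))\<^sup>2) + 2 * R\<^sup>2 * (norm l)\<^sup>2"
proof -
  interpret \<nu>: prob_space \<nu> by fact
  interpret P: pair_prob_space \<nu> \<nu> by unfold_locales
  note [measurable_cong] = \<nu>(2)
  let ?A = "cball 0 R :: (real ^ 'd) set"
  have [measurable]: "?A \<in> sets borel" by simp
  have Re: "1 - Re (char_fun \<nu> l) = (\<integral>x. 1 - cos (l \<bullet> x) \<partial>\<nu>)"
  proof -
    have "integrable \<nu> (\<lambda>x. iexp (l \<bullet> x))" by (rule integrable_iexp_inner[OF \<nu>.finite_measure_axioms \<nu>(2)])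
    then have "Re (char_fun \<nu> l) = (\<integral>x. cos (l \<bullet> x) \<partial>\<nu>)"
      unfolding char_fun_def by (simp add: Re_exp flip: integral_Re)
    moreover have "integrable \<nu> (\<lambda>x. cos (l \<bullet> x))" by (rule \<nu>.integrable_const_bound[of _ 1]) auto
    ultimately show ?thesis using \<nu>.prob_space by simp
  qed
  have ge0: "0 \<le> (\<integral>x. 1 - cos (l \<bullet> x) \<partial>\<nu>)" by (intro integral_nonneg_AE AE_I2) simp
  have i1: "integrable (\<nu> \<Otimes>\<^sub>M \<nu>) (\<lambda>p. (1 - cos (l \<bullet> fst p)) * indicator ?A (snd p))"
    by (rule P.integrable_const_bound[of _ 2], rule AE_I2)
       (use abs_one_minus_cos_le in \<open>simp add: abs_mult indicator_def\<close>, measurable)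
  have i2: "integrable (\<nu> \<Otimes>\<^sub>M \<nu>) (\<lambda>p. 1 - cos (l \<bullet> (fst p - snd p)))"
    by (rule P.integrable_const_bound[of _ 2], rule AE_I2)
       (use abs_one_minus_cos_le in simp, measurable)
  \<comment> \<open>The mass of the ball is traded for integration over the second copy. On the ball
    the comparison of 1 - cos at x with its value at x - y costs at most R^2 |l|^2; undoing the
    factor 1/2 produces the constants 4 and 2.\<close>
  have "(1/2) * (\<integral>x. 1 - cos (l \<bullet> x) \<partial>\<nu>) \<le> measure \<nu> ?A * (\<integral>x. 1 - cos (l \<bullet> x) \<partial>\<nu>)"
    using R ge0 by (intro mult_right_mono) auto
  also have "\<dots> = (\<integral>x. (\<integral>y. (1 - cos (l \<bullet> x)) * indicator ?A y \<partial>\<nu>) \<partial>\<nu>)"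
    using sets_eq_imp_space_eq[OF \<nu>(2)] by simp
  also have "\<dots> = (\<integral>p. (1 - cos (l \<bullet> fst p)) * indicator ?A (snd p) \<partial>(\<nu> \<Otimes>\<^sub>M \<nu>))"
    using P.integral_fst'[OF i1] by simp
  also have "\<dots> \<le> (\<integral>p. 2 * (1 - cos (l \<bullet> (fst p - snd p))) + R\<^sup>2 * (norm l)\<^sup>2 \<partial>(\<nu> \<Otimes>\<^sub>M \<nu>))"
  proof (rule integral_mono[OF i1])
    show "integrable (\<nu> \<Otimes>\<^sub>M \<nu>) (\<lambda>p. 2 * (1 - cos (l \<bullet> (fst p - snd p))) + R\<^sup>2 * (norm l)\<^sup>2)"
      by (rule Bochner_Integration.integrable_add[OF integrable_mult_right[OF i2] P.integrable_const])
    fix p :: "(real ^ 'd) \<times> (real ^ 'd)"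
    show "(1 - cos (l \<bullet> fst p)) * indicator ?A (snd p) \<le> 2 * (1 - cos (l \<bullet> (fst p - snd p))) + R\<^sup>2 * (norm l)\<^sup>2"
    proof (cases "snd p \<in> ?A")
      case True
      have "1 - cos (l \<bullet> fst p) \<le> 2 * (1 - cos (l \<bullet> (fst p - snd p))) + 2 * (1 - cos (l \<bullet> snd p))"
        using one_minus_cos_add_le[of "l \<bullet> (fst p - snd p)" "l \<bullet> snd p"] by (simp add: inner_diff_right)
      moreover have "2 * (1 - cos (l \<bullet> snd p)) \<le> (l \<bullet> snd p)\<^sup>2"
        using one_minus_cos_le[of "l \<bullet> snd p"] by simp
      moreover have "(l \<bullet> snd p)\<^sup>2 \<le> R\<^sup>2 * (norm l)\<^sup>2"
      proof -
        have "\<bar>l \<bullet> snd p\<bar> \<le> norm l * norm (snd p)" by (rule Cauchy_Schwarz_ineq2)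
        also have "\<dots> \<le> norm l * R" using True by (intro mult_left_mono) auto
        finally have "\<bar>l \<bullet> snd p\<bar>\<^sup>2 \<le> (norm l * R)\<^sup>2" by (intro power_mono) auto
        then show ?thesis by (simp add: power_mult_distrib mult.commute)
      qed
      ultimately show ?thesis using True by simp
    qed simp
  qed
  also have "\<dots> = 2 * (1 - (cmod (char_fun \<nu> l))\<^sup>2) + R\<^sup>2 * (norm l)\<^sup>2"
    unfolding Bochner_Integration.integral_add[OF integrable_mult_right[OF i2] P.integrable_const]
      integral_mult_right_zero integral_pair_cos[OF \<nu>] using P.prob_space by simp
  finally show ?thesis unfolding Re by simp
qed

lemma LBINT_integral_one_minus_cos:
  fixes y :: "'a \<Rightarrow> real"
  assumes M: "sigma_finite_measure M" and y: "y \<in> borel_measurable M" "integrable M (\<lambda>x. min 2 ((y x)\<^sup>2))"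
  shows "(LBINT t:{0..1}. \<integral>x. 1 - cos (t * y x) \<partial>M) = (\<integral>x. 1 - sinc (y x) \<partial>M)"
proof -
  have "(CLINT t:{0..1}|lborel. \<integral>x. 1 * of_real (1 - cos (t * y x)) \<partial>M) = (\<integral>x. 1 * of_real (1 - sinc (y x)) \<partial>M)"
    by (rule integral_one_minus_sinc[OF M _ y(1) _ y(2)]) auto
  moreover have e: "indicator {0..1} t *\<^sub>R complex_of_real z = complex_of_real (indicator {0..1} t *\<^sub>R z)" for t z :: real
    by (simp add: scaleR_conv_of_real)
  ultimately have "complex_of_real (LBINT t:{0..1}. \<integral>x. 1 - cos (t * y x) \<partial>M) = of_real (\<integral>x. 1 - sinc (y x) \<partial>M)"
    unfolding set_lebesgue_integral_def mult_1_left integral_complex_of_real e by (simp only:)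
  then show ?thesis by (simp only: of_real_eq_iff)
qed

section \<open>Levy exponents and their second differences\<close>

lemma levy_integrand_0[simp]: "levy_integrand l 0 = 0"
  by (simp add: levy_integrand_def)

lemma set_integral_levy_integrand:
  "(CLINT x:(- {0})|M. levy_integrand l x) = (CLINT x|M. levy_integrand l x)"
  unfolding set_lebesgue_integral_def
  by (intro Bochner_Integration.integral_cong) (auto simp: indicator_def)

lemma set_integrable_levy_integrand:
  "set_integrable M (- {0}) (levy_integrand l) \<longleftrightarrow> integrable M (levy_integrand l)"
  unfolding set_integrable_def
  by (intro Bochner_Integration.integrable_cong) (auto simp: indicator_def)

lemma levy_exponent_alt:
  "levy_exponent a 0 M l = \<i> * complex_of_real (a \<bullet> l) + (CLINT x|M. levy_integrand l x)"
  by (simp add: levy_exponent_def set_integral_levy_integrand)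

lemma has_levy_representationD:
  assumes "has_levy_representation \<mu> a 0 M"
  shows "prob_space \<mu>" "sets \<mu> = sets borel" "integrable M (levy_integrand l)"
    "char_fun \<mu> l = exp (\<i> * complex_of_real (a \<bullet> l) + (CLINT x|M. levy_integrand l x))"
  using assms by (auto simp: has_levy_representation_def infinitely_divisible_def levy_exponent_alt
      set_integrable_levy_integrand)

text \<open>The compensating term and the constant 1 are affine in the frequency and cancel,
  whatever the truncation.\<close>

lemma levy_integrand_second_difference:
  "levy_integrand l x - levy_integrand (l + f) x / 2 - levy_integrand (l - f) x / 2
     = iexp (l \<bullet> x) * of_real (1 - cos (f \<bullet> x))"
  unfolding iexp_second_difference
  by (auto simp: levy_integrand_def indicator_def inner_simps algebra_simps diff_divide_distrib add_divide_distrib)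

lemma prob_space_iid_sum_law:
  fixes \<nu> :: "(real ^ 'd) measure"
  assumes \<nu>: "prob_space \<nu>" "sets \<nu> = sets borel"
  shows "prob_space (iid_sum_law n \<nu>)" "sets (iid_sum_law n \<nu>) = sets borel"
proof -
  interpret \<nu>: prob_space \<nu> by fact
  interpret P: product_prob_space "\<lambda>_ :: nat. \<nu>" "{1..n}" by unfold_locales
  note [measurable_cong] = \<nu>(2)
  show "prob_space (iid_sum_law n \<nu>)"
    unfolding iid_sum_law_def by (rule P.prob_space_distr) measurable
qed (simp add: iid_sum_law_def)

lemma exists_cball_measure_gt:
  fixes \<nu> :: "(real ^ 'd) measure"
  assumes \<nu>: "prob_space \<nu>" "sets \<nu> = sets borel" and \<epsilon>: "\<epsilon> > 0"
  shows "\<exists>R>0. measure \<nu> (cball 0 R) > 1 - \<epsilon>"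
proof -
  interpret \<nu>: prob_space \<nu> by fact
  have "(\<lambda>n. measure \<nu> (cball 0 (real n))) \<longlonglongrightarrow> measure \<nu> (\<Union>n. cball 0 (real n))"
  proof (rule \<nu>.finite_Lim_measure_incseq)
    show "range (\<lambda>n. cball 0 (real n)) \<subseteq> sets \<nu>" unfolding \<nu>(2) by (rule image_subsetI) simp
    show "incseq (\<lambda>n. cball (0 :: real ^ 'd) (real n))" unfolding incseq_def by (intro allI impI subset_cball) simp
  qed
  moreover have "(\<Union>n. cball (0 :: real ^ 'd) (real n)) = UNIV"
  proof (intro equalityI subsetI UNIV_I)
    fix x :: "real ^ 'd"
    obtain n where "norm x \<le> real n" using real_arch_simple by blast
    then show "x \<in> (\<Union>n. cball 0 (real n))" by auto
  qed
  moreover have "measure \<nu> UNIV = 1"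
    using \<nu>.prob_space sets_eq_imp_space_eq[OF \<nu>(2)] by simp
  ultimately have "(\<lambda>n. measure \<nu> (cball 0 (real n))) \<longlonglongrightarrow> 1" by simp
  then have "eventually (\<lambda>n. measure \<nu> (cball 0 (real n)) > 1 - \<epsilon>) sequentially"
    by (rule order_tendstoD(1)) (use \<epsilon> in simp)
  then have "eventually (\<lambda>n. measure \<nu> (cball 0 (real n)) > 1 - \<epsilon> \<and> n > 0) sequentially"
    by (rule eventually_conj[OF _ eventually_gt_at_top])
  then obtain n where "measure \<nu> (cball 0 (real n)) > 1 - \<epsilon>" "n > 0" by (auto simp: eventually_sequentially)
  then show ?thesis by (intro exI[of _ "real n"]) auto
qed

section \<open>The domain of attraction of a stable law\<close>

locale stable_attraction =
  fixes \<alpha> :: real and \<sigma> :: "(real ^ 'd) measure" and \<nu> \<mu>X :: "(real ^ 'd) measure"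
    and a :: "real ^ 'd" and c :: "nat \<Rightarrow> real" and d :: "nat \<Rightarrow> real ^ 'd"
  assumes alpha: "0 < \<alpha>" "\<alpha> < 2" and sigma: "sphere_measure \<sigma>"
    and nu: "prob_space \<nu>" "sets \<nu> = sets borel"
    and X: "has_levy_representation \<mu>X a 0 (polar_measure \<alpha> \<sigma> (\<lambda>r s. 1))"
    and c_pos: "\<And>n. n \<ge> 1 \<Longrightarrow> c n > 0"
    and attraction: "weakly_converges
          (\<lambda>n. distr (iid_sum_law n \<nu>) borel (\<lambda>x. inverse (c n) *\<^sub>R x - d n)) \<mu>X"
begin

abbreviation "M0 \<equiv> polar_measure \<alpha> \<sigma> (\<lambda>r s. 1)"
abbreviation "\<phi> \<equiv> char_fun \<nu>"
definition "s n = inverse (c n)"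
text \<open>\<open>\<Gamma>\<close> is minus the real part of the stable exponent
  \<open>\<Psi>\<close>, and \<open>\<Delta> l f\<close> is minus half its second difference at
  \<open>l\<close> with step \<open>f\<close>. The drift \<open>a\<close> enters neither of
  them.\<close>

definition "\<Gamma> l = (\<integral>x. 1 - cos (l \<bullet> x) \<partial>M0)"
definition "\<Delta> l f = (CLINT x|M0. iexp (l \<bullet> x) * of_real (1 - cos (f \<bullet> x)))"
definition "\<Psi> l = \<i> * complex_of_real (a \<bullet> l) + (CLINT x|M0. levy_integrand l x)"

sublocale nu: prob_space \<nu> by (rule nu)
lemmas nu_sets[measurable_cong] = nu(2)

lemma s_pos: "n \<ge> 1 \<Longrightarrow> s n > 0"
  using c_pos by (simp add: s_def)

lemma Gamma_nonneg: "0 \<le> \<Gamma> l"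
  unfolding \<Gamma>_def by (intro integral_nonneg_AE AE_I2) simp

lemma norm_Delta_le: "cmod (\<Delta> l f) \<le> \<Gamma> f"
proof -
  have "cmod (\<Delta> l f) \<le> (\<integral>x. cmod (iexp (l \<bullet> x) * of_real (1 - cos (f \<bullet> x))) \<partial>M0)"
    unfolding \<Delta>_def by (rule integral_norm_bound)
  also have "\<dots> = \<Gamma> f"
    unfolding \<Gamma>_def by (intro Bochner_Integration.integral_cong) (simp_all add: norm_mult del: of_real_diff)
  finally show ?thesis .
qed

lemmas X_D = has_levy_representationD[OF X]

lemma Psi_second_difference: "2 * \<Psi> l - \<Psi> (l + f) - \<Psi> (l - f) = 2 * \<Delta> l f"
proof -
  have "\<Delta> l f = (CLINT x|M0. levy_integrand l x - levy_integrand (l + f) x / 2 - levy_integrand (l - f) x / 2)"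
    unfolding \<Delta>_def levy_integrand_second_difference ..
  also have "\<dots> = (CLINT x|M0. levy_integrand l x) - (CLINT x|M0. levy_integrand (l + f) x) / 2 - (CLINT x|M0. levy_integrand (l - f) x) / 2"
    using X_D(3) by simp
  finally have eq: "\<Delta> l f = (CLINT x|M0. levy_integrand l x) - (CLINT x|M0. levy_integrand (l + f) x) / 2 - (CLINT x|M0. levy_integrand (l - f) x) / 2" .
  show ?thesis unfolding \<Psi>_def eq by (simp add: inner_simps algebra_simps)
qed

lemma Re_Psi: "Re (\<Psi> l) = - \<Gamma> l"
proof -
  have "Re (\<Psi> l) = (\<integral>x. Re (levy_integrand l x) \<partial>M0)"
    unfolding \<Psi>_def using integral_Re[OF X_D(3)[of l]] by simp
  also have "\<dots> = (\<integral>x. - (1 - cos (l \<bullet> x)) \<partial>M0)"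
    by (intro Bochner_Integration.integral_cong) (simp_all add: levy_integrand_def Re_exp)
  also have "\<dots> = - \<Gamma> l" unfolding \<Gamma>_def by (rule integral_minus)
  finally show ?thesis .
qed

definition "\<mu>n n = distr (iid_sum_law n \<nu>) borel (\<lambda>x. inverse (c n) *\<^sub>R x - d n)"

lemma mu_n: "prob_space (\<mu>n n)" "sets (\<mu>n n) = sets borel"
proof -
  show "prob_space (\<mu>n n)" unfolding \<mu>n_def
    by (intro prob_space.prob_space_distr prob_space_iid_sum_law nu)
       (auto simp: measurable_cong_sets[OF prob_space_iid_sum_law(2)[OF nu] refl])
qed (simp add: \<mu>n_def)

lemma char_fun_mu_n: "char_fun (\<mu>n n) l = iexp (- (l \<bullet> d n)) * \<phi> (s n *\<^sub>R l) ^ n"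
  unfolding \<mu>n_def s_def by (rule char_fun_iid_sum_law[OF nu])

lemma char_lim: "(\<lambda>n. iexp (- (l \<bullet> d n)) * \<phi> (s n *\<^sub>R l) ^ n) \<longlonglongrightarrow> exp (\<Psi> l)"
proof -
  have "(\<lambda>n. char_fun (\<mu>n n) l) \<longlonglongrightarrow> char_fun \<mu>X l"
  proof (rule weakly_converges_imp_char_fun)
    show "weakly_converges \<mu>n \<mu>X" using attraction unfolding \<mu>n_def[abs_def] .
  qed (use mu_n X_D(1,2) in \<open>auto intro: prob_space.axioms(1) prob_space_imp_sigma_finite prob_space.finite_measure\<close>)
  then show ?thesis unfolding char_fun_mu_n X_D(4) \<Psi>_def .
qed

text \<open>The modulus is blind to the factors coming from the centering \<open>d n\<close>, and
  the modulus of the limit is exp (- \<Gamma> l).\<close>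

lemma sym_lim: "(\<lambda>n. real n * (1 - (cmod (\<phi> (s n *\<^sub>R l)))\<^sup>2)) \<longlonglongrightarrow> 2 * \<Gamma> l"
proof (rule power_tendsto_pos_imp)
  have "(\<lambda>n. (cmod (iexp (- (l \<bullet> d n)) * \<phi> (s n *\<^sub>R l) ^ n))\<^sup>2) \<longlonglongrightarrow> (cmod (exp (\<Psi> l)))\<^sup>2"
    by (intro tendsto_power tendsto_norm char_lim)
  moreover have "(cmod (exp (\<Psi> l)))\<^sup>2 = exp (- (2 * \<Gamma> l))"
    by (simp add: Re_Psi flip: exp_of_nat_mult)
  moreover have "(cmod (iexp (- (l \<bullet> d n)) * \<phi> (s n *\<^sub>R l) ^ n))\<^sup>2 = ((cmod (\<phi> (s n *\<^sub>R l)))\<^sup>2) ^ n" for n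
    by (simp only: norm_mult norm_exp_i_times norm_power mult_1_left power_mult[symmetric] mult.commute)
  ultimately show "(\<lambda>n. ((cmod (\<phi> (s n *\<^sub>R l)))\<^sup>2) ^ n) \<longlonglongrightarrow> exp (- (2 * \<Gamma> l))" by simp
qed simp

lemma sym_nonneg: "0 \<le> 1 - (cmod (\<phi> l))\<^sup>2"
  using norm_char_fun_le[OF nu.finite_measure_axioms, of l] nu.prob_space by (simp add: power_le_one)

text \<open>The point is uniformity over a ball of frequencies, which pointwise limits do not give.
  Weak convergence bounds |chi - 1| by 1/2 for all |l| <= u at once; then |phi|^(2 n) >= 1/4 >
  e^(-2), and x <= exp (- (1 - x)) turns this into the bound 2.\<close>

lemma sym_bounded: "\<exists>u>0. eventually (\<lambda>n. \<forall>l. norm l \<le> u \<longrightarrow> real n * (1 - (cmod (\<phi> (s n *\<^sub>R l)))\<^sup>2) \<le> 2) sequentially"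
proof -
  interpret X: prob_space \<mu>X by (rule X_D)
  note [measurable_cong] = X_D(2)
  \<comment> \<open>A bounded continuous majorant of |iexp (l . x) - 1| that serves every
    \<open>l\<close> with norm at most \<open>u\<close>.\<close>
  define f where "f u x = min 2 (u * norm x)" for u :: real and x :: "real ^ 'd"
  have "(\<lambda>m. \<integral>x. f (1 / real m) x \<partial>\<mu>X) \<longlonglongrightarrow> (\<integral>x. 0 \<partial>\<mu>X)"
  proof (rule integral_dominated_convergence[where w="\<lambda>_. 2"])
    have "(\<lambda>m. f (1 / real m) x) \<longlonglongrightarrow> min 2 (0 * norm x)" for x
      unfolding f_def by (intro tendsto_min tendsto_const tendsto_mult lim_1_over_n)
    then show "AE x in \<mu>X. (\<lambda>m. f (1 / real m) x) \<longlonglongrightarrow> 0" by simp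
  qed (auto simp: f_def[abs_def])
  then have "eventually (\<lambda>m. (\<integral>x. f (1 / real m) x \<partial>\<mu>X) < 1 / 2 \<and> m > 0) sequentially"
    by (intro eventually_conj eventually_gt_at_top order_tendstoD(2)) auto
  then obtain m where m: "(\<integral>x. f (1 / real m) x \<partial>\<mu>X) < 1 / 2" "m > 0" by (auto simp: eventually_sequentially)
  define u where "u = 1 / real m"
  have u: "u > 0" using m by (simp add: u_def)
  have f_cont: "continuous_on UNIV (f u)" unfolding f_def[abs_def] by (intro continuous_intros)
  have f_bd: "\<bar>f u x\<bar> \<le> 2" for x using u by (simp add: f_def)
  have "(\<lambda>n. \<integral>x. f u x \<partial>\<mu>n n) \<longlonglongrightarrow> (\<integral>x. f u x \<partial>\<mu>X)"
    using attraction f_cont f_bd unfolding weakly_converges_def \<mu>n_def by (auto intro!: boundedI[of _ 2])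
  then have "eventually (\<lambda>n. (\<integral>x. f u x \<partial>\<mu>n n) < 1 / 2) sequentially"
    using m unfolding u_def by (intro order_tendstoD(2)) auto
  then have "eventually (\<lambda>n. \<forall>l. norm l \<le> u \<longrightarrow> real n * (1 - (cmod (\<phi> (s n *\<^sub>R l)))\<^sup>2) \<le> 2) sequentially"
  proof eventually_elim
    case (elim n)
    interpret m: prob_space "\<mu>n n" by (rule mu_n)
    note [measurable_cong] = mu_n(2)
    show ?case
    proof (intro allI impI)
      fix l :: "real ^ 'd" assume l: "norm l \<le> u"
      let ?\<chi> = "char_fun (\<mu>n n) l"
      have i: "integrable (\<mu>n n) (\<lambda>x. iexp (l \<bullet> x))" by (rule integrable_iexp_inner[OF m.finite_measure_axioms mu_n(2)])
      have "cmod (?\<chi> - 1) = cmod (CLINT x|\<mu>n n. iexp (l \<bullet> x) - 1)"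
        using i m.prob_space unfolding char_fun_def by simp
      also have "\<dots> \<le> (\<integral>x. cmod (iexp (l \<bullet> x) - 1) \<partial>\<mu>n n)" by (rule integral_norm_bound)
      also have "\<dots> \<le> (\<integral>x. f u x \<partial>\<mu>n n)"
      proof (rule integral_mono)
        show "integrable (\<mu>n n) (\<lambda>x. cmod (iexp (l \<bullet> x) - 1))" using i by simp
        show "integrable (\<mu>n n) (f u)"
          by (rule m.integrable_const_bound[of _ 2]) (use f_bd in \<open>auto simp: f_def[abs_def]\<close>)
        fix x :: "real ^ 'd"
        have "cmod (iexp (l \<bullet> x) - 1) \<le> 2" using norm_triangle_ineq4[of "iexp (l \<bullet> x)" 1] by simp
        moreover have "cmod (iexp (l \<bullet> x) - 1) \<le> u * norm x"
          using norm_iexp_diff_one_le[of "l \<bullet> x"] Cauchy_Schwarz_ineq2[of l x] mult_right_mono[OF l norm_ge_zero[of x]] by linarith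
        ultimately show "cmod (iexp (l \<bullet> x) - 1) \<le> f u x" by (simp add: f_def)
      qed
      finally have "cmod (?\<chi> - 1) < 1 / 2" using elim by linarith
      then have "cmod ?\<chi> > 1 / 2" using norm_triangle_ineq2[of 1 "1 - ?\<chi>"] by (simp add: norm_minus_commute)
      moreover have "cmod ?\<chi> = cmod (\<phi> (s n *\<^sub>R l)) ^ n"
        unfolding char_fun_mu_n by (simp only: norm_mult norm_exp_i_times norm_power mult_1_left)
      ultimately have "(1 / 2)\<^sup>2 \<le> (cmod (\<phi> (s n *\<^sub>R l)) ^ n)\<^sup>2" by (intro power_mono) auto
      also have "\<dots> = ((cmod (\<phi> (s n *\<^sub>R l)))\<^sup>2) ^ n" by (simp only: power_mult[symmetric] mult.commute)
      also have "\<dots> \<le> exp (- (1 - (cmod (\<phi> (s n *\<^sub>R l)))\<^sup>2)) ^ n"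
        using exp_ge_add_one_self[of "- (1 - (cmod (\<phi> (s n *\<^sub>R l)))\<^sup>2)"] by (intro power_mono) auto
      also have "\<dots> = exp (- (real n * (1 - (cmod (\<phi> (s n *\<^sub>R l)))\<^sup>2)))" by (simp only: exp_of_nat_mult[symmetric] mult_minus_right)
      finally have ge: "1 / 4 \<le> exp (- (real n * (1 - (cmod (\<phi> (s n *\<^sub>R l)))\<^sup>2)))" by (simp add: power2_eq_square)
      have e2: "exp (- 2 :: real) \<le> 1 / 4"
      proof -
        have "(2::real)\<^sup>2 \<le> (exp 1)\<^sup>2" using exp_ge_add_one_self[of 1] by (intro power_mono) auto
        also have "(exp 1)\<^sup>2 = exp (2::real)" by (simp flip: exp_of_nat_mult)
        finally have "exp (2::real) \<ge> 4" by simp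
        then show ?thesis by (simp add: exp_minus field_simps)
      qed
      show "real n * (1 - (cmod (\<phi> (s n *\<^sub>R l)))\<^sup>2) \<le> 2"
      proof (rule ccontr)
        assume "\<not> real n * (1 - (cmod (\<phi> (s n *\<^sub>R l)))\<^sup>2) \<le> 2"
        then have "exp (- (real n * (1 - (cmod (\<phi> (s n *\<^sub>R l)))\<^sup>2))) < exp (- 2)" by simp
        then show False using ge e2 by linarith
      qed
    qed
  qed
  then show ?thesis using u by blast
qed

section \<open>Growth of the norming sequence\<close>

lemma Gamma_scale: "t > 0 \<Longrightarrow> \<Gamma> (t *\<^sub>R l) = t powr \<alpha> * \<Gamma> l"
  using integral_scale_stable[OF sigma, of t "\<lambda>x. 1 - cos (l \<bullet> x)" \<alpha>] by (simp add: \<Gamma>_def)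

text \<open>Were \<open>\<Gamma>\<close> identically 0, averaging along each axis would make 1 -
  sinc of every coordinate integrate to 0 under \<open>M0\<close>. All coordinates would vanish
  almost everywhere, although the region |x| > 1 has positive mass.\<close>

lemma Gamma_pos: "\<exists>e. \<Gamma> e > 0"
proof (rule ccontr)
  assume "\<not> (\<exists>e. \<Gamma> e > 0)"
  then have G0: "\<Gamma> e = 0" for e using Gamma_nonneg[of e] by (smt (verit))
  have int_min: "integrable M0 (\<lambda>x. min 2 ((axis k 1 \<bullet> x)\<^sup>2))" for k
  proof (rule Bochner_Integration.integrable_bound)
    show "integrable M0 (\<lambda>x. 2 * min 1 ((norm x)\<^sup>2))"
      by (intro integrable_mult_right integrable_stable_min sigma alpha)
    have "norm (min 2 ((axis k 1 \<bullet> x)\<^sup>2)) \<le> norm (2 * min 1 ((norm x)\<^sup>2))" for x :: "real ^ 'd"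
    proof -
      have "(x $ k)\<^sup>2 \<le> (norm x)\<^sup>2" using component_le_norm_cart[of x k] by (simp add: abs_le_square_iff[symmetric])
      then have "(x $ k)\<^sup>2 \<le> 2 * (norm x)\<^sup>2" using zero_le_power2[of "norm x"] by linarith
      then show ?thesis by (auto simp: inner_axis' min_def)
    qed
    then show "AE x in M0. norm (min 2 ((axis k 1 \<bullet> x)\<^sup>2)) \<le> norm (2 * min 1 ((norm x)\<^sup>2))" by simp
  qed measurable
  have "AE x in M0. x $ k = 0" for k
  proof -
    have inner: "(\<integral>x. 1 - cos (t * (axis k 1 \<bullet> x)) \<partial>M0) = 0" for t
      using G0[of "t *\<^sub>R axis k 1"] by (simp add: \<Gamma>_def)
    have "(\<integral>x. 1 - sinc (axis k 1 \<bullet> x) \<partial>M0) = (LBINT t:{0..1}. \<integral>x. 1 - cos (t * (axis k 1 \<bullet> x)) \<partial>M0)"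
      by (rule LBINT_integral_one_minus_cos[symmetric, OF sigma_finite_stable[OF sigma alpha] _ int_min]) measurable
    also have "\<dots> = 0" unfolding inner by (simp add: set_lebesgue_integral_def)
    finally have "(\<integral>x. 1 - sinc (axis k 1 \<bullet> x) \<partial>M0) = 0" .
    moreover have "integrable M0 (\<lambda>x. 1 - sinc (axis k 1 \<bullet> x))"
    proof (rule Bochner_Integration.integrable_bound[OF int_min[of k]])
      show "AE x in M0. norm (1 - sinc (axis k 1 \<bullet> x)) \<le> norm (min 2 ((axis k 1 \<bullet> x)\<^sup>2))"
      proof (rule AE_I2)
        fix x :: "real ^ 'd"
        show "norm (1 - sinc (axis k 1 \<bullet> x)) \<le> norm (min 2 ((axis k 1 \<bullet> x)\<^sup>2))"
          using one_minus_sinc_le[of "axis k 1 \<bullet> x"] one_minus_sinc_nonneg[of "axis k 1 \<bullet> x"]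
            zero_le_power2[of "axis k 1 \<bullet> x"] unfolding real_norm_def by linarith
      qed
    qed measurable
    ultimately have "AE x in M0. 1 - sinc (axis k 1 \<bullet> x) = 0"
      using one_minus_sinc_nonneg integral_nonneg_eq_0_iff_AE by blast
    then show ?thesis
    proof eventually_elim
      case (elim x)
      have "min 1 ((axis k 1 \<bullet> x)\<^sup>2) \<le> 0"
        using one_minus_sinc_ge[of "axis k 1 \<bullet> x"] unfolding elim by linarith
      then have "(axis k 1 \<bullet> x)\<^sup>2 \<le> 0" by (metis min_le_iff_disj not_one_le_zero)
      then show ?case by (simp add: inner_axis')
    qed
  qed
  then have "AE x in M0. \<forall>k\<in>UNIV. x $ k = 0" by (intro AE_finite_allI) auto
  then have "AE x in M0. \<not> norm x > 1"
  proof eventually_elim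
    case (elim x)
    then have "x = 0" by (simp add: vec_eq_iff)
    then show ?case by simp
  qed
  then have "emeasure M0 {x. norm x > 1} = 0" by (subst (asm) AE_iff_measurable[of "{x. norm x > 1}"]) auto
  then show False
    using emeasure_stable_tail[OF sigma alpha(1), of 1] sphere_measure_pos[OF sigma] alpha by (simp add: field_simps)
qed

lemma sym_symmetrization: "(\<integral>z. 1 - cos (l \<bullet> z) \<partial>symmetrization \<nu>) = 1 - (cmod (\<phi> l))\<^sup>2"
  by (rule integral_symmetrization_cos[OF nu])

lemma sym_tendsto_0: "(\<lambda>n. 1 - (cmod (\<phi> (s n *\<^sub>R l)))\<^sup>2) \<longlonglongrightarrow> 0"
proof -
  have "(\<lambda>n. (real n * (1 - (cmod (\<phi> (s n *\<^sub>R l)))\<^sup>2)) * (1 / real n)) \<longlonglongrightarrow> (2 * \<Gamma> l) * 0"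
    by (intro tendsto_mult sym_lim lim_1_over_n)
  then have "(\<lambda>n. (real n * (1 - (cmod (\<phi> (s n *\<^sub>R l)))\<^sup>2)) * (1 / real n)) \<longlonglongrightarrow> 0" by simp
  moreover have "eventually (\<lambda>n. (real n * (1 - (cmod (\<phi> (s n *\<^sub>R l)))\<^sup>2)) * (1 / real n) = 1 - (cmod (\<phi> (s n *\<^sub>R l)))\<^sup>2) sequentially"
    using eventually_gt_at_top[of 0] by eventually_elim simp
  ultimately show ?thesis by (rule Lim_transform_eventually)
qed

text \<open>Otherwise |phi| would equal 1 along the whole line through \<open>e\<close>, and the
  limit in \<open>sym_lim\<close> would be 0.\<close>

lemma symmetrization_nondegenerate:
  assumes e: "\<Gamma> e > 0" shows "\<not> (AE z in symmetrization \<nu>. e \<bullet> z = 0)"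
proof
  assume ae: "AE z in symmetrization \<nu>. e \<bullet> z = 0"
  have z0: "(\<integral>z. 1 - cos ((x *\<^sub>R e) \<bullet> z) \<partial>symmetrization \<nu>) = 0" for x
  proof (rule integral_eq_zero_AE)
    show "AE z in symmetrization \<nu>. 1 - cos ((x *\<^sub>R e) \<bullet> z) = 0"
      using ae by eventually_elim simp
  qed
  have "(cmod (\<phi> (x *\<^sub>R e)))\<^sup>2 = 1" for x using z0[of x] unfolding sym_symmetrization by simp
  then have "(\<lambda>n. 0 :: real) \<longlonglongrightarrow> 2 * \<Gamma> e" using sym_lim[of e] by simp
  then show False using e LIMSEQ_unique[OF _ tendsto_const] by fastforce
qed

text \<open>The decay of 1 - |phi|^2 at each frequency does not prevent large \<open>s n\<close>,
  since 1 - cos has zeros far out. After averaging over \<open>t\<close> the integrand is at least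
  min(1, (s n (e . z))^2) / 9, which is bounded below as long as \<open>s n\<close> is.\<close>

lemma s_tendsto_0: "s \<longlonglongrightarrow> 0"
proof -
  obtain e where e: "\<Gamma> e > 0" using Gamma_pos by blast
  let ?S = "symmetrization \<nu>"
  interpret S: prob_space ?S by (rule prob_space_symmetrization[OF nu])
  note [measurable_cong] = sets_symmetrization[OF nu]
  have avg: "(LBINT t:{0..1}. 1 - (cmod (\<phi> (s n *\<^sub>R (t *\<^sub>R e))))\<^sup>2) = (\<integral>z. 1 - sinc (s n * (e \<bullet> z)) \<partial>?S)" for n
  proof -
    have "(LBINT t:{0..1}. \<integral>z. 1 - cos (t * (s n * (e \<bullet> z))) \<partial>?S) = (\<integral>z. 1 - sinc (s n * (e \<bullet> z)) \<partial>?S)"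
    proof (rule LBINT_integral_one_minus_cos)
      show "integrable ?S (\<lambda>z. min 2 ((s n * (e \<bullet> z))\<^sup>2))"
        by (rule S.integrable_const_bound[of _ 2]) auto
    qed (auto intro: S.sigma_finite_measure_axioms)
    moreover have "(\<integral>z. 1 - cos (t * (s n * (e \<bullet> z))) \<partial>?S) = 1 - (cmod (\<phi> (s n *\<^sub>R (t *\<^sub>R e))))\<^sup>2" for t
      using sym_symmetrization[of "s n *\<^sub>R (t *\<^sub>R e)"] by (simp add: ac_simps)
    ultimately show ?thesis by simp
  qed
  have meas: "(\<lambda>t. 1 - (cmod (\<phi> (s n *\<^sub>R (t *\<^sub>R e))))\<^sup>2) \<in> borel_measurable borel" for n
    unfolding sym_symmetrization[symmetric] by measurable
  have "(\<lambda>n. LBINT t:{0..1}. 1 - (cmod (\<phi> (s n *\<^sub>R (t *\<^sub>R e))))\<^sup>2) \<longlonglongrightarrow> (LBINT t:{0..1::real}. 0)"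
    unfolding set_lebesgue_integral_def
  proof (rule integral_dominated_convergence[where w="\<lambda>t. indicator {0..1} t"])
    show "AE t in lborel. (\<lambda>n. indicator {0..1} t *\<^sub>R (1 - (cmod (\<phi> (s n *\<^sub>R (t *\<^sub>R e))))\<^sup>2)) \<longlonglongrightarrow> indicator {0..1::real} t *\<^sub>R 0"
      by (intro AE_I2 tendsto_scaleR[OF tendsto_const] sym_tendsto_0)
    show "AE t in lborel. norm (indicator {0..1} t *\<^sub>R (1 - (cmod (\<phi> (s n *\<^sub>R (t *\<^sub>R e))))\<^sup>2)) \<le> indicator {0..1::real} t" for n
      using sym_nonneg[of "s n *\<^sub>R (_ *\<^sub>R e)"] by (intro AE_I2) (simp add: indicator_def)
    show "(\<lambda>t. indicator {0..1} t *\<^sub>R (1 - (cmod (\<phi> (s n *\<^sub>R (t *\<^sub>R e))))\<^sup>2)) \<in> borel_measurable lborel" for n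
      using meas[of n] by simp
  qed simp_all
  then have lim: "(\<lambda>n. \<integral>z. 1 - sinc (s n * (e \<bullet> z)) \<partial>?S) \<longlonglongrightarrow> 0"
    unfolding avg by (simp add: set_lebesgue_integral_def)
  have small: "eventually (\<lambda>n. s n < \<delta>) sequentially" if \<delta>: "\<delta> > 0" for \<delta>
  proof -
    have imin: "integrable ?S (\<lambda>z. min 1 ((t * (e \<bullet> z))\<^sup>2))" for t
      by (rule S.integrable_const_bound[of _ 1]) auto
    \<comment> \<open>\<open>J\<close> is positive because e . z is not almost surely 0 under the
      symmetrized law; \<open>s n \<ge> \<delta>\<close> would keep the averaged integral above
      J/9.\<close>
    define J where "J = (\<integral>z. min 1 ((\<delta> * (e \<bullet> z))\<^sup>2) \<partial>?S)"
    have "J \<noteq> 0"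
    proof
      assume "J = 0"
      then have "AE z in ?S. min 1 ((\<delta> * (e \<bullet> z))\<^sup>2) = 0"
        unfolding J_def using integral_nonneg_eq_0_iff_AE[OF imin] by simp
      then have "AE z in ?S. e \<bullet> z = 0"
      proof eventually_elim
        case (elim z)
        then have "(\<delta> * (e \<bullet> z))\<^sup>2 = 0" by (metis min_def zero_neq_one)
        then show ?case using \<delta> by simp
      qed
      then show False using symmetrization_nondegenerate[OF e] by blast
    qed
    moreover have "J \<ge> 0" unfolding J_def by (intro integral_nonneg_AE AE_I2) simp
    ultimately have J: "J / 9 > 0" by simp
    from order_tendstoD(2)[OF lim J] eventually_ge_at_top[of 1]
    show ?thesis
    proof eventually_elim
      case (elim n)
      show ?case
      proof (rule ccontr)
        assume "\<not> s n < \<delta>"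
        then have sn: "\<delta> \<le> s n" by simp
        have "J / 9 \<le> (\<integral>z. 1 - sinc (s n * (e \<bullet> z)) \<partial>?S)"
          unfolding J_def integral_divide_zero[symmetric]
        proof (rule integral_mono)
          show "integrable ?S (\<lambda>z. 1 - sinc (s n * (e \<bullet> z)))"
            by (rule S.integrable_const_bound[of _ 2], rule AE_I2)
               (unfold real_norm_def, rule abs_one_minus_sinc_le, measurable)
          fix z
          have "(\<delta> * (e \<bullet> z))\<^sup>2 \<le> (s n * (e \<bullet> z))\<^sup>2"
            using sn \<delta> by (simp add: power_mult_distrib mult_right_mono power_mono)
          then have "min 1 ((\<delta> * (e \<bullet> z))\<^sup>2) / 9 \<le> min 1 ((s n * (e \<bullet> z))\<^sup>2) / 9" by (intro divide_right_mono min.mono) auto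
          also have "\<dots> \<le> 1 - sinc (s n * (e \<bullet> z))" by (rule one_minus_sinc_ge)
          finally show "min 1 ((\<delta> * (e \<bullet> z))\<^sup>2) / 9 \<le> 1 - sinc (s n * (e \<bullet> z))" .
        qed (use imin in simp)
        then show False using elim by linarith
      qed
    qed
  qed
  show ?thesis
  proof (rule order_tendstoI)
    fix x :: real assume "x < 0"
    show "eventually (\<lambda>n. x < s n) sequentially"
      using eventually_ge_at_top[of 1] by eventually_elim (use s_pos \<open>x < 0\<close> in force)
  qed (use small in blast)
qed

text \<open>Truncating e . z at a level \<open>K\<close> where it has a positive second moment keeps
  x (e . z) in the range of the quadratic lower bound for 1 - cos, provided \<open>x\<close> is
  small.\<close>

lemma sym_quadratic_lower:
  assumes e: "\<Gamma> e > 0"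
  shows "\<exists>k>0. \<exists>x0>0. \<forall>x. 0 \<le> x \<and> x \<le> x0 \<longrightarrow> k * x\<^sup>2 \<le> 1 - (cmod (\<phi> (x *\<^sub>R e)))\<^sup>2"
proof -
  let ?S = "symmetrization \<nu>"
  interpret S: prob_space ?S by (rule prob_space_symmetrization[OF nu])
  note [measurable_cong] = sets_symmetrization[OF nu]
  define f where "f K z = (if \<bar>e \<bullet> z\<bar> \<le> real K then (e \<bullet> z)\<^sup>2 else 0)" for K and z :: "real ^ 'd"
  have [measurable]: "f K \<in> borel_measurable borel" for K unfolding f_def[abs_def] by measurable
  have f_int: "integrable ?S (f K)" for K
  proof (rule S.integrable_const_bound[of _ "(real K)\<^sup>2"])
    show "AE z in ?S. norm (f K z) \<le> (real K)\<^sup>2"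
      by (intro AE_I2) (auto simp: f_def abs_le_square_iff[symmetric])
  qed measurable
  have "\<exists>K. (\<integral>z. f K z \<partial>?S) \<noteq> 0"
  proof (rule ccontr)
    assume neg: "\<not> ?thesis"
    have "AE z in ?S. f K z = 0" for K
    proof -
      have "AE z in ?S. 0 \<le> f K z" by (intro AE_I2) (simp add: f_def)
      then show ?thesis using neg integral_nonneg_eq_0_iff_AE[OF f_int[of K]] by blast
    qed
    then have "AE z in ?S. \<forall>K. f K z = 0" by (simp add: AE_all_countable)
    then have "AE z in ?S. e \<bullet> z = 0"
    proof eventually_elim
      case (elim z)
      obtain K where "\<bar>e \<bullet> z\<bar> \<le> real K" using real_arch_simple by blast
      then show ?case using elim[rule_format, of K] by (simp add: f_def)
    qed
    then show False using symmetrization_nondegenerate[OF e] by blast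
  qed
  then obtain K where K: "(\<integral>z. f K z \<partial>?S) \<noteq> 0" by blast
  have "(\<integral>z. f K z \<partial>?S) \<ge> 0" by (intro integral_nonneg_AE AE_I2) (simp add: f_def)
  then have k: "(\<integral>z. f K z \<partial>?S) / 3 > 0" using K by simp
  have "(\<integral>z. f K z \<partial>?S) / 3 * x\<^sup>2 \<le> 1 - (cmod (\<phi> (x *\<^sub>R e)))\<^sup>2" if x: "0 \<le> x" "x \<le> 1 / (real K + 1)" for x
  proof -
    have "(\<integral>z. f K z \<partial>?S) / 3 * x\<^sup>2 = (\<integral>z. f K z * (x\<^sup>2 / 3) \<partial>?S)" by simp
    also have "\<dots> \<le> (\<integral>z. 1 - cos ((x *\<^sub>R e) \<bullet> z) \<partial>?S)"
    proof (rule integral_mono)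
      show "integrable ?S (\<lambda>z. f K z * (x\<^sup>2 / 3))" using f_int by simp
      show "integrable ?S (\<lambda>z. 1 - cos ((x *\<^sub>R e) \<bullet> z))"
        by (rule S.integrable_const_bound[of _ 2], rule AE_I2)
           (unfold real_norm_def, rule abs_one_minus_cos_le, measurable)
      fix z
      show "f K z * (x\<^sup>2 / 3) \<le> 1 - cos ((x *\<^sub>R e) \<bullet> z)"
      proof (cases "\<bar>e \<bullet> z\<bar> \<le> real K")
        case True
        have "\<bar>x * (e \<bullet> z)\<bar> \<le> (1 / (real K + 1)) * real K"
          unfolding abs_mult using x True by (intro mult_mono) auto
        also have "\<dots> \<le> 2" by (simp add: field_simps)
        finally have "(x * (e \<bullet> z))\<^sup>2 / 3 \<le> 1 - cos (x * (e \<bullet> z))" by (rule one_minus_cos_ge)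
        then show ?thesis using True by (simp add: f_def power_mult_distrib mult.commute)
      qed (simp add: f_def)
    qed
    finally show ?thesis unfolding sym_symmetrization .
  qed
  then show ?thesis using k by (intro exI[of _ "(\<integral>z. f K z \<partial>?S) / 3"] conjI exI[of _ "1 / (real K + 1)"]) auto
qed

text \<open>The quadratic lower bound at frequency t e gives k t^2 n (s n)^2 <= n (1 - |phi|^2),
  whose limit is 2 t^alpha times the value of \<open>\<Gamma>\<close> at \<open>e\<close>. Dividing
  by t^2 and taking \<open>t\<close> large makes this as small as desired, because
  \<open>\<alpha> < 2\<close>.\<close>

lemma n_s_square_tendsto_0: "(\<lambda>n. real n * (s n)\<^sup>2) \<longlonglongrightarrow> 0"
proof (rule order_tendstoI)
  fix x :: real assume "x < 0"
  then show "eventually (\<lambda>n. x < real n * (s n)\<^sup>2) sequentially"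
    by (intro always_eventually allI) (smt (verit) of_nat_0_le_iff zero_le_mult_iff zero_le_power2)
next
  fix \<epsilon> :: real assume \<epsilon>: "0 < \<epsilon>"
  obtain e where e: "\<Gamma> e > 0" using Gamma_pos by blast
  obtain k x0 where k: "k > 0" "x0 > 0" "\<And>x. 0 \<le> x \<Longrightarrow> x \<le> x0 \<Longrightarrow> k * x\<^sup>2 \<le> 1 - (cmod (\<phi> (x *\<^sub>R e)))\<^sup>2"
    using sym_quadratic_lower[OF e] by blast
  have "((\<lambda>t. t powr (\<alpha> - 2)) \<longlongrightarrow> 0) at_top"
    using alpha by (intro tendsto_neg_powr filterlim_ident) auto
  then have "eventually (\<lambda>t. t powr (\<alpha> - 2) < \<epsilon> * k / (3 * \<Gamma> e)) at_top"
    by (rule order_tendstoD(2)) (use \<epsilon> k e in simp)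
  then have "eventually (\<lambda>t. t powr (\<alpha> - 2) < \<epsilon> * k / (3 * \<Gamma> e) \<and> t > 0) at_top"
    by (intro eventually_conj eventually_gt_at_top)
  then obtain t :: real where t: "t powr (\<alpha> - 2) < \<epsilon> * k / (3 * \<Gamma> e)" "t > 0"
    by (auto simp: eventually_at_top_linorder)
  \<comment> \<open>The factor 3 leaves room above the limit, which is twice this value of
    \<open>\<Gamma>\<close>.\<close>
  have bd: "3 * \<Gamma> (t *\<^sub>R e) < \<epsilon> * k * t\<^sup>2"
  proof -
    have "t powr \<alpha> = t powr (\<alpha> - 2) * t\<^sup>2" using t by (simp add: powr_diff)
    then have "3 * \<Gamma> (t *\<^sub>R e) = (t powr (\<alpha> - 2) * (3 * \<Gamma> e)) * t\<^sup>2" using Gamma_scale[OF t(2)] by simp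
    also have "\<dots> < (\<epsilon> * k) * t\<^sup>2"
      using t e by (intro mult_strict_right_mono) (auto simp: field_simps)
    finally show ?thesis .
  qed
  have "\<Gamma> (t *\<^sub>R e) > 0" using Gamma_scale[OF t(2), of e] t e by simp
  then have "eventually (\<lambda>n. real n * (1 - (cmod (\<phi> (s n *\<^sub>R (t *\<^sub>R e))))\<^sup>2) < 3 * \<Gamma> (t *\<^sub>R e)) sequentially"
    by (intro order_tendstoD(2)[OF sym_lim]) auto
  moreover have "eventually (\<lambda>n. s n < x0 / t) sequentially"
    by (rule order_tendstoD(2)[OF s_tendsto_0]) (use k t in simp)
  ultimately show "eventually (\<lambda>n. real n * (s n)\<^sup>2 < \<epsilon>) sequentially"
    using eventually_ge_at_top[of 1]
  proof eventually_elim
    case (elim n)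
    have "k * (s n * t)\<^sup>2 \<le> 1 - (cmod (\<phi> ((s n * t) *\<^sub>R e)))\<^sup>2"
      using elim t s_pos[of n] by (intro k(3)) (auto simp: field_simps)
    then have "real n * (k * (s n * t)\<^sup>2) \<le> real n * (1 - (cmod (\<phi> (s n *\<^sub>R (t *\<^sub>R e))))\<^sup>2)"
      by (intro mult_left_mono) auto
    also have "\<dots> < \<epsilon> * k * t\<^sup>2" using elim bd by linarith
    finally have "(k * t\<^sup>2) * (real n * (s n)\<^sup>2) < (k * t\<^sup>2) * \<epsilon>" by (simp add: power_mult_distrib ac_simps)
    then show ?case using k t by (simp add: mult_less_cancel_left)
  qed
qed

text \<open>Desymmetrization costs a term of order n (s n)^2, which is below 1 for large
  \<open>n\<close>; the rest is the uniform bound of \<open>sym_bounded\<close>.\<close>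

lemma one_minus_Re_bounded:
  "\<exists>u>0. \<exists>C. eventually (\<lambda>n. \<forall>l. norm l \<le> u \<longrightarrow> real n * (1 - Re (\<phi> (s n *\<^sub>R l))) \<le> C) sequentially"
proof -
  obtain u where u: "u > 0"
    "eventually (\<lambda>n. \<forall>l. norm l \<le> u \<longrightarrow> real n * (1 - (cmod (\<phi> (s n *\<^sub>R l)))\<^sup>2) \<le> 2) sequentially"
    using sym_bounded by blast
  obtain R where R: "R > 0" "measure \<nu> (cball 0 R) > 1 - 1 / 2"
    using exists_cball_measure_gt[OF nu, of "1/2"] by auto
  have "eventually (\<lambda>n. real n * (s n)\<^sup>2 < 1) sequentially"
    by (rule order_tendstoD(2)[OF n_s_square_tendsto_0]) simp
  then have "eventually (\<lambda>n. \<forall>l. norm l \<le> u \<longrightarrow> real n * (1 - Re (\<phi> (s n *\<^sub>R l))) \<le> 8 + 2 * R\<^sup>2 * u\<^sup>2) sequentially"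
    using u(2)
  proof eventually_elim
    case (elim n)
    show ?case
    proof (intro allI impI)
      fix l :: "real ^ 'd" assume l: "norm l \<le> u"
      have "1 - Re (\<phi> (s n *\<^sub>R l)) \<le> 4 * (1 - (cmod (\<phi> (s n *\<^sub>R l)))\<^sup>2) + 2 * R\<^sup>2 * (norm (s n *\<^sub>R l))\<^sup>2"
        using R by (intro one_minus_Re_char_fun_le[OF nu]) auto
      then have "real n * (1 - Re (\<phi> (s n *\<^sub>R l))) \<le> real n * (4 * (1 - (cmod (\<phi> (s n *\<^sub>R l)))\<^sup>2) + 2 * R\<^sup>2 * (norm (s n *\<^sub>R l))\<^sup>2)"
        by (intro mult_left_mono) auto
      also have "\<dots> = 4 * (real n * (1 - (cmod (\<phi> (s n *\<^sub>R l)))\<^sup>2)) + 2 * R\<^sup>2 * ((norm l)\<^sup>2 * (real n * (s n)\<^sup>2))"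
        by (simp add: power_mult_distrib algebra_simps)
      also have "\<dots> \<le> 4 * 2 + 2 * R\<^sup>2 * (u\<^sup>2 * 1)"
        using elim l by (intro add_mono mult_left_mono mult_mono power_mono) auto
      finally show "real n * (1 - Re (\<phi> (s n *\<^sub>R l))) \<le> 8 + 2 * R\<^sup>2 * u\<^sup>2" by simp
    qed
  qed
  then show ?thesis using u(1) by blast
qed

lemma phi_tendsto_1: "(\<lambda>n. \<phi> (s n *\<^sub>R l)) \<longlonglongrightarrow> 1"
proof -
  have "(\<lambda>n. CLINT x|\<nu>. iexp ((s n *\<^sub>R l) \<bullet> x)) \<longlonglongrightarrow> (CLINT x|\<nu>. 1)"
  proof (rule integral_dominated_convergence[where w="\<lambda>_. 1"])
    have "(\<lambda>n. iexp (s n * (l \<bullet> x))) \<longlonglongrightarrow> iexp (0 * (l \<bullet> x))" for x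
      by (intro tendsto_exp tendsto_mult tendsto_of_real tendsto_const s_tendsto_0)
    then show "AE x in \<nu>. (\<lambda>n. iexp ((s n *\<^sub>R l) \<bullet> x)) \<longlonglongrightarrow> 1" by simp
  qed (simp_all, measurable)
  then show ?thesis using nu.prob_space by (simp add: char_fun_def)
qed

text \<open>A bound for the increment of \<open>\<phi>\<close> under a shift by
  \<open>s n *\<^sub>R l\<close>, the same for every base point.\<close>

definition "\<beta> n l = (\<integral>x. cmod (iexp ((s n *\<^sub>R l) \<bullet> x) - 1) \<partial>\<nu>)"

lemma norm_iexp_minus_1_square: "(cmod (iexp y - 1))\<^sup>2 = 2 * (1 - cos y)"
proof -
  have "(cmod (iexp y - 1))\<^sup>2 = (cos y - 1)\<^sup>2 + (sin y)\<^sup>2"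
    by (simp add: cmod_power2 Re_exp Im_exp)
  then show ?thesis using sin_cos_squared_add[of y] by (simp add: power2_eq_square algebra_simps)
qed

lemma integrable_cmod: "integrable \<nu> (\<lambda>x. cmod (iexp (l \<bullet> x) - 1))"
  using integrable_iexp_inner[OF nu.finite_measure_axioms nu(2), of l] by simp

lemma Re_phi: "(\<integral>x. 1 - cos (l \<bullet> x) \<partial>\<nu>) = 1 - Re (\<phi> l)"
proof -
  have i: "integrable \<nu> (\<lambda>x. iexp (l \<bullet> x))" by (rule integrable_iexp_inner[OF nu.finite_measure_axioms nu(2)])
  have "Re (\<phi> l) = (\<integral>x. cos (l \<bullet> x) \<partial>\<nu>)"
    unfolding char_fun_def using integral_Re[OF i] by (simp add: Re_exp)
  moreover have "integrable \<nu> (\<lambda>x. cos (l \<bullet> x))" by (rule nu.integrable_const_bound[of _ 1]) auto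
  ultimately show ?thesis using nu.prob_space by simp
qed

text \<open>Split at a radius \<open>R\<close> independent of \<open>n\<close>. Inside, the
  integrand is at most s_n |l| R, so n (s n)^2 -> 0 applies. Outside, Cauchy-Schwarz gives 2 (1 - Re
  phi) times the probability of the complement: the former is O(1/n) by \<open>bdd\<close> and the
  latter is small.\<close>

lemma n_beta_square_tendsto_0:
  assumes bdd: "eventually (\<lambda>n. real n * (1 - Re (\<phi> (s n *\<^sub>R l))) \<le> C) sequentially"
  shows "(\<lambda>n. real n * (\<beta> n l)\<^sup>2) \<longlonglongrightarrow> 0"
proof (rule order_tendstoI)
  fix x :: real assume "x < 0"
  then show "eventually (\<lambda>n. x < real n * (\<beta> n l)\<^sup>2) sequentially"
    by (intro always_eventually allI) (smt (verit) of_nat_0_le_iff zero_le_mult_iff zero_le_power2)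
next
  fix \<epsilon> :: real assume \<epsilon>: "0 < \<epsilon>"
  define C' where "C' = max C 0 + 1"
  have C': "C' > 0" "C \<le> C'" by (auto simp: C'_def)
  have "\<epsilon> / (8 * C') > 0" using \<epsilon> C' by simp
  \<comment> \<open>This tail probability makes the outer part at most 4 C' eps / (8 C') = eps/2;
    the inner part will cost eps/4.\<close>
  from exists_cball_measure_gt[OF nu this]
  obtain R where R: "R > 0" "measure \<nu> (cball 0 R) > 1 - \<epsilon> / (8 * C')" by blast
  let ?A = "cball 0 R :: (real ^ 'd) set"
  have A[measurable]: "?A \<in> sets borel" by simp
  have compl: "measure \<nu> (- ?A) < \<epsilon> / (8 * C')"
  proof -
    have "measure \<nu> (space \<nu> - ?A) = 1 - measure \<nu> ?A" by (rule nu.prob_compl) measurable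
    then show ?thesis using R sets_eq_imp_space_eq[OF nu(2)] by (simp add: Compl_eq_Diff_UNIV)
  qed
  define b where "b = 2 * (norm l)\<^sup>2 * R\<^sup>2"
  have b: "b \<ge> 0" by (simp add: b_def)
  have "(\<lambda>n. b * (real n * (s n)\<^sup>2)) \<longlonglongrightarrow> b * 0" by (intro tendsto_mult tendsto_const n_s_square_tendsto_0)
  then have "eventually (\<lambda>n. b * (real n * (s n)\<^sup>2) < \<epsilon> / 4) sequentially"
    using \<epsilon> by (intro order_tendstoD(2)) auto
  with bdd show "eventually (\<lambda>n. real n * (\<beta> n l)\<^sup>2 < \<epsilon>) sequentially"
  proof eventually_elim
    case (elim n)
    let ?X = "\<lambda>x. cmod (iexp ((s n *\<^sub>R l) \<bullet> x) - 1)"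
    have X2: "\<bar>?X x\<bar> \<le> 2" for x using norm_triangle_ineq4[of "iexp ((s n *\<^sub>R l) \<bullet> x)" 1] by simp
    have Xm: "?X \<in> borel_measurable \<nu>" by measurable
    have iX: "integrable \<nu> ?X" by (rule integrable_cmod)
    have i1: "integrable \<nu> (\<lambda>x. ?X x * indicator ?A x)" "integrable \<nu> (\<lambda>x. ?X x * indicator (- ?A) x)"
      using iX by (intro integrable_mult_indicator[where 'b=real, simplified mult.commute real_scaleR_def]; simp add: nu(2))+
    have "\<beta> n l = (\<integral>x. ?X x * indicator ?A x + ?X x * indicator (- ?A) x \<partial>\<nu>)"
      unfolding \<beta>_def by (intro Bochner_Integration.integral_cong) (auto simp: indicator_def)
    also have "\<dots> = (\<integral>x. ?X x * indicator ?A x \<partial>\<nu>) + (\<integral>x. ?X x * indicator (- ?A) x \<partial>\<nu>)"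
      using i1 by (rule Bochner_Integration.integral_add)
    finally have split: "\<beta> n l = (\<integral>x. ?X x * indicator ?A x \<partial>\<nu>) + (\<integral>x. ?X x * indicator (- ?A) x \<partial>\<nu>)" .
    have "(\<integral>x. ?X x * indicator ?A x \<partial>\<nu>) \<le> (\<integral>x. \<bar>s n\<bar> * norm l * R \<partial>\<nu>)"
    proof (rule integral_mono[OF i1(1)])
      fix x :: "real ^ 'd"
      show "?X x * indicator ?A x \<le> \<bar>s n\<bar> * norm l * R"
      proof (cases "x \<in> ?A")
        case True
        have "?X x \<le> \<bar>(s n *\<^sub>R l) \<bullet> x\<bar>" by (rule norm_iexp_diff_one_le)
        also have "\<dots> \<le> norm (s n *\<^sub>R l) * norm x" by (rule Cauchy_Schwarz_ineq2)
        also have "\<dots> \<le> (\<bar>s n\<bar> * norm l) * R" using True by (auto intro!: mult_left_mono)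
        finally show ?thesis using True by simp
      qed (use R in simp)
    qed simp
    then have m1: "(\<integral>x. ?X x * indicator ?A x \<partial>\<nu>) \<le> \<bar>s n\<bar> * norm l * R" using nu.prob_space by simp
    have m1': "0 \<le> (\<integral>x. ?X x * indicator ?A x \<partial>\<nu>)" by (intro integral_nonneg_AE AE_I2) simp
    have "(\<integral>x. ?X x * indicator ?A x \<partial>\<nu>)\<^sup>2 \<le> (\<bar>s n\<bar> * norm l * R)\<^sup>2" using m1 m1' by (intro power_mono)
    then have p1: "(\<integral>x. ?X x * indicator ?A x \<partial>\<nu>)\<^sup>2 \<le> (norm l)\<^sup>2 * R\<^sup>2 * (s n)\<^sup>2" by (simp add: power_mult_distrib ac_simps)
    have "(\<integral>x. ?X x * indicator (- ?A) x \<partial>\<nu>)\<^sup>2 \<le> (\<integral>x. (?X x)\<^sup>2 \<partial>\<nu>) * measure \<nu> (- ?A)"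
      by (rule nu.integral_mult_indicator_square_le[OF Xm X2]) (simp add: nu(2))
    also have "(\<integral>x. (?X x)\<^sup>2 \<partial>\<nu>) = 2 * (1 - Re (\<phi> (s n *\<^sub>R l)))"
      unfolding norm_iexp_minus_1_square integral_mult_right_zero Re_phi ..
    finally have p2: "(\<integral>x. ?X x * indicator (- ?A) x \<partial>\<nu>)\<^sup>2 \<le> 2 * (1 - Re (\<phi> (s n *\<^sub>R l))) * measure \<nu> (- ?A)" .
    have sq: "(p + q)\<^sup>2 \<le> 2 * p\<^sup>2 + 2 * q\<^sup>2" for p q :: real
      using sum_squares_bound[of p q] by (simp add: power2_sum)
    have "(\<beta> n l)\<^sup>2 \<le> 2 * ((norm l)\<^sup>2 * R\<^sup>2 * (s n)\<^sup>2) + 2 * (2 * (1 - Re (\<phi> (s n *\<^sub>R l))) * measure \<nu> (- ?A))"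
      unfolding split using sq p1 p2 by (smt (verit))
    then have "real n * (\<beta> n l)\<^sup>2 \<le> real n * (2 * ((norm l)\<^sup>2 * R\<^sup>2 * (s n)\<^sup>2) + 2 * (2 * (1 - Re (\<phi> (s n *\<^sub>R l))) * measure \<nu> (- ?A)))"
      by (intro mult_left_mono) auto
    also have "\<dots> = b * (real n * (s n)\<^sup>2) + 4 * (real n * (1 - Re (\<phi> (s n *\<^sub>R l)))) * measure \<nu> (- ?A)"
      by (simp add: b_def algebra_simps)
    also have "\<dots> \<le> \<epsilon> / 4 + 4 * C' * (\<epsilon> / (8 * C'))"
    proof (rule add_mono)
      show "4 * (real n * (1 - Re (\<phi> (s n *\<^sub>R l)))) * measure \<nu> (- ?A) \<le> 4 * C' * (\<epsilon> / (8 * C'))"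
        by (rule mult_mono) (use elim compl C' in auto)
    qed (use elim in simp)
    also have "\<dots> < \<epsilon>" using C' \<epsilon> by simp
    finally show ?case .
  qed
qed

end

lemma min_one_sum_le:
  fixes f :: "'a \<Rightarrow> real"
  assumes "finite A" "\<And>k. k \<in> A \<Longrightarrow> 0 \<le> f k"
  shows "min 1 (\<Sum>k\<in>A. f k) \<le> (\<Sum>k\<in>A. min 1 (f k))"
  using assms
proof (induction A)
  case (insert k A)
  have "0 \<le> (\<Sum>k\<in>A. f k)" "0 \<le> f k" using insert by (auto intro: sum_nonneg)
  then have "min 1 (f k + (\<Sum>k\<in>A. f k)) \<le> min 1 (f k) + min 1 (\<Sum>k\<in>A. f k)" by (auto simp: min_def)
  also have "\<dots> \<le> min 1 (f k) + (\<Sum>k\<in>A. min 1 (f k))" using insert by (intro add_left_mono) auto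
  finally show ?case using insert.hyps by simp
qed simp

text \<open>One \<open>sinc\<close> term per coordinate axis, so that the sum vanishes only at the
  origin for \<open>u \<noteq> 0\<close>; the bounds that follow make it comparable to
  \<open>min 1 ((norm x)\<^sup>2)\<close>.\<close>

definition sinc_weight :: "real \<Rightarrow> real ^ 'd \<Rightarrow> real" where
  "sinc_weight u x = (\<Sum>k\<in>UNIV. 1 - sinc ((u *\<^sub>R axis k 1) \<bullet> x))"

lemma sinc_weight_measurable[measurable]: "sinc_weight u \<in> borel_measurable borel"
  unfolding sinc_weight_def[abs_def] by measurable

lemma sinc_weight_nonneg: "0 \<le> sinc_weight u x"
  unfolding sinc_weight_def by (intro sum_nonneg one_minus_sinc_nonneg)

lemma one_minus_sinc_inner_le: "1 - sinc (f \<bullet> x) \<le> (2 + (norm f)\<^sup>2) * min 1 ((norm x)\<^sup>2)"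
  for f x :: "real ^ 'd"
proof (cases "norm x \<le> 1")
  case True
  have "1 - sinc (f \<bullet> x) \<le> (f \<bullet> x)\<^sup>2 / 2" using one_minus_sinc_le[of "f \<bullet> x"] by (simp only: min.bounded_iff)
  also have "\<dots> \<le> (f \<bullet> x)\<^sup>2" by simp
  also have "\<dots> \<le> (norm f * norm x)\<^sup>2"
    using Cauchy_Schwarz_ineq2[of f x] by (simp add: abs_le_square_iff[symmetric])
  also have "\<dots> \<le> (2 + (norm f)\<^sup>2) * (norm x)\<^sup>2" by (simp add: power_mult_distrib mult_right_mono)
  also have "(norm x)\<^sup>2 = min 1 ((norm x)\<^sup>2)" using True by (simp add: power_le_one min_absorb2)
  finally show ?thesis .
next
  case False
  then have m: "min 1 ((norm x)\<^sup>2) = 1" by (simp add: min_absorb1 one_le_power)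
  have "1 - sinc (f \<bullet> x) \<le> 2" using one_minus_sinc_le[of "f \<bullet> x"] by (simp only: min.bounded_iff)
  also have "\<dots> \<le> (2 + (norm f)\<^sup>2) * min 1 ((norm x)\<^sup>2)" unfolding m by simp
  finally show ?thesis .
qed

lemma sinc_weight_le:
  "sinc_weight u (x :: real ^ 'd) \<le> (real CARD('d) * (2 + u\<^sup>2)) * min 1 ((norm x)\<^sup>2)"
proof -
  have "sinc_weight u x \<le> (\<Sum>k\<in>(UNIV :: 'd set). (2 + (norm (u *\<^sub>R axis k (1::real)))\<^sup>2) * min 1 ((norm x)\<^sup>2))"
    unfolding sinc_weight_def by (intro sum_mono one_minus_sinc_inner_le)
  then show ?thesis by (simp add: norm_axis_1)
qed

lemma sinc_weight_ge:
  "min 1 (u\<^sup>2) / 9 * min 1 ((norm x)\<^sup>2) \<le> sinc_weight u (x :: real ^ 'd)"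
proof -
  have "(norm x)\<^sup>2 = (\<Sum>k\<in>UNIV. (x $ k)\<^sup>2)"
    unfolding power2_norm_eq_inner inner_vec_def inner_real_def by (simp add: power2_eq_square)
  then have "min 1 ((norm x)\<^sup>2) \<le> (\<Sum>k\<in>UNIV. min 1 ((x $ k)\<^sup>2))" by (simp add: min_one_sum_le)
  then have "min 1 (u\<^sup>2) / 9 * min 1 ((norm x)\<^sup>2) \<le> min 1 (u\<^sup>2) / 9 * (\<Sum>k\<in>UNIV. min 1 ((x $ k)\<^sup>2))"
    by (intro mult_left_mono) auto
  also have "\<dots> = (\<Sum>k\<in>UNIV. min 1 (u\<^sup>2) / 9 * min 1 ((x $ k)\<^sup>2))" by (rule sum_distrib_left)
  also have "\<dots> \<le> sinc_weight u x" unfolding sinc_weight_def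
  proof (rule sum_mono)
    fix k
    have "min 1 (u\<^sup>2) * min 1 ((x $ k)\<^sup>2) \<le> min 1 ((u * x $ k)\<^sup>2)"
    proof (rule min.boundedI)
      show "min 1 (u\<^sup>2) * min 1 ((x $ k)\<^sup>2) \<le> 1" by (intro mult_le_one) auto
      have "min 1 (u\<^sup>2) * min 1 ((x $ k)\<^sup>2) \<le> u\<^sup>2 * (x $ k)\<^sup>2" by (intro mult_mono) auto
      then show "min 1 (u\<^sup>2) * min 1 ((x $ k)\<^sup>2) \<le> (u * x $ k)\<^sup>2" by (simp only: power_mult_distrib)
    qed
    then have "min 1 (u\<^sup>2) / 9 * min 1 ((x $ k)\<^sup>2) \<le> min 1 ((u * x $ k)\<^sup>2) / 9" by simp
    also have "\<dots> \<le> 1 - sinc (u * x $ k)" by (rule one_minus_sinc_ge)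
    also have "u * x $ k = (u *\<^sub>R axis k 1) \<bullet> x" by (simp add: inner_axis')
    finally show "min 1 (u\<^sup>2) / 9 * min 1 ((x $ k)\<^sup>2) \<le> 1 - sinc ((u *\<^sub>R axis k 1) \<bullet> x)" .
  qed
  finally show ?thesis .
qed

section \<open>Limits of second differences of the characteristic function\<close>

context stable_attraction
begin

text \<open>The phases from \<open>d n\<close> cancel in \<open>R n\<close>, so the powers
  \<open>R n ^ n\<close> converge, and the bound of \<open>norm_char_fun_square_diff_le\<close>
  makes n |R n - 1| small enough for the logarithm. This gives the limit of the multiplicative
  difference n (p^2 - p1 p2); the additive one differs from it by a product of two increments, which
  is O(n beta^2).\<close>

lemma second_difference_lim:
  assumes bdd: "eventually (\<lambda>n. real n * (1 - Re (\<phi> (s n *\<^sub>R f))) \<le> C) sequentially"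
    and \<Gamma>f: "\<Gamma> f \<le> 1 / 16"
  shows "(\<lambda>n. of_nat n * (\<integral>x. iexp ((s n *\<^sub>R l) \<bullet> x) * of_real (1 - cos ((s n *\<^sub>R f) \<bullet> x)) \<partial>\<nu>)) \<longlonglongrightarrow> \<Delta> l f"
proof -
  define p where "p n = \<phi> (s n *\<^sub>R l)" for n
  define p1 where "p1 n = \<phi> (s n *\<^sub>R (l + f))" for n
  define p2 where "p2 n = \<phi> (s n *\<^sub>R (l - f))" for n
  define Q where "Q n = p1 n * p2 n" for n
  define R where "R n = (p n)\<^sup>2 / Q n" for n
  have lims: "p \<longlonglongrightarrow> 1" "p1 \<longlonglongrightarrow> 1" "p2 \<longlonglongrightarrow> 1"
    unfolding p_def[abs_def] p1_def[abs_def] p2_def[abs_def] by (rule phi_tendsto_1)+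
  have Q1: "Q \<longlonglongrightarrow> 1" using tendsto_mult[OF lims(2,3)] by (simp add: Q_def[abs_def])
  have P: "cmod ((p n)\<^sup>2 - Q n) \<le> 1 - (cmod (\<phi> (s n *\<^sub>R f)))\<^sup>2" for n
    using norm_char_fun_square_diff_le[OF nu, of "s n *\<^sub>R l" "s n *\<^sub>R f"]
    unfolding p_def Q_def p1_def p2_def by (simp only: scaleR_add_right scaleR_diff_right)
  have Rn: "R n ^ n = (iexp (- (l \<bullet> d n)) * p n ^ n)\<^sup>2 / ((iexp (- ((l + f) \<bullet> d n)) * p1 n ^ n) * (iexp (- ((l - f) \<bullet> d n)) * p2 n ^ n))" for n
  proof -
    have "(iexp (- (l \<bullet> d n)))\<^sup>2 = iexp (- ((l + f) \<bullet> d n)) * iexp (- ((l - f) \<bullet> d n))"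
      unfolding power2_eq_square iexp_add[symmetric] by (simp add: inner_simps)
    then show ?thesis
      by (simp add: R_def Q_def power_mult_distrib power_divide power_mult[symmetric] mult.commute mult.left_commute)
  qed
  have "(\<lambda>n. R n ^ n) \<longlonglongrightarrow> (exp (\<Psi> l))\<^sup>2 / (exp (\<Psi> (l + f)) * exp (\<Psi> (l - f)))"
    unfolding Rn p_def p1_def p2_def by (intro tendsto_divide tendsto_power tendsto_mult char_lim) simp
  also have "(exp (\<Psi> l))\<^sup>2 / (exp (\<Psi> (l + f)) * exp (\<Psi> (l - f))) = exp (2 * \<Delta> l f)"
    unfolding Psi_second_difference[symmetric] by (simp add: exp_diff exp_double)
  finally have R_lim: "(\<lambda>n. R n ^ n) \<longlonglongrightarrow> exp (2 * \<Delta> l f)" .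
  \<comment> \<open>The limit is at most 2/16. Dividing the bound 3/16 by |Q| > 3/4 yields exactly
    the 1/4 required by \<open>power_tendsto_exp_imp\<close>.\<close>
  have "eventually (\<lambda>n. real n * (1 - (cmod (\<phi> (s n *\<^sub>R f)))\<^sup>2) < 3 / 16) sequentially"
    by (rule order_tendstoD(2)[OF sym_lim]) (use \<Gamma>f in simp)
  moreover have Qev: "eventually (\<lambda>n. cmod (Q n) > 3 / 4) sequentially"
    by (rule order_tendstoD(1)[OF tendsto_norm[OF Q1]]) simp
  ultimately have small: "eventually (\<lambda>n. real n * cmod (R n - 1) \<le> 1 / 4) sequentially"
  proof eventually_elim
    case (elim n)
    then have "Q n \<noteq> 0" by auto
    then have "R n - 1 = ((p n)\<^sup>2 - Q n) / Q n" by (simp add: R_def field_simps)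
    then have "real n * cmod (R n - 1) = real n * cmod ((p n)\<^sup>2 - Q n) / cmod (Q n)" by (simp add: norm_divide)
    also have "\<dots> \<le> (3 / 16) / (3 / 4)"
    proof (rule frac_le)
      show "real n * cmod ((p n)\<^sup>2 - Q n) \<le> 3 / 16"
        using mult_left_mono[OF P[of n], of "real n"] elim by linarith
    qed (use elim in auto)
    finally show ?case by simp
  qed
  have "cmod (2 * \<Delta> l f) \<le> 1" using norm_Delta_le[of l f] \<Gamma>f by (simp add: norm_mult)
  from tendsto_mult[OF power_tendsto_exp_imp[OF R_lim this small] Q1]
  have "(\<lambda>n. of_nat n * (R n - 1) * Q n) \<longlonglongrightarrow> 2 * \<Delta> l f" by simp
  moreover have "eventually (\<lambda>n. of_nat n * (R n - 1) * Q n = of_nat n * ((p n)\<^sup>2 - Q n)) sequentially"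
    using Qev
  proof eventually_elim
    case (elim n)
    then have "Q n \<noteq> 0" by auto
    then show ?case by (simp add: R_def field_simps)
  qed
  ultimately have nP: "(\<lambda>n. of_nat n * ((p n)\<^sup>2 - Q n)) \<longlonglongrightarrow> 2 * \<Delta> l f"
    by (rule Lim_transform_eventually)
  have diff_le: "cmod (\<phi> (s n *\<^sub>R l) - \<phi> (s n *\<^sub>R (l + g))) \<le> (\<integral>x. cmod (iexp ((s n *\<^sub>R g) \<bullet> x) - 1) \<partial>\<nu>)" for n g
  proof -
    note i = integrable_iexp_inner[OF nu.finite_measure_axioms nu(2)]
    have eq: "cmod (iexp ((s n *\<^sub>R l) \<bullet> x) - iexp ((s n *\<^sub>R (l + g)) \<bullet> x)) = cmod (iexp ((s n *\<^sub>R g) \<bullet> x) - 1)" for x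
    proof -
      have "iexp ((s n *\<^sub>R l) \<bullet> x) - iexp ((s n *\<^sub>R (l + g)) \<bullet> x) = iexp ((s n *\<^sub>R l) \<bullet> x) * (1 - iexp ((s n *\<^sub>R g) \<bullet> x))"
        by (simp only: scaleR_add_right inner_add_left iexp_add) (simp only: right_diff_distrib mult_1_right)
      then show ?thesis by (simp only: norm_mult norm_exp_i_times mult_1_left norm_minus_commute)
    qed
    have "\<phi> (s n *\<^sub>R l) - \<phi> (s n *\<^sub>R (l + g)) = (\<integral>x. iexp ((s n *\<^sub>R l) \<bullet> x) - iexp ((s n *\<^sub>R (l + g)) \<bullet> x) \<partial>\<nu>)"
      unfolding char_fun_def using i by (intro Bochner_Integration.integral_diff[symmetric])
    also have "cmod \<dots> \<le> (\<integral>x. cmod (iexp ((s n *\<^sub>R l) \<bullet> x) - iexp ((s n *\<^sub>R (l + g)) \<bullet> x)) \<partial>\<nu>)"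
      by (rule integral_norm_bound)
    finally show ?thesis unfolding eq .
  qed
  have b1: "cmod (p n - p1 n) \<le> \<beta> n f" for n
    unfolding p_def p1_def \<beta>_def by (rule diff_le)
  have b2: "cmod (p n - p2 n) \<le> \<beta> n f" for n
  proof -
    have eq: "cmod (iexp ((s n *\<^sub>R (- f)) \<bullet> x) - 1) = cmod (iexp ((s n *\<^sub>R f) \<bullet> x) - 1)" for x
    proof -
      have "(cmod (iexp ((s n *\<^sub>R (- f)) \<bullet> x) - 1))\<^sup>2 = (cmod (iexp ((s n *\<^sub>R f) \<bullet> x) - 1))\<^sup>2"
        unfolding norm_iexp_minus_1_square by simp
      then show ?thesis by (simp only: power2_eq_iff_nonneg norm_ge_zero)
    qed
    have "cmod (p n - p2 n) \<le> (\<integral>x. cmod (iexp ((s n *\<^sub>R (- f)) \<bullet> x) - 1) \<partial>\<nu>)"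
      using diff_le[of n "- f"] unfolding p_def p2_def by simp
    then show ?thesis unfolding \<beta>_def eq .
  qed
  have "(\<lambda>n. of_nat n * ((p n - p1 n) * (p n - p2 n))) \<longlonglongrightarrow> 0"
  proof (rule Lim_null_comparison[OF _ n_beta_square_tendsto_0[OF bdd]])
    show "eventually (\<lambda>n. cmod (of_nat n * ((p n - p1 n) * (p n - p2 n))) \<le> real n * (\<beta> n f)\<^sup>2) sequentially"
    proof (intro always_eventually allI)
      fix n
      have "cmod (p n - p1 n) * cmod (p n - p2 n) \<le> \<beta> n f * \<beta> n f"
        using b1[of n] b2[of n] order_trans[OF norm_ge_zero b1[of n]] by (intro mult_mono) auto
      then show "cmod (of_nat n * ((p n - p1 n) * (p n - p2 n))) \<le> real n * (\<beta> n f)\<^sup>2"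
        by (simp add: norm_mult power2_eq_square mult_left_mono)
    qed
  qed
  \<comment> \<open>Since p^2 - p1 p2 + (p - p1) (p - p2) = p (2 p - p1 - p2), division by 2 p
    leaves p - p1/2 - p2/2.\<close>
  from tendsto_add[OF nP this]
  have "(\<lambda>n. (of_nat n * ((p n)\<^sup>2 - Q n) + of_nat n * ((p n - p1 n) * (p n - p2 n))) / (2 * p n)) \<longlonglongrightarrow> (2 * \<Delta> l f + 0) / (2 * 1)"
    by (intro tendsto_divide tendsto_mult[OF tendsto_const] lims) auto
  then have lim: "(\<lambda>n. (of_nat n * ((p n)\<^sup>2 - Q n) + of_nat n * ((p n - p1 n) * (p n - p2 n))) / (2 * p n)) \<longlonglongrightarrow> \<Delta> l f" by simp
  have "eventually (\<lambda>n. (of_nat n * ((p n)\<^sup>2 - Q n) + of_nat n * ((p n - p1 n) * (p n - p2 n))) / (2 * p n)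
      = of_nat n * (\<integral>x. iexp ((s n *\<^sub>R l) \<bullet> x) * of_real (1 - cos ((s n *\<^sub>R f) \<bullet> x)) \<partial>\<nu>)) sequentially"
    using order_tendstoD(1)[OF tendsto_norm[OF lims(1)], of 0, simplified]
  proof eventually_elim
    case (elim n)
    have I: "(\<integral>x. iexp ((s n *\<^sub>R l) \<bullet> x) * of_real (1 - cos ((s n *\<^sub>R f) \<bullet> x)) \<partial>\<nu>) = p n - p1 n / 2 - p2 n / 2"
      using char_fun_second_difference[OF nu.finite_measure_axioms nu(2), of "s n *\<^sub>R l" "s n *\<^sub>R f"]
      unfolding p_def p1_def p2_def by (simp only: scaleR_add_right scaleR_diff_right)
    show ?case using elim unfolding I Q_def by (simp add: field_simps power2_eq_square)
  qed
  from Lim_transform_eventually[OF lim this] show ?thesis .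
qed

text \<open>\<open>sym_bounded\<close> bounds \<open>\<Gamma>\<close> by 1 on a ball; homogeneity
  lowers this to 1/16 on the ball shrunk by the factor t with t^alpha = 1/16.\<close>

lemma exists_good_radius:
  "\<exists>u>0. \<exists>C. eventually (\<lambda>n. \<forall>l. norm l \<le> u \<longrightarrow> real n * (1 - Re (\<phi> (s n *\<^sub>R l))) \<le> C) sequentially
     \<and> (\<forall>l. norm l \<le> u \<longrightarrow> \<Gamma> l \<le> 1 / 16)"
proof -
  obtain u C where u: "u > 0" "eventually (\<lambda>n. \<forall>l. norm l \<le> u \<longrightarrow> real n * (1 - Re (\<phi> (s n *\<^sub>R l))) \<le> C) sequentially"
    using one_minus_Re_bounded by blast
  obtain u1 where u1: "u1 > 0"
    "eventually (\<lambda>n. \<forall>l. norm l \<le> u1 \<longrightarrow> real n * (1 - (cmod (\<phi> (s n *\<^sub>R l)))\<^sup>2) \<le> 2) sequentially"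
    using sym_bounded by blast
  have G1: "\<Gamma> l \<le> 1" if "norm l \<le> u1" for l
  proof -
    have "eventually (\<lambda>n. real n * (1 - (cmod (\<phi> (s n *\<^sub>R l)))\<^sup>2) \<le> 2) sequentially"
      using u1(2) by eventually_elim (use that in blast)
    then have "2 * \<Gamma> l \<le> 2" by (intro tendsto_upperbound[OF sym_lim]) auto
    then show ?thesis by simp
  qed
  define t where "t = (1 / 16) powr (1 / \<alpha>)"
  have t: "t > 0" "t powr \<alpha> = 1 / 16" using alpha by (auto simp: t_def powr_powr)
  define u' where "u' = min u (t * u1)"
  have "\<Gamma> l \<le> 1 / 16" if "norm l \<le> u'" for l
  proof -
    have "norm l \<le> t * u1" using that by (simp add: u'_def)
    then have "norm ((1 / t) *\<^sub>R l) \<le> u1" using t by (simp add: field_simps)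
    from G1[OF this] have "\<Gamma> (t *\<^sub>R ((1 / t) *\<^sub>R l)) \<le> 1 / 16" unfolding Gamma_scale[OF t(1)] t(2) by simp
    then show ?thesis using t by simp
  qed
  moreover have "eventually (\<lambda>n. \<forall>l. norm l \<le> u' \<longrightarrow> real n * (1 - Re (\<phi> (s n *\<^sub>R l))) \<le> C) sequentially"
    using u(2) by eventually_elim (auto simp: u'_def)
  moreover have "u' > 0" using u t u1 by (simp add: u'_def)
  ultimately show ?thesis by blast
qed

text \<open>Second differences with step \<open>t *\<^sub>R e\<close> are integrated over
  \<open>t\<close> in [0,1]. The uniform bound \<open>bdd\<close> on n (1 - Re phi) is the
  dominating constant.\<close>

lemma sinc_lim:
  assumes bdd: "eventually (\<lambda>n. \<forall>l. norm l \<le> u \<longrightarrow> real n * (1 - Re (\<phi> (s n *\<^sub>R l))) \<le> C) sequentially"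
    and small: "\<And>l. norm l \<le> u \<Longrightarrow> \<Gamma> l \<le> 1 / 16" and e: "norm e \<le> u"
  shows "(\<lambda>n. of_nat n * (\<integral>x. iexp ((s n *\<^sub>R l) \<bullet> x) * of_real (1 - sinc ((s n *\<^sub>R e) \<bullet> x)) \<partial>\<nu>))
    \<longlonglongrightarrow> (CLINT x|M0. iexp (l \<bullet> x) * of_real (1 - sinc (e \<bullet> x)))"
proof -
  define S where "S n t = of_nat n * (\<integral>x. iexp ((s n *\<^sub>R l) \<bullet> x) * of_real (1 - cos (t * ((s n *\<^sub>R e) \<bullet> x))) \<partial>\<nu>)" for n t
  have te: "norm (t *\<^sub>R e) \<le> u" if "t \<in> {0..1}" for t
  proof -
    have "\<bar>t\<bar> * norm e \<le> 1 * norm e" using that by (intro mult_right_mono) auto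
    then show ?thesis using e by simp
  qed
  have S_lim: "(\<lambda>n. S n t) \<longlonglongrightarrow> \<Delta> l (t *\<^sub>R e)" if "t \<in> {0..1}" for t
  proof -
    have "eventually (\<lambda>n. real n * (1 - Re (\<phi> (s n *\<^sub>R (t *\<^sub>R e)))) \<le> C) sequentially"
      using bdd by eventually_elim (use te[OF that] in blast)
    from second_difference_lim[OF this small[OF te[OF that]], of l] show ?thesis
      unfolding S_def by (simp add: ac_simps)
  qed
  have avg1: "(CLINT t:{0..1}|lborel. S n t) = of_nat n * (\<integral>x. iexp ((s n *\<^sub>R l) \<bullet> x) * of_real (1 - sinc ((s n *\<^sub>R e) \<bullet> x)) \<partial>\<nu>)" for n
  proof -
    have "(CLINT t:{0..1}|lborel. S n t) = of_nat n * (CLINT t:{0..1}|lborel. \<integral>x. iexp ((s n *\<^sub>R l) \<bullet> x) * of_real (1 - cos (t * ((s n *\<^sub>R e) \<bullet> x))) \<partial>\<nu>)"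
      unfolding S_def set_lebesgue_integral_def by (simp only: mult_scaleR_right[symmetric] integral_mult_right_zero)
    also have "(CLINT t:{0..1}|lborel. \<integral>x. iexp ((s n *\<^sub>R l) \<bullet> x) * of_real (1 - cos (t * ((s n *\<^sub>R e) \<bullet> x))) \<partial>\<nu>)
       = (\<integral>x. iexp ((s n *\<^sub>R l) \<bullet> x) * of_real (1 - sinc ((s n *\<^sub>R e) \<bullet> x)) \<partial>\<nu>)"
    proof (rule integral_one_minus_sinc)
      show "integrable \<nu> (\<lambda>x. min 2 (((s n *\<^sub>R e) \<bullet> x)\<^sup>2))"
        by (rule nu.integrable_const_bound[of _ 2]) auto
    qed (auto intro: nu.sigma_finite_measure_axioms)
    finally show ?thesis .
  qed
  have avg2: "(CLINT t:{0..1}|lborel. \<Delta> l (t *\<^sub>R e)) = (CLINT x|M0. iexp (l \<bullet> x) * of_real (1 - sinc (e \<bullet> x)))"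
  proof -
    have "(CLINT t:{0..1}|lborel. CLINT x|M0. iexp (l \<bullet> x) * of_real (1 - cos (t * (e \<bullet> x)))) = (CLINT x|M0. iexp (l \<bullet> x) * of_real (1 - sinc (e \<bullet> x)))"
    proof (rule integral_one_minus_sinc[OF sigma_finite_stable[OF sigma alpha]])
      show "integrable M0 (\<lambda>x. min 2 ((e \<bullet> x)\<^sup>2))"
      proof (rule Bochner_Integration.integrable_bound)
        show "integrable M0 (\<lambda>x. (2 + (norm e)\<^sup>2) * min 1 ((norm x)\<^sup>2))"
          by (intro integrable_mult_right integrable_stable_min sigma alpha)
        have "min 2 ((e \<bullet> x)\<^sup>2) \<le> (2 + (norm e)\<^sup>2) * min 1 ((norm x)\<^sup>2)" for x
        proof (cases "(norm x)\<^sup>2 \<le> 1")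
          case True
          have "\<bar>e \<bullet> x\<bar> \<le> \<bar>norm e * norm x\<bar>" using Cauchy_Schwarz_ineq2[of e x] by simp
          then have "(e \<bullet> x)\<^sup>2 \<le> (norm e)\<^sup>2 * (norm x)\<^sup>2" by (simp only: abs_le_square_iff power_mult_distrib)
          also have "\<dots> \<le> (2 + (norm e)\<^sup>2) * (norm x)\<^sup>2" by (intro mult_right_mono) auto
          finally show ?thesis using True by (simp add: min_absorb2 min.coboundedI2)
        next
          case False
          then show ?thesis by (simp add: min_absorb1 min.coboundedI1)
        qed
        then show "AE x in M0. norm (min 2 ((e \<bullet> x)\<^sup>2)) \<le> norm ((2 + (norm e)\<^sup>2) * min 1 ((norm x)\<^sup>2))"
          by (intro AE_I2) (simp add: abs_mult)
      qed measurable
    qed auto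
    then show ?thesis unfolding \<Delta>_def by (simp only: inner_scaleR_left)
  qed
  have S_meas: "S n \<in> borel_measurable borel" for n
    unfolding S_def[abs_def] by measurable
  have D_meas: "(\<lambda>t. \<Delta> l (t *\<^sub>R e)) \<in> borel_measurable borel"
  proof -
    interpret M0: sigma_finite_measure M0 by (rule sigma_finite_stable[OF sigma alpha])
    show ?thesis unfolding \<Delta>_def by measurable
  qed
  obtain n0 where n0: "\<And>n l. n \<ge> n0 \<Longrightarrow> norm l \<le> u \<Longrightarrow> real n * (1 - Re (\<phi> (s n *\<^sub>R l))) \<le> C"
    using bdd by (auto simp: eventually_sequentially)
  have S_bd: "cmod (S n t) \<le> C" if "n \<ge> n0" "t \<in> {0..1}" for n t
  proof -
    have "cmod (S n t) = real n * cmod (\<integral>x. iexp ((s n *\<^sub>R l) \<bullet> x) * of_real (1 - cos (t * ((s n *\<^sub>R e) \<bullet> x))) \<partial>\<nu>)"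
      unfolding S_def norm_mult norm_of_nat ..
    also have "\<dots> \<le> real n * (\<integral>x. cmod (iexp ((s n *\<^sub>R l) \<bullet> x) * of_real (1 - cos (t * ((s n *\<^sub>R e) \<bullet> x)))) \<partial>\<nu>)"
      by (intro mult_left_mono integral_norm_bound) auto
    also have "(\<lambda>x. cmod (iexp ((s n *\<^sub>R l) \<bullet> x) * of_real (1 - cos (t * ((s n *\<^sub>R e) \<bullet> x))))) = (\<lambda>x. 1 - cos ((s n *\<^sub>R (t *\<^sub>R e)) \<bullet> x))"
      by (auto simp: norm_mult ac_simps simp del: of_real_diff)
    also have "(\<integral>x. 1 - cos ((s n *\<^sub>R (t *\<^sub>R e)) \<bullet> x) \<partial>\<nu>) = 1 - Re (\<phi> (s n *\<^sub>R (t *\<^sub>R e)))" by (rule Re_phi)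
    also have "real n * \<dots> \<le> C" by (rule n0[OF that(1) te[OF that(2)]])
    finally show ?thesis .
  qed
  \<comment> \<open>The dominating bound holds only from \<open>n0\<close> on, so dominated
    convergence is applied to the shifted sequence.\<close>
  have "(\<lambda>n. CLINT t:{0..1}|lborel. S (n + n0) t) \<longlonglongrightarrow> (CLINT t:{0..1}|lborel. \<Delta> l (t *\<^sub>R e))"
    unfolding set_lebesgue_integral_def
  proof (rule integral_dominated_convergence[where w="\<lambda>t. indicator {0..1} t * C"])
    show "AE t in lborel. (\<lambda>n. indicator {0..1} t *\<^sub>R S (n + n0) t) \<longlonglongrightarrow> indicator {0..1} t *\<^sub>R \<Delta> l (t *\<^sub>R e)"
    proof (rule AE_I2)
      fix t :: real
      show "(\<lambda>n. indicator {0..1} t *\<^sub>R S (n + n0) t) \<longlonglongrightarrow> indicator {0..1} t *\<^sub>R \<Delta> l (t *\<^sub>R e)"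
      proof (cases "t \<in> {0..1}")
        case True
        from LIMSEQ_ignore_initial_segment[OF S_lim[OF True], of n0] show ?thesis using True by simp
      qed simp
    qed
    show "AE t in lborel. norm (indicator {0..1} t *\<^sub>R S (n + n0) t) \<le> indicator {0..1} t * C" for n
      using S_bd[of "n + n0"] by (intro AE_I2) (simp add: indicator_def)
    show "(\<lambda>t. indicator {0..1} t *\<^sub>R S (n + n0) t) \<in> borel_measurable lborel" for n
      using S_meas[of "n + n0"] by simp
    show "(\<lambda>t. indicator {0..1} t *\<^sub>R \<Delta> l (t *\<^sub>R e)) \<in> borel_measurable lborel"
      using D_meas by simp
    show "integrable lborel (\<lambda>t. indicator {0..1::real} t * C)" by simp
  qed
  then have "(\<lambda>n. CLINT t:{0..1}|lborel. S n t) \<longlonglongrightarrow> (CLINT t:{0..1}|lborel. \<Delta> l (t *\<^sub>R e))"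
    by (rule LIMSEQ_offset)
  then show ?thesis unfolding avg1 avg2 .
qed

end

lemma isCont_cong_open:
  assumes "open U" "x \<in> U" "isCont g x" "\<And>y. y \<in> U \<Longrightarrow> f y = g y"
  shows "isCont f x"
proof -
  have "eventually (\<lambda>y. f y = g y) (nhds x)"
    using eventually_nhds_in_open[OF assms(1,2)] by eventually_elim (rule assms(4))
  then show ?thesis using assms(3) by (simp add: isCont_cong)
qed

section \<open>Convergence of the rescaled jump law away from the origin\<close>

context stable_attraction
begin

text \<open>The measures \<open>n P(s n H \<in> dx)\<close> are unbounded near the origin; multiplied by the weight
  \<open>\<Sum>\<^sub>k (1 - sinc (u x\<^sub>k))\<close> they become finite measures, whose characteristic functions are averages
  of second differences of \<open>n \<phi>(s n \<cdot>)\<close> and hence do not depend on the centering.\<close>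

definition "scaled n = distr \<nu> borel (\<lambda>x. s n *\<^sub>R x)"
definition "weighted u n = density (scaled n) (\<lambda>x. ennreal (real n * sinc_weight u x))"
definition "weighted_limit u = density M0 (\<lambda>x. ennreal (sinc_weight u x))"

lemma prob_space_scaled: "prob_space (scaled n)"
  unfolding scaled_def by (rule nu.prob_space_distr) measurable

lemma sets_scaled[measurable_cong]: "sets (scaled n) = sets borel"
  by (simp add: scaled_def)

lemma sets_weighted[measurable_cong]: "sets (weighted u n) = sets borel"
  and sets_weighted_limit[measurable_cong]: "sets (weighted_limit u) = sets borel"
  by (simp_all add: weighted_def weighted_limit_def sets_scaled)

lemma integrable_sinc_weight: "integrable M0 (sinc_weight u)"
proof (rule Bochner_Integration.integrable_bound)
  show "integrable M0 (\<lambda>x. (real CARD('d) * (2 + u\<^sup>2)) * min 1 ((norm x)\<^sup>2))"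
    by (intro integrable_mult_right integrable_stable_min sigma alpha)
  show "AE x in M0. norm (sinc_weight u x) \<le> norm ((real CARD('d) * (2 + u\<^sup>2)) * min 1 ((norm x)\<^sup>2))"
  proof (rule AE_I2)
    fix x :: "real ^ 'd"
    show "norm (sinc_weight u x) \<le> norm ((real CARD('d) * (2 + u\<^sup>2)) * min 1 ((norm x)\<^sup>2))"
      using sinc_weight_le[of u x] sinc_weight_nonneg[of u x] by (simp add: abs_of_nonneg)
  qed
qed measurable

lemma sinc_weight_bounded: "\<bar>sinc_weight u (x :: real ^ 'd)\<bar> \<le> real CARD('d) * 2"
proof -
  have "sinc_weight u x \<le> (\<Sum>k\<in>(UNIV :: 'd set). 2)"
    unfolding sinc_weight_def
  proof (rule sum_mono)
    fix k show "1 - sinc (u *\<^sub>R axis k 1 \<bullet> x) \<le> 2"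
      using one_minus_sinc_le[of "u *\<^sub>R axis k 1 \<bullet> x"] by (simp only: min.bounded_iff)
  qed
  then show ?thesis using sinc_weight_nonneg[of u x] by simp
qed

lemma finite_weighted: "finite_measure (weighted u n)"
proof -
  interpret p: prob_space "scaled n" by (rule prob_space_scaled)
  have i: "integrable (scaled n) (\<lambda>x. real n * sinc_weight u x)"
    by (rule p.integrable_const_bound[of _ "real n * (real CARD('d) * 2)"], rule AE_I2)
       (unfold real_norm_def abs_mult abs_of_nat, rule mult_left_mono[OF sinc_weight_bounded], simp, measurable)
  have "emeasure (weighted u n) (space (weighted u n)) = (\<integral>\<^sup>+x. ennreal (real n * sinc_weight u x) \<partial>scaled n)"
    unfolding weighted_def by (simp add: emeasure_density cong: nn_integral_cong)
  also have "\<dots> = ennreal (\<integral>x. real n * sinc_weight u x \<partial>scaled n)"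
    by (rule nn_integral_eq_integral[OF i]) (simp add: sinc_weight_nonneg)
  finally show ?thesis by (intro finite_measureI) simp
qed

lemma finite_weighted_limit: "finite_measure (weighted_limit u)"
proof -
  have "emeasure (weighted_limit u) (space (weighted_limit u)) = (\<integral>\<^sup>+x. ennreal (sinc_weight u x) \<partial>M0)"
    unfolding weighted_limit_def by (simp add: emeasure_density cong: nn_integral_cong)
  also have "\<dots> = ennreal (\<integral>x. sinc_weight u x \<partial>M0)"
    by (rule nn_integral_eq_integral[OF integrable_sinc_weight]) (simp add: sinc_weight_nonneg)
  finally show ?thesis by (intro finite_measureI) simp
qed

lemma char_fun_weighted:
  "char_fun (weighted u n) l = (\<Sum>k\<in>UNIV. of_nat n * (\<integral>x. iexp ((s n *\<^sub>R l) \<bullet> x) * of_real (1 - sinc ((s n *\<^sub>R (u *\<^sub>R axis k 1)) \<bullet> x)) \<partial>\<nu>))"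
proof -
  have i: "integrable \<nu> (\<lambda>x. iexp ((s n *\<^sub>R l) \<bullet> x) * of_real (1 - sinc ((s n *\<^sub>R (u *\<^sub>R axis k 1)) \<bullet> x)))" for k
  proof (rule nu.integrable_const_bound[of _ 2], rule AE_I2)
    fix x :: "real ^ 'd"
    show "cmod (iexp ((s n *\<^sub>R l) \<bullet> x) * of_real (1 - sinc ((s n *\<^sub>R (u *\<^sub>R axis k 1)) \<bullet> x))) \<le> 2"
      unfolding norm_mult norm_exp_i_times norm_of_real mult_1_left by (rule abs_one_minus_sinc_le)
  qed measurable
  have "char_fun (weighted u n) l = (\<integral>x. (real n * sinc_weight u x) *\<^sub>R iexp (l \<bullet> x) \<partial>scaled n)"
    unfolding char_fun_def weighted_def by (rule integral_density) (auto simp: sinc_weight_nonneg)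
  also have "\<dots> = (\<integral>x. (real n * sinc_weight u (s n *\<^sub>R x)) *\<^sub>R iexp (l \<bullet> (s n *\<^sub>R x)) \<partial>\<nu>)"
    unfolding scaled_def by (rule integral_distr) measurable
  also have "(\<lambda>x. (real n * sinc_weight u (s n *\<^sub>R x)) *\<^sub>R iexp (l \<bullet> (s n *\<^sub>R x))) =
     (\<lambda>x. of_nat n * (\<Sum>k\<in>UNIV. iexp ((s n *\<^sub>R l) \<bullet> x) * of_real (1 - sinc ((s n *\<^sub>R (u *\<^sub>R axis k 1)) \<bullet> x))))"
  proof
    fix x :: "real ^ 'd"
    have "(s n *\<^sub>R (u *\<^sub>R axis k 1)) \<bullet> x = (u *\<^sub>R axis k 1) \<bullet> (s n *\<^sub>R x)" for k by (simp add: inner_axis')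
    moreover have "(s n *\<^sub>R l) \<bullet> x = l \<bullet> (s n *\<^sub>R x)" by simp
    ultimately have "(\<Sum>k\<in>UNIV. iexp ((s n *\<^sub>R l) \<bullet> x) * of_real (1 - sinc ((s n *\<^sub>R (u *\<^sub>R axis k 1)) \<bullet> x)))
        = iexp (l \<bullet> (s n *\<^sub>R x)) * of_real (sinc_weight u (s n *\<^sub>R x))"
      unfolding sinc_weight_def of_real_sum sum_distrib_left by (simp only:)
    then show "(real n * sinc_weight u (s n *\<^sub>R x)) *\<^sub>R iexp (l \<bullet> (s n *\<^sub>R x)) =
        of_nat n * (\<Sum>k\<in>UNIV. iexp ((s n *\<^sub>R l) \<bullet> x) * of_real (1 - sinc ((s n *\<^sub>R (u *\<^sub>R axis k 1)) \<bullet> x)))"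
      by (simp only: scaleR_conv_of_real of_real_mult of_real_of_nat_eq mult.assoc) (simp only: mult.commute)
  qed
  also have "(\<integral>x. of_nat n * (\<Sum>k\<in>UNIV. iexp ((s n *\<^sub>R l) \<bullet> x) * of_real (1 - sinc ((s n *\<^sub>R (u *\<^sub>R axis k 1)) \<bullet> x))) \<partial>\<nu>)
    = of_nat n * (\<Sum>k\<in>UNIV. \<integral>x. iexp ((s n *\<^sub>R l) \<bullet> x) * of_real (1 - sinc ((s n *\<^sub>R (u *\<^sub>R axis k 1)) \<bullet> x)) \<partial>\<nu>)"
    unfolding integral_mult_right_zero using i by (subst Bochner_Integration.integral_sum) simp_all
  finally show ?thesis by (simp only: sum_distrib_left)
qed

lemma char_fun_weighted_limit:
  "char_fun (weighted_limit u) l = (\<Sum>k\<in>UNIV. CLINT x|M0. iexp (l \<bullet> x) * of_real (1 - sinc ((u *\<^sub>R axis k 1) \<bullet> x)))"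
proof -
  have i: "integrable M0 (\<lambda>x. iexp (l \<bullet> x) * of_real (1 - sinc ((u *\<^sub>R axis k 1) \<bullet> x)))" for k
  proof (rule Bochner_Integration.integrable_bound)
    show "integrable M0 (\<lambda>x. (2 + (norm (u *\<^sub>R axis k (1::real) :: real ^ 'd))\<^sup>2) * min 1 ((norm x)\<^sup>2))"
      by (intro integrable_mult_right integrable_stable_min sigma alpha)
    show "AE x in M0. cmod (iexp (l \<bullet> x) * of_real (1 - sinc ((u *\<^sub>R axis k 1) \<bullet> x))) \<le> norm ((2 + (norm (u *\<^sub>R axis k (1::real) :: real ^ 'd))\<^sup>2) * min 1 ((norm x)\<^sup>2))"
    proof (rule AE_I2)
      fix x :: "real ^ 'd"
      have "cmod (iexp (l \<bullet> x) * of_real (1 - sinc ((u *\<^sub>R axis k 1) \<bullet> x))) = 1 - sinc ((u *\<^sub>R axis k 1) \<bullet> x)"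
        unfolding norm_mult norm_exp_i_times norm_of_real mult_1_left by (rule abs_of_nonneg[OF one_minus_sinc_nonneg])
      also have "\<dots> \<le> (2 + (norm (u *\<^sub>R axis k (1::real) :: real ^ 'd))\<^sup>2) * min 1 ((norm x)\<^sup>2)" by (rule one_minus_sinc_inner_le)
      also have "\<dots> \<le> norm ((2 + (norm (u *\<^sub>R axis k (1::real) :: real ^ 'd))\<^sup>2) * min 1 ((norm x)\<^sup>2))" unfolding real_norm_def by (rule abs_ge_self)
      finally show "cmod (iexp (l \<bullet> x) * of_real (1 - sinc ((u *\<^sub>R axis k 1) \<bullet> x))) \<le> norm ((2 + (norm (u *\<^sub>R axis k (1::real) :: real ^ 'd))\<^sup>2) * min 1 ((norm x)\<^sup>2))" .
    qed
  qed measurable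
  have "char_fun (weighted_limit u) l = (\<integral>x. sinc_weight u x *\<^sub>R iexp (l \<bullet> x) \<partial>M0)"
    unfolding char_fun_def weighted_limit_def by (rule integral_density) (auto simp: sinc_weight_nonneg)
  also have "(\<lambda>x. sinc_weight u x *\<^sub>R iexp (l \<bullet> x)) = (\<lambda>x. \<Sum>k\<in>UNIV. iexp (l \<bullet> x) * of_real (1 - sinc ((u *\<^sub>R axis k 1) \<bullet> x)))"
    unfolding sinc_weight_def scaleR_conv_of_real of_real_sum sum_distrib_right by (simp only: mult.commute)
  also have "(\<integral>x. (\<Sum>k\<in>UNIV. iexp (l \<bullet> x) * of_real (1 - sinc ((u *\<^sub>R axis k 1) \<bullet> x))) \<partial>M0)
     = (\<Sum>k\<in>UNIV. CLINT x|M0. iexp (l \<bullet> x) * of_real (1 - sinc ((u *\<^sub>R axis k 1) \<bullet> x)))"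
    by (rule Bochner_Integration.integral_sum) (rule i)
  finally show ?thesis .
qed

lemma weighted_weakly_converges: "\<exists>u>0. weakly_converges (weighted u) (weighted_limit u)"
proof -
  obtain u C where u: "u > 0"
    "eventually (\<lambda>n. \<forall>l. norm l \<le> u \<longrightarrow> real n * (1 - Re (\<phi> (s n *\<^sub>R l))) \<le> C) sequentially"
    "\<And>l. norm l \<le> u \<Longrightarrow> \<Gamma> l \<le> 1 / 16"
    using exists_good_radius by blast
  have "norm (u *\<^sub>R axis k (1::real) :: real ^ 'd) \<le> u" for k using u(1) by (simp add: norm_axis_1)
  note lim = sinc_lim[OF u(2,3) this]
  have "(\<lambda>n. char_fun (weighted u n) l) \<longlonglongrightarrow> char_fun (weighted_limit u) l" for l
    unfolding char_fun_weighted char_fun_weighted_limit by (intro tendsto_sum lim)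
  then have "weakly_converges (weighted u) (weighted_limit u)"
    by (intro levy_continuity_finite finite_weighted finite_weighted_limit sets_weighted sets_weighted_limit)
  then show ?thesis using u(1) by blast
qed

text \<open>Dividing \<open>G\<close> by the weight gives a bounded function, which is integrated
  against the weakly convergent measures \<open>weighted u n\<close>; the weight then cancels. The
  converging factor \<open>\<kappa>\<close> is kept inside the integrand, so that another norming
  sequence can be substituted later.\<close>

theorem tendsto_integral_scaled:
  fixes G :: "real ^ 'd \<Rightarrow> real"
  assumes \<kappa>: "\<kappa> \<longlonglongrightarrow> k" "k > 0"
    and G[measurable]: "G \<in> borel_measurable borel" and bound: "\<And>x. \<bar>G x\<bar> \<le> C * min 1 ((norm x)\<^sup>2)"
    and cont: "\<And>x. x \<noteq> 0 \<Longrightarrow> norm x \<noteq> r \<Longrightarrow> isCont G x"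
  shows "(\<lambda>n. real n * (\<integral>x. G ((\<kappa> n * s n) *\<^sub>R x) \<partial>\<nu>)) \<longlonglongrightarrow> (k powr \<alpha>) * (\<integral>x. G x \<partial>M0)"
proof -
  obtain u where u: "u > 0" "weakly_converges (weighted u) (weighted_limit u)"
    using weighted_weakly_converges by blast
  define w where "w = (sinc_weight u :: real ^ 'd \<Rightarrow> real)"
  have [measurable]: "w \<in> borel_measurable borel" unfolding w_def by measurable
  obtain B where B: "\<And>n. \<bar>\<kappa> n\<bar> \<le> B" using convergent_imp_Bseq[of \<kappa>] \<kappa>(1) by (auto simp: convergent_def Bseq_def)
  have kB: "\<bar>k\<bar> \<le> B"
    by (rule tendsto_upperbound[OF tendsto_rabs[OF \<kappa>(1)]]) (use B in auto)
  have C: "C \<ge> 0" using order_trans[OF abs_ge_zero bound[of "axis undefined 1"]] by (simp add: norm_axis_1)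
  \<comment> \<open>The constant of \<open>sinc_weight_ge\<close>, by which the weight dominates
    \<open>min 1 ((norm x)\<^sup>2)\<close>.\<close>
  define c0 where "c0 = min 1 (u\<^sup>2) / 9"
  have c0: "c0 > 0" using u by (simp add: c0_def)
  define B' where "B' = C * (1 + B\<^sup>2) / c0"
  have quot: "\<bar>G (t *\<^sub>R x) / w x\<bar> \<le> B'" if t: "\<bar>t\<bar> \<le> B" for t x
  proof (cases "x = 0")
    case True
    then have "G (t *\<^sub>R x) = 0" using bound[of 0] by simp
    then show ?thesis using C c0 by (simp add: B'_def)
  next
    case False
    define m where "m = min 1 ((norm x)\<^sup>2)"
    have m: "m > 0" using False by (simp add: m_def)
    have wx: "c0 * m \<le> w x" unfolding c0_def w_def m_def by (rule sinc_weight_ge)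
    then have wpos: "w x > 0" using c0 m by (meson less_le_trans mult_pos_pos)
    have "\<bar>t\<bar>\<^sup>2 \<le> B\<^sup>2" using t by (intro power_mono) auto
    then have tx: "(norm (t *\<^sub>R x))\<^sup>2 \<le> (1 + B\<^sup>2) * (norm x)\<^sup>2"
      by (simp add: power_mult_distrib mult_right_mono)
    have "min 1 ((norm (t *\<^sub>R x))\<^sup>2) \<le> (1 + B\<^sup>2) * m"
    proof (cases "(norm x)\<^sup>2 \<le> 1")
      case True then show ?thesis using tx unfolding m_def by (simp add: min.coboundedI2 min_absorb2)
    next
      case False then show ?thesis unfolding m_def by (simp add: min.coboundedI1 min_absorb1)
    qed
    then have "\<bar>G (t *\<^sub>R x)\<bar> \<le> C * ((1 + B\<^sup>2) * m)" using bound[of "t *\<^sub>R x"] C by (meson mult_left_mono order_trans)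
    also have "\<dots> = B' * (c0 * m)" using c0 by (simp add: B'_def)
    also have "\<dots> \<le> B' * w x" using wx C c0 by (intro mult_left_mono) (auto simp: B'_def)
    finally show ?thesis using wpos by (simp add: abs_divide field_simps)
  qed
  \<comment> \<open>Points where G (k x) / w x may be discontinuous: the zero of the weight, and the
    preimage under scaling by \<open>k\<close> of the exceptional sphere of
    \<open>G\<close>.\<close>
  let ?N = "{0} \<union> sphere 0 (r / k) :: (real ^ 'd) set"
  have Nx: "x \<noteq> 0" "norm x \<noteq> r / k" if "x \<notin> ?N" for x using that by auto
  have lim: "(\<lambda>n. \<integral>x. G (\<kappa> n *\<^sub>R x) / w x \<partial>weighted u n) \<longlonglongrightarrow> (\<integral>x. G (k *\<^sub>R x) / w x \<partial>weighted_limit u)"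
  proof (rule weakly_converges_integral_varying[OF u(2) finite_weighted sets_weighted finite_weighted_limit sets_weighted_limit])
    show "closed ?N" by auto
    show "?N \<noteq> {}" by simp
    have s0: "{x. norm x = R} \<in> null_sets M0" for R
      by (rule polar_measure_sphere_null[OF sigma]) simp
    have "?N = {x. norm x = 0} \<union> {x. norm x = r / k}" by (auto simp: dist_norm)
    then have "?N \<in> null_sets M0" using s0 by (metis null_sets.Un)
    then show "?N \<in> null_sets (weighted_limit u)"
    proof -
      assume n: "?N \<in> null_sets M0"
      have f: "(\<lambda>x. ennreal (sinc_weight u x)) \<in> borel_measurable M0" by measurable
      have "AE x in M0. x \<in> ?N \<longrightarrow> ennreal (sinc_weight u x) = 0"
        using AE_not_in[OF n] by eventually_elim blast
      then show ?thesis unfolding weighted_limit_def null_sets_density_iff[OF f] using null_setsD2[OF n] by blast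
    qed
    show "(\<lambda>x. G (\<kappa> n *\<^sub>R x) / w x) \<in> borel_measurable borel" for n by measurable
    show "(\<lambda>x. G (k *\<^sub>R x) / w x) \<in> borel_measurable borel" by measurable
    show "\<bar>G (\<kappa> n *\<^sub>R x) / w x\<bar> \<le> B'" for n x by (rule quot[OF B])
    show "\<bar>G (k *\<^sub>R x) / w x\<bar> \<le> B'" for x by (rule quot[OF kB])
    fix x :: "real ^ 'd" assume x: "x \<notin> ?N"
    have kx: "k *\<^sub>R x \<noteq> 0" "norm (k *\<^sub>R x) \<noteq> r" using Nx[OF x] \<kappa>(2) by (auto simp: field_simps)
    have 1: "filterlim (\<lambda>p. \<kappa> (fst p)) (nhds k) (sequentially \<times>\<^sub>F nhds x)"
      by (rule filterlim_compose[OF \<kappa>(1) filterlim_fst])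
    have 2: "filterlim snd (nhds x) (sequentially \<times>\<^sub>F nhds x)" by (rule filterlim_snd)
    have 3: "((\<lambda>p. G (\<kappa> (fst p) *\<^sub>R snd p)) \<longlongrightarrow> G (k *\<^sub>R x)) (sequentially \<times>\<^sub>F nhds x)"
      by (rule isCont_tendsto_compose[OF cont[OF kx]]) (rule tendsto_scaleR[OF 1 2])
    have wcont: "isCont w x"
      unfolding w_def sinc_weight_def
      by (intro continuous_sum continuous_diff continuous_const isCont_o2[OF _ isCont_sinc] continuous_inner continuous_ident)
    have 4: "((\<lambda>p. w (snd p)) \<longlongrightarrow> w x) (sequentially \<times>\<^sub>F nhds x)"
      by (rule isCont_tendsto_compose[OF wcont 2])
    have "c0 * min 1 ((norm x)\<^sup>2) > 0" using c0 Nx(1)[OF x] by simp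
    then have "w x \<noteq> 0" using sinc_weight_ge[of u x] unfolding w_def c0_def by linarith
    from tendsto_divide[OF 3 4 this]
    show "((\<lambda>(n, y). G (\<kappa> n *\<^sub>R y) / w y) \<longlongrightarrow> G (k *\<^sub>R x) / w x) (sequentially \<times>\<^sub>F nhds x)"
      by (simp add: case_prod_beta')
  qed
  \<comment> \<open>At the origin, where the weight vanishes, both sides are 0 because
    \<open>bound\<close> forces G 0 = 0.\<close>
  have canc: "w x * (G (t *\<^sub>R x) / w x) = G (t *\<^sub>R x)" for t x
  proof (cases "x = 0")
    case True
    then show ?thesis using bound[of 0] by simp
  next
    case False
    then have "c0 * min 1 ((norm x)\<^sup>2) > 0" using c0 by simp
    then have "w x \<noteq> 0" using sinc_weight_ge[of u x] unfolding w_def c0_def by linarith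
    then show ?thesis by simp
  qed
  have w0: "0 \<le> w x" for x unfolding w_def by (rule sinc_weight_nonneg)
  have lhs: "(\<integral>x. G (\<kappa> n *\<^sub>R x) / w x \<partial>weighted u n) = real n * (\<integral>x. G ((\<kappa> n * s n) *\<^sub>R x) \<partial>\<nu>)" for n
  proof -
    have "(\<integral>x. G (\<kappa> n *\<^sub>R x) / w x \<partial>weighted u n) = (\<integral>x. (real n * w x) *\<^sub>R (G (\<kappa> n *\<^sub>R x) / w x) \<partial>scaled n)"
      unfolding weighted_def w_def[symmetric] by (rule integral_density) (auto simp: w0)
    also have "\<dots> = (\<integral>x. real n * G (\<kappa> n *\<^sub>R x) \<partial>scaled n)"
      unfolding real_scaleR_def mult.assoc canc ..
    also have "\<dots> = (\<integral>x. real n * G (\<kappa> n *\<^sub>R (s n *\<^sub>R x)) \<partial>\<nu>)"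
      unfolding scaled_def by (rule integral_distr) measurable
    finally show ?thesis by simp
  qed
  have rhs: "(\<integral>x. G (k *\<^sub>R x) / w x \<partial>weighted_limit u) = (k powr \<alpha>) * (\<integral>x. G x \<partial>M0)"
  proof -
    have "(\<integral>x. G (k *\<^sub>R x) / w x \<partial>weighted_limit u) = (\<integral>x. w x *\<^sub>R (G (k *\<^sub>R x) / w x) \<partial>M0)"
      unfolding weighted_limit_def w_def[symmetric] by (rule integral_density) (auto simp: w0)
    also have "\<dots> = (\<integral>x. G (k *\<^sub>R x) \<partial>M0)" unfolding real_scaleR_def canc ..
    also have "\<dots> = (k powr \<alpha>) *\<^sub>R (\<integral>x. G x \<partial>M0)" by (rule integral_scale_stable[OF sigma \<kappa>(2) G])
    finally show ?thesis by simp
  qed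
  show ?thesis using lim unfolding lhs rhs .
qed

section \<open>Tails and quantiles of the norm\<close>

lemma tail_lim:
  assumes r: "r > 0"
  shows "(\<lambda>n. real n * measure \<nu> {x. norm (s n *\<^sub>R x) > r}) \<longlonglongrightarrow> measure \<sigma> (sphere 0 1) * (r powr (- \<alpha>) / \<alpha>)"
proof -
  let ?G = "indicat_real {x :: real ^ 'd. norm x > r}"
  have "(\<lambda>n. real n * (\<integral>x. ?G ((1 * s n) *\<^sub>R x) \<partial>\<nu>)) \<longlonglongrightarrow> (1 powr \<alpha>) * (\<integral>x. ?G x \<partial>M0)"
  proof (rule tendsto_integral_scaled[where r=r and C="max 1 (1 / r\<^sup>2)"])
    show "?G \<in> borel_measurable borel" by measurable
    show "\<bar>?G x\<bar> \<le> max 1 (1 / r\<^sup>2) * min 1 ((norm x)\<^sup>2)" for x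
    proof (cases "norm x > r")
      case True
      then have "r\<^sup>2 \<le> (norm x)\<^sup>2" using r by (intro power_mono) auto
      then have "1 \<le> (1 / r\<^sup>2) * (norm x)\<^sup>2" using r by (simp add: field_simps)
      also have "\<dots> \<le> max 1 (1 / r\<^sup>2) * (norm x)\<^sup>2" by (intro mult_right_mono) auto
      finally have ge: "1 \<le> max 1 (1 / r\<^sup>2) * (norm x)\<^sup>2" .
      have "1 \<le> max 1 (1 / r\<^sup>2) * min 1 ((norm x)\<^sup>2)"
      proof (cases "1 \<le> (norm x)\<^sup>2")
        case True
        then have m: "min 1 ((norm x)\<^sup>2) = 1" by (rule min_absorb1)
        show ?thesis unfolding m by simp
      next
        case False
        then have m: "min 1 ((norm x)\<^sup>2) = (norm x)\<^sup>2" by (intro min_absorb2) simp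
        show ?thesis unfolding m by (rule ge)
      qed
      then show ?thesis using True by simp
    qed (simp add: le_max_iff_disj zero_le_mult_iff)
    fix x :: "real ^ 'd" assume "norm x \<noteq> r"
    show "isCont ?G x"
    proof (cases "norm x > r")
      case True
      show ?thesis
        by (rule isCont_cong_open[where U="{y. norm y > r}" and g="\<lambda>_. 1"])
           (use True in \<open>auto intro!: open_Collect_less continuous_intros\<close>)
    next
      case False
      then have "norm x < r" using \<open>norm x \<noteq> r\<close> by simp
      show ?thesis
        by (rule isCont_cong_open[where U="{y. norm y < r}" and g="\<lambda>_. 0"])
           (use \<open>norm x < r\<close> in \<open>auto intro!: open_Collect_less continuous_intros\<close>)
    qed
  qed auto
  moreover have "(\<integral>x. ?G ((1 * s n) *\<^sub>R x) \<partial>\<nu>) = measure \<nu> {x. norm (s n *\<^sub>R x) > r}" for n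
  proof -
    have "(\<integral>x. ?G ((1 * s n) *\<^sub>R x) \<partial>\<nu>) = (\<integral>x. indicat_real {x. norm (s n *\<^sub>R x) > r} x \<partial>\<nu>)"
      by (intro Bochner_Integration.integral_cong) (auto simp: indicator_def)
    then show ?thesis using sets_eq_imp_space_eq[OF nu(2)] by simp
  qed
  moreover have "(\<integral>x. ?G x \<partial>M0) = measure \<sigma> (sphere 0 1) * (r powr (- \<alpha>) / \<alpha>)"
    using emeasure_stable_tail[OF sigma alpha(1) r] alpha by (simp add: measure_def)
  ultimately show ?thesis by simp
qed

definition "quantile n = Inf {x. measure \<nu> {y. norm y > x} \<le> inverse (real n)}"
definition "mass = measure \<sigma> (sphere 0 1)"
text \<open>The radius beyond which \<open>M0\<close> has mass exactly 1, that is the solution r of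
  mass r^(-alpha) / alpha = 1.\<close>

definition "b_lim = (mass / \<alpha>) powr (1 / \<alpha>)"

lemma mass_pos: "mass > 0"
  unfolding mass_def by (rule sphere_measure_pos[OF sigma])

lemma b_lim_pos: "b_lim > 0"
  unfolding b_lim_def using mass_pos alpha by simp

lemma b_lim_powr: "b_lim powr (- \<alpha>) = \<alpha> / mass"
  unfolding b_lim_def using mass_pos alpha by (simp add: powr_powr powr_minus)

lemma tail_eq:
  assumes "n \<ge> 1" shows "measure \<nu> {x. norm (s n *\<^sub>R x) > r} = measure \<nu> {x. norm x > r / s n}"
  using s_pos[OF assms] by (simp add: field_simps)

text \<open>For r above \<open>b_lim\<close> the limiting tail is below 1, so r / s_n itself belongs
  to the set whose infimum is the quantile.\<close>

lemma quantile_upper: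
  assumes r: "r > b_lim" shows "eventually (\<lambda>n. s n * quantile n \<le> r) sequentially"
proof -
  have rpos: "r > 0" using r b_lim_pos by linarith
  have "r powr (- \<alpha>) < b_lim powr (- \<alpha>)"
    using r b_lim_pos alpha by (intro powr_less_mono2_neg) auto
  then have "mass * (r powr (- \<alpha>) / \<alpha>) < 1" unfolding b_lim_powr using mass_pos alpha by (simp add: field_simps)
  then have "eventually (\<lambda>n. real n * measure \<nu> {x. norm (s n *\<^sub>R x) > r} < 1) sequentially"
    by (intro order_tendstoD(2)[OF tail_lim[OF rpos]]) (simp add: mass_def)
  then show ?thesis
    \<comment> \<open>For \<open>n \<ge> 2\<close> a negative x is excluded, its tail probability 1
      being above 1/n; so 0 bounds the set from below.\<close>
    using eventually_ge_at_top[of 2]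
  proof eventually_elim
    case (elim n)
    have n: "n \<ge> 1" "real n > 1" using elim by auto
    have sn: "s n > 0" using s_pos n by blast
    have "measure \<nu> {x. norm x > r / s n} \<le> inverse (real n)"
      using elim n unfolding tail_eq[OF n(1)] by (simp add: field_simps)
    moreover have "bdd_below {x. measure \<nu> {y. norm y > x} \<le> inverse (real n)}"
    proof (rule bdd_belowI[of _ 0])
      fix x assume x: "x \<in> {x. measure \<nu> {y. norm y > x} \<le> inverse (real n)}"
      show "0 \<le> x"
      proof (rule ccontr)
        assume "\<not> 0 \<le> x"
        then have "{y :: real ^ 'd. norm y > x} = space \<nu>"
          using sets_eq_imp_space_eq[OF nu(2)] by (auto intro: less_le_trans[of _ 0])
        then have "1 \<le> inverse (real n)" using x nu.prob_space by simp
        then show False using n by (simp add: field_simps)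
      qed
    qed
    ultimately have "quantile n \<le> r / s n" unfolding quantile_def by (intro cInf_lower) auto
    then show ?case using sn by (simp add: field_simps)
  qed
qed

lemma quantile_lower:
  assumes r: "0 < r" "r < b_lim" shows "eventually (\<lambda>n. r \<le> s n * quantile n) sequentially"
proof -
  have "b_lim powr (- \<alpha>) < r powr (- \<alpha>)"
    using r alpha by (intro powr_less_mono2_neg) auto
  then have "1 < mass * (r powr (- \<alpha>) / \<alpha>)" unfolding b_lim_powr using mass_pos alpha by (simp add: field_simps)
  then have "eventually (\<lambda>n. 1 < real n * measure \<nu> {x. norm (s n *\<^sub>R x) > r}) sequentially"
    by (intro order_tendstoD(1)[OF tail_lim[OF r(1)]]) (simp add: mass_def)
  then show ?thesis
    using eventually_ge_at_top[of 1]
  proof eventually_elim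
    case (elim n)
    have sn: "s n > 0" using s_pos elim by blast
    have big: "inverse (real n) < measure \<nu> {x. norm x > r / s n}"
      using elim unfolding tail_eq[OF elim(2)] by (simp add: field_simps)
    have "inverse (real n) > 0" using elim by simp
    \<comment> \<open>Exhibits an element of the set, because the infimum of an empty set would be
      unspecified.\<close>
    from exists_cball_measure_gt[OF nu this]
    obtain R where R: "measure \<nu> (cball 0 R) > 1 - inverse (real n)" by blast
    have "measure \<nu> (space \<nu> - cball 0 R) = 1 - measure \<nu> (cball 0 R)"
      by (rule nu.prob_compl) (simp add: nu(2))
    moreover have "space \<nu> - cball 0 R = {y. norm y > R}"
      using sets_eq_imp_space_eq[OF nu(2)] by (auto simp: not_le)
    ultimately have "R \<in> {x. measure \<nu> {y. norm y > x} \<le> inverse (real n)}" using R by simp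
    then have "r / s n \<le> quantile n"
      unfolding quantile_def
    proof (intro cInf_greatest)
      fix x assume x: "x \<in> {x. measure \<nu> {y. norm y > x} \<le> inverse (real n)}"
      show "r / s n \<le> x"
      proof (rule ccontr)
        assume "\<not> r / s n \<le> x"
        then have "measure \<nu> {y. norm y > r / s n} \<le> measure \<nu> {y. norm y > x}"
          by (intro nu.finite_measure_mono) (auto simp: nu(2))
        then show False using big x by simp
      qed
    qed blast
    then show ?case using sn by (simp add: field_simps)
  qed
qed

lemma quantile_lim: "(\<lambda>n. s n * quantile n) \<longlonglongrightarrow> b_lim"
proof (rule order_tendstoI)
  fix x assume x: "x < b_lim"
  have "eventually (\<lambda>n. (max x 0 + b_lim) / 2 \<le> s n * quantile n) sequentially"
    using x b_lim_pos by (intro quantile_lower) (auto simp: max_def)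
  then show "eventually (\<lambda>n. x < s n * quantile n) sequentially"
    by eventually_elim (use x b_lim_pos in \<open>auto simp: max_def split: if_splits\<close>)
next
  fix x assume x: "b_lim < x"
  have "eventually (\<lambda>n. s n * quantile n \<le> (x + b_lim) / 2) sequentially"
    using x by (intro quantile_upper) auto
  then show "eventually (\<lambda>n. s n * quantile n < x) sequentially"
    by eventually_elim (use x in auto)
qed

theorem tendsto_integral_quantile:
  fixes G :: "real ^ 'd \<Rightarrow> complex" and v :: "nat \<Rightarrow> real"
  assumes v: "(\<lambda>n. inverse (v n) * quantile n) \<longlonglongrightarrow> mass powr (1 / \<alpha>)"
    and G[measurable]: "G \<in> borel_measurable borel" and bound: "\<And>x. cmod (G x) \<le> C * min 1 ((norm x)\<^sup>2)"
    and cont: "\<And>x. x \<noteq> 0 \<Longrightarrow> norm x \<noteq> r \<Longrightarrow> isCont G x"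
  shows "(\<lambda>n. of_nat n * (\<integral>x. G (inverse (v n) *\<^sub>R x) \<partial>\<nu>)) \<longlonglongrightarrow> of_real \<alpha> * (\<integral>x. G x \<partial>M0)"
proof -
  define \<kappa> where "\<kappa> n = inverse (v n) / s n" for n
  have "(\<lambda>n. (inverse (v n) * quantile n) / (s n * quantile n)) \<longlonglongrightarrow> mass powr (1 / \<alpha>) / b_lim"
    using b_lim_pos by (intro tendsto_divide v quantile_lim) auto
  moreover have "eventually (\<lambda>n. (inverse (v n) * quantile n) / (s n * quantile n) = \<kappa> n) sequentially"
    using order_tendstoD(1)[OF quantile_lim b_lim_pos] by eventually_elim (auto simp: \<kappa>_def)
  ultimately have \<kappa>: "\<kappa> \<longlonglongrightarrow> mass powr (1 / \<alpha>) / b_lim" by (rule Lim_transform_eventually)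
  \<comment> \<open>The mass of sigma cancels, and the alpha-th power of this ratio is the factor
    alpha of the conclusion.\<close>
  have k: "mass powr (1 / \<alpha>) / b_lim = \<alpha> powr (1 / \<alpha>)"
    unfolding b_lim_def using mass_pos alpha by (simp add: powr_divide)
  have k_pos: "mass powr (1 / \<alpha>) / b_lim > 0" using mass_pos b_lim_pos by simp
  have k_powr: "(mass powr (1 / \<alpha>) / b_lim) powr \<alpha> = \<alpha>" unfolding k using alpha by (simp add: powr_powr)
  have C: "C \<ge> 0" using order_trans[OF norm_ge_zero bound[of "axis undefined 1"]] by (simp add: norm_axis_1)
  have real_case: "(\<lambda>n. real n * (\<integral>x. g (inverse (v n) *\<^sub>R x) \<partial>\<nu>)) \<longlonglongrightarrow> \<alpha> * (\<integral>x. g x \<partial>M0)"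
    if g: "g \<in> borel_measurable borel" "\<And>x. \<bar>g x\<bar> \<le> cmod (G x)" "\<And>x. isCont G x \<Longrightarrow> isCont g x" for g :: "real ^ 'd \<Rightarrow> real"
  proof -
    have "(\<lambda>n. real n * (\<integral>x. g ((\<kappa> n * s n) *\<^sub>R x) \<partial>\<nu>)) \<longlonglongrightarrow> \<alpha> * (\<integral>x. g x \<partial>M0)"
      using tendsto_integral_scaled[OF \<kappa> k_pos g(1) order_trans[OF g(2) bound] g(3)[OF cont], of r] unfolding k_powr by blast
    moreover have "eventually (\<lambda>n. real n * (\<integral>x. g ((\<kappa> n * s n) *\<^sub>R x) \<partial>\<nu>) = real n * (\<integral>x. g (inverse (v n) *\<^sub>R x) \<partial>\<nu>)) sequentially"
      using eventually_ge_at_top[of 1]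
    proof eventually_elim
      case (elim n)
      have "\<kappa> n * s n = inverse (v n)" using s_pos[OF elim] by (simp add: \<kappa>_def)
      then show ?case by simp
    qed
    ultimately show ?thesis by (rule Lim_transform_eventually)
  qed
  have G1: "cmod (G x) \<le> C" for x
    using order_trans[OF bound[of x] mult_left_mono[of "min 1 ((norm x)\<^sup>2)" 1 C]] C by simp
  have i1: "integrable \<nu> (\<lambda>x. G (inverse (v n) *\<^sub>R x))" for n
    by (rule nu.integrable_const_bound[of _ C]) (use G1 in auto)
  have i2: "integrable M0 G"
  proof (rule Bochner_Integration.integrable_bound)
    show "integrable M0 (\<lambda>x. C * min 1 ((norm x)\<^sup>2))"
      by (intro integrable_mult_right integrable_stable_min sigma alpha)
    show "AE x in M0. cmod (G x) \<le> norm (C * min 1 ((norm x)\<^sup>2))"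
      using order_trans[OF bound abs_ge_self] unfolding real_norm_def by (intro AE_I2)
  qed measurable
  have "(\<lambda>n. real n * (\<integral>x. Re (G (inverse (v n) *\<^sub>R x)) \<partial>\<nu>)) \<longlonglongrightarrow> \<alpha> * (\<integral>x. Re (G x) \<partial>M0)"
    by (rule real_case) (auto intro: abs_Re_le_cmod continuous_Re)
  moreover have "(\<lambda>n. real n * (\<integral>x. Im (G (inverse (v n) *\<^sub>R x)) \<partial>\<nu>)) \<longlonglongrightarrow> \<alpha> * (\<integral>x. Im (G x) \<partial>M0)"
    by (rule real_case) (auto intro: abs_Im_le_cmod continuous_Im)
  ultimately show ?thesis
    unfolding tendsto_complex_iff using integral_Re[OF i1] integral_Im[OF i1] integral_Re[OF i2] integral_Im[OF i2] by simp
qed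

end

section \<open>The tempering kernel\<close>

text \<open>Here \<open>q\<close> is the tempering function in one fixed direction \<open>s\<close>, \<open>tail\<close> is the paper's \<open>\<pi>(\<cdot>, s)\<close> and
  \<open>p\<close> is its negative derivative, the density of \<open>\<Pi>(\<cdot>, s)\<close>.\<close>

locale tempering_profile =
  fixes \<alpha> :: real and q :: "real \<Rightarrow> real"
  assumes alpha_pos: "0 < \<alpha>"
    and q_anti: "antimono_on {0<..} q"
    and q_0: "(q \<longlongrightarrow> \<alpha>) (at_right 0)"
    and q_top: "(q \<longlongrightarrow> 0) at_top"
    and q_meas[measurable]: "(\<lambda>r. if r > 0 then q r else 0) \<in> borel_measurable borel"
begin

definition "q0 r = (if r > 0 then q r else 0)"
definition "g r = r powr (- \<alpha> - 1) * q0 r"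
definition "tail u = u powr \<alpha> * (LINT r|lborel. indicator {u<..} r * g r)"
text \<open>Formal differentiation of \<open>tail\<close> gives alpha tail / u from the power and -
  q0 / u from the lower limit of the integral.\<close>

definition "p u = (if u > 0 then (q0 u - \<alpha> * tail u) / u else 0)"

lemma q0_meas[measurable]: "q0 \<in> borel_measurable borel"
  unfolding q0_def[abs_def] by measurable

lemma g_meas[measurable]: "g \<in> borel_measurable borel"
  unfolding g_def[abs_def] by measurable

lemma q0_nonneg: "0 \<le> q0 r"
proof (cases "r > 0")
  case True
  have "eventually (\<lambda>x. q x \<le> q r) at_top"
    using eventually_ge_at_top[of r] by eventually_elim (use q_anti True in \<open>auto simp: monotone_on_def\<close>)
  then have "0 \<le> q r" using q_top by (intro tendsto_upperbound[OF q_top]) auto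
  then show ?thesis by (simp add: q0_def)
qed (simp add: q0_def)

lemma q0_le: "q0 r \<le> \<alpha>"
proof (cases "r > 0")
  case True
  have "eventually (\<lambda>x. q r \<le> q x) (at_right 0)"
    using eventually_at_right_less[of 0] eventually_at_right_real[OF True]
    by eventually_elim (use q_anti True in \<open>auto simp: monotone_on_def\<close>)
  then have "q r \<le> \<alpha>" by (intro tendsto_lowerbound[OF q_0]) auto
  then show ?thesis using True by (simp add: q0_def)
qed (use alpha_pos in \<open>simp add: q0_def\<close>)

lemma q0_anti: "0 < x \<Longrightarrow> x \<le> y \<Longrightarrow> q0 y \<le> q0 x"
  using q_anti by (auto simp: q0_def monotone_on_def)

lemma g_nonneg: "0 \<le> g r"
  unfolding g_def using q0_nonneg by simp

lemma nn_g_le: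
  assumes "u > 0"
  shows "(\<integral>\<^sup>+r. ennreal (g r) * indicator {u<..} r \<partial>lborel) \<le> ennreal (q0 u * (u powr (- \<alpha>) / \<alpha>))"
proof -
  have "(\<integral>\<^sup>+r. ennreal (g r) * indicator {u<..} r \<partial>lborel)
      \<le> (\<integral>\<^sup>+r. ennreal (q0 u) * (ennreal (r powr (- \<alpha> - 1)) * indicator {u<..} r) \<partial>lborel)"
  proof (rule nn_integral_mono)
    fix r :: real
    show "ennreal (g r) * indicator {u<..} r \<le> ennreal (q0 u) * (ennreal (r powr (- \<alpha> - 1)) * indicator {u<..} r)"
    proof (cases "r > u")
      case True
      then have "q0 r \<le> q0 u" using assms by (intro q0_anti) auto
      then have "g r \<le> q0 u * r powr (- \<alpha> - 1)" unfolding g_def by (subst mult.commute) (intro mult_right_mono, auto)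
      then have "ennreal (g r) \<le> ennreal (q0 u * r powr (- \<alpha> - 1))" by (rule ennreal_leI)
      then show ?thesis using True q0_nonneg by (simp add: ennreal_mult')
    qed simp
  qed
  also have "\<dots> = ennreal (q0 u) * ennreal (u powr (- \<alpha>) / \<alpha>)"
    by (subst nn_integral_cmult) (auto simp: nn_integral_powr_tail[OF alpha_pos assms])
  also have "\<dots> = ennreal (q0 u * (u powr (- \<alpha>) / \<alpha>))" by (rule ennreal_mult'[symmetric]) (rule q0_nonneg)
  finally show ?thesis .
qed

lemma g_integrable: "u > 0 \<Longrightarrow> integrable lborel (\<lambda>r. indicator {u<..} r * g r)"
proof (rule integrableI_bounded)
  assume u: "u > 0"
  have "(\<integral>\<^sup>+r. ennreal (norm (indicator {u<..} r * g r)) \<partial>lborel) = (\<integral>\<^sup>+r. ennreal (g r) * indicator {u<..} r \<partial>lborel)"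
    by (intro nn_integral_cong) (auto simp: indicator_def g_nonneg)
  also have "\<dots> < \<infinity>" using nn_g_le[OF u] ennreal_less_top le_less_trans by (metis infinity_ennreal_def)
  finally show "(\<integral>\<^sup>+r. ennreal (norm (indicator {u<..} r * g r)) \<partial>lborel) < \<infinity>" .
qed measurable

lemma nn_g:
  assumes u: "u > 0"
  shows "(\<integral>\<^sup>+r. ennreal (g r) * indicator {u<..} r \<partial>lborel) = ennreal (u powr (- \<alpha>) * tail u)"
proof -
  have "(\<integral>\<^sup>+r. ennreal (g r) * indicator {u<..} r \<partial>lborel) = (\<integral>\<^sup>+r. ennreal (indicator {u<..} r * g r) \<partial>lborel)"
    by (intro nn_integral_cong) (auto simp: indicator_def)
  also have "\<dots> = ennreal (LINT r|lborel. indicator {u<..} r * g r)"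
    by (rule nn_integral_eq_integral[OF g_integrable[OF u]]) (simp add: g_nonneg)
  also have "(LINT r|lborel. indicator {u<..} r * g r) = u powr (- \<alpha>) * tail u"
    unfolding tail_def using u by (simp add: powr_minus)
  finally show ?thesis .
qed

lemma tail_nonneg: "0 \<le> tail u"
  unfolding tail_def using g_nonneg by (intro mult_nonneg_nonneg integral_nonneg_AE AE_I2) auto

text \<open>On the range of integration q is at most its value at \<open>u\<close>, and the
  remaining power integrates to u^(-alpha) / alpha. This is what makes \<open>p\<close>
  nonnegative.\<close>

lemma alpha_tail_le: "u > 0 \<Longrightarrow> \<alpha> * tail u \<le> q0 u"
proof -
  assume u: "u > 0"
  have "ennreal (u powr (- \<alpha>) * tail u) \<le> ennreal (q0 u * (u powr (- \<alpha>) / \<alpha>))"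
    using nn_g[OF u] nn_g_le[OF u] by simp
  then have "u powr (- \<alpha>) * tail u \<le> q0 u * (u powr (- \<alpha>) / \<alpha>)"
    using q0_nonneg alpha_pos by (subst (asm) ennreal_le_iff) auto
  then have "u powr (- \<alpha>) * (\<alpha> * tail u) \<le> u powr (- \<alpha>) * q0 u" using alpha_pos by (simp add: field_simps)
  then show ?thesis using u by simp
qed

lemma p_nonneg: "0 \<le> p u"
  unfolding p_def using alpha_tail_le[of u] by simp

lemma tail_meas[measurable]: "tail \<in> borel_measurable borel"
proof -
  have eq: "(LINT r|lborel. indicator {u<..} r * g r) = (LINT r|lborel. (if u < r then g r else 0))" for u
    by (intro Bochner_Integration.integral_cong) (auto simp: indicator_def)
  have "(\<lambda>u. LINT r|lborel. (if u < r then g r else 0)) \<in> borel_measurable borel" by measurable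
  then show ?thesis unfolding tail_def[abs_def] eq by measurable
qed

lemma p_meas[measurable]: "p \<in> borel_measurable borel"
  unfolding p_def[abs_def] by measurable

lemma nn_powr_interval:
  assumes "0 < u" "u \<le> b"
  shows "(\<integral>\<^sup>+w. ennreal (\<alpha> * w powr (\<alpha> - 1)) * indicator {u<..b} w \<partial>lborel) = ennreal (b powr \<alpha> - u powr \<alpha>)"
proof -
  have "(\<integral>\<^sup>+w. ennreal (\<alpha> * w powr (\<alpha> - 1)) * indicator {u<..b} w \<partial>lborel) = (\<integral>\<^sup>+w. ennreal (\<alpha> * w powr (\<alpha> - 1)) * indicator {u..b} w \<partial>lborel)"
    by (rule nn_integral_cong_AE) (use AE_lborel_singleton[of u] in eventually_elim, auto simp: indicator_def)
  also have "\<dots> = ennreal (b powr \<alpha> - u powr \<alpha>)"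
    by (rule nn_integral_FTC_Icc) (use assms alpha_pos in \<open>auto intro!: derivative_eq_intros\<close>)
  finally show ?thesis .
qed

text \<open>Tonelli's theorem, arranged as an identity between finite nonnegative quantities since
  \<open>q r / r\<close> need not be integrable at infinity.\<close>

lemma nn_p_interval:
  assumes u: "0 < u" and R: "u < R"
  shows "(\<integral>\<^sup>+w. ennreal (p w) * indicator {u<..R} w \<partial>lborel) + ennreal (tail R) = ennreal (tail u)"
proof -
  let ?J = "{u<..R}"
  define A where "A = (\<integral>\<^sup>+r. ennreal (q0 r / r) * indicator ?J r \<partial>lborel)"
  define X where "X = (\<integral>\<^sup>+w. ennreal (\<alpha> * tail w / w) * indicator ?J w \<partial>lborel)"
  define Pp where "Pp = (\<integral>\<^sup>+w. ennreal (p w) * indicator ?J w \<partial>lborel)"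
  \<comment> \<open>On the bounded interval the integrand is at most alpha / u. As X is part of A,
    it is finite too and may be cancelled in \<open>ennreal\<close>.\<close>
  have A_fin: "A \<noteq> \<infinity>"
  proof -
    have "A \<le> (\<integral>\<^sup>+r. ennreal (\<alpha> / u) * indicator ?J r \<partial>lborel)"
      unfolding A_def
    proof (rule nn_integral_mono)
      fix r :: real
      show "ennreal (q0 r / r) * indicator ?J r \<le> ennreal (\<alpha> / u) * indicator ?J r"
        using u q0_le[of r] q0_nonneg[of r] alpha_pos by (auto simp: indicator_def intro!: ennreal_leI frac_le)
    qed
    also have "\<dots> = ennreal (\<alpha> / u) * ennreal (R - u)"
      using R by (subst nn_integral_cmult_indicator) auto
    also have "\<dots> < \<infinity>" by (simp add: ennreal_mult_less_top)
    finally show ?thesis by simp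
  qed
  have PX: "Pp + X = A"
  proof -
    have "Pp + X = (\<integral>\<^sup>+w. ennreal (p w) * indicator ?J w + ennreal (\<alpha> * tail w / w) * indicator ?J w \<partial>lborel)"
      unfolding Pp_def X_def by (rule nn_integral_add[symmetric]) measurable
    also have "\<dots> = A" unfolding A_def
    proof (rule nn_integral_cong)
      fix w :: real
      show "ennreal (p w) * indicator ?J w + ennreal (\<alpha> * tail w / w) * indicator ?J w = ennreal (q0 w / w) * indicator ?J w"
      proof (cases "w \<in> ?J")
        case True
        then have w: "w > 0" using u by auto
        have "ennreal (p w) + ennreal (\<alpha> * tail w / w) = ennreal (p w + \<alpha> * tail w / w)"
          using p_nonneg tail_nonneg alpha_pos w by (intro ennreal_plus[symmetric]) auto
        also have "p w + \<alpha> * tail w / w = q0 w / w" using w by (simp add: p_def diff_divide_distrib)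
        finally show ?thesis using True by simp
      qed simp
    qed
    finally show ?thesis .
  qed
  have X_fin: "X \<noteq> \<infinity>"
  proof
    assume "X = \<infinity>"
    then show False using PX A_fin by simp
  qed
  \<comment> \<open>Exchanging the order, the integral of alpha w^(alpha - 1) up to min r R leaves
    (min r R)^alpha - u^alpha as weight of g r. Adding \<open>tail u\<close> removes u^alpha; for r
    <= R what remains is r^alpha g r = q0 r / r, and beyond R it is the integrand of
    \<open>tail R\<close>.\<close>
  have "X + ennreal (tail u) = A + ennreal (tail R)"
  proof -
    have "X = (\<integral>\<^sup>+w. (\<integral>\<^sup>+r. (if w < r then ennreal (g r) else 0) * (ennreal (\<alpha> * w powr (\<alpha> - 1)) * indicator ?J w) \<partial>lborel) \<partial>lborel)"
      unfolding X_def
    proof (rule nn_integral_cong)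
      fix w :: real
      show "ennreal (\<alpha> * tail w / w) * indicator ?J w = (\<integral>\<^sup>+r. (if w < r then ennreal (g r) else 0) * (ennreal (\<alpha> * w powr (\<alpha> - 1)) * indicator ?J w) \<partial>lborel)"
      proof (cases "w \<in> ?J")
        case True
        then have w: "w > 0" using u by auto
        have "(\<integral>\<^sup>+r. (if w < r then ennreal (g r) else 0) * (ennreal (\<alpha> * w powr (\<alpha> - 1)) * indicator ?J w) \<partial>lborel)
          = (\<integral>\<^sup>+r. ennreal (g r) * indicator {w<..} r \<partial>lborel) * ennreal (\<alpha> * w powr (\<alpha> - 1))"
          using True by (subst nn_integral_multc[symmetric]) (auto intro!: nn_integral_cong simp: indicator_def)
        also have "\<dots> = ennreal (w powr (- \<alpha>) * tail w * (\<alpha> * w powr (\<alpha> - 1)))"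
          unfolding nn_g[OF w] using tail_nonneg alpha_pos by (intro ennreal_mult'[symmetric]) auto
        also have "w powr (- \<alpha>) * tail w * (\<alpha> * w powr (\<alpha> - 1)) = \<alpha> * tail w / w"
        proof -
          have "w powr (- \<alpha>) * w powr (\<alpha> - 1) = 1 / w"
            using w by (simp only: powr_add[symmetric]) (simp add: powr_minus_divide)
          then show ?thesis by (simp add: mult.left_commute mult.assoc)
        qed
        finally show ?thesis using True by simp
      qed simp
    qed
    also have "\<dots> = (\<integral>\<^sup>+r. (\<integral>\<^sup>+w. (if w < r then ennreal (g r) else 0) * (ennreal (\<alpha> * w powr (\<alpha> - 1)) * indicator ?J w) \<partial>lborel) \<partial>lborel)"
      by (rule lborel_pair.Fubini') measurable
    also have "\<dots> = (\<integral>\<^sup>+r. ennreal (g r * (min r R powr \<alpha> - u powr \<alpha>)) * indicator {u<..} r \<partial>lborel)"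
    proof (rule nn_integral_cong)
      fix r :: real
      show "(\<integral>\<^sup>+w. (if w < r then ennreal (g r) else 0) * (ennreal (\<alpha> * w powr (\<alpha> - 1)) * indicator ?J w) \<partial>lborel)
          = ennreal (g r * (min r R powr \<alpha> - u powr \<alpha>)) * indicator {u<..} r"
      proof (cases "r > u")
        case True
        have "(\<integral>\<^sup>+w. (if w < r then ennreal (g r) else 0) * (ennreal (\<alpha> * w powr (\<alpha> - 1)) * indicator ?J w) \<partial>lborel)
           = (\<integral>\<^sup>+w. ennreal (g r) * (ennreal (\<alpha> * w powr (\<alpha> - 1)) * indicator {u<..min r R} w) \<partial>lborel)"
          by (rule nn_integral_cong_AE) (use AE_lborel_singleton[of r] in eventually_elim, auto simp: indicator_def)
        also have "\<dots> = ennreal (g r) * (\<integral>\<^sup>+w. ennreal (\<alpha> * w powr (\<alpha> - 1)) * indicator {u<..min r R} w \<partial>lborel)"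
          by (rule nn_integral_cmult) measurable
        also have "(\<integral>\<^sup>+w. ennreal (\<alpha> * w powr (\<alpha> - 1)) * indicator {u<..min r R} w \<partial>lborel) = ennreal (min r R powr \<alpha> - u powr \<alpha>)"
          using True R by (intro nn_powr_interval u) auto
        also have "ennreal (g r) * \<dots> = ennreal (g r * (min r R powr \<alpha> - u powr \<alpha>))"
          by (rule ennreal_mult'[symmetric]) (rule g_nonneg)
        finally show ?thesis using True by simp
      next
        case False
        then have "(\<integral>\<^sup>+w. (if w < r then ennreal (g r) else 0) * (ennreal (\<alpha> * w powr (\<alpha> - 1)) * indicator ?J w) \<partial>lborel) = (\<integral>\<^sup>+(w::real). 0 \<partial>lborel)"
          by (intro nn_integral_cong) (auto simp: indicator_def)
        then show ?thesis using False by simp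
      qed
    qed
    finally have X: "X = (\<integral>\<^sup>+r. ennreal (g r * (min r R powr \<alpha> - u powr \<alpha>)) * indicator {u<..} r \<partial>lborel)" .
    have tu: "ennreal (tail w) = (\<integral>\<^sup>+r. ennreal (w powr \<alpha> * g r) * indicator {w<..} r \<partial>lborel)" if w: "w > 0" for w
    proof -
      have "w powr \<alpha> * (w powr (- \<alpha>) * tail w) = tail w"
        using w by (simp add: powr_minus mult.assoc[symmetric])
      then have "ennreal (tail w) = ennreal (w powr \<alpha>) * ennreal (w powr (- \<alpha>) * tail w)"
        by (simp only: ennreal_mult'[symmetric] powr_ge_zero)
      also have "\<dots> = (\<integral>\<^sup>+r. ennreal (w powr \<alpha>) * (ennreal (g r) * indicator {w<..} r) \<partial>lborel)"
        unfolding nn_g[OF w, symmetric] by (rule nn_integral_cmult[symmetric]) measurable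
      finally show ?thesis by (simp add: ennreal_mult' mult.assoc)
    qed
    have "X + ennreal (tail u) = (\<integral>\<^sup>+r. ennreal (g r * (min r R powr \<alpha> - u powr \<alpha>)) * indicator {u<..} r + ennreal (u powr \<alpha> * g r) * indicator {u<..} r \<partial>lborel)"
      unfolding X tu[OF u] by (rule nn_integral_add[symmetric]) measurable
    also have "\<dots> = (\<integral>\<^sup>+r. ennreal (q0 r / r) * indicator ?J r + ennreal (R powr \<alpha> * g r) * indicator {R<..} r \<partial>lborel)"
    proof (rule nn_integral_cong)
      fix r :: real
      show "ennreal (g r * (min r R powr \<alpha> - u powr \<alpha>)) * indicator {u<..} r + ennreal (u powr \<alpha> * g r) * indicator {u<..} r
         = ennreal (q0 r / r) * indicator ?J r + ennreal (R powr \<alpha> * g r) * indicator {R<..} r"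
      proof (cases "r > u")
        case True
        have "u powr \<alpha> \<le> min r R powr \<alpha>" using True R u alpha_pos by (intro powr_mono2) auto
        then have "ennreal (g r * (min r R powr \<alpha> - u powr \<alpha>)) + ennreal (u powr \<alpha> * g r) = ennreal (g r * (min r R powr \<alpha> - u powr \<alpha>) + u powr \<alpha> * g r)"
          using g_nonneg by (intro ennreal_plus[symmetric]) auto
        also have "g r * (min r R powr \<alpha> - u powr \<alpha>) + u powr \<alpha> * g r = min r R powr \<alpha> * g r" by (simp add: algebra_simps)
        finally have e: "ennreal (g r * (min r R powr \<alpha> - u powr \<alpha>)) + ennreal (u powr \<alpha> * g r) = ennreal (min r R powr \<alpha> * g r)" .
        have "r powr \<alpha> * g r = q0 r / r"
        proof -
          have "r powr \<alpha> * r powr (- \<alpha> - 1) = 1 / r" using True u by (simp add: powr_add[symmetric] powr_minus_divide)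
          then show ?thesis unfolding g_def by (simp add: mult.assoc[symmetric])
        qed
        then show ?thesis using e True R by (cases "r \<le> R") (auto simp: min_def)
      next
        case False
        then show ?thesis using R by simp
      qed
    qed
    also have "\<dots> = A + ennreal (tail R)"
      unfolding A_def tu[OF less_trans[OF u R]] by (rule nn_integral_add) measurable
    finally show ?thesis .
  qed
  moreover have "X + (Pp + ennreal (tail R)) = A + ennreal (tail R)" unfolding PX[symmetric] by (simp only: ac_simps)
  ultimately have "X + (Pp + ennreal (tail R)) = X + ennreal (tail u)" by (simp only:)
  then show ?thesis using X_fin unfolding ennreal_add_left_cancel Pp_def by auto
qed

lemma tail_top: "(\<lambda>n. tail (real n)) \<longlonglongrightarrow> 0"
proof (rule tendsto_sandwich[of "\<lambda>_. 0" _ _ "\<lambda>n. q0 (real n) / \<alpha>"])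
  show "eventually (\<lambda>n. tail (real n) \<le> q0 (real n) / \<alpha>) sequentially"
    using eventually_gt_at_top[of 0] by eventually_elim (use alpha_tail_le alpha_pos in \<open>simp add: field_simps\<close>)
  have "(\<lambda>n. q (real n) / \<alpha>) \<longlonglongrightarrow> 0 / \<alpha>"
    using alpha_pos by (intro tendsto_divide filterlim_compose[OF q_top filterlim_real_sequentially] tendsto_const) auto
  then have "(\<lambda>n. q (real n) / \<alpha>) \<longlonglongrightarrow> 0" by simp
  moreover have "eventually (\<lambda>n. q (real n) / \<alpha> = q0 (real n) / \<alpha>) sequentially"
    using eventually_gt_at_top[of 0] by eventually_elim (simp add: q0_def)
  ultimately show "(\<lambda>n. q0 (real n) / \<alpha>) \<longlonglongrightarrow> 0" by (rule Lim_transform_eventually)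
qed (use tail_nonneg in auto)

lemma nn_p_tail:
  assumes u: "0 < u"
  shows "(\<integral>\<^sup>+w. ennreal (p w) * indicator {u<..} w \<partial>lborel) = ennreal (tail u)"
proof -
  define f where "f n w = ennreal (p w) * indicator {u<..real n} w" for n and w :: real
  have "(\<lambda>n. integral\<^sup>N lborel (f n)) \<longlonglongrightarrow> (\<integral>\<^sup>+w. ennreal (p w) * indicator {u<..} w \<partial>lborel)"
  proof (rule nn_integral_LIMSEQ)
    show "incseq f" unfolding incseq_def f_def[abs_def] le_fun_def by (auto simp: indicator_def)
    show "f n \<in> borel_measurable lborel" for n unfolding f_def[abs_def] by measurable
    fix w :: real
    obtain N where "w \<le> real N" using real_arch_simple by blast
    have "eventually (\<lambda>n. f n w = ennreal (p w) * indicator {u<..} w) sequentially"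
      using eventually_ge_at_top[of N]
    proof eventually_elim
      case (elim n)
      then have "w \<le> real n" using \<open>w \<le> real N\<close> of_nat_mono[of N n, where 'a=real] by linarith
      then show ?case by (simp add: f_def indicator_def)
    qed
    then show "(\<lambda>n. f n w) \<longlonglongrightarrow> ennreal (p w) * indicator {u<..} w" by (rule tendsto_eventually)
  qed
  moreover have "(\<lambda>n. ennreal (tail (real n))) \<longlonglongrightarrow> ennreal 0" by (intro tendsto_ennrealI tail_top)
  ultimately have "(\<lambda>n. integral\<^sup>N lborel (f n) + ennreal (tail (real n))) \<longlonglongrightarrow> (\<integral>\<^sup>+w. ennreal (p w) * indicator {u<..} w \<partial>lborel) + ennreal 0"
    by (intro tendsto_add)
  moreover have "eventually (\<lambda>n. integral\<^sup>N lborel (f n) + ennreal (tail (real n)) = ennreal (tail u)) sequentially"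
  proof -
    obtain N where "u < real N" using reals_Archimedean2 by blast
    show ?thesis using eventually_ge_at_top[of N]
    proof eventually_elim
      case (elim n)
      then have "u < real n" using \<open>u < real N\<close> of_nat_mono[of N n, where 'a=real] by linarith
      then show ?case unfolding f_def[abs_def] by (rule nn_p_interval[OF u])
    qed
  qed
  ultimately have "(\<lambda>n::nat. ennreal (tail u)) \<longlonglongrightarrow> (\<integral>\<^sup>+w. ennreal (p w) * indicator {u<..} w \<partial>lborel) + ennreal 0"
    by (rule Lim_transform_eventually)
  then show ?thesis using LIMSEQ_unique[OF tendsto_const] by (metis add.right_neutral ennreal_0)
qed

text \<open>After r = u y the prefactor u^alpha is gone and \<open>u\<close> occurs only in the
  argument of q, which prepares the limit at 0.\<close>

lemma tail_subst:
  assumes u: "u > 0"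
  shows "tail u = (LINT y|lborel. indicator {1<..} y * (y powr (- \<alpha> - 1) * q0 (u * y)))"
proof -
  have "(LINT r|lborel. indicator {u<..} r * g r) = \<bar>u\<bar> *\<^sub>R (LINT y|lborel. indicator {u<..} (0 + u * y) * g (0 + u * y))"
    using u by (intro lborel_integral_real_affine) auto
  also have "(\<lambda>y. indicator {u<..} (0 + u * y) * g (0 + u * y)) = (\<lambda>y. u powr (- \<alpha> - 1) * (indicator {1<..} y * (y powr (- \<alpha> - 1) * q0 (u * y))))"
    using u by (auto simp: g_def indicator_def powr_mult)
  finally have "(LINT r|lborel. indicator {u<..} r * g r) = u * (u powr (- \<alpha> - 1) * (LINT y|lborel. indicator {1<..} y * (y powr (- \<alpha> - 1) * q0 (u * y))))"
    using u by simp
  moreover have "u powr \<alpha> * (u * u powr (- \<alpha> - 1)) = 1"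
    using u by (simp add: powr_mult_base powr_add[symmetric])
  ultimately show ?thesis unfolding tail_def by (simp add: mult.assoc[symmetric])
qed

lemma powr_integrable: "integrable lborel (\<lambda>y. indicator {1<..} y * y powr (- \<alpha> - 1))"
  and powr_integral: "(LINT y|lborel. indicator {1<..} y * y powr (- \<alpha> - 1)) = 1 / \<alpha>"
proof -
  have "(\<integral>\<^sup>+y. ennreal (indicator {1<..} y * y powr (- \<alpha> - 1)) \<partial>lborel) = (\<integral>\<^sup>+y. ennreal (y powr (- \<alpha> - 1)) * indicator {1<..} y \<partial>lborel)"
    by (intro nn_integral_cong) (auto simp: indicator_def)
  also have "\<dots> = ennreal (1 / \<alpha>)" using nn_integral_powr_tail[OF alpha_pos, of 1] by simp
  finally have n: "(\<integral>\<^sup>+y. ennreal (indicator {1<..} y * y powr (- \<alpha> - 1)) \<partial>lborel) = ennreal (1 / \<alpha>)" .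
  show "integrable lborel (\<lambda>y. indicator {1<..} y * y powr (- \<alpha> - 1))"
    by (rule integrableI_nonneg) (use n in auto)
  show "(LINT y|lborel. indicator {1<..} y * y powr (- \<alpha> - 1)) = 1 / \<alpha>"
    using alpha_pos by (subst integral_eq_nn_integral) (simp_all add: n)
qed

text \<open>Here q(0+) = alpha enters: it is exactly compensated by the integral 1/alpha of
  y^(-alpha - 1) over y > 1.\<close>

lemma tail_0: "(\<lambda>n. tail (1 / real (Suc n))) \<longlonglongrightarrow> 1"
proof -
  have "(\<lambda>n. LINT y|lborel. indicator {1<..} y * (y powr (- \<alpha> - 1) * q0 (1 / real (Suc n) * y)))
     \<longlonglongrightarrow> (LINT y|lborel. indicator {1<..} y * (y powr (- \<alpha> - 1) * \<alpha>))"
  proof (rule integral_dominated_convergence[where w="\<lambda>y. indicator {1<..} y * y powr (- \<alpha> - 1) * \<alpha>"])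
    show "integrable lborel (\<lambda>y. indicator {1<..} y * y powr (- \<alpha> - 1) * \<alpha>)" using powr_integrable by simp
    show "AE y in lborel. norm (indicator {1<..} y * (y powr (- \<alpha> - 1) * q0 (1 / real (Suc n) * y))) \<le> indicator {1<..} y * y powr (- \<alpha> - 1) * \<alpha>" for n
      using q0_nonneg q0_le by (intro AE_I2) (auto simp: indicator_def abs_mult intro!: mult_left_mono)
    show "AE y in lborel. (\<lambda>n. indicator {1<..} y * (y powr (- \<alpha> - 1) * q0 (1 / real (Suc n) * y))) \<longlonglongrightarrow> indicator {1<..} y * (y powr (- \<alpha> - 1) * \<alpha>)"
    proof (rule AE_I2)
      fix y :: real
      show "(\<lambda>n. indicator {1<..} y * (y powr (- \<alpha> - 1) * q0 (1 / real (Suc n) * y))) \<longlonglongrightarrow> indicator {1<..} y * (y powr (- \<alpha> - 1) * \<alpha>)"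
      proof (cases "y > 1")
        case True
        have "(\<lambda>n. 1 / real (Suc n) * y) \<longlonglongrightarrow> 0 * y" by (intro tendsto_mult tendsto_const LIMSEQ_Suc[OF lim_1_over_n])
        then have "filterlim (\<lambda>n. 1 / real (Suc n) * y) (at_right 0) sequentially"
          using True by (intro tendsto_imp_filterlim_at_right) auto
        from filterlim_compose[OF q_0 this]
        have "(\<lambda>n. q0 (1 / real (Suc n) * y)) \<longlonglongrightarrow> \<alpha>" using True by (simp add: q0_def)
        then show ?thesis by (intro tendsto_mult tendsto_const)
      qed simp
    qed
  qed simp_all
  moreover have "(LINT y|lborel. indicator {1<..} y * (y powr (- \<alpha> - 1) * \<alpha>)) = 1"
  proof -
    have "(LINT y|lborel. indicator {1<..} y * (y powr (- \<alpha> - 1) * \<alpha>)) = (LINT y|lborel. indicator {1<..} y * y powr (- \<alpha> - 1) * \<alpha>)"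
      by (simp add: mult.assoc)
    also have "\<dots> = 1" using powr_integral alpha_pos by (simp only: integral_mult_left_zero) simp
    finally show ?thesis .
  qed
  ultimately show ?thesis by (simp add: tail_subst)
qed

lemma nn_p: "(\<integral>\<^sup>+w. ennreal (p w) \<partial>lborel) = 1"
proof -
  define f where "f n w = ennreal (p w) * indicator {1 / real (Suc n)<..} w" for n and w :: real
  have "(\<lambda>n. integral\<^sup>N lborel (f n)) \<longlonglongrightarrow> (\<integral>\<^sup>+w. ennreal (p w) \<partial>lborel)"
  proof (rule nn_integral_LIMSEQ)
    show "incseq f" unfolding incseq_def f_def[abs_def] le_fun_def
    proof (intro allI impI)
      fix m n :: nat and w :: real assume "m \<le> n"
      then have "1 / real (Suc n) \<le> 1 / real (Suc m)" by (intro divide_left_mono) auto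
      then show "ennreal (p w) * indicator {1 / real (Suc m)<..} w \<le> ennreal (p w) * indicator {1 / real (Suc n)<..} w"
        by (auto simp: indicator_def)
    qed
    show "f n \<in> borel_measurable lborel" for n unfolding f_def[abs_def] by measurable
    fix w :: real
    show "(\<lambda>n. f n w) \<longlonglongrightarrow> ennreal (p w)"
    proof (cases "w > 0")
      case True
      then have "eventually (\<lambda>n. 1 / real (Suc n) < w) sequentially"
        by (intro order_tendstoD(2)[OF LIMSEQ_Suc[OF lim_1_over_n]])
      then have "eventually (\<lambda>n. f n w = ennreal (p w)) sequentially"
        by eventually_elim (simp add: f_def)
      then show ?thesis by (rule tendsto_eventually)
    qed (simp add: f_def p_def)
  qed
  moreover have "integral\<^sup>N lborel (f n) = ennreal (tail (1 / real (Suc n)))" for n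
    unfolding f_def by (rule nn_p_tail) simp
  moreover have "(\<lambda>n. ennreal (tail (1 / real (Suc n)))) \<longlonglongrightarrow> ennreal 1" by (intro tendsto_ennrealI tail_0)
  ultimately have "(\<lambda>n. ennreal (tail (1 / real (Suc n)))) \<longlonglongrightarrow> (\<integral>\<^sup>+w. ennreal (p w) \<partial>lborel)"
    "(\<lambda>n. ennreal (tail (1 / real (Suc n)))) \<longlonglongrightarrow> ennreal 1" by simp_all
  from LIMSEQ_unique[OF this] show ?thesis by simp
qed

lemma p_integrable: "integrable lborel p"
  by (rule integrableI_nonneg) (use p_nonneg nn_p in auto)

lemma integral_p_interval:
  assumes a: "0 < a" "a \<le> w"
  shows "integral {a..w} p = tail a - tail w"
proof (cases "a = w")
  case False
  then have aw: "a < w" using a by simp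
  have si: "set_integrable lborel {a..w} p"
    using p_integrable by (intro integrable_mult_indicator[where M=lborel, simplified set_integrable_def[symmetric]]) (auto simp: set_integrable_def)
  have n: "(\<integral>\<^sup>+x. ennreal (indicator {a..w} x *\<^sub>R p x) \<partial>lborel) = (\<integral>\<^sup>+x. ennreal (p x) * indicator {a<..w} x \<partial>lborel)"
    by (rule nn_integral_cong_AE) (use AE_lborel_singleton[of a] in eventually_elim, auto simp: indicator_def)
  have "ennreal (LBINT x:{a..w}. p x) + ennreal (tail w) = ennreal (tail a)"
  proof -
    have "(\<integral>\<^sup>+x. ennreal (indicator {a..w} x *\<^sub>R p x) \<partial>lborel) = ennreal (LBINT x:{a..w}. p x)"
      unfolding set_lebesgue_integral_def
      by (rule nn_integral_eq_integral) (use si p_nonneg in \<open>auto simp: set_integrable_def\<close>)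
    then show ?thesis using n nn_p_interval[OF a(1) aw] by simp
  qed
  moreover have "0 \<le> (LBINT x:{a..w}. p x)"
    unfolding set_lebesgue_integral_def using p_nonneg by (intro integral_nonneg_AE AE_I2) auto
  ultimately have "(LBINT x:{a..w}. p x) + tail w = tail a"
    using tail_nonneg by (simp flip: ennreal_plus)
  then show ?thesis using set_borel_integral_eq_integral(2)[OF si] by simp
qed simp

text \<open>On an interval around \<open>u\<close>, \<open>tail\<close> is a constant minus an
  indefinite integral of \<open>p\<close>, hence continuous. Then \<open>p\<close> is continuous
  wherever q is, and the fundamental theorem applies at \<open>u\<close>.\<close>

lemma tail_deriv:
  assumes u: "u > 0" and q: "isCont q u"
  shows "(tail has_real_derivative - p u) (at u)"
proof -
  define a where "a = u / 2"
  define b where "b = 2 * u"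
  have ab: "0 < a" "a < u" "u < b" using u by (auto simp: a_def b_def)
  have "set_integrable lborel {a..b} p"
    using p_integrable by (intro integrable_mult_indicator[where M=lborel, simplified set_integrable_def[symmetric]]) (auto simp: set_integrable_def)
  then have int: "p integrable_on {a..b}" by (rule set_borel_integral_eq_integral(1))
  have tail_eq: "tail w = tail a - integral {a..w} p" if "w \<in> {a..b}" for w
    using integral_p_interval[OF ab(1), of w] that by simp
  have "continuous_on {a..b} (\<lambda>w. tail a - integral {a..w} p)"
    by (intro continuous_intros indefinite_integral_continuous_1 int)
  then have "continuous_on {a..b} tail" by (rule continuous_on_eq) (rule tail_eq[symmetric])
  then have ct: "isCont tail u" using ab by (intro continuous_on_interior[of "{a..b}"]) auto
  have "isCont (\<lambda>w. (q w - \<alpha> * tail w) / w) u" using u q ct by (intro continuous_intros) auto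
  from isCont_cong_open[where U="{0<..}" and f=p, OF _ _ this] have "isCont p u"
    using u by (auto simp: p_def q0_def)
  then have "continuous (at u within {a..b} - {}) p" by (rule continuous_at_imp_continuous_at_within)
  then have "((\<lambda>w. integral {a..w} p) has_vector_derivative p u) (at u within {a..b} - {})"
    using ab by (intro integral_has_vector_derivative_continuous_at[OF int]) auto
  then have "((\<lambda>w. integral {a..w} p) has_real_derivative p u) (at u within {a..b})"
    by (simp add: has_real_derivative_iff_has_vector_derivative)
  then have "((\<lambda>w. integral {a..w} p) has_real_derivative p u) (at u)"
    using ab by (simp add: at_within_Icc_at)
  then have d: "((\<lambda>w. tail a - integral {a..w} p) has_real_derivative 0 - p u) (at u)"
    by (intro derivative_intros)
  have "((\<lambda>w. tail a - integral {a..w} p) has_real_derivative - p u) (at u) \<longleftrightarrow> (tail has_real_derivative - p u) (at u)"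
  proof (rule DERIV_cong_ev)
    show "eventually (\<lambda>w. tail a - integral {a..w} p = tail w) (nhds u)"
    proof -
      have "eventually (\<lambda>w. w \<in> {a<..<b}) (nhds u)" using ab by (intro eventually_nhds_in_open) auto
      then show ?thesis
      proof eventually_elim
        case (elim w)
        then have "w \<in> {a..b}" by auto
        from tail_eq[OF this] show ?case by (rule sym)
      qed
    qed
  qed auto
  then show ?thesis using d by simp
qed

text \<open>A monotone function has countably many discontinuities. This exceptional set is Lebesgue
  null, and since it is countable, the density written with \<open>deriv\<close> is also Borel
  measurable.\<close>

lemma density_deriv_tail:
  "density lborel (\<lambda>u. ennreal (- deriv tail u) * indicator {0<..} u) = density lborel (\<lambda>u. ennreal (p u))"
proof -
  define D where "D = {u \<in> {0<..}. \<not> isCont q u}"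
  have "mono_on {0<..} (\<lambda>u. - q u)" using q_anti by (auto simp: monotone_on_def)
  from mono_on_ctble_discont_open[OF open_greaterThan this]
  have "countable {a \<in> {0<..}. \<not> isCont (\<lambda>u. - q u) a}" .
  moreover have "isCont (\<lambda>u. - q u) a \<longleftrightarrow> isCont q a" for a
    using continuous_minus[of "at a" q] continuous_minus[of "at a" "\<lambda>u. - q u"] by auto
  ultimately have D: "countable D" by (simp add: D_def)
  have eq: "ennreal (- deriv tail u) * indicator {0<..} u = ennreal (p u)" if "u \<notin> D" for u
  proof (cases "u > 0")
    case True
    then have "deriv tail u = - p u" using that by (intro DERIV_imp_deriv tail_deriv) (auto simp: D_def)
    then show ?thesis using True by simp
  qed (simp add: p_def)
  have m: "(\<lambda>u. ennreal (- deriv tail u) * indicator {0<..} u) \<in> borel_measurable lborel"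
    by (rule measurable_discrete_difference[of "\<lambda>u. ennreal (p u)" _ _ D]) (use D eq in auto)
  show ?thesis
  proof (rule density_cong[OF m])
    have "AE u in lborel. u \<notin> D" using D emeasure_lborel_countable[OF D]
      by (intro AE_not_in) (auto simp: null_sets_def intro: sets.countable)
    then show "AE u in lborel. ennreal (- deriv tail u) * indicator {0<..} u = ennreal (p u)"
      by eventually_elim (rule eq)
  qed measurable
qed

end

context tempering_profile
begin

text \<open>The minimum of a stable radius and an independent tempering variable has the tempered
  radial density: split according to which of the two is smaller.\<close>

lemma nn_integral_min:
  fixes F :: "real \<Rightarrow> ennreal"
  assumes [measurable]: "F \<in> borel_measurable borel"
  shows "(\<integral>\<^sup>+r. (ennreal (\<alpha> * r powr (- \<alpha> - 1)) * indicator {0<..} r) * (\<integral>\<^sup>+t. ennreal (p t) * F (min r t) \<partial>lborel) \<partial>lborel)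
    = (\<integral>\<^sup>+r. ennreal (r powr (- \<alpha> - 1) * q0 r) * F r * indicator {0<..} r \<partial>lborel)"
proof -
  define c where "c r = ennreal (\<alpha> * r powr (- \<alpha> - 1)) * indicator {0<..} r" for r :: real
  have [measurable]: "c \<in> borel_measurable borel" unfolding c_def[abs_def] by measurable
  have "(\<integral>\<^sup>+r. c r * (\<integral>\<^sup>+t. ennreal (p t) * F (min r t) \<partial>lborel) \<partial>lborel)
     = (\<integral>\<^sup>+r. (\<integral>\<^sup>+t. c r * (ennreal (p t) * F (min r t)) \<partial>lborel) \<partial>lborel)"
    by (intro nn_integral_cong nn_integral_cmult[symmetric]) measurable
  \<comment> \<open>For r < t the minimum is the radius, and integrating out \<open>t\<close> gives
    \<open>tail r\<close>; for t <= r it is \<open>t\<close>, and integrating out the radius gives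
    t^(-alpha).\<close>
  also have "\<dots> = (\<integral>\<^sup>+r. (\<integral>\<^sup>+t. (if r < t then c r * F r * ennreal (p t) else 0) + (if t \<le> r then c r * F t * ennreal (p t) else 0) \<partial>lborel) \<partial>lborel)"
    by (intro nn_integral_cong) (auto simp: min_def ac_simps)
  also have "\<dots> = (\<integral>\<^sup>+r. (\<integral>\<^sup>+t. (if r < t then c r * F r * ennreal (p t) else 0) \<partial>lborel) + (\<integral>\<^sup>+t. (if t \<le> r then c r * F t * ennreal (p t) else 0) \<partial>lborel) \<partial>lborel)"
    by (intro nn_integral_cong nn_integral_add) measurable
  also have "\<dots> = (\<integral>\<^sup>+r. (\<integral>\<^sup>+t. (if r < t then c r * F r * ennreal (p t) else 0) \<partial>lborel) \<partial>lborel) + (\<integral>\<^sup>+r. (\<integral>\<^sup>+t. (if t \<le> r then c r * F t * ennreal (p t) else 0) \<partial>lborel) \<partial>lborel)"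
    by (rule nn_integral_add) measurable
  also have "(\<integral>\<^sup>+r. (\<integral>\<^sup>+t. (if r < t then c r * F r * ennreal (p t) else 0) \<partial>lborel) \<partial>lborel) = (\<integral>\<^sup>+r. c r * F r * ennreal (tail r) \<partial>lborel)"
  proof (rule nn_integral_cong)
    fix r :: real
    show "(\<integral>\<^sup>+t. (if r < t then c r * F r * ennreal (p t) else 0) \<partial>lborel) = c r * F r * ennreal (tail r)"
    proof (cases "r > 0")
      case True
      have "(\<integral>\<^sup>+t. (if r < t then c r * F r * ennreal (p t) else 0) \<partial>lborel) = (\<integral>\<^sup>+t. c r * F r * (ennreal (p t) * indicator {r<..} t) \<partial>lborel)"
        by (intro nn_integral_cong) (auto simp: indicator_def)
      also have "\<dots> = c r * F r * (\<integral>\<^sup>+t. ennreal (p t) * indicator {r<..} t \<partial>lborel)"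
        by (rule nn_integral_cmult) measurable
      finally show ?thesis unfolding nn_p_tail[OF True] .
    next
      case False
      then have "c r = 0" by (simp add: c_def)
      then show ?thesis by (simp only: mult_zero_left if_cancel nn_integral_const)
    qed
  qed
  also have "(\<integral>\<^sup>+r. (\<integral>\<^sup>+t. (if t \<le> r then c r * F t * ennreal (p t) else 0) \<partial>lborel) \<partial>lborel)
     = (\<integral>\<^sup>+t. (\<integral>\<^sup>+r. (if t \<le> r then c r * F t * ennreal (p t) else 0) \<partial>lborel) \<partial>lborel)"
    by (rule lborel_pair.Fubini') measurable
  also have "\<dots> = (\<integral>\<^sup>+t. F t * ennreal (p t) * ennreal (t powr (- \<alpha>)) \<partial>lborel)"
  proof (rule nn_integral_cong)
    fix t :: real
    show "(\<integral>\<^sup>+r. (if t \<le> r then c r * F t * ennreal (p t) else 0) \<partial>lborel) = F t * ennreal (p t) * ennreal (t powr (- \<alpha>))"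
    proof (cases "t > 0")
      case True
      have "(\<integral>\<^sup>+r. (if t \<le> r then c r * F t * ennreal (p t) else 0) \<partial>lborel)
         = (\<integral>\<^sup>+r. F t * ennreal (p t) * ennreal \<alpha> * (ennreal (r powr (- \<alpha> - 1)) * indicator {t<..} r) \<partial>lborel)"
      proof (rule nn_integral_cong_AE)
        show "AE r in lborel. (if t \<le> r then c r * F t * ennreal (p t) else 0) = F t * ennreal (p t) * ennreal \<alpha> * (ennreal (r powr (- \<alpha> - 1)) * indicator {t<..} r)"
          using AE_lborel_singleton[of t]
          by eventually_elim (use True alpha_pos in \<open>auto simp: c_def indicator_def ennreal_mult' ac_simps\<close>)
      qed
      also have "\<dots> = F t * ennreal (p t) * ennreal \<alpha> * (\<integral>\<^sup>+r. ennreal (r powr (- \<alpha> - 1)) * indicator {t<..} r \<partial>lborel)"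
        by (rule nn_integral_cmult) measurable
      also have "\<dots> = F t * ennreal (p t) * (ennreal \<alpha> * ennreal (t powr (- \<alpha>) / \<alpha>))"
        unfolding nn_integral_powr_tail[OF alpha_pos True] by (simp only: mult.assoc)
      also have "ennreal \<alpha> * ennreal (t powr (- \<alpha>) / \<alpha>) = ennreal (t powr (- \<alpha>))"
        using alpha_pos by (subst ennreal_mult'[symmetric]) auto
      finally show ?thesis .
    next
      case False
      then have "p t = 0" by (simp add: p_def)
      then show ?thesis by (simp add: nn_integral_0_iff_AE)
    qed
  qed
  also have "(\<integral>\<^sup>+r. c r * F r * ennreal (tail r) \<partial>lborel) + (\<integral>\<^sup>+t. F t * ennreal (p t) * ennreal (t powr (- \<alpha>)) \<partial>lborel)
     = (\<integral>\<^sup>+r. c r * F r * ennreal (tail r) + F r * ennreal (p r) * ennreal (r powr (- \<alpha>)) \<partial>lborel)"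
    by (rule nn_integral_add[symmetric]) measurable
  \<comment> \<open>The two contributions add up by alpha tail r + r p r = q0 r, which is the
    definition of \<open>p\<close>.\<close>
  also have "\<dots> = (\<integral>\<^sup>+r. ennreal (r powr (- \<alpha> - 1) * q0 r) * F r * indicator {0<..} r \<partial>lborel)"
  proof (rule nn_integral_cong)
    fix r :: real
    show "c r * F r * ennreal (tail r) + F r * ennreal (p r) * ennreal (r powr (- \<alpha>)) = ennreal (r powr (- \<alpha> - 1) * q0 r) * F r * indicator {0<..} r"
    proof (cases "r > 0")
      case True
      have "ennreal (r powr (- \<alpha> - 1) * q0 r) = ennreal (\<alpha> * r powr (- \<alpha> - 1) * tail r + p r * r powr (- \<alpha>))"
      proof -
        have "r powr (- \<alpha>) = r powr (- \<alpha> - 1) * r" using True by (simp add: powr_diff)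
        then have "\<alpha> * r powr (- \<alpha> - 1) * tail r + p r * r powr (- \<alpha>) = r powr (- \<alpha> - 1) * (\<alpha> * tail r + p r * r)"
          by (simp add: algebra_simps)
        also have "\<alpha> * tail r + p r * r = q0 r" using True by (simp add: p_def)
        finally show ?thesis by simp
      qed
      also have "\<dots> = ennreal (\<alpha> * r powr (- \<alpha> - 1)) * ennreal (tail r) + ennreal (p r) * ennreal (r powr (- \<alpha>))"
        using tail_nonneg p_nonneg alpha_pos by (simp add: ennreal_mult ennreal_plus)
      finally show ?thesis using True by (simp add: c_def algebra_simps)
    qed (simp add: c_def p_def)
  qed
  finally show ?thesis unfolding c_def .
qed

end

section \<open>The tempering kernel in all directions\<close>

locale tempering =
  fixes \<alpha> :: real and q :: "real \<Rightarrow> real ^ 'd \<Rightarrow> real" and \<sigma> :: "(real ^ 'd) measure"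
  assumes alpha: "0 < \<alpha>" "\<alpha> < 2" and temp: "tempering_function \<alpha> q" and sigma: "sphere_measure \<sigma>"
begin

abbreviation "M0 \<equiv> polar_measure \<alpha> \<sigma> (\<lambda>r s. 1)"
abbreviation "M \<equiv> polar_measure \<alpha> \<sigma> q"

text \<open>\<open>D \<cdot> s\<close> is the density of \<open>\<Pi>(\<cdot>, s)\<close>, extended by zero so that it is measurable everywhere.\<close>

definition "qe r s = (if r > 0 \<and> s \<in> sphere 0 1 then q r s else 0)"
definition "ge t s = (LINT r|lborel. (if t < r then r powr (- \<alpha> - 1) * qe r s else 0))"
definition "D t s = (if t > 0 \<and> s \<in> sphere 0 1 then (qe t s - \<alpha> * (t powr \<alpha> * ge t s)) / t else 0)"

lemma qe_meas[measurable]: "(\<lambda>(r, s). qe r s) \<in> borel_measurable (borel \<Otimes>\<^sub>M borel)"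
proof -
  have "(\<lambda>(r, s). q r s) \<in> borel_measurable (restrict_space borel ({0<..} \<times> sphere 0 1))"
    using temp by (simp add: tempering_function_def)
  moreover have "{0<..} \<times> sphere 0 1 \<in> sets (borel :: (real \<times> (real ^ 'd)) measure)"
    unfolding borel_prod[symmetric] by (intro pair_measureI) auto
  ultimately have "(\<lambda>x. if x \<in> {0<..} \<times> sphere 0 1 then (case x of (r, s) \<Rightarrow> q r s) else 0) \<in> borel_measurable borel"
    by (subst (asm) measurable_restrict_space_iff[where c=0]) auto
  also have "(\<lambda>x. if x \<in> {0<..} \<times> sphere 0 1 then (case x of (r, s) \<Rightarrow> q r s) else 0) = (\<lambda>(r, s). qe r s)"
    by (auto simp: qe_def)
  finally show ?thesis by (simp only: borel_prod)
qed

lemma profile: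
  assumes s: "s \<in> sphere 0 1" shows "tempering_profile \<alpha> (\<lambda>r. q r s)"
proof
  show "antimono_on {0<..} (\<lambda>r. q r s)" "((\<lambda>r. q r s) \<longlongrightarrow> \<alpha>) (at_right 0)" "((\<lambda>r. q r s) \<longlongrightarrow> 0) at_top"
    using temp s unfolding tempering_function_def by blast+
  have "(\<lambda>r. if r > 0 then q r s else 0) = (\<lambda>r. qe r s)" using s by (auto simp: qe_def)
  then show "(\<lambda>r. if 0 < r then q r s else 0) \<in> borel_measurable borel" by simp
qed (rule alpha)

lemma profile_eq:
  assumes s: "s \<in> sphere 0 1"
  shows "tempering_profile.q0 (\<lambda>r. q r s) r = qe r s"
    and "tempering_profile.tail \<alpha> (\<lambda>r. q r s) t = t powr \<alpha> * ge t s"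
    and "tempering_profile.p \<alpha> (\<lambda>r. q r s) t = D t s"
proof -
  interpret tempering_profile \<alpha> "\<lambda>r. q r s" by (rule profile[OF s])
  show q0: "q0 r = qe r s" for r using s by (auto simp: q0_def qe_def)
  show tail: "tail t = t powr \<alpha> * ge t s" for t
    unfolding tail_def ge_def g_def q0
    by (intro arg_cong2[where f="(*)"] refl Bochner_Integration.integral_cong) (auto simp: indicator_def)
  show "p t = D t s" using s by (simp add: p_def D_def q0 tail)
qed

lemma ge_meas[measurable]: "(\<lambda>(t, s). ge t s) \<in> borel_measurable (borel \<Otimes>\<^sub>M borel)"
  unfolding ge_def by measurable

lemma D_meas[measurable]: "(\<lambda>(t, s). D t s) \<in> borel_measurable (borel \<Otimes>\<^sub>M borel)"
proof -
  have [measurable]: "sphere 0 1 \<in> sets (borel :: (real ^ 'd) measure)" by simp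
  show ?thesis unfolding D_def by measurable
qed

lemma D_nonneg: "0 \<le> D t s"
proof (cases "s \<in> sphere 0 1")
  case True
  interpret tempering_profile \<alpha> "\<lambda>r. q r s" by (rule profile[OF True])
  show ?thesis using p_nonneg[of t] by (simp add: profile_eq[OF True])
qed (simp add: D_def)

lemma nn_D: "s \<in> sphere 0 1 \<Longrightarrow> (\<integral>\<^sup>+t. ennreal (D t s) \<partial>lborel) = 1"
  using tempering_profile.nn_p[OF profile] profile_eq(3) by simp

lemma D_integrable: "integrable lborel (\<lambda>t. D t s)"
proof (cases "s \<in> sphere 0 1")
  case True
  have "tempering_profile.p \<alpha> (\<lambda>r. q r s) = (\<lambda>t. D t s)" by (rule ext) (rule profile_eq(3)[OF True])
  then show ?thesis using tempering_profile.p_integrable[OF profile[OF True]] by simp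
qed (simp add: D_def)

lemma D_integral_le: "(\<integral>t. D t s \<partial>lborel) \<le> 1"
proof (cases "s \<in> sphere 0 1")
  case True
  have "(\<integral>t. D t s \<partial>lborel) = 1"
    using nn_D[OF True] D_nonneg by (subst integral_eq_nn_integral) auto
  then show ?thesis by simp
qed (simp add: D_def)

lemma tempering_law_eq:
  assumes s: "s \<in> sphere 0 1"
  shows "tempering_law \<alpha> q s = density lborel (\<lambda>t. ennreal (D t s))"
proof -
  interpret tempering_profile \<alpha> "\<lambda>r. q r s" by (rule profile[OF s])
  have tt: "tempering_tail \<alpha> q w s = tail w" if "w > 0" for w
    unfolding tempering_tail_def tail_def set_lebesgue_integral_def
    by (intro arg_cong2[where f="(*)"] refl Bochner_Integration.integral_cong) (use that in \<open>auto simp: indicator_def g_def q0_def\<close>)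
  have "deriv (\<lambda>w. tempering_tail \<alpha> q w s) u = deriv tail u" if "u > 0" for u
  proof (rule deriv_cong_ev)
    have "eventually (\<lambda>w. w \<in> {0<..}) (nhds u)" using that by (intro eventually_nhds_in_open) auto
    then show "eventually (\<lambda>w. tempering_tail \<alpha> q w s = tail w) (nhds u)"
      by eventually_elim (use tt in auto)
  qed simp
  then have "(\<lambda>u. ennreal (- deriv (\<lambda>w. tempering_tail \<alpha> q w s) u) * indicator {0<..} u) = (\<lambda>u. ennreal (- deriv tail u) * indicator {0<..} u)"
    by (auto simp: indicator_def)
  then show ?thesis unfolding tempering_law_def using density_deriv_tail by (simp add: profile_eq(3)[OF s])
qed

text \<open>Continuity in the direction is assumed of q at each fixed radius; it passes to the
  integral because q is bounded by alpha uniformly in the direction.\<close>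

lemma ge_continuous:
  assumes t: "t > 0" and s: "s \<in> sphere 0 1" "\<And>n. S n \<in> sphere 0 1" and lim: "S \<longlonglongrightarrow> s"
  shows "(\<lambda>n. qe t (S n)) \<longlonglongrightarrow> qe t s" "(\<lambda>n. ge t (S n)) \<longlonglongrightarrow> ge t s"
proof -
  have q: "(\<lambda>n. qe r (S n)) \<longlonglongrightarrow> qe r s" if r: "r > 0" for r
  proof -
    have "continuous_on (sphere 0 1) (q r)" using temp r unfolding tempering_function_def by blast
    then have "(\<lambda>n. q r (S n)) \<longlonglongrightarrow> q r s" using s lim unfolding continuous_on_sequentially comp_def by blast
    then show ?thesis using s r by (simp add: qe_def)
  qed
  show "(\<lambda>n. qe t (S n)) \<longlonglongrightarrow> qe t s" by (rule q[OF t])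
  have bd: "\<bar>qe r (S n)\<bar> \<le> \<alpha>" for r n
  proof -
    interpret tempering_profile \<alpha> "\<lambda>r. q r (S n)" by (rule profile[OF s(2)])
    show ?thesis using q0_nonneg[of r] q0_le[of r] by (simp add: profile_eq[OF s(2)])
  qed
  have m: "(\<lambda>r. if t < r then r powr (- \<alpha> - 1) * qe r s' else 0) \<in> borel_measurable lborel" for s' by measurable
  show "(\<lambda>n. ge t (S n)) \<longlonglongrightarrow> ge t s"
    unfolding ge_def
  proof (rule integral_dominated_convergence[where w="\<lambda>r. indicator {t<..} r * r powr (- \<alpha> - 1) * \<alpha>", OF m m])
    have "(\<integral>\<^sup>+r. ennreal (norm (indicator {t<..} r * r powr (- \<alpha> - 1))) \<partial>lborel) = (\<integral>\<^sup>+r. ennreal (r powr (- \<alpha> - 1)) * indicator {t<..} r \<partial>lborel)"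
      by (intro nn_integral_cong) (auto simp: indicator_def)
    also have "\<dots> < \<infinity>" unfolding nn_integral_powr_tail[OF alpha(1) t] by simp
    finally have "integrable lborel (\<lambda>r. indicator {t<..} r * r powr (- \<alpha> - 1))"
      by (intro integrableI_bounded) auto
    then show "integrable lborel (\<lambda>r. indicator {t<..} r * r powr (- \<alpha> - 1) * \<alpha>)" by simp
    show "AE r in lborel. norm (if t < r then r powr (- \<alpha> - 1) * qe r (S n) else 0) \<le> indicator {t<..} r * r powr (- \<alpha> - 1) * \<alpha>" for n
      using bd by (intro AE_I2) (auto simp: indicator_def abs_mult intro!: mult_left_mono)
    show "AE r in lborel. (\<lambda>n. if t < r then r powr (- \<alpha> - 1) * qe r (S n) else 0) \<longlonglongrightarrow> (if t < r then r powr (- \<alpha> - 1) * qe r s else 0)"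
    proof (rule AE_I2)
      fix r :: real
      show "(\<lambda>n. if t < r then r powr (- \<alpha> - 1) * qe r (S n) else 0) \<longlonglongrightarrow> (if t < r then r powr (- \<alpha> - 1) * qe r s else 0)"
      proof (cases "t < r")
        case True
        then have "(\<lambda>n. r powr (- \<alpha> - 1) * qe r (S n)) \<longlonglongrightarrow> r powr (- \<alpha> - 1) * qe r s"
          using t by (intro tendsto_mult tendsto_const q) auto
        then show ?thesis using True by simp
      qed simp
    qed
  qed
qed

text \<open>Scheffe's lemma: pointwise convergence of densities that all have mass 1 is convergence
  in L1.\<close>

lemma D_L1_continuous:
  assumes s: "s \<in> sphere 0 1" "\<And>n. S n \<in> sphere 0 1" and lim: "S \<longlonglongrightarrow> s"
  shows "(\<lambda>n. \<integral>t. \<bar>D t (S n) - D t s\<bar> \<partial>lborel) \<longlonglongrightarrow> 0"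
proof -
  have "(\<lambda>n. \<integral>\<^sup>+t. norm (D t (S n) - D t s) \<partial>lborel) \<longlonglongrightarrow> 0"
  proof (rule Scheffe_lemma2)
    show "(\<lambda>t. D t (S n)) \<in> borel_measurable lborel" for n by measurable
    show "integrable lborel (\<lambda>t. D t s)" by (rule D_integrable)
    have "(\<lambda>n. D t (S n)) \<longlonglongrightarrow> D t s" for t
    proof (cases "t > 0")
      case True
      have "(\<lambda>n. (qe t (S n) - \<alpha> * (t powr \<alpha> * ge t (S n))) / t) \<longlonglongrightarrow> (qe t s - \<alpha> * (t powr \<alpha> * ge t s)) / t"
        using True by (intro tendsto_divide tendsto_diff tendsto_mult tendsto_const ge_continuous[OF True s lim]) auto
      then show ?thesis using True s by (simp add: D_def)
    qed (simp add: D_def)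
    then show "AE t in lborel. (\<lambda>n. D t (S n)) \<longlonglongrightarrow> D t s" by simp
    show "(\<integral>\<^sup>+t. norm (D t (S n)) \<partial>lborel) \<le> (\<integral>\<^sup>+t. norm (D t s) \<partial>lborel)" for n
      using nn_D[OF s(1)] nn_D[OF s(2)] D_nonneg by simp
  qed
  moreover have "(\<integral>\<^sup>+t. norm (D t (S n) - D t s) \<partial>lborel) = ennreal (\<integral>t. \<bar>D t (S n) - D t s\<bar> \<partial>lborel)" for n
    using D_integrable by (subst nn_integral_eq_integral) auto
  ultimately have "(\<lambda>n. ennreal (\<integral>t. \<bar>D t (S n) - D t s\<bar> \<partial>lborel)) \<longlonglongrightarrow> ennreal 0" by simp
  then show ?thesis by (subst (asm) tendsto_ennreal_iff) auto
qed

text \<open>\<open>Kf f x\<close> is the conditional expectation of \<open>f\<close> at the tempered jump, given that the untempered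
  one is \<open>x\<close>.\<close>

definition "dir x = x /\<^sub>R norm x" for x :: "real ^ 'd"
definition "trunc x t = min (norm x) t *\<^sub>R dir x" for x :: "real ^ 'd"
definition "Kf f x = (\<integral>t. D t (dir x) *\<^sub>R f (trunc x t) \<partial>lborel)" for f :: "real ^ 'd \<Rightarrow> complex"

lemma dir_meas[measurable]: "dir \<in> borel_measurable borel"
  unfolding dir_def[abs_def] by measurable

lemma trunc_meas[measurable]: "(\<lambda>(x, t). trunc x t) \<in> borel_measurable (borel \<Otimes>\<^sub>M borel)"
  unfolding trunc_def by measurable

lemma dir_sphere: "x \<noteq> 0 \<Longrightarrow> dir x \<in> sphere 0 1"
  by (simp add: dir_def)

lemma norm_trunc: "x \<noteq> 0 \<Longrightarrow> t > 0 \<Longrightarrow> norm (trunc x t) = min (norm x) t"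
  by (simp add: trunc_def dir_def)

lemma Kf_meas[measurable]:
  assumes [measurable]: "f \<in> borel_measurable borel" shows "Kf f \<in> borel_measurable borel"
  unfolding Kf_def[abs_def] by measurable

lemma D_scale_integrable:
  assumes [measurable]: "F \<in> borel_measurable borel" and F: "\<And>t. cmod (F t) \<le> C"
  shows "integrable lborel (\<lambda>t. D t s *\<^sub>R F t)"
proof (rule Bochner_Integration.integrable_bound)
  show "integrable lborel (\<lambda>t. C * D t s)" using D_integrable by simp
  show "AE t in lborel. norm (D t s *\<^sub>R F t) \<le> norm (C * D t s)"
  proof (rule AE_I2)
    fix t
    have "norm (D t s *\<^sub>R F t) \<le> D t s * C" using F[of t] D_nonneg[of t s] by (simp add: mult_left_mono)
    then show "norm (D t s *\<^sub>R F t) \<le> norm (C * D t s)" by (simp add: mult.commute abs_le_iff)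
  qed
qed measurable

text \<open>Tempering only shortens a vector, and the kernel has mass at most 1, so a bound that is
  nondecreasing in the norm survives averaging.\<close>

lemma Kf_bound:
  assumes [measurable]: "f \<in> borel_measurable borel" and f: "\<And>x. cmod (f x) \<le> \<Phi> (norm x)"
    and mono: "\<And>a b. 0 \<le> a \<Longrightarrow> a \<le> b \<Longrightarrow> \<Phi> a \<le> \<Phi> b" and B: "\<And>a. \<Phi> a \<le> B" and \<Phi>0: "0 \<le> \<Phi> 0"
  shows "cmod (Kf f x) \<le> \<Phi> (norm x)"
proof (cases "x = 0")
  case True
  \<comment> \<open>Division by zero makes \<open>dir 0 = 0\<close>, which is off the sphere; there
    the density is 0 and so is \<open>Kf f 0\<close>.\<close>
  then have "dir x \<notin> sphere 0 1" by (simp add: dir_def)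
  then have "D t (dir x) = 0" for t by (simp add: D_def)
  then show ?thesis using \<Phi>0 True by (simp add: Kf_def)
next
  case False
  have \<Phi>x: "0 \<le> \<Phi> (norm x)" using \<Phi>0 mono[of 0 "norm x"] by simp
  have f1: "cmod (f y) \<le> B" for y using order_trans[OF f B] .
  have "cmod (Kf f x) \<le> (\<integral>t. norm (D t (dir x) *\<^sub>R f (trunc x t)) \<partial>lborel)"
    unfolding Kf_def by (rule integral_norm_bound)
  also have "\<dots> \<le> (\<integral>t. \<Phi> (norm x) * D t (dir x) \<partial>lborel)"
  proof (rule integral_mono)
    show "integrable lborel (\<lambda>t. norm (D t (dir x) *\<^sub>R f (trunc x t)))"
      by (intro integrable_norm D_scale_integrable[of _ B] f1) measurable
    show "integrable lborel (\<lambda>t. \<Phi> (norm x) * D t (dir x))" using D_integrable by simp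
    fix t
    show "norm (D t (dir x) *\<^sub>R f (trunc x t)) \<le> \<Phi> (norm x) * D t (dir x)"
    proof (cases "t > 0")
      case True
      have "norm (trunc x t) \<le> norm x" using norm_trunc[OF False True] by simp
      then have "cmod (f (trunc x t)) \<le> \<Phi> (norm x)" by (intro order_trans[OF f mono]) auto
      then have "D t (dir x) * cmod (f (trunc x t)) \<le> D t (dir x) * \<Phi> (norm x)"
        using D_nonneg by (intro mult_left_mono) auto
      then show ?thesis using D_nonneg[of t "dir x"] by (simp add: ac_simps)
    qed (simp add: D_def)
  qed
  also have "\<dots> = \<Phi> (norm x) * (\<integral>t. D t (dir x) \<partial>lborel)" by simp
  also have "\<dots> \<le> \<Phi> (norm x) * 1" using \<Phi>x by (intro mult_left_mono D_integral_le) auto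
  finally show ?thesis by simp
qed

text \<open>The point x enters through the density, handled by L1 continuity, and through the
  truncated vector, handled by dominated convergence. If |x| differs from 1, the truncated vector
  meets the exceptional sphere only for t = 1, a null event.\<close>

lemma Kf_isCont:
  assumes f[measurable]: "f \<in> borel_measurable borel" and bd: "\<And>x. cmod (f x) \<le> C"
    and cont: "\<And>y. y \<noteq> 0 \<Longrightarrow> norm y \<noteq> 1 \<Longrightarrow> isCont f y" and x: "x \<noteq> 0" "norm x \<noteq> 1"
  shows "isCont (Kf f) x"
  unfolding continuous_at_sequentially comp_def
proof (intro allI impI)
  fix X assume X: "X \<longlonglongrightarrow> x"
  have C: "C \<ge> 0" using order_trans[OF norm_ge_zero bd] .
  \<comment> \<open>The sequence is modified in finitely many terms to avoid the origin, which has
    no direction.\<close>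
  define Y where "Y n = (if X n = 0 then x else X n)" for n
  have ev: "eventually (\<lambda>n. Y n = X n) sequentially"
    using tendsto_imp_eventually_ne[OF X x(1)] by eventually_elim (simp add: Y_def)
  then have Y: "Y \<longlonglongrightarrow> x" using X by (intro Lim_transform_eventually[OF X]) (auto elim: eventually_mono)
  have Y0: "Y n \<noteq> 0" for n using x by (simp add: Y_def)
  have dirY: "(\<lambda>n. dir (Y n)) \<longlonglongrightarrow> dir x"
    unfolding dir_def using x by (intro tendsto_intros Y) auto
  have L1: "(\<lambda>n. \<integral>t. \<bar>D t (dir (Y n)) - D t (dir x)\<bar> \<partial>lborel) \<longlonglongrightarrow> 0"
    by (rule D_L1_continuous[OF dir_sphere[OF x(1)] dir_sphere[OF Y0] dirY])
  have L2: "(\<lambda>n. \<integral>t. D t (dir x) *\<^sub>R f (trunc (Y n) t) \<partial>lborel) \<longlonglongrightarrow> (\<integral>t. D t (dir x) *\<^sub>R f (trunc x t) \<partial>lborel)"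
  proof (rule integral_dominated_convergence[where w="\<lambda>t. C * D t (dir x)"])
    show "integrable lborel (\<lambda>t. C * D t (dir x))" using D_integrable by simp
    show "AE t in lborel. norm (D t (dir x) *\<^sub>R f (trunc (Y n) t)) \<le> C * D t (dir x)" for n
    proof (rule AE_I2)
      fix t
      show "norm (D t (dir x) *\<^sub>R f (trunc (Y n) t)) \<le> C * D t (dir x)"
        using mult_right_mono[OF bd[of "trunc (Y n) t"] D_nonneg[of t "dir x"]] D_nonneg[of t "dir x"] by (simp add: mult.commute)
    qed
    show "AE t in lborel. (\<lambda>n. D t (dir x) *\<^sub>R f (trunc (Y n) t)) \<longlonglongrightarrow> D t (dir x) *\<^sub>R f (trunc x t)"
      using AE_lborel_singleton[of 1]
    proof eventually_elim
      case (elim t)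
      show ?case
      proof (cases "t > 0")
        case True
        have "isCont f (trunc x t)"
        proof (rule cont)
          have n: "norm (trunc x t) = min (norm x) t" by (rule norm_trunc[OF x(1) True])
          then show "norm (trunc x t) \<noteq> 1" using elim x(2) by (simp add: min_def)
          have "norm (trunc x t) > 0" unfolding n using x(1) True by simp
          then show "trunc x t \<noteq> 0" by auto
        qed
        moreover have "(\<lambda>n. trunc (Y n) t) \<longlonglongrightarrow> trunc x t"
          unfolding trunc_def by (intro tendsto_scaleR tendsto_min tendsto_norm Y tendsto_const dirY)
        ultimately have "(\<lambda>n. f (trunc (Y n) t)) \<longlonglongrightarrow> f (trunc x t)" by (rule isCont_tendsto_compose)
        then show ?thesis by (rule tendsto_scaleR[OF tendsto_const])
      qed (simp add: D_def)
    qed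
  qed measurable
  have "(\<lambda>n. Kf f (Y n) - (\<integral>t. D t (dir x) *\<^sub>R f (trunc (Y n) t) \<partial>lborel)) \<longlonglongrightarrow> 0"
  proof (rule Lim_null_comparison)
    show "eventually (\<lambda>n. cmod (Kf f (Y n) - (\<integral>t. D t (dir x) *\<^sub>R f (trunc (Y n) t) \<partial>lborel))
        \<le> C * (\<integral>t. \<bar>D t (dir (Y n)) - D t (dir x)\<bar> \<partial>lborel)) sequentially"
    proof (intro always_eventually allI)
      fix n
      have i: "integrable lborel (\<lambda>t. D t s *\<^sub>R f (trunc (Y n) t))" for s
        by (rule D_scale_integrable[of _ C]) (use bd in measurable)
      have "Kf f (Y n) - (\<integral>t. D t (dir x) *\<^sub>R f (trunc (Y n) t) \<partial>lborel) = (\<integral>t. D t (dir (Y n)) *\<^sub>R f (trunc (Y n) t) - D t (dir x) *\<^sub>R f (trunc (Y n) t) \<partial>lborel)"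
        unfolding Kf_def using i by (intro Bochner_Integration.integral_diff[symmetric])
      also have "cmod \<dots> \<le> (\<integral>t. cmod (D t (dir (Y n)) *\<^sub>R f (trunc (Y n) t) - D t (dir x) *\<^sub>R f (trunc (Y n) t)) \<partial>lborel)"
        by (rule integral_norm_bound)
      also have "\<dots> \<le> (\<integral>t. C * \<bar>D t (dir (Y n)) - D t (dir x)\<bar> \<partial>lborel)"
      proof (rule integral_mono)
        show "integrable lborel (\<lambda>t. cmod (D t (dir (Y n)) *\<^sub>R f (trunc (Y n) t) - D t (dir x) *\<^sub>R f (trunc (Y n) t)))"
          using i by (intro integrable_norm Bochner_Integration.integrable_diff)
        show "integrable lborel (\<lambda>t. C * \<bar>D t (dir (Y n)) - D t (dir x)\<bar>)"
          using D_integrable by (intro integrable_mult_right integrable_abs Bochner_Integration.integrable_diff)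
        fix t
        have "cmod (D t (dir (Y n)) *\<^sub>R f (trunc (Y n) t) - D t (dir x) *\<^sub>R f (trunc (Y n) t)) = \<bar>D t (dir (Y n)) - D t (dir x)\<bar> * cmod (f (trunc (Y n) t))"
          by (simp flip: scaleR_left_diff_distrib)
        also have "\<dots> \<le> \<bar>D t (dir (Y n)) - D t (dir x)\<bar> * C" by (intro mult_left_mono bd) auto
        finally show "cmod (D t (dir (Y n)) *\<^sub>R f (trunc (Y n) t) - D t (dir x) *\<^sub>R f (trunc (Y n) t)) \<le> C * \<bar>D t (dir (Y n)) - D t (dir x)\<bar>"
          by (simp add: mult.commute)
      qed
      finally show "cmod (Kf f (Y n) - (\<integral>t. D t (dir x) *\<^sub>R f (trunc (Y n) t) \<partial>lborel))
        \<le> C * (\<integral>t. \<bar>D t (dir (Y n)) - D t (dir x)\<bar> \<partial>lborel)" by simp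
    qed
    show "(\<lambda>n. C * (\<integral>t. \<bar>D t (dir (Y n)) - D t (dir x)\<bar> \<partial>lborel)) \<longlonglongrightarrow> 0"
      using tendsto_mult[OF tendsto_const L1] by simp
  qed
  from tendsto_add[OF this L2]
  have "(\<lambda>n. Kf f (Y n)) \<longlonglongrightarrow> Kf f x" by (simp add: Kf_def)
  then show "(\<lambda>n. Kf f (X n)) \<longlonglongrightarrow> Kf f x"
    by (rule Lim_transform_eventually) (use ev in eventually_elim, simp)
qed

end

lemma isCont_norm_cutoff:
  fixes h1 h2 :: "real ^ 'd \<Rightarrow> 'b :: real_normed_vector"
  assumes h1: "isCont h1 x" and h2: "isCont h2 x" and r: "norm x \<noteq> r"
  shows "isCont (\<lambda>y. if norm y < r then h1 y else h2 y) x" "isCont (\<lambda>y. if norm y \<le> r then h1 y else h2 y :: 'b) x"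
proof -
  have o: "open {y :: real ^ 'd. norm y < r}" "open {y :: real ^ 'd. norm y > r}"
    by (intro open_Collect_less continuous_intros)+
  show "isCont (\<lambda>y. if norm y < r then h1 y else h2 y) x"
  proof (cases "norm x < r")
    case True show ?thesis by (rule isCont_cong_open[OF o(1) _ h1]) (use True in auto)
  next
    case False
    then have "norm x > r" using r by simp
    show ?thesis by (rule isCont_cong_open[OF o(2) _ h2]) (use \<open>norm x > r\<close> in auto)
  qed
  show "isCont (\<lambda>y. if norm y \<le> r then h1 y else h2 y) x"
  proof (cases "norm x < r")
    case True show ?thesis by (rule isCont_cong_open[OF o(1) _ h1]) (use True in auto)
  next
    case False
    then have "norm x > r" using r by simp
    show ?thesis by (rule isCont_cong_open[OF o(2) _ h2]) (use \<open>norm x > r\<close> in auto)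
  qed
qed

section \<open>Negligibility of the squared truncated means\<close>

context stable_attraction
begin

lemma tendsto_integral_quantile_real:
  fixes g :: "real ^ 'd \<Rightarrow> real"
  assumes v: "(\<lambda>n. inverse (v n) * quantile n) \<longlonglongrightarrow> mass powr (1 / \<alpha>)"
    and [measurable]: "g \<in> borel_measurable borel" and bound: "\<And>x. \<bar>g x\<bar> \<le> C * min 1 ((norm x)\<^sup>2)"
    and cont: "\<And>x. x \<noteq> 0 \<Longrightarrow> norm x \<noteq> r \<Longrightarrow> isCont g x"
  shows "(\<lambda>n. real n * (\<integral>x. g (inverse (v n) *\<^sub>R x) \<partial>\<nu>)) \<longlonglongrightarrow> \<alpha> * (\<integral>x. g x \<partial>M0)"
proof -
  have "(\<lambda>n. of_nat n * (\<integral>x. complex_of_real (g (inverse (v n) *\<^sub>R x)) \<partial>\<nu>)) \<longlonglongrightarrow> of_real \<alpha> * (\<integral>x. complex_of_real (g x) \<partial>M0)"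
  proof (rule tendsto_integral_quantile[OF v, where C=C and r=r])
    show "isCont (\<lambda>x. complex_of_real (g x)) x" if "x \<noteq> 0" "norm x \<noteq> r" for x
      using cont[OF that] by (rule continuous_of_real)
  qed (use bound in auto)
  then have "(\<lambda>n. complex_of_real (real n * (\<integral>x. g (inverse (v n) *\<^sub>R x) \<partial>\<nu>))) \<longlonglongrightarrow> of_real (\<alpha> * (\<integral>x. g x \<partial>M0))"
    by (simp only: integral_complex_of_real of_real_mult of_real_of_nat_eq)
  then show ?thesis by (simp only: tendsto_of_real_iff)
qed

lemma small_ball_tendsto_0:
  "(\<lambda>m. \<integral>x. (if norm x \<le> 1 / real (Suc m) then min 1 ((norm x)\<^sup>2) else 0) \<partial>M0) \<longlonglongrightarrow> 0"
proof -
  have "(\<lambda>m. \<integral>x. (if norm x \<le> 1 / real (Suc m) then min 1 ((norm x)\<^sup>2) else 0) \<partial>M0) \<longlonglongrightarrow> (\<integral>x. 0 \<partial>M0)"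
  proof (rule integral_dominated_convergence[OF _ _ integrable_stable_min[OF sigma alpha]])
    have "(\<lambda>m. if norm x \<le> 1 / real (Suc m) then min 1 ((norm x)\<^sup>2) else 0) \<longlonglongrightarrow> 0" for x :: "real ^ 'd"
    proof (cases "x = 0")
      case False
      then have "eventually (\<lambda>m. 1 / real (Suc m) < norm x) sequentially"
        by (intro order_tendstoD(2)[OF LIMSEQ_Suc[OF lim_1_over_n]]) simp
      then have "eventually (\<lambda>m. (if norm x \<le> 1 / real (Suc m) then min 1 ((norm x)\<^sup>2) else 0) = 0) sequentially"
        by (rule eventually_mono) (simp only: not_le[symmetric] if_False)
      then show ?thesis by (rule tendsto_eventually)
    qed simp
    then show "AE x in M0. (\<lambda>m. if norm x \<le> 1 / real (Suc m) then min 1 ((norm x)\<^sup>2) else 0) \<longlonglongrightarrow> 0" by simp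
  qed auto
  then show ?thesis by simp
qed

text \<open>Split at a small radius delta. By Cauchy-Schwarz the inner part of the squared mean is
  at most the truncated second moment, and n times that tends to alpha times an integral of
  \<open>M0\<close> over a small ball. The outer part is a probability of order 1/n, so n times its
  square vanishes.\<close>

lemma n_mean_square_tendsto_0:
  assumes v: "(\<lambda>n. inverse (v n) * quantile n) \<longlonglongrightarrow> mass powr (1 / \<alpha>)"
  shows "(\<lambda>n. real n * (\<integral>x. min 1 (norm (inverse (v n) *\<^sub>R x)) \<partial>\<nu>)\<^sup>2) \<longlonglongrightarrow> 0"
proof (rule order_tendstoI)
  fix y :: real assume y: "y < 0"
  have "0 \<le> real n * (\<integral>x. min 1 (norm (inverse (v n) *\<^sub>R x)) \<partial>\<nu>)\<^sup>2" for n by simp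
  from less_le_trans[OF y this] show "eventually (\<lambda>n. y < real n * (\<integral>x. min 1 (norm (inverse (v n) *\<^sub>R x)) \<partial>\<nu>)\<^sup>2) sequentially"
    by simp
next
  fix \<epsilon> :: real assume \<epsilon>: "0 < \<epsilon>"
  define e where "e \<delta> x = (if norm x \<le> \<delta> then min 1 ((norm x)\<^sup>2) else 0)" for \<delta> and x :: "real ^ 'd"
  define b where "b \<delta> x = (if norm x \<le> \<delta> then 0 else 1 :: real)" for \<delta> and x :: "real ^ 'd"
  have [measurable]: "e \<delta> \<in> borel_measurable borel" "b \<delta> \<in> borel_measurable borel" for \<delta>
    unfolding e_def[abs_def] b_def[abs_def] by measurable
  have "eventually (\<lambda>m. (\<integral>x. e (1 / real (Suc m)) x \<partial>M0) < \<epsilon> / (4 * \<alpha>)) sequentially"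
    unfolding e_def by (rule order_tendstoD(2)[OF small_ball_tendsto_0]) (use \<epsilon> alpha in simp)
  then obtain m where m: "(\<integral>x. e (1 / real (Suc m)) x \<partial>M0) < \<epsilon> / (4 * \<alpha>)" by (auto simp: eventually_sequentially)
  define \<delta> where "\<delta> = 1 / real (Suc m)"
  have \<delta>: "\<delta> > 0" "\<delta> \<le> 1" by (auto simp: \<delta>_def)
  have e_lim: "(\<lambda>n. real n * (\<integral>x. e \<delta> (inverse (v n) *\<^sub>R x) \<partial>\<nu>)) \<longlonglongrightarrow> \<alpha> * (\<integral>x. e \<delta> x \<partial>M0)"
  proof (rule tendsto_integral_quantile_real[OF v, where C=1 and r=\<delta>])
    show "isCont (e \<delta>) x" if "x \<noteq> 0" "norm x \<noteq> \<delta>" for x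
      unfolding e_def[abs_def] by (rule isCont_norm_cutoff(2)[OF _ _ that(2)]) (auto intro!: continuous_intros)
  qed (auto simp: e_def)
  have b_lim: "(\<lambda>n. real n * (\<integral>x. b \<delta> (inverse (v n) *\<^sub>R x) \<partial>\<nu>)) \<longlonglongrightarrow> \<alpha> * (\<integral>x. b \<delta> x \<partial>M0)"
  proof (rule tendsto_integral_quantile_real[OF v, where C="1 / \<delta>\<^sup>2" and r=\<delta>])
    show "isCont (b \<delta>) x" if "x \<noteq> 0" "norm x \<noteq> \<delta>" for x
      unfolding b_def[abs_def] by (rule isCont_norm_cutoff(2)[OF _ _ that(2)]) auto
    show "\<bar>b \<delta> x\<bar> \<le> 1 / \<delta>\<^sup>2 * min 1 ((norm x)\<^sup>2)" for x
    proof (cases "norm x \<le> \<delta>")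
      case False
      then have "\<delta>\<^sup>2 \<le> (norm x)\<^sup>2" using \<delta> by (intro power_mono) auto
      moreover have "\<delta>\<^sup>2 \<le> 1" using \<delta> by (simp add: power_le_one)
      ultimately have "\<delta>\<^sup>2 \<le> min 1 ((norm x)\<^sup>2)" by simp
      then show ?thesis using False \<delta> by (simp add: b_def field_simps)
    qed (simp add: b_def)
  qed measurable
  have "(\<lambda>n. 2 * (real n * (\<integral>x. e \<delta> (inverse (v n) *\<^sub>R x) \<partial>\<nu>)) + 2 * (real n * (\<integral>x. b \<delta> (inverse (v n) *\<^sub>R x) \<partial>\<nu>))\<^sup>2 * (1 / real n))
     \<longlonglongrightarrow> 2 * (\<alpha> * (\<integral>x. e \<delta> x \<partial>M0)) + 2 * (\<alpha> * (\<integral>x. b \<delta> x \<partial>M0))\<^sup>2 * 0"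
    by (intro tendsto_add tendsto_mult[OF tendsto_mult[OF tendsto_const tendsto_power[OF b_lim]] lim_1_over_n]
        tendsto_mult[OF tendsto_const e_lim])
  moreover have "2 * (\<alpha> * (\<integral>x. e \<delta> x \<partial>M0)) + 2 * (\<alpha> * (\<integral>x. b \<delta> x \<partial>M0))\<^sup>2 * 0 < \<epsilon>"
    using m alpha \<epsilon> unfolding \<delta>_def[symmetric] by (simp add: field_simps)
  ultimately have "eventually (\<lambda>n. 2 * (real n * (\<integral>x. e \<delta> (inverse (v n) *\<^sub>R x) \<partial>\<nu>)) + 2 * (real n * (\<integral>x. b \<delta> (inverse (v n) *\<^sub>R x) \<partial>\<nu>))\<^sup>2 * (1 / real n) < \<epsilon>) sequentially"
    by (rule order_tendstoD(2))
  then show "eventually (\<lambda>n. real n * (\<integral>x. min 1 (norm (inverse (v n) *\<^sub>R x)) \<partial>\<nu>)\<^sup>2 < \<epsilon>) sequentially"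
    using eventually_gt_at_top[of 0]
  proof eventually_elim
    case (elim n)
    let ?y = "\<lambda>x. inverse (v n) *\<^sub>R x :: real ^ 'd"
    define X where "X x = (if norm (?y x) \<le> \<delta> then min 1 (norm (?y x)) else 0)" for x
    have X[measurable]: "X \<in> borel_measurable \<nu>" unfolding X_def[abs_def] by measurable
    have Xb: "\<bar>X x\<bar> \<le> 1" for x by (simp add: X_def)
    have iX: "integrable \<nu> X" by (rule nu.integrable_const_bound[of _ 1]) (use Xb in auto)
    have ib: "integrable \<nu> (\<lambda>x. b \<delta> (?y x))" by (rule nu.integrable_const_bound[of _ 1]) (auto simp: b_def)
    have im: "integrable \<nu> (\<lambda>x. min 1 (norm (?y x)))" by (rule nu.integrable_const_bound[of _ 1]) auto
    have le: "(\<integral>x. min 1 (norm (?y x)) \<partial>\<nu>) \<le> (\<integral>x. X x \<partial>\<nu>) + (\<integral>x. b \<delta> (?y x) \<partial>\<nu>)"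
      unfolding Bochner_Integration.integral_add[OF iX ib, symmetric]
      by (rule integral_mono[OF im Bochner_Integration.integrable_add[OF iX ib]]) (auto simp: X_def b_def)
    have ge0: "0 \<le> (\<integral>x. min 1 (norm (?y x)) \<partial>\<nu>)" by (intro integral_nonneg_AE AE_I2) auto
    have "(\<integral>x. X x \<partial>\<nu>)\<^sup>2 \<le> (\<integral>x. (X x)\<^sup>2 \<partial>\<nu>)"
      using nu.integral_mult_indicator_square_le[OF X Xb, of "space \<nu>"] nu.prob_space
      by (simp cong: Bochner_Integration.integral_cong)
    also have "(\<integral>x. (X x)\<^sup>2 \<partial>\<nu>) = (\<integral>x. e \<delta> (?y x) \<partial>\<nu>)"
    proof (rule Bochner_Integration.integral_cong[OF refl])
      fix x
      have "(min 1 z)\<^sup>2 = min 1 (z\<^sup>2)" if "0 \<le> z" for z :: real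
      proof (cases "z \<le> 1")
        case True
        then have "z\<^sup>2 \<le> 1" using that by (simp add: power_le_one)
        then show ?thesis using True by (simp add: min_absorb2)
      next
        case False
        then have "1 \<le> z\<^sup>2" by (simp add: one_le_power)
        then show ?thesis using False by (simp add: min_absorb1)
      qed
      from this[of "norm (?y x)"] show "(X x)\<^sup>2 = e \<delta> (?y x)" unfolding X_def e_def by auto
    qed
    finally have X2: "(\<integral>x. X x \<partial>\<nu>)\<^sup>2 \<le> (\<integral>x. e \<delta> (?y x) \<partial>\<nu>)" .
    have "(\<integral>x. min 1 (norm (?y x)) \<partial>\<nu>)\<^sup>2 \<le> ((\<integral>x. X x \<partial>\<nu>) + (\<integral>x. b \<delta> (?y x) \<partial>\<nu>))\<^sup>2"
      using le ge0 by (intro power_mono)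
    also have "\<dots> \<le> 2 * (\<integral>x. X x \<partial>\<nu>)\<^sup>2 + 2 * (\<integral>x. b \<delta> (?y x) \<partial>\<nu>)\<^sup>2"
      using sum_squares_bound[of "\<integral>x. X x \<partial>\<nu>" "\<integral>x. b \<delta> (?y x) \<partial>\<nu>"] by (simp add: power2_sum)
    also have "\<dots> \<le> 2 * (\<integral>x. e \<delta> (?y x) \<partial>\<nu>) + 2 * (\<integral>x. b \<delta> (?y x) \<partial>\<nu>)\<^sup>2" using X2 by simp
    finally have "real n * (\<integral>x. min 1 (norm (?y x)) \<partial>\<nu>)\<^sup>2 \<le> real n * (2 * (\<integral>x. e \<delta> (?y x) \<partial>\<nu>) + 2 * (\<integral>x. b \<delta> (?y x) \<partial>\<nu>)\<^sup>2)"
      by (intro mult_left_mono) auto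
    also have "\<dots> = 2 * (real n * (\<integral>x. e \<delta> (?y x) \<partial>\<nu>)) + 2 * (real n * (\<integral>x. b \<delta> (?y x) \<partial>\<nu>))\<^sup>2 * (1 / real n)"
      using elim(2) by (simp add: power_mult_distrib power2_eq_square field_simps)
    finally show ?case using elim(1) by linarith
  qed
qed

end

section \<open>The tempered measure and the law of a tempered jump\<close>

context tempering
begin

lemma q_meas_pair: "(\<lambda>(r, s). q r s) \<in> borel_measurable (restrict_space lborel {0<..} \<Otimes>\<^sub>M \<sigma>)"
proof -
  have 1[measurable]: "(\<lambda>r. r) \<in> borel_measurable (restrict_space lborel {0<..})"
    by (rule measurable_restrict_space1) simp
  note 2[measurable] = measurable_sphere_measure_ident[OF sigma]
  have "(\<lambda>p. (case p of (r, s) \<Rightarrow> qe r s)) \<in> borel_measurable (restrict_space lborel {0<..} \<Otimes>\<^sub>M \<sigma>)"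
    by (rule measurable_compose[OF _ qe_meas, of "\<lambda>p. p", simplified]) (simp add: measurable_pair_iff comp_def, measurable)
  then show ?thesis
    by (rule measurable_cong[THEN iffD1, rotated])
       (auto simp: space_pair_measure space_restrict_space sphere_measure_space[OF sigma] qe_def)
qed

text \<open>In polar coordinates the kernel leaves the direction fixed, so the claim reduces to
  \<open>nn_integral_min\<close> on each ray.\<close>

lemma nn_integral_tempered:
  fixes G :: "real ^ 'd \<Rightarrow> ennreal"
  assumes G[measurable]: "G \<in> borel_measurable borel"
  shows "(\<integral>\<^sup>+x. (\<integral>\<^sup>+t. ennreal (\<alpha> * D t (dir x)) * G (trunc x t) \<partial>lborel) \<partial>M0) = (\<integral>\<^sup>+x. G x \<partial>M)"
proof -
  have "(\<integral>\<^sup>+x. (\<integral>\<^sup>+t. ennreal (\<alpha> * D t (dir x)) * G (trunc x t) \<partial>lborel) \<partial>M0)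
    = (\<integral>\<^sup>+s. (\<integral>\<^sup>+r. ennreal (r powr (- \<alpha> - 1)) * (\<integral>\<^sup>+t. ennreal (\<alpha> * D t (dir (r *\<^sub>R s))) * G (trunc (r *\<^sub>R s) t) \<partial>lborel) * indicator {0<..} r \<partial>lborel) \<partial>\<sigma>)"
    by (rule nn_integral_stable_polar_measure[OF sigma]) measurable
  also have "\<dots> = (\<integral>\<^sup>+s. (\<integral>\<^sup>+r. ennreal (r powr (- \<alpha> - 1) * q r s) * G (r *\<^sub>R s) * indicator {0<..} r \<partial>lborel) \<partial>\<sigma>)"
  proof (rule nn_integral_cong)
    fix s assume "s \<in> space \<sigma>"
    then have s: "s \<in> sphere 0 1" using sphere_measure_space[OF sigma] by simp
    interpret tempering_profile \<alpha> "\<lambda>r. q r s" by (rule profile[OF s])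
    define F where "F r = G (r *\<^sub>R s)" for r
    have [measurable]: "F \<in> borel_measurable borel" unfolding F_def[abs_def] by measurable
    have "(\<integral>\<^sup>+r. ennreal (r powr (- \<alpha> - 1)) * (\<integral>\<^sup>+t. ennreal (\<alpha> * D t (dir (r *\<^sub>R s))) * G (trunc (r *\<^sub>R s) t) \<partial>lborel) * indicator {0<..} r \<partial>lborel)
       = (\<integral>\<^sup>+r. (ennreal (\<alpha> * r powr (- \<alpha> - 1)) * indicator {0<..} r) * (\<integral>\<^sup>+t. ennreal (p t) * F (min r t) \<partial>lborel) \<partial>lborel)"
    proof (rule nn_integral_cong)
      fix r :: real
      show "ennreal (r powr (- \<alpha> - 1)) * (\<integral>\<^sup>+t. ennreal (\<alpha> * D t (dir (r *\<^sub>R s))) * G (trunc (r *\<^sub>R s) t) \<partial>lborel) * indicator {0<..} r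
         = (ennreal (\<alpha> * r powr (- \<alpha> - 1)) * indicator {0<..} r) * (\<integral>\<^sup>+t. ennreal (p t) * F (min r t) \<partial>lborel)"
      proof (cases "r > 0")
        case True
        have d: "dir (r *\<^sub>R s) = s" and n: "norm (r *\<^sub>R s) = r" using s True by (auto simp: dir_def)
        have "(\<integral>\<^sup>+t. ennreal (\<alpha> * D t (dir (r *\<^sub>R s))) * G (trunc (r *\<^sub>R s) t) \<partial>lborel) = (\<integral>\<^sup>+t. ennreal \<alpha> * (ennreal (p t) * F (min r t)) \<partial>lborel)"
          unfolding trunc_def d n F_def profile_eq(3)[OF s] using alpha(1) by (intro nn_integral_cong) (simp add: ennreal_mult' mult.assoc)
        also have "\<dots> = ennreal \<alpha> * (\<integral>\<^sup>+t. ennreal (p t) * F (min r t) \<partial>lborel)" by (rule nn_integral_cmult) measurable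
        finally show ?thesis using True alpha(1) by (simp add: ennreal_mult' ac_simps)
      qed simp
    qed
    also have "\<dots> = (\<integral>\<^sup>+r. ennreal (r powr (- \<alpha> - 1) * q0 r) * F r * indicator {0<..} r \<partial>lborel)"
      by (rule nn_integral_min) measurable
    also have "\<dots> = (\<integral>\<^sup>+r. ennreal (r powr (- \<alpha> - 1) * q r s) * G (r *\<^sub>R s) * indicator {0<..} r \<partial>lborel)"
      by (intro nn_integral_cong) (auto simp: indicator_def q0_def F_def)
    finally show "(\<integral>\<^sup>+r. ennreal (r powr (- \<alpha> - 1)) * (\<integral>\<^sup>+t. ennreal (\<alpha> * D t (dir (r *\<^sub>R s))) * G (trunc (r *\<^sub>R s) t) \<partial>lborel) * indicator {0<..} r \<partial>lborel)
      = (\<integral>\<^sup>+r. ennreal (r powr (- \<alpha> - 1) * q r s) * G (r *\<^sub>R s) * indicator {0<..} r \<partial>lborel)" .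
  qed
  also have "\<dots> = (\<integral>\<^sup>+x. G x \<partial>M)" by (rule nn_integral_polar_measure[OF sigma q_meas_pair G, symmetric])
  finally show ?thesis .
qed

text \<open>To go from nonnegative to complex integrands, the preceding identity is read as
  \<open>M\<close> being the image, under truncation, of a density on
  \<open>M0 \<Otimes>\<^sub>M lborel\<close>. Integrability of \<open>f\<close> then carries over to
  the product and Fubini applies.\<close>

lemma integral_tempered:
  fixes f :: "real ^ 'd \<Rightarrow> complex"
  assumes f: "integrable M f"
  shows "(\<integral>x. f x \<partial>M) = of_real \<alpha> * (\<integral>x. Kf f x \<partial>M0)"
proof -
  have fm[measurable]: "f \<in> borel_measurable borel"
    using borel_measurable_integrable[OF f] measurable_cong_sets[OF sets_polar_measure refl] by blast
  interpret M0: sigma_finite_measure M0 by (rule sigma_finite_stable[OF sigma alpha])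
  interpret P: pair_sigma_finite M0 lborel by unfold_locales
  define w where "w p = \<alpha> * D (snd p) (dir (fst p))" for p
  define \<tau> where "\<tau> p = trunc (fst p) (snd p)" for p
  have w0: "0 \<le> w p" for p unfolding w_def using alpha(1) D_nonneg by simp
  have [measurable]: "w \<in> borel_measurable (M0 \<Otimes>\<^sub>M lborel)" "\<tau> \<in> borel_measurable (M0 \<Otimes>\<^sub>M lborel)"
    unfolding w_def[abs_def] \<tau>_def[abs_def] by measurable
  let ?B = "density (M0 \<Otimes>\<^sub>M lborel) (\<lambda>p. ennreal (w p))"
  have tB[measurable]: "\<tau> \<in> borel_measurable ?B" by simp
  have M: "M = distr ?B borel \<tau>"
  proof (rule measure_eqI)
    fix A assume "A \<in> sets M"
    then have A[measurable]: "A \<in> sets borel" by simp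
    have "emeasure M A = (\<integral>\<^sup>+x. indicator A x \<partial>M)" by simp
    also have "\<dots> = (\<integral>\<^sup>+x. (\<integral>\<^sup>+t. ennreal (w (x, t)) * indicator A (\<tau> (x, t)) \<partial>lborel) \<partial>M0)"
      by (subst nn_integral_tempered[symmetric]) (simp_all add: w_def \<tau>_def)
    also have "\<dots> = (\<integral>\<^sup>+p. ennreal (w p) * indicator A (\<tau> p) \<partial>(M0 \<Otimes>\<^sub>M lborel))"
      by (rule lborel.nn_integral_fst) measurable
    also have "\<dots> = (\<integral>\<^sup>+p. indicator A (\<tau> p) \<partial>?B)" by (rule nn_integral_density[symmetric]) measurable
    also have "\<dots> = (\<integral>\<^sup>+x. indicator A x \<partial>distr ?B borel \<tau>)" by (rule nn_integral_distr[OF tB, symmetric]) simp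
    also have "\<dots> = emeasure (distr ?B borel \<tau>) A" by simp
    finally show "emeasure M A = emeasure (distr ?B borel \<tau>) A" .
  qed simp
  have "integrable ?B (\<lambda>p. f (\<tau> p))" using f unfolding M by (subst (asm) integrable_distr_eq[OF tB fm])
  then have i: "integrable (M0 \<Otimes>\<^sub>M lborel) (\<lambda>p. w p *\<^sub>R f (\<tau> p))"
    by (subst (asm) integrable_density) (simp_all add: w0)
  have "(\<integral>x. f x \<partial>M) = (\<integral>p. f (\<tau> p) \<partial>?B)" unfolding M by (rule integral_distr[OF tB fm])
  also have "\<dots> = (\<integral>p. w p *\<^sub>R f (\<tau> p) \<partial>(M0 \<Otimes>\<^sub>M lborel))" by (rule integral_density) (simp_all add: w0)
  also have "\<dots> = (\<integral>x. (\<integral>t. w (x, t) *\<^sub>R f (\<tau> (x, t)) \<partial>lborel) \<partial>M0)" by (rule P.integral_fst'[OF i, symmetric])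
  also have "\<dots> = (\<integral>x. of_real \<alpha> * Kf f x \<partial>M0)"
    unfolding w_def \<tau>_def Kf_def fst_conv snd_conv scaleR_scaleR[symmetric] by (simp add: scaleR_conv_of_real)
  finally show ?thesis by simp
qed

text \<open>The conditional distribution prescribes the joint law on rectangles, which generate the
  product sigma-algebra. As H is almost surely nonzero, its direction almost surely lies on the
  sphere, where the tempering law has density \<open>D\<close>.\<close>

lemma joint_law:
  fixes P :: "'w measure" and H :: "'w \<Rightarrow> real ^ 'd" and T :: "'w \<Rightarrow> real"
  assumes P: "prob_space P" and H[measurable]: "H \<in> borel_measurable P" and H0: "measure P {\<omega> \<in> space P. H \<omega> = 0} = 0"
    and T[measurable]: "T \<in> borel_measurable P"
    and cond: "has_cond_distribution P T H (\<lambda>h. tempering_law \<alpha> q (h /\<^sub>R norm h))"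
  shows "distr P (borel \<Otimes>\<^sub>M borel) (\<lambda>\<omega>. (H \<omega>, T \<omega>))
    = density (distr P borel H \<Otimes>\<^sub>M lborel) (\<lambda>(h, t). ennreal (D t (dir h)))" (is "?L = ?R")
proof -
  interpret P: prob_space P by fact
  interpret \<nu>: prob_space "distr P borel H" by (rule P.prob_space_distr) measurable
  have ne: "AE \<omega> in P. H \<omega> \<noteq> 0"
  proof (rule AE_I[where N="{\<omega> \<in> space P. H \<omega> = 0}"])
    show "emeasure P {\<omega> \<in> space P. H \<omega> = 0} = 0" using H0 by (simp add: P.emeasure_eq_measure)
  qed auto
  have rect: "emeasure ?L (B \<times> A) = emeasure ?R (B \<times> A)" if [measurable]: "B \<in> sets borel" "A \<in> sets borel" for B :: "(real ^ 'd) set" and A :: "real set"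
  proof -
    have "emeasure ?L (B \<times> A) = emeasure P {\<omega> \<in> space P. T \<omega> \<in> A \<and> H \<omega> \<in> B}"
      by (subst emeasure_distr) (auto intro!: arg_cong[where f="emeasure P"])
    also have "\<dots> = (\<integral>\<^sup>+\<omega>. emeasure (tempering_law \<alpha> q (dir (H \<omega>))) A * indicator B (H \<omega>) \<partial>P)"
      using cond that unfolding has_cond_distribution_def dir_def by blast
    also have "\<dots> = (\<integral>\<^sup>+\<omega>. (\<integral>\<^sup>+t. ennreal (D t (dir (H \<omega>))) * indicator A t \<partial>lborel) * indicator B (H \<omega>) \<partial>P)"
    proof (rule nn_integral_cong_AE)
      show "AE \<omega> in P. emeasure (tempering_law \<alpha> q (dir (H \<omega>))) A * indicator B (H \<omega>) = (\<integral>\<^sup>+t. ennreal (D t (dir (H \<omega>))) * indicator A t \<partial>lborel) * indicator B (H \<omega>)"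
        using ne
      proof eventually_elim
        case (elim \<omega>)
        have "emeasure (tempering_law \<alpha> q (dir (H \<omega>))) A = (\<integral>\<^sup>+t. ennreal (D t (dir (H \<omega>))) * indicator A t \<partial>lborel)"
          unfolding tempering_law_eq[OF dir_sphere[OF elim]] by (rule emeasure_density) measurable
        then show ?case by simp
      qed
    qed
    also have "\<dots> = (\<integral>\<^sup>+h. (\<integral>\<^sup>+t. ennreal (D t (dir h)) * indicator A t \<partial>lborel) * indicator B h \<partial>distr P borel H)"
      by (rule nn_integral_distr[symmetric]) measurable
    also have "\<dots> = (\<integral>\<^sup>+h. (\<integral>\<^sup>+t. (case (h, t) of (h, t) \<Rightarrow> ennreal (D t (dir h))) * indicator (B \<times> A) (h, t) \<partial>lborel) \<partial>distr P borel H)"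
      by (intro nn_integral_cong) (auto simp: indicator_def)
    also have "\<dots> = (\<integral>\<^sup>+p. (case p of (h, t) \<Rightarrow> ennreal (D t (dir h))) * indicator (B \<times> A) p \<partial>(distr P borel H \<Otimes>\<^sub>M lborel))"
      by (rule lborel.nn_integral_fst) measurable
    also have "\<dots> = emeasure ?R (B \<times> A)"
      by (rule emeasure_density[symmetric]) measurable
    finally show ?thesis .
  qed
  show ?thesis
  proof (rule measure_eqI_generator_eq[OF Int_stable_pair_measure_generator[of borel borel]])
    show "{a \<times> b |a b. a \<in> sets (borel :: (real ^ 'd) measure) \<and> b \<in> sets (borel :: real measure)} \<subseteq> Pow UNIV" by simp
    show "sets ?L = sigma_sets UNIV {a \<times> b |a b. a \<in> sets (borel :: (real ^ 'd) measure) \<and> b \<in> sets (borel :: real measure)}"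
      by (simp add: sets_pair_measure)
    show "sets ?R = sigma_sets UNIV {a \<times> b |a b. a \<in> sets (borel :: (real ^ 'd) measure) \<and> b \<in> sets (borel :: real measure)}"
      by (simp add: sets_pair_measure)
    show "range (\<lambda>_ :: nat. UNIV) \<subseteq> {a \<times> b |a b. a \<in> sets (borel :: (real ^ 'd) measure) \<and> b \<in> sets (borel :: real measure)}"
      by (auto intro!: exI[of _ UNIV])
    have "prob_space ?L" by (rule P.prob_space_distr) measurable
    then show "emeasure ?L UNIV \<noteq> \<infinity>" using prob_space.emeasure_le_1[of ?L UNIV] by (auto simp: top_unique)
  qed (use rect in auto)
qed

text \<open>Scaling by 1/v moves into the argument: a tempered jump divided by v is the truncation
  at t of h/v, and the direction that governs the law of t is the same for h and h/v.\<close>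

lemma integral_tempered_jump:
  fixes P :: "'w measure" and H :: "'w \<Rightarrow> real ^ 'd" and T :: "'w \<Rightarrow> real" and f :: "real ^ 'd \<Rightarrow> complex"
  assumes P: "prob_space P" and H[measurable]: "H \<in> borel_measurable P" and H0: "measure P {\<omega> \<in> space P. H \<omega> = 0} = 0"
    and T[measurable]: "T \<in> borel_measurable P"
    and cond: "has_cond_distribution P T H (\<lambda>h. tempering_law \<alpha> q (h /\<^sub>R norm h))"
    and f[measurable]: "f \<in> borel_measurable borel" and bd: "\<And>x. cmod (f x) \<le> C" and v: "v > 0"
  shows "(\<integral>p. f (inverse v *\<^sub>R tempered_jump v (fst p) (snd p)) \<partial>distr P (borel \<Otimes>\<^sub>M borel) (\<lambda>\<omega>. (H \<omega>, T \<omega>)))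
    = (\<integral>h. Kf f (inverse v *\<^sub>R h) \<partial>distr P borel H)"
proof -
  interpret P: prob_space P by fact
  interpret \<nu>: prob_space "distr P borel H" by (rule P.prob_space_distr) measurable
  interpret PP: pair_sigma_finite "distr P borel H" lborel by unfold_locales
  define w where "w p = D (snd p) (dir (fst p))" for p
  define g where "g p = f (trunc (inverse v *\<^sub>R fst p) (snd p))" for p
  have w0: "0 \<le> w p" for p unfolding w_def by (rule D_nonneg)
  have [measurable]: "w \<in> borel_measurable (distr P borel H \<Otimes>\<^sub>M lborel)" "g \<in> borel_measurable (distr P borel H \<Otimes>\<^sub>M lborel)"
    unfolding w_def[abs_def] g_def[abs_def] by measurable
  have dirv: "dir (inverse v *\<^sub>R h) = dir h" for h
    using v by (simp add: dir_def)
  have jump: "inverse v *\<^sub>R tempered_jump v h t = trunc (inverse v *\<^sub>R h) t" for h t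
  proof -
    have "inverse v * min (norm h) (v * t) = min (inverse v * norm h) t"
      using v by (simp add: min_mult_distrib_left mult.assoc[symmetric])
    then show ?thesis unfolding tempered_jump_def trunc_def dirv using v by (simp add: dir_def)
  qed
  have J: "distr P (borel \<Otimes>\<^sub>M borel) (\<lambda>\<omega>. (H \<omega>, T \<omega>)) = density (distr P borel H \<Otimes>\<^sub>M lborel) (\<lambda>p. ennreal (w p))"
    unfolding joint_law[OF P H H0 T cond] w_def by (simp add: case_prod_beta')
  have "prob_space (density (distr P borel H \<Otimes>\<^sub>M lborel) (\<lambda>p. ennreal (w p)))"
    unfolding J[symmetric] by (rule P.prob_space_distr) measurable
  then interpret J: prob_space "density (distr P borel H \<Otimes>\<^sub>M lborel) (\<lambda>p. ennreal (w p))" .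
  have "integrable (density (distr P borel H \<Otimes>\<^sub>M lborel) (\<lambda>p. ennreal (w p))) g"
    by (rule J.integrable_const_bound[of _ C]) (use bd in \<open>auto simp: g_def\<close>)
  then have i: "integrable (distr P borel H \<Otimes>\<^sub>M lborel) (\<lambda>p. w p *\<^sub>R g p)"
    by (subst (asm) integrable_density) (simp_all add: w0)
  have "(\<integral>p. f (inverse v *\<^sub>R tempered_jump v (fst p) (snd p)) \<partial>distr P (borel \<Otimes>\<^sub>M borel) (\<lambda>\<omega>. (H \<omega>, T \<omega>)))
     = (\<integral>p. g p \<partial>density (distr P borel H \<Otimes>\<^sub>M lborel) (\<lambda>p. ennreal (w p)))"
    unfolding J jump g_def ..
  also have "\<dots> = (\<integral>p. w p *\<^sub>R g p \<partial>(distr P borel H \<Otimes>\<^sub>M lborel))" by (rule integral_density) (simp_all add: w0)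
  also have "\<dots> = (\<integral>h. (\<integral>t. w (h, t) *\<^sub>R g (h, t) \<partial>lborel) \<partial>distr P borel H)" by (rule PP.integral_fst'[OF i, symmetric])
  also have "\<dots> = (\<integral>h. Kf f (inverse v *\<^sub>R h) \<partial>distr P borel H)"
    unfolding w_def g_def Kf_def dirv by simp
  finally show ?thesis .
qed

end

section \<open>Centered triangular arrays\<close>

text \<open>Multiplying by the centering phase turns the compensated increment into n (iexp (- beta)
  phi - 1) up to n (iexp beta - 1 - i beta), which is at most n beta^2. The exponent is thus the
  same before and after centering.\<close>

lemma tendsto_power_centered:
  fixes \<phi> :: "nat \<Rightarrow> complex" and \<beta> :: "nat \<Rightarrow> real"
  assumes \<phi>: "\<And>n. cmod (\<phi> n) \<le> 1"
    and lim: "(\<lambda>n. of_nat n * (\<phi> n - 1 - \<i> * of_real (\<beta> n))) \<longlonglongrightarrow> \<psi>"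
    and sq: "(\<lambda>n. real n * (\<beta> n)\<^sup>2) \<longlonglongrightarrow> 0" and \<psi>: "cmod (exp \<psi>) \<le> 1"
  shows "(\<lambda>n. (iexp (- \<beta> n) * \<phi> n) ^ n) \<longlonglongrightarrow> exp \<psi>"
proof (rule tendsto_power_exp[OF _ _ \<psi>])
  show "cmod (iexp (- \<beta> n) * \<phi> n) \<le> 1" for n using \<phi>[of n] by (simp add: norm_mult del: of_real_minus)
  have "(\<lambda>n. (\<beta> n)\<^sup>2) \<longlonglongrightarrow> 0"
  proof (rule Lim_null_comparison[OF _ sq])
    show "eventually (\<lambda>n. norm ((\<beta> n)\<^sup>2) \<le> real n * (\<beta> n)\<^sup>2) sequentially"
      using eventually_ge_at_top[of 1]
    proof eventually_elim
      case (elim n)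
      then show ?case using mult_right_mono[of 1 "real n" "(\<beta> n)\<^sup>2"] by simp
    qed
  qed
  then have \<beta>: "\<beta> \<longlonglongrightarrow> 0" by simp
  have e: "(\<lambda>n. iexp (- \<beta> n)) \<longlonglongrightarrow> iexp (- 0)"
    by (intro tendsto_intros \<beta>)
  have r: "(\<lambda>n. of_nat n * (iexp (- \<beta> n) * (iexp (\<beta> n) - 1 - \<i> * of_real (\<beta> n)))) \<longlonglongrightarrow> 0"
  proof (rule Lim_null_comparison[OF _ sq], rule always_eventually, rule allI)
    fix n
    have "cmod (iexp (\<beta> n) - 1 - \<i> * of_real (\<beta> n)) \<le> (\<beta> n)\<^sup>2"
      using norm_iexp_diff_linear_le[of "\<beta> n"] by (rule order_trans) simp
    then show "norm (of_nat n * (iexp (- \<beta> n) * (iexp (\<beta> n) - 1 - \<i> * of_real (\<beta> n)))) \<le> real n * (\<beta> n)\<^sup>2"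
      by (simp only: norm_mult norm_of_nat norm_exp_i_times mult_1 mult_left_mono of_nat_0_le_iff)
  qed
  have "(\<lambda>n. iexp (- \<beta> n) * (of_nat n * (\<phi> n - 1 - \<i> * of_real (\<beta> n)))
      - of_nat n * (iexp (- \<beta> n) * (iexp (\<beta> n) - 1 - \<i> * of_real (\<beta> n)))) \<longlonglongrightarrow> iexp (- 0) * \<psi> - 0"
    by (intro tendsto_diff tendsto_mult e lim r)
  moreover have "iexp (- \<beta> n) * (of_nat n * (\<phi> n - 1 - \<i> * of_real (\<beta> n)))
      - of_nat n * (iexp (- \<beta> n) * (iexp (\<beta> n) - 1 - \<i> * of_real (\<beta> n))) = of_nat n * (iexp (- \<beta> n) * \<phi> n - 1)" for n
  proof -
    have "iexp (- \<beta> n) * iexp (\<beta> n) = 1" unfolding iexp_add[symmetric] by simp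
    then show ?thesis by algebra
  qed
  ultimately show "(\<lambda>n. of_nat n * (iexp (- \<beta> n) * \<phi> n - 1)) \<longlonglongrightarrow> \<psi>" by simp
qed

lemma (in prob_space) char_fun_sum_iid:
  fixes Z :: "nat \<Rightarrow> 'a \<Rightarrow> real ^ 'd"
  assumes indep: "indep_vars (\<lambda>_. borel) Z {1..n}"
    and ident: "\<And>j. j \<in> {1..n} \<Longrightarrow> distr M borel (Z j) = \<nu>"
  shows "char_fun (distr M borel (\<lambda>\<omega>. (\<Sum>j = 1..n. Z j \<omega>) - b)) l = iexp (- (l \<bullet> b)) * char_fun \<nu> l ^ n"
proof -
  have Z: "random_variable borel (Z j)" if "j \<in> {1..n}" for j using indep that by (simp add: indep_vars_def)
  have sum: "random_variable borel (\<lambda>\<omega>. (\<Sum>j = 1..n. Z j \<omega>) - b)"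
    by (intro borel_measurable_diff borel_measurable_sum Z) auto
  have ind: "indep_vars (\<lambda>_. borel) (\<lambda>j \<omega>. iexp (l \<bullet> Z j \<omega>)) {1..n}"
    by (rule indep_vars_compose2[OF indep]) measurable
  have int: "integrable M (\<lambda>\<omega>. iexp (l \<bullet> Z j \<omega>))" if "j \<in> {1..n}" for j
  proof (rule integrable_const_bound[of _ 1])
    note [measurable] = Z[OF that]
    show "(\<lambda>\<omega>. iexp (l \<bullet> Z j \<omega>)) \<in> borel_measurable M" by measurable
  qed simp
  have cf: "(\<integral>\<omega>. iexp (l \<bullet> Z j \<omega>) \<partial>M) = char_fun \<nu> l" if "j \<in> {1..n}" for j
    unfolding char_fun_def ident[OF that, symmetric] by (rule integral_distr[OF Z[OF that], symmetric]) measurable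
  have "char_fun (distr M borel (\<lambda>\<omega>. (\<Sum>j = 1..n. Z j \<omega>) - b)) l = (\<integral>\<omega>. iexp (l \<bullet> ((\<Sum>j = 1..n. Z j \<omega>) - b)) \<partial>M)"
    unfolding char_fun_def by (rule integral_distr[OF sum]) measurable
  also have "(\<lambda>\<omega>. iexp (l \<bullet> ((\<Sum>j = 1..n. Z j \<omega>) - b))) = (\<lambda>\<omega>. iexp (- (l \<bullet> b)) * (\<Prod>j = 1..n. iexp (l \<bullet> Z j \<omega>)))"
  proof
    fix \<omega>
    have "l \<bullet> ((\<Sum>j = 1..n. Z j \<omega>) - b) = - (l \<bullet> b) + (\<Sum>j = 1..n. l \<bullet> Z j \<omega>)"
      by (simp add: inner_diff_right inner_sum_right)
    then show "iexp (l \<bullet> ((\<Sum>j = 1..n. Z j \<omega>) - b)) = iexp (- (l \<bullet> b)) * (\<Prod>j = 1..n. iexp (l \<bullet> Z j \<omega>))"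
      by (simp only: iexp_add of_real_sum sum_distrib_left exp_sum finite_atLeastAtMost)
  qed
  also have "(\<integral>\<omega>. iexp (- (l \<bullet> b)) * (\<Prod>j = 1..n. iexp (l \<bullet> Z j \<omega>)) \<partial>M) = iexp (- (l \<bullet> b)) * (\<Prod>j = 1..n. \<integral>\<omega>. iexp (l \<bullet> Z j \<omega>) \<partial>M)"
    by (simp only: integral_mult_right_zero indep_vars_lebesgue_integral[OF finite_atLeastAtMost ind int])
  also have "(\<Prod>j = 1..n. \<integral>\<omega>. iexp (l \<bullet> Z j \<omega>) \<partial>M) = char_fun \<nu> l ^ n"
    using cf by (simp add: prod.cong[OF refl, of _ _ "\<lambda>_. char_fun \<nu> l"])
  finally show ?thesis .
qed

text \<open>This agrees with \<^const>\<open>levy_integrand\<close> off the unit sphere, which is a null set for the Levy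
  measures in question.\<close>

definition open_levy_integrand :: "real ^ 'd \<Rightarrow> real ^ 'd \<Rightarrow> complex" where
  "open_levy_integrand l x = iexp (l \<bullet> x) - 1 - \<i> * of_real (if norm x < 1 then l \<bullet> x else 0)"

lemma open_levy_integrand_meas[measurable]: "open_levy_integrand l \<in> borel_measurable borel"
  unfolding open_levy_integrand_def[abs_def] by measurable

lemma norm_open_levy_integrand_le:
  "cmod (open_levy_integrand l x) \<le> (2 + (norm l)\<^sup>2) * min 1 ((norm x)\<^sup>2)"
proof (cases "norm x < 1")
  case True
  have "cmod (open_levy_integrand l x) \<le> (l \<bullet> x)\<^sup>2 / 2"
    using True norm_iexp_diff_linear_le[of "l \<bullet> x"] by (simp add: open_levy_integrand_def)
  also have "\<dots> \<le> (l \<bullet> x)\<^sup>2" by simp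
  also have "\<dots> \<le> (norm l * norm x)\<^sup>2"
    using Cauchy_Schwarz_ineq2[of l x] by (simp add: abs_le_square_iff[symmetric])
  also have "\<dots> \<le> (2 + (norm l)\<^sup>2) * (norm x)\<^sup>2" by (simp add: power_mult_distrib mult_right_mono)
  finally show ?thesis using True by (simp add: power_le_one min_absorb2)
next
  case False
  then have m: "min 1 ((norm x)\<^sup>2) = 1" by (simp add: min_absorb1 one_le_power)
  have "cmod (open_levy_integrand l x) \<le> cmod (iexp (l \<bullet> x)) + cmod 1"
    using norm_triangle_ineq4[of "iexp (l \<bullet> x)" 1] False unfolding open_levy_integrand_def by (simp only: if_False of_real_0 mult_zero_right diff_zero)
  also have "\<dots> \<le> (2 + (norm l)\<^sup>2) * min 1 ((norm x)\<^sup>2)" unfolding m by simp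
  finally show ?thesis .
qed

lemma isCont_open_levy_integrand:
  fixes x :: "real ^ 'd"
  assumes "norm x \<noteq> 1" shows "isCont (open_levy_integrand l) x"
proof -
  have "isCont (\<lambda>y. if norm y < 1 then l \<bullet> y else 0) x"
    by (rule isCont_norm_cutoff[OF _ _ assms]) (intro continuous_intros)+
  then show ?thesis unfolding open_levy_integrand_def[abs_def] by (intro continuous_intros)
qed

context tempering
begin

lemma integral_levy_integrand_tempered:
  assumes int: "integrable M (levy_integrand l)"
  shows "(\<integral>x. levy_integrand l x \<partial>M) = of_real \<alpha> * (\<integral>x. Kf (open_levy_integrand l) x \<partial>M0)"
proof -
  have "AE x in M. norm x \<noteq> 1" using polar_measure_sphere_null[OF sigma q_meas_pair, of 1] by (rule AE_I') auto
  then have ae: "AE x in M. levy_integrand l x = open_levy_integrand l x"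
    by eventually_elim (auto simp: levy_integrand_def open_levy_integrand_def indicator_def)
  have lm: "levy_integrand l \<in> borel_measurable M" by (rule borel_measurable_integrable[OF int])
  have om: "open_levy_integrand l \<in> borel_measurable M" by measurable
  have "(\<integral>x. levy_integrand l x \<partial>M) = (\<integral>x. open_levy_integrand l x \<partial>M)"
    by (rule integral_cong_AE[OF lm om ae])
  also have "\<dots> = of_real \<alpha> * (\<integral>x. Kf (open_levy_integrand l) x \<partial>M0)"
    by (rule integral_tempered) (use int integrable_cong_AE[OF lm om ae] in simp)
  finally show ?thesis .
qed

lemma norm_Kf_open_levy_integrand_le:
  "cmod (Kf (open_levy_integrand l) x) \<le> (2 + (norm l)\<^sup>2) * min 1 ((norm x)\<^sup>2)"
proof (rule Kf_bound[where \<Phi>="\<lambda>r. (2 + (norm l)\<^sup>2) * min 1 (r\<^sup>2)" and B="2 + (norm l)\<^sup>2"])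
  show "(2 + (norm l)\<^sup>2) * min 1 (a\<^sup>2) \<le> (2 + (norm l)\<^sup>2) * min 1 (b\<^sup>2)" if "0 \<le> a" "a \<le> b" for a b :: real
    using power_mono[OF that(2,1), of 2] by (intro mult_left_mono min.mono) auto
  show "(2 + (norm l)\<^sup>2) * min 1 (a\<^sup>2) \<le> 2 + (norm l)\<^sup>2" for a
    by (rule order_trans[OF mult_left_mono[of _ 1]]) auto
qed (use norm_open_levy_integrand_le in auto)

lemma isCont_Kf_open_levy_integrand:
  assumes "x \<noteq> 0" "norm x \<noteq> 1" shows "isCont (Kf (open_levy_integrand l)) x"
proof (rule Kf_isCont[where C="2 + (norm l)\<^sup>2", OF _ _ _ assms])
  show "cmod (open_levy_integrand l x) \<le> 2 + (norm l)\<^sup>2" for x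
    by (rule order_trans[OF norm_open_levy_integrand_le], rule order_trans[OF mult_left_mono[of _ 1]]) auto
qed (auto intro: isCont_open_levy_integrand)

end

lemma tempered_jump_meas[measurable (raw)]:
  assumes [measurable]: "h \<in> borel_measurable N" "t \<in> borel_measurable N"
  shows "(\<lambda>x. tempered_jump v (h x) (t x)) \<in> borel_measurable N"
  unfolding tempered_jump_def by measurable

theorem theorem4p3:
  fixes \<alpha> :: real
    and \<sigma> :: "(real ^ 'd) measure"
    and q :: "real \<Rightarrow> real ^ 'd \<Rightarrow> real"
    and P :: "'w measure"
    and H :: "'w \<Rightarrow> real ^ 'd" and T :: "'w \<Rightarrow> real"
    and Hs :: "nat \<Rightarrow> 'w \<Rightarrow> real ^ 'd" and Ts :: "nat \<Rightarrow> 'w \<Rightarrow> real"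
    and a :: "real ^ 'd" and \<mu>X \<rho> :: "(real ^ 'd) measure"
    and v :: "nat \<Rightarrow> real"
    and Y :: "nat \<Rightarrow> nat \<Rightarrow> 'w \<Rightarrow> real ^ 'd"
    and S :: "nat \<Rightarrow> nat \<Rightarrow> 'w \<Rightarrow> real ^ 'd"
    and cent :: "nat \<Rightarrow> real ^ 'd"
  assumes alpha: "0 < \<alpha>" "\<alpha> < 2"
    and sigma: "sphere_measure \<sigma>"
    and q: "tempering_function \<alpha> q"
    and P: "prob_space P"
    and H: "H \<in> borel_measurable P" "measure P {\<omega> \<in> space P. H \<omega> = 0} = 0"
    and X: "has_levy_representation \<mu>X a 0 (polar_measure \<alpha> \<sigma> (\<lambda>r s. 1))"
    and attraction: "in_domain_of_attraction (distr P borel H) \<mu>X"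
    and T: "T \<in> borel_measurable P" "AE \<omega> in P. T \<omega> > 0"
    and cond: "has_cond_distribution P T H (\<lambda>h. tempering_law \<alpha> q (h /\<^sub>R norm h))"
    and indep: "prob_space.indep_vars P (\<lambda>_. borel \<Otimes>\<^sub>M borel) (\<lambda>j \<omega>. (Hs j \<omega>, Ts j \<omega>)) {1..}"
    and ident: "\<And>j. j \<ge> 1 \<Longrightarrow>
        distr P (borel \<Otimes>\<^sub>M borel) (\<lambda>\<omega>. (Hs j \<omega>, Ts j \<omega>)) =
        distr P (borel \<Otimes>\<^sub>M borel) (\<lambda>\<omega>. (H \<omega>, T \<omega>))"
    and v: "\<And>n. n \<ge> 1 \<Longrightarrow> v n > 0" "filterlim v at_top sequentially"
    and v_lim: "(\<lambda>n. inverse (v n) * norm_quantile P H n)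
        \<longlonglongrightarrow> measure \<sigma> (sphere 0 1) powr (1 / \<alpha>)"
    and Y: "\<And>n j \<omega>. Y n j \<omega> = tempered_jump (v n) (Hs j \<omega>) (Ts j \<omega>)"
    and S: "\<And>n k \<omega>. S n k \<omega> = (\<Sum>j = 1..k. Y n j \<omega>)"
    and cent: "\<And>n. cent n =
        real n *\<^sub>R (LINT x:{x. norm x < 1}|distr P borel (\<lambda>\<omega>. inverse (v n) *\<^sub>R Y n 1 \<omega>). x)"
    and rho: "has_levy_representation \<rho> 0 0 (polar_measure \<alpha> \<sigma> q)"
  shows "weakly_converges
           (\<lambda>n. distr P borel (\<lambda>\<omega>. inverse (v n) *\<^sub>R S n n \<omega> - cent n)) \<rho>"
proof -
  interpret P: prob_space P by (rule P)
  interpret tempering \<alpha> q \<sigma> by unfold_locales (fact alpha q sigma)+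
  obtain c :: "nat \<Rightarrow> real" and d :: "nat \<Rightarrow> real ^ 'd" where cd: "\<And>n. n \<ge> 1 \<Longrightarrow> c n > 0"
    "weakly_converges (\<lambda>n. distr (iid_sum_law n (distr P borel H)) borel (\<lambda>x. inverse (c n) *\<^sub>R x - d n)) \<mu>X"
    using attraction unfolding in_domain_of_attraction_def by blast
  define \<nu>H where "\<nu>H = distr P borel H"
  have \<nu>H: "prob_space \<nu>H" "sets \<nu>H = sets borel" by (auto simp: \<nu>H_def intro: P.prob_space_distr H)
  interpret A: stable_attraction \<alpha> \<sigma> \<nu>H \<mu>X a c d
    by (rule stable_attraction.intro[OF alpha sigma \<nu>H X cd(1) cd(2)[folded \<nu>H_def]])
  note [measurable_cong] = \<nu>H(2)
  note [measurable] = H(1) T(1)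
  have qH: "norm_quantile P H n = A.quantile n" for n
  proof -
    have "measure \<nu>H {y. norm y > x} = measure P {\<omega> \<in> space P. norm (H \<omega>) > x}" for x
      unfolding \<nu>H_def by (subst measure_distr) (auto intro!: arg_cong[where f="measure P"])
    then show ?thesis unfolding norm_quantile_def A.quantile_def by simp
  qed
  have vl: "(\<lambda>n. inverse (v n) * A.quantile n) \<longlonglongrightarrow> A.mass powr (1 / \<alpha>)"
    using v_lim unfolding qH A.mass_def .
  have HsTs[measurable]: "(\<lambda>\<omega>. (Hs j \<omega>, Ts j \<omega>)) \<in> measurable P (borel \<Otimes>\<^sub>M borel)" if "j \<ge> 1" for j
    using indep that by (simp add: P.indep_vars_def)
  define \<kappa> where "\<kappa> = distr P (borel \<Otimes>\<^sub>M borel) (\<lambda>\<omega>. (H \<omega>, T \<omega>))"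
  have \<kappa>s[measurable_cong]: "sets \<kappa> = sets (borel \<Otimes>\<^sub>M borel)" by (simp add: \<kappa>_def)
  \<comment> \<open>The scaled jump as one measurable function of a pair, so that independence and
    identity of the laws pass from the pairs to the jumps. \<open>N n\<close> will be the common law
    in row \<open>n\<close>.\<close>
  define J where "J n p = inverse (v n) *\<^sub>R tempered_jump (v n) (fst p) (snd p)" for n and p :: "(real ^ 'd) \<times> real"
  have J[measurable]: "J n \<in> borel_measurable (borel \<Otimes>\<^sub>M borel)" for n unfolding J_def[abs_def] by measurable
  define N where "N n = distr \<kappa> borel (J n)" for n
  interpret \<kappa>: prob_space \<kappa> unfolding \<kappa>_def by (rule P.prob_space_distr) measurable
  have N: "prob_space (N n)" and Ns[measurable_cong]: "sets (N n) = sets borel" for n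
    by (auto simp: N_def intro!: \<kappa>.prob_space_distr)
  have NJ: "distr P borel (\<lambda>\<omega>. J n (Hs j \<omega>, Ts j \<omega>)) = N n" if "j \<ge> 1" for n j
    unfolding N_def \<kappa>_def ident[OF that, symmetric]
    by (rule distr_distr[OF J HsTs[OF that], unfolded comp_def, symmetric])
  have YJ: "inverse (v n) *\<^sub>R Y n j \<omega> = J n (Hs j \<omega>, Ts j \<omega>)" for n j \<omega> by (simp add: Y J_def)
  have N_int: "(\<integral>x. f x \<partial>N n) = (\<integral>h. Kf f (inverse (v n) *\<^sub>R h) \<partial>\<nu>H)"
    if [measurable]: "f \<in> borel_measurable borel" and "\<And>x. cmod (f x) \<le> C" "n \<ge> 1" for f C n
  proof -
    have "(\<integral>x. f x \<partial>N n) = (\<integral>p. f (J n p) \<partial>\<kappa>)" unfolding N_def by (rule integral_distr) measurable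
    also have "\<dots> = (\<integral>h. Kf f (inverse (v n) *\<^sub>R h) \<partial>\<nu>H)"
      unfolding J_def \<kappa>_def \<nu>H_def by (rule integral_tempered_jump[OF P H T(1) cond that(1,2) v(1)[OF that(3)]])
    finally show ?thesis .
  qed
  have "char_fun (distr P borel (\<lambda>\<omega>. inverse (v n) *\<^sub>R S n n \<omega> - cent n)) l
      = iexp (- (l \<bullet> cent n)) * char_fun (N n) l ^ n" for l n
  proof -
    have "P.indep_vars (\<lambda>_. borel) (\<lambda>j \<omega>. J n (Hs j \<omega>, Ts j \<omega>)) {1..n}"
      by (rule P.indep_vars_compose2[OF P.indep_vars_subset[OF indep]]) auto
    from P.char_fun_sum_iid[OF this, of "N n" "cent n" l]
    show ?thesis using NJ by (simp add: S scaleR_sum_right YJ)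
  qed
  note cf = this
  have centN: "cent n = real n *\<^sub>R (\<integral>x. (if norm x < 1 then x else 0) \<partial>N n)" for n
    unfolding cent YJ NJ[OF order_refl] set_lebesgue_integral_def
    by (intro arg_cong2[where f=scaleR] refl Bochner_Integration.integral_cong) auto
  have "(\<lambda>n. iexp (- (l \<bullet> cent n)) * char_fun (N n) l ^ n) \<longlonglongrightarrow> char_fun \<rho> l" for l
  proof -
    define g where "g x = (if norm x < 1 then l \<bullet> x else 0)" for x
    have [measurable]: "g \<in> borel_measurable borel" unfolding g_def[abs_def] by measurable
    have g_le: "\<bar>g x\<bar> \<le> norm l * min 1 (norm x)" for x
    proof (cases "norm x < 1")
      case True
      then show ?thesis using Cauchy_Schwarz_ineq2[of l x] by (simp add: g_def)
    qed (simp add: g_def)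
    then have g1: "\<bar>g x\<bar> \<le> norm l" for x
      by (rule order_trans[OF _ order_trans[OF mult_left_mono[of _ 1]]]) auto
    define \<beta> where "\<beta> n = (\<integral>x. g x \<partial>N n)" for n
    define \<psi> where "\<psi> = (\<integral>x. levy_integrand l x \<partial>M)"
    have ig: "integrable (N n) g" for n
      by (rule finite_measure.integrable_const_bound[OF prob_space.finite_measure[OF N], of _ "norm l"]) (use g1 in auto)
    have l_cent: "l \<bullet> cent n = real n * \<beta> n" for n
    proof -
      have i: "integrable (N n) (\<lambda>x. if norm x < 1 then x else 0 :: real ^ 'd)"
        by (rule finite_measure.integrable_const_bound[OF prob_space.finite_measure[OF N], of _ 1]) auto
      have "l \<bullet> (\<integral>x. (if norm x < 1 then x else 0) \<partial>N n) = (\<integral>x. l \<bullet> (if norm x < 1 then x else 0) \<partial>N n)"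
        using i by simp
      also have "\<dots> = \<beta> n" unfolding \<beta>_def g_def by (intro Bochner_Integration.integral_cong) auto
      finally show ?thesis unfolding centN by simp
    qed
    \<comment> \<open>As \<open>cent n\<close> is \<open>n\<close> times a truncated mean, the
      centering splits into one phase for each of the \<open>n\<close> factors.\<close>
    have power: "iexp (- (l \<bullet> cent n)) * char_fun (N n) l ^ n = (iexp (- \<beta> n) * char_fun (N n) l) ^ n" for n
    proof -
      have "iexp (- (l \<bullet> cent n)) = iexp (- \<beta> n) ^ n"
        unfolding l_cent exp_of_nat_mult[symmetric] by (simp add: ac_simps)
      then show ?thesis by (simp only: power_mult_distrib)
    qed
    have \<rho>: "prob_space \<rho>" "char_fun \<rho> l = exp \<psi>" and il: "integrable M (levy_integrand l)"
      using has_levy_representationD(1)[OF rho] has_levy_representationD(3,4)[OF rho, of l] by (simp_all add: \<psi>_def)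
    have "(\<lambda>n. (iexp (- \<beta> n) * char_fun (N n) l) ^ n) \<longlonglongrightarrow> exp \<psi>"
    proof (rule tendsto_power_centered)
      show "cmod (char_fun (N n) l) \<le> 1" for n
        using norm_char_fun_le[of "N n" l] N[of n] by (simp add: prob_space.prob_space prob_space.finite_measure)
      \<comment> \<open>\<open>exp \<psi>\<close> is a value of the characteristic function of the
        probability measure \<open>\<rho>\<close>.\<close>
      show "cmod (exp \<psi>) \<le> 1"
        using norm_char_fun_le[of \<rho> l] \<rho> by (simp add: prob_space.prob_space prob_space.finite_measure)
      have "(\<lambda>n. of_nat n * (\<integral>h. Kf (open_levy_integrand l) (inverse (v n) *\<^sub>R h) \<partial>\<nu>H)) \<longlonglongrightarrow> \<psi>"
        unfolding \<psi>_def integral_levy_integrand_tempered[OF il]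
        by (rule A.tendsto_integral_quantile[OF vl _ norm_Kf_open_levy_integrand_le isCont_Kf_open_levy_integrand]) measurable
      moreover have "eventually (\<lambda>n. of_nat n * (\<integral>h. Kf (open_levy_integrand l) (inverse (v n) *\<^sub>R h) \<partial>\<nu>H)
          = of_nat n * (char_fun (N n) l - 1 - \<i> * of_real (\<beta> n))) sequentially"
        using eventually_ge_at_top[of 1]
      proof eventually_elim
        case (elim n)
        interpret N: prob_space "N n" by (rule N)
        have b: "cmod (open_levy_integrand l x) \<le> 2 + (norm l)\<^sup>2" for x
          by (rule order_trans[OF norm_open_levy_integrand_le], rule order_trans[OF mult_left_mono[of _ 1]]) auto
        have ie: "integrable (N n) (\<lambda>x. iexp (l \<bullet> x))" by (rule integrable_iexp_inner[OF N.finite_measure_axioms Ns])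
        have ic: "integrable (N n) (\<lambda>x. \<i> * complex_of_real (g x))" using ig by simp
        have "(\<integral>h. Kf (open_levy_integrand l) (inverse (v n) *\<^sub>R h) \<partial>\<nu>H) = (\<integral>x. open_levy_integrand l x \<partial>N n)"
          by (rule N_int[OF _ b elim, symmetric]) measurable
        also have "\<dots> = (\<integral>x. iexp (l \<bullet> x) - 1 - \<i> * complex_of_real (g x) \<partial>N n)"
          unfolding open_levy_integrand_def g_def ..
        also have "\<dots> = (\<integral>x. iexp (l \<bullet> x) - 1 \<partial>N n) - (\<integral>x. \<i> * complex_of_real (g x) \<partial>N n)"
          using ie ic by (intro Bochner_Integration.integral_diff) auto
        also have "(\<integral>x. iexp (l \<bullet> x) - 1 \<partial>N n) = char_fun (N n) l - 1"
          unfolding char_fun_def using ie by (subst Bochner_Integration.integral_diff) (auto simp: N.prob_space)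
        also have "(\<integral>x. \<i> * complex_of_real (g x) \<partial>N n) = \<i> * of_real (\<beta> n)"
          unfolding \<beta>_def by (simp only: integral_mult_right_zero integral_complex_of_real)
        finally show ?case by simp
      qed
      ultimately show "(\<lambda>n. of_nat n * (char_fun (N n) l - 1 - \<i> * of_real (\<beta> n))) \<longlonglongrightarrow> \<psi>"
        by (rule Lim_transform_eventually)
      \<comment> \<open>The mean of the tempered jump is compared with the untempered one: averaging
        over the tempering keeps the bound |l| min(1, |x|), so |beta n| is at most |l| times the
        mean of min(1, |H|/v_n).\<close>
      show "(\<lambda>n. real n * (\<beta> n)\<^sup>2) \<longlonglongrightarrow> 0"
      proof (rule Lim_null_comparison)
        show "(\<lambda>n. (norm l)\<^sup>2 * (real n * (\<integral>x. min 1 (norm (inverse (v n) *\<^sub>R x)) \<partial>\<nu>H)\<^sup>2)) \<longlonglongrightarrow> 0"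
          by (rule tendsto_mult_right_zero[OF A.n_mean_square_tendsto_0[OF vl]])
        show "eventually (\<lambda>n. norm (real n * (\<beta> n)\<^sup>2) \<le> (norm l)\<^sup>2 * (real n * (\<integral>x. min 1 (norm (inverse (v n) *\<^sub>R x)) \<partial>\<nu>H)\<^sup>2)) sequentially"
          using eventually_ge_at_top[of 1]
        proof eventually_elim
          case (elim n)
          let ?m = "\<integral>x. min 1 (norm (inverse (v n) *\<^sub>R x)) \<partial>\<nu>H"
          have Kg: "cmod (Kf (\<lambda>x. of_real (g x)) x) \<le> norm l * min 1 (norm x)" for x
          proof (rule Kf_bound[where \<Phi>="\<lambda>r. norm l * min 1 r" and B="norm l"])
            show "norm l * min 1 r \<le> norm l * min 1 t" if "0 \<le> r" "r \<le> t" for r t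
              using that by (intro mult_left_mono min.mono) auto
            show "norm l * min 1 r \<le> norm l" for r
              by (rule order_trans[OF mult_left_mono[of _ 1]]) auto
          qed (use g_le in auto)
          have "\<bar>\<beta> n\<bar> = cmod (\<integral>x. complex_of_real (g x) \<partial>N n)" by (simp add: \<beta>_def)
          also have "\<dots> = cmod (\<integral>h. Kf (\<lambda>x. of_real (g x)) (inverse (v n) *\<^sub>R h) \<partial>\<nu>H)"
            by (subst N_int[OF _ _ elim, of _ "norm l"]) (use g1 in auto)
          also have "\<dots> \<le> (\<integral>h. norm l * min 1 (norm (inverse (v n) *\<^sub>R h)) \<partial>\<nu>H)"
          proof (rule Bochner_Integration.integral_norm_bound_integral)
            show im: "integrable \<nu>H (\<lambda>h. norm l * min 1 (norm (inverse (v n) *\<^sub>R h)))"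
              by (intro integrable_mult_right A.nu.integrable_const_bound[of _ 1]) auto
            show "integrable \<nu>H (\<lambda>h. Kf (\<lambda>x. of_real (g x)) (inverse (v n) *\<^sub>R h))"
              by (rule Bochner_Integration.integrable_bound[OF im])
                 (measurable, rule AE_I2, rule order_trans[OF Kg], simp)
          qed (rule Kg)
          also have "\<dots> = norm l * ?m" by (rule integral_mult_right_zero)
          finally have "\<bar>\<beta> n\<bar>\<^sup>2 \<le> (norm l * ?m)\<^sup>2" by (intro power_mono) auto
          then have "real n * (\<beta> n)\<^sup>2 \<le> real n * (norm l * ?m)\<^sup>2" by (intro mult_left_mono) auto
          then show ?case by (simp add: power_mult_distrib ac_simps)
        qed
      qed
    qed
    then show ?thesis unfolding power \<rho>(2) .
  qed
  then show ?thesis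
  proof (intro levy_continuity_finite)
    have m: "(\<lambda>\<omega>. inverse (v n) *\<^sub>R S n n \<omega> - cent n) \<in> borel_measurable P" for n
    proof -
      have "(\<lambda>\<omega>. (\<Sum>j = 1..n. J n (Hs j \<omega>, Ts j \<omega>)) - cent n) \<in> borel_measurable P"
        by (intro borel_measurable_diff borel_measurable_sum measurable_compose[OF HsTs J]) auto
      then show ?thesis by (simp add: S scaleR_sum_right YJ)
    qed
    show "finite_measure (distr P borel (\<lambda>\<omega>. inverse (v n) *\<^sub>R S n n \<omega> - cent n))" for n
      by (intro prob_space.finite_measure P.prob_space_distr m)
    show "finite_measure \<rho>" "sets \<rho> = sets borel"
      using has_levy_representationD[OF rho] by (auto intro: prob_space.finite_measure)
  qed (simp_all add: cf)
qed

end
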